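(* There exists $\epsilon_0>0$ such that the following holds. Let $u_0\in L^2(\mathbb{R})\cap L^\infty(\mathbb{R})$ be a (real-valued) initial data and let $u\in L^\infty_t(L^2_x)\cap L^2_t(\mathcal{N}_x)$ be an associated global weak solution of the equation $$\partial_t u=-(-\Delta)^{\frac12}\mathcal{M}(u)+\partial_x\left(\frac{u^2}{2}\right),\qquad u(0,x)=u_0(x),\quad x\in\mathbb{R},$$ satisfying the energy inequality $\|u(t,\cdot)\|_{L^2}^2+\int_0^{t}\|u(s,\cdot)\|_{\mathcal{N}}^2\,ds\leq \|u_0\|_{L^2}^2$ for almost every $t>0$. Let $0<T<+\infty$. If $u\in L^4\big([0,T],H^{\frac34+\epsilon}(\mathbb{R})\big)$ for some $0<\epsilon<\epsilon_0$, then $u\in L^\infty\big([0,T],L^\infty(\mathbb{R})\big)$.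
   Context: The operators are Fourier multipliers on $\mathbb{R}$: $\widehat{(-\Delta)^{a}f}(\xi)=|\xi|^{2a}\widehat f(\xi)$, and $\widehat{\mathcal{M}(f)}(\xi)=\mathfrak{m}(\xi)\widehat f(\xi)$ with $\mathfrak{m}(\xi)=\sqrt{(1+\xi^2)\frac{\tanh(\xi)}{\xi}}$ (so $\mathfrak m(0)=1$). $\mathcal{M}^{\frac12}$ is the multiplier with symbol $\mathfrak{m}(\xi)^{\frac12}$. The functional $\|\cdot\|_{\mathcal{N}}$ is $\|f\|_{\mathcal{N}}=\left(\int_{\mathbb{R}}\left|(-\Delta)^{\frac14}\mathcal{M}^{\frac12}(f)\right|^2dx\right)^{\frac12}$, where $(-\Delta)^{\frac14}\mathcal{M}^{\frac12}$ has symbol $|\xi|^{\frac12}\mathfrak m(\xi)^{\frac12}$, and $\mathcal{N}(\mathbb{R})$ is the set of real functions $f$ with $\|f\|_{\mathcal{N}}<+\infty$. $H^s(\mathbb{R})$ is the usual inhomogeneous Sobolev space. The notation $L^p_t(X_x)$ means $L^p\big((0,+\infty),X(\mathbb{R})\big)$. A weak solution is understood in the usual distributional sense: for all $\phi\in C_c^\infty([0,+\infty)\times\mathbb{R})$, $$\int_0^{+\infty}\!\!\int_{\mathbb{R}}\Big(u\,\partial_t\phi-u\,(-\Delta)^{\frac12}\mathcal{M}(\phi)-\frac{u^2}{2}\partial_x\phi\Big)dx\,dt+\int_{\mathbb{R}}u_0(x)\phi(0,x)\,dx=0.$$ *)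

theory Defs
  imports "HOL-Analysis.Analysis" "HOL-Probability.Essential_Supremum"
begin

section \<open>Lebesgue norms on the line\<close>

text \<open>Norms take values in \<^typ>\<open>ennreal\<close>; a function belongs to the corresponding space
  iff its norm is finite. Non-measurable functions have norm \<open>\<infinity>\<close>.\<close>

definition L2_norm :: "(real \<Rightarrow> 'a::real_normed_vector) \<Rightarrow> ennreal" where
  "L2_norm f =
     (if f \<in> borel_measurable lebesgue \<and> integrable lebesgue (\<lambda>x. (norm (f x))\<^sup>2)
      then ennreal (sqrt (LINT x|lebesgue. (norm (f x))\<^sup>2)) else \<infinity>)"

definition Linf_norm :: "(real \<Rightarrow> 'a::real_normed_vector) \<Rightarrow> ennreal" where
  "Linf_norm f =
     (if f \<in> borel_measurable lebesgue
      then esssup lebesgue (\<lambda>x. ennreal (norm (f x))) else \<infinity>)"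

section \<open>Fourier transform\<close>

definition fourier :: "(real \<Rightarrow> complex) \<Rightarrow> real \<Rightarrow> complex" where
  "fourier f \<xi> = (LINT x|lebesgue. cis (- (x * \<xi>)) * f x)"

definition inverse_fourier :: "(real \<Rightarrow> complex) \<Rightarrow> real \<Rightarrow> complex" where
  "inverse_fourier F x = (1 / (2 * pi)) *\<^sub>R (LINT \<xi>|lebesgue. cis (x * \<xi>) * F \<xi>)"

text \<open>The Fourier--Plancherel transform, as a relation since it is only determined almost
  everywhere: \<open>F\<close> is the \<open>L\<^sup>2\<close>-limit of the transforms of the truncations of \<open>f\<close> to \<open>[-R, R]\<close>.\<close>

definition L2_fourier :: "(real \<Rightarrow> complex) \<Rightarrow> (real \<Rightarrow> complex) \<Rightarrow> bool" where
  "L2_fourier f F \<longleftrightarrow> L2_norm f < \<infinity> \<and> L2_norm F < \<infinity> \<and>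
     ((\<lambda>R. L2_norm (\<lambda>\<xi>. fourier (\<lambda>x. indicator {-R..R} x *\<^sub>R f x) \<xi> - F \<xi>)) \<longlongrightarrow> 0) at_top"

section \<open>Fourier multipliers and function spaces\<close>

text \<open>Two versions of the multiplier with symbol \<open>\<sigma>\<close>: a pointwise formula, used for test functions,
  and a relation \<open>g = \<sigma>(D) f\<close> between square integrable functions.\<close>

definition multiplier :: "(real \<Rightarrow> real) \<Rightarrow> (real \<Rightarrow> complex) \<Rightarrow> real \<Rightarrow> complex" where
  "multiplier \<sigma> f = inverse_fourier (\<lambda>\<xi>. of_real (\<sigma> \<xi>) * fourier f \<xi>)"

definition L2_multiplier ::
    "(real \<Rightarrow> real) \<Rightarrow> (real \<Rightarrow> complex) \<Rightarrow> (real \<Rightarrow> complex) \<Rightarrow> bool" where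
  "L2_multiplier \<sigma> f g \<longleftrightarrow>
     (\<exists>F. L2_fourier f F \<and> L2_fourier g (\<lambda>\<xi>. of_real (\<sigma> \<xi>) * F \<xi>))"

definition frac_laplacian_symbol :: "real \<Rightarrow> real \<Rightarrow> real" where
  "frac_laplacian_symbol a \<xi> = \<bar>\<xi>\<bar> powr (2 * a)"

definition M_symbol :: "real \<Rightarrow> real" where
  "M_symbol \<xi> = (if \<xi> = 0 then 1 else sqrt ((1 + \<xi>\<^sup>2) * (tanh \<xi> / \<xi>)))"

text \<open>The functional \<open>\<parallel>f\<parallel>\<^bsub>\<N>\<^esub>\<close>, for \<open>f \<in> L\<^sup>2\<close>. The infimum only chooses a representative \<open>g\<close> of
  \<open>(-\<Delta>)\<^bsup>1/4\<^esup> \<M>\<^bsup>1/2\<^esup> f\<close>: all such \<open>g\<close> agree almost everywhere, and if there is none in \<open>L\<^sup>2\<close>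
  then the infimum of the empty set is \<open>\<infinity>\<close>. The same applies to the Sobolev norm below.\<close>

definition N_norm :: "(real \<Rightarrow> real) \<Rightarrow> ennreal" where
  "N_norm f =
     (INF g \<in> {g. L2_multiplier (\<lambda>\<xi>. frac_laplacian_symbol (1/4) \<xi> * M_symbol \<xi> powr (1/2))
                    (\<lambda>x. complex_of_real (f x)) g}. L2_norm g)"

text \<open>The norm of \<open>H\<^sup>s\<close>, for \<open>s \<ge> 0\<close> (so that \<open>H\<^sup>s \<subseteq> L\<^sup>2\<close>).\<close>

definition sobolev_norm :: "real \<Rightarrow> (real \<Rightarrow> real) \<Rightarrow> ennreal" where
  "sobolev_norm s f =
     (INF F \<in> {F. L2_fourier (\<lambda>x. complex_of_real (f x)) F}.
        L2_norm (\<lambda>\<xi>. (1 + \<xi>\<^sup>2) powr (s / 2) *\<^sub>R F \<xi>))"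

text \<open>\<open>u \<in> L\<^sup>p(I, X)\<close> and \<open>u \<in> L\<^sup>\<infinity>(I, X)\<close>, where \<open>N\<close> is the norm of \<open>X\<close> and \<open>u t\<close> is the
  function \<open>u(t, \<cdot>)\<close>.\<close>

definition in_Lp_time ::
    "nat \<Rightarrow> real set \<Rightarrow> ((real \<Rightarrow> real) \<Rightarrow> ennreal) \<Rightarrow> (real \<Rightarrow> real \<Rightarrow> real) \<Rightarrow> bool" where
  "in_Lp_time p I N u \<longleftrightarrow>
     (\<lambda>(t, x). u t x) \<in> borel_measurable (lebesgue_on (I \<times> UNIV)) \<and>
     (\<integral>\<^sup>+t. (N (u t)) ^ p \<partial>lebesgue_on I) < \<infinity>"

definition in_Linf_time ::
    "real set \<Rightarrow> ((real \<Rightarrow> real) \<Rightarrow> ennreal) \<Rightarrow> (real \<Rightarrow> real \<Rightarrow> real) \<Rightarrow> bool" where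
  "in_Linf_time I N u \<longleftrightarrow>
     (\<lambda>(t, x). u t x) \<in> borel_measurable (lebesgue_on (I \<times> UNIV)) \<and>
     (\<exists>C<\<infinity>. AE t in lebesgue_on I. N (u t) \<le> C)"

section \<open>Weak solutions\<close>

fun C_k :: "nat \<Rightarrow> (real \<times> real \<Rightarrow> real) \<Rightarrow> bool" where
  "C_k 0 f \<longleftrightarrow> continuous_on UNIV f"
| "C_k (Suc k) f \<longleftrightarrow>
     (\<exists>f\<^sub>1 f\<^sub>2. C_k k f\<^sub>1 \<and> C_k k f\<^sub>2 \<and>
        (\<forall>p. (f has_derivative (\<lambda>(s, y). s * f\<^sub>1 p + y * f\<^sub>2 p)) (at p)))"

text \<open>Elements of \<open>C\<^sub>c\<^sup>\<infinity>([0,\<infinity>) \<times> \<real>)\<close> are the restrictions to \<open>t \<ge> 0\<close> of smooth compactly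
  supported functions on the plane; only their values for \<open>t \<ge> 0\<close> are used below.\<close>

definition test_function :: "(real \<times> real \<Rightarrow> real) \<Rightarrow> bool" where
  "test_function \<phi> \<longleftrightarrow> (\<forall>k. C_k k \<phi>) \<and> compact (closure {p. \<phi> p \<noteq> 0})"

text \<open>The identity is written in \<^typ>\<open>complex\<close> because \<^const>\<open>multiplier\<close> is complex valued; its value
  on real functions is real as the symbol is even.\<close>

definition weak_solution :: "(real \<Rightarrow> real) \<Rightarrow> (real \<Rightarrow> real \<Rightarrow> real) \<Rightarrow> bool" where
  "weak_solution u\<^sub>0 u \<longleftrightarrow>
     (\<forall>\<phi>. test_function \<phi> \<longrightarrow>
        (LINT t|lebesgue_on {0<..}. LINT x|lebesgue.
           (complex_of_real (u t x * deriv (\<lambda>s. \<phi> (s, x)) t)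
          - complex_of_real (u t x) *
              multiplier (\<lambda>\<xi>. frac_laplacian_symbol (1/2) \<xi> * M_symbol \<xi>)
                (\<lambda>y. complex_of_real (\<phi> (t, y))) x
          - complex_of_real ((u t x)\<^sup>2 / 2 * deriv (\<lambda>y. \<phi> (t, y)) x)))
        + complex_of_real (LINT x|lebesgue. u\<^sub>0 x * \<phi> (0, x)) = 0)"

end

theory Submission
  imports Defs "HOL-Probability.Probability"
begin

text \<open>Write \<open>p(\<xi>) = \<bar>\<xi>\<bar> m(\<xi>)\<close>. Testing the weak formulation with \<open>\<phi>(s, x) = a(s) \<chi>(x/R) w(s, x)\<close>, where \<open>w\<close>
  solves the backward linear equation with band-limited datum at a time \<open>t\<close>, and letting \<open>R \<rightarrow> \<infinity>\<close> gives the
  Duhamel formula paired with \<open>w\<close>. When the datum is an approximate Dirac mass at \<open>y\<close>, the initial term is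
  at most \<open>\<parallel>u\<^sub>0\<parallel>\<^bsub>\<infinity>\<^esub>\<close> times the \<open>L\<^sup>1\<close> norm of the kernel of \<open>e\<^bsup>-tp(D)\<^esup>\<close>, which is bounded for
  \<open>0 < t \<le> T\<close>. The quadratic term is estimated on the Fourier side: since the transform of \<open>u\<^sup>2\<close> is a
  convolution, \<open>\<bar>\<xi> + \<eta>\<bar>\<close> splits into \<open>\<bar>\<xi> + \<eta>\<bar>\<^bsup>3/4+\<epsilon>\<^esup>\<close>, absorbed by the Sobolev norms of \<open>u\<close>, and
  \<open>\<bar>\<xi> + \<eta>\<bar>\<^bsup>1/4-\<epsilon>\<^esup>\<close>, and \<open>\<bar>\<zeta>\<bar>\<^bsup>1/4-\<epsilon>\<^esup> e\<^bsup>-\<tau>p(\<zeta>)\<^esup>\<close> is square integrable in \<open>(\<tau>, \<zeta>)\<close>, so that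
  \<open>u \<in> L\<^sup>4(H\<^bsup>3/4+\<epsilon>\<^esup>)\<close> suffices. Hence \<open>u(s, y)\<close> is bounded uniformly in \<open>y\<close>, for almost every \<open>s\<close>.\<close>

section \<open>Smooth functions and test functions\<close>

text \<open>The weak formulation accepts only smooth, compactly supported test functions.
  Band-limiting the datum makes w smooth on the whole plane, also after the time t of the datum,
  because differentiating w only multiplies its amplitude by p(\<xi>) or i \<xi>. The cutoff
  \<chi>(x/R) does not commute with the nonlocal operator. On the Fourier side it averages against
  an approximate identity, with decay uniform in R, and the error vanishes in
  \<open>L\<^sup>2\<close>, the space in which u(s) is paired.

  The symbol p behaves like \<bar>\<xi>\<bar> at 0, so the kernel bound works with one derivative of
  the symbol, taken on a half-line, instead of two on the line.

  Test functions see u through time integrals, so the Duhamel bound holds only outside a null set of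
  times, which depends on t, y and the band. Hence t and y run through the rationals and the band
  through the integers. At a good time s, t decreases to s, and continuity in y of the integral that
  inverts the transform of u(s) recovers all y.\<close>

fun C_k_real :: "nat \<Rightarrow> (real \<Rightarrow> real) \<Rightarrow> bool" where
  "C_k_real 0 f \<longleftrightarrow> continuous_on UNIV f"
| "C_k_real (Suc k) f \<longleftrightarrow>
     (\<exists>f'. C_k_real k f' \<and> (\<forall>x. (f has_real_derivative f' x) (at x)))"

definition smooth_real :: "(real \<Rightarrow> real) \<Rightarrow> bool" where
  "smooth_real f \<longleftrightarrow> (\<forall>k. C_k_real k f)"

section \<open>One-variable C^k functions\<close>

lemma C_k_real_Suc_imp: "C_k_real (Suc k) f \<Longrightarrow> C_k_real k f"
proof (induction k arbitrary: f)
  case 0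
  then obtain f' where "\<And>x. (f has_real_derivative f' x) (at x)"
    by auto
  then show ?case
    by (auto intro!: DERIV_continuous_on[of UNIV f f'])
next
  case (Suc k)
  then obtain f' where f': "C_k_real (Suc k) f'" "\<forall>x. (f has_real_derivative f' x) (at x)"
    using C_k_real.simps(2) by blast
  then show ?case using Suc.IH by auto
qed

lemma C_k_real_add: "C_k_real k f \<Longrightarrow> C_k_real k g \<Longrightarrow> C_k_real k (\<lambda>x. f x + g x)"
proof (induction k arbitrary: f g)
  case 0
  then show ?case by (auto intro!: continuous_intros)
next
  case (Suc k)
  then obtain f' g' where "C_k_real k f'" "C_k_real k g'"
    and d: "\<forall>x. (f has_real_derivative f' x) (at x)" "\<forall>x. (g has_real_derivative g' x) (at x)"
    by auto
  then have "C_k_real k (\<lambda>x. f' x + g' x)"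
    by (intro Suc.IH)
  then show ?case
    using d by (auto intro!: exI[of _ "\<lambda>x. f' x + g' x"] derivative_eq_intros)
qed

lemma C_k_real_mult: "C_k_real k f \<Longrightarrow> C_k_real k g \<Longrightarrow> C_k_real k (\<lambda>x. f x * g x)"
proof (induction k arbitrary: f g)
  case 0
  then show ?case by (auto intro!: continuous_intros)
next
  case (Suc k)
  have fg: "C_k_real k f" "C_k_real k g"
    using Suc.prems C_k_real_Suc_imp by blast+
  obtain f' g' where fg': "C_k_real k f'" "C_k_real k g'"
    and d: "\<forall>x. (f has_real_derivative f' x) (at x)" "\<forall>x. (g has_real_derivative g' x) (at x)"
    using Suc.prems by auto
  have "C_k_real k (\<lambda>x. f' x * g x + f x * g' x)"
    using fg fg' by (intro C_k_real_add Suc.IH)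
  then show ?case
    using d by (auto intro!: exI[of _ "\<lambda>x. f' x * g x + f x * g' x"] derivative_eq_intros)
qed

lemma C_k_real_const: "C_k_real k (\<lambda>x. c)"
proof (induction k arbitrary: c)
  case (Suc k)
  show ?case using Suc.IH[of 0] by (auto intro!: exI[of _ "\<lambda>x. 0"])
qed auto

lemma C_k_real_affine: "C_k_real k f \<Longrightarrow> C_k_real k (\<lambda>x. f (c * x + d))"
proof (induction k arbitrary: f)
  case 0
  then have "continuous_on UNIV f" by simp
  then show ?case
    by (auto intro!: continuous_on_compose2[of UNIV f UNIV] continuous_intros)
next
  case (Suc k)
  then obtain f' where f': "C_k_real k f'" and d: "\<forall>x. (f has_real_derivative f' x) (at x)"
    by auto
  have "((\<lambda>x. f (c * x + d)) has_real_derivative f' (c * x + d) * c) (at x)" for x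
    by (rule DERIV_chain2[where f=f, OF d[rule_format]]) (auto intro!: derivative_eq_intros)
  moreover have "C_k_real k (\<lambda>x. f' (c * x + d) * c)"
    using f' by (intro C_k_real_mult C_k_real_const Suc.IH)
  ultimately show ?case by auto
qed

lemma C_k_real_inverse:
  assumes "\<And>x. f x \<noteq> 0"
  shows "C_k_real k f \<Longrightarrow> C_k_real k (\<lambda>x. inverse (f x))"
proof (induction k)
  case 0
  then show ?case using assms by (auto intro!: continuous_intros)
next
  case (Suc k)
  then obtain f' where f': "C_k_real k f'" and d: "\<forall>x. (f has_real_derivative f' x) (at x)"
    by auto
  have inv: "C_k_real k (\<lambda>x. inverse (f x))"
    using Suc C_k_real_Suc_imp by blast
  have "((\<lambda>x. inverse (f x)) has_real_derivative (-1) * (f' x * (inverse (f x) * inverse (f x)))) (at x)" for x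
    using assms d by (auto intro!: derivative_eq_intros)
  moreover have "C_k_real k (\<lambda>x. (-1) * (f' x * (inverse (f x) * inverse (f x))))"
    by (intro C_k_real_mult C_k_real_const f' inv)
  ultimately show ?case by auto
qed

lemma smooth_real_mult: "smooth_real f \<Longrightarrow> smooth_real g \<Longrightarrow> smooth_real (\<lambda>x. f x * g x)"
  by (simp add: smooth_real_def C_k_real_mult)

lemma smooth_real_affine: "smooth_real f \<Longrightarrow> smooth_real (\<lambda>x. f (c * x + d))"
  by (simp add: smooth_real_def C_k_real_affine)

lemma smooth_real_const: "smooth_real (\<lambda>x. c)"
  by (simp add: smooth_real_def C_k_real_const)

lemma smooth_real_add: "smooth_real f \<Longrightarrow> smooth_real g \<Longrightarrow> smooth_real (\<lambda>x. f x + g x)"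
  by (simp add: smooth_real_def C_k_real_add)

lemma smooth_real_continuous: "smooth_real f \<Longrightarrow> continuous_on UNIV f"
  unfolding smooth_real_def using C_k_real.simps(1) by blast

lemma smooth_realI_deriv:
  assumes "smooth_real f'" "\<And>x. (f has_real_derivative f' x) (at x)"
  shows "smooth_real f"
  unfolding smooth_real_def
proof
  fix k
  have "C_k_real (Suc k) f" using assms by (auto simp: smooth_real_def)
  then show "C_k_real k f" by (rule C_k_real_Suc_imp)
qed

lemma smooth_real_deriv:
  assumes "smooth_real f"
  obtains f' where "smooth_real f'" "\<And>x. (f has_real_derivative f' x) (at x)"
proof
  have "C_k_real (Suc k) f" for k using assms by (simp add: smooth_real_def)
  then have *: "\<exists>f'. C_k_real k f' \<and> (\<forall>x. (f has_real_derivative f' x) (at x))" for k by simp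
  \<comment> \<open>The witness supplied by the recursion may change with k; uniqueness of the
    derivative identifies each of them with \<open>deriv f\<close>.\<close>
  have **: "C_k_real k (deriv f) \<and> (\<forall>x. (f has_real_derivative deriv f x) (at x))" for k
  proof -
    obtain f' where f': "C_k_real k f'" "\<forall>x. (f has_real_derivative f' x) (at x)" using * by blast
    then have "f' = deriv f" by (auto simp: fun_eq_iff intro!: DERIV_imp_deriv[symmetric])
    with f' show ?thesis by simp
  qed
  show "smooth_real (deriv f)" using ** by (simp add: smooth_real_def)
  show "(f has_real_derivative deriv f x) (at x)" for x using ** by simp
qed

section \<open>Flat functions and a smooth step\<close>

definition flat_exp :: "real poly \<Rightarrow> real \<Rightarrow> real" where
  "flat_exp q x = (if x > 0 then poly q (1/x) * exp (- (1/x)) else 0)"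

lemma poly_times_exp_minus_tendsto_0:
  fixes q :: "real poly"
  shows "((\<lambda>y. poly q y * exp (- y)) \<longlongrightarrow> 0) at_top"
proof -
  have "((\<lambda>y. \<Sum>i\<le>degree q. coeff q i * (y ^ i / exp y)) \<longlongrightarrow> (\<Sum>i\<le>degree q. coeff q i * 0)) at_top"
    by (intro tendsto_intros tendsto_power_div_exp_0)
  then show ?thesis
    by (simp add: poly_altdef sum_distrib_right exp_minus divide_inverse mult.assoc)
qed

text \<open>Allowing a polynomial in 1/x in front of exp(-1/x) makes the class closed under
  differentiation: the new polynomial is X^2 (q - q'). Smoothness of the whole class then follows by
  one induction, and the gluing point 0 is treated only here.\<close>

lemma flat_exp_has_derivative:
  "(flat_exp q has_real_derivative flat_exp ([:0,0,1:] * (q - pderiv q)) x) (at x)"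
proof -
  consider "x > 0" | "x < 0" | "x = 0" by linarith
  then show ?thesis
  proof cases
    case 1
    have i: "((\<lambda>x. 1 / x) has_real_derivative - (1 / x)\<^sup>2) (at x)"
      using 1 by (auto intro!: derivative_eq_intros simp: power2_eq_square)
    have "((\<lambda>x. poly q (1/x) * exp (- (1/x))) has_real_derivative
        (poly (pderiv q) (1/x) * (- (1 / x)\<^sup>2)) * exp (- (1/x)) +
        (exp (- (1/x)) * - (- (1 / x)\<^sup>2)) * poly q (1/x)) (at x)"
      by (rule DERIV_mult[OF DERIV_chain2[OF poly_DERIV i] DERIV_fun_exp[OF DERIV_minus[OF i]]])
    then have "((\<lambda>x. poly q (1/x) * exp (- (1/x))) has_real_derivative
        flat_exp ([:0,0,1:] * (q - pderiv q)) x) (at x)"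
      by (rule DERIV_cong) (use 1 in \<open>simp add: flat_exp_def algebra_simps power2_eq_square\<close>)
    moreover have ev: "eventually (\<lambda>y. poly q (1/y) * exp (- (1/y)) = flat_exp q y) (nhds x)"
      by (rule eventually_mono[OF eventually_nhds_in_open[of "{0<..}" x]])
         (use 1 in \<open>auto simp: flat_exp_def\<close>)
    ultimately show ?thesis using DERIV_cong_ev[OF refl ev refl] by simp
  next
    case 2
    have "((\<lambda>x. 0) has_real_derivative flat_exp ([:0,0,1:] * (q - pderiv q)) x) (at x)"
      using 2 by (auto simp: flat_exp_def)
    moreover have ev: "eventually (\<lambda>y. 0 = flat_exp q y) (nhds x)"
      by (rule eventually_mono[OF eventually_nhds_in_open[of "{..<0}" x]])
         (use 2 in \<open>auto simp: flat_exp_def\<close>)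
    ultimately show ?thesis using DERIV_cong_ev[OF refl ev refl] by simp
  next
    case 3
    \<comment> \<open>Dividing by h is multiplying by 1/h, so the difference quotient at 0 has the
      same form, with X q in place of q.\<close>
    have "((\<lambda>h. poly (pCons 0 q) (inverse h) * exp (- inverse h)) \<longlongrightarrow> 0) (at_right 0)"
      by (rule filterlim_compose[OF poly_times_exp_minus_tendsto_0 filterlim_inverse_at_top_right])
    then have "((\<lambda>h. flat_exp q h / h) \<longlongrightarrow> 0) (at_right 0)"
      by (rule Lim_transform_eventually)
         (auto simp: eventually_at_filter flat_exp_def field_simps)
    moreover have "((\<lambda>h. flat_exp q h / h) \<longlongrightarrow> 0) (at_left 0)"
      by (rule Lim_transform_eventually[OF tendsto_const])
         (auto simp: eventually_at_filter flat_exp_def)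
    ultimately have "((\<lambda>h. flat_exp q h / h) \<longlongrightarrow> 0) (at 0)"
      using filterlim_split_at by blast
    then show ?thesis using 3 by (simp add: DERIV_def flat_exp_def)
  qed
qed

lemma smooth_flat_exp: "smooth_real (flat_exp q)"
  unfolding smooth_real_def
proof
  fix k show "C_k_real k (flat_exp q)"
  proof (induction k arbitrary: q)
    case 0
    show ?case using DERIV_continuous_on[OF flat_exp_has_derivative] by simp
  next
    case (Suc k)
    then show ?case using flat_exp_has_derivative by auto
  qed
qed

text \<open>The usual smooth transition from 0 to 1 across the unit interval;
  \<open>flat_exp 1\<close> is exp(-1/x) on the positive half-line.\<close>

definition smooth_step :: "real \<Rightarrow> real" where
  "smooth_step x = flat_exp 1 x * inverse (flat_exp 1 x + flat_exp 1 (1 - x))"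

lemma smooth_step_denominator_pos: "flat_exp 1 x + flat_exp 1 (1 - x) > 0"
  by (auto simp: flat_exp_def add_pos_pos)

lemma smooth_smooth_step: "smooth_real smooth_step"
proof -
  have a: "smooth_real (\<lambda>x. flat_exp 1 (1 - x))"
    using smooth_real_affine[OF smooth_flat_exp, of 1 "-1" 1] by simp
  have "smooth_real (\<lambda>x. flat_exp 1 x + flat_exp 1 (1 - x))"
    by (rule smooth_real_add[OF smooth_flat_exp a])
  then have "smooth_real (\<lambda>x. inverse (flat_exp 1 x + flat_exp 1 (1 - x)))"
    unfolding smooth_real_def
    by (intro allI C_k_real_inverse) (use smooth_step_denominator_pos in \<open>auto simp: less_le\<close>)
  then show ?thesis
    unfolding smooth_step_def[abs_def] by (rule smooth_real_mult[OF smooth_flat_exp])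
qed

lemma smooth_step_bounds: "0 \<le> smooth_step x" "smooth_step x \<le> 1"
proof -
  have "flat_exp 1 x \<ge> 0" "flat_exp 1 (1 - x) \<ge> 0" by (auto simp: flat_exp_def)
  then show "0 \<le> smooth_step x" "smooth_step x \<le> 1"
    using smooth_step_denominator_pos[of x] unfolding smooth_step_def
    by (auto simp: divide_inverse[symmetric] divide_le_eq)
qed

lemma smooth_step_eq_0: "x \<le> 0 \<Longrightarrow> smooth_step x = 0"
  and smooth_step_eq_1: "1 \<le> x \<Longrightarrow> smooth_step x = 1"
  by (auto simp: smooth_step_def flat_exp_def)

section \<open>C^k functions of two variables\<close>

lemma C_k_Suc_imp: "C_k (Suc k) f \<Longrightarrow> C_k k f"
proof (induction k arbitrary: f)
  case 0
  then obtain f1 f2 where "\<And>p. (f has_derivative (\<lambda>(s, y). s * f1 p + y * f2 p)) (at p)"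
    by (auto simp del: split_paired_All)
  then show ?case
    using has_derivative_continuous_on[of UNIV f "\<lambda>p (s, y). s * f1 p + y * f2 p"] by simp
next
  case (Suc k)
  then obtain f1 f2 where f: "C_k (Suc k) f1" "C_k (Suc k) f2"
     "\<forall>p. (f has_derivative (\<lambda>(s, y). s * f1 p + y * f2 p)) (at p)"
    using C_k.simps(2) by blast
  show ?case unfolding C_k.simps using f Suc.IH by blast
qed

lemma C_k_add: "C_k k f \<Longrightarrow> C_k k g \<Longrightarrow> C_k k (\<lambda>p. f p + g p)"
proof (induction k arbitrary: f g)
  case 0
  then show ?case by (auto intro!: continuous_intros)
next
  case (Suc k)
  obtain f1 f2 where f: "C_k k f1" "C_k k f2"
     "\<And>p. (f has_derivative (\<lambda>(s, y). s * f1 p + y * f2 p)) (at p)" using Suc.prems unfolding C_k.simps by blast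
  obtain g1 g2 where g: "C_k k g1" "C_k k g2"
     "\<And>p. (g has_derivative (\<lambda>(s, y). s * g1 p + y * g2 p)) (at p)" using Suc.prems unfolding C_k.simps by blast
  have "((\<lambda>p. f p + g p) has_derivative (\<lambda>(s, y). s * (f1 p + g1 p) + y * (f2 p + g2 p))) (at p)" for p
    by (rule has_derivative_eq_rhs[OF has_derivative_add[OF f(3) g(3)]])
       (auto simp: algebra_simps)
  moreover have "C_k k (\<lambda>p. f1 p + g1 p)" "C_k k (\<lambda>p. f2 p + g2 p)"
    using f g by (auto intro!: Suc.IH)
  ultimately show ?case unfolding C_k.simps by (intro exI conjI allI)
qed

lemma C_k_mult: "C_k k f \<Longrightarrow> C_k k g \<Longrightarrow> C_k k (\<lambda>p. f p * g p)"
proof (induction k arbitrary: f g)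
  case 0
  then show ?case by (auto intro!: continuous_intros)
next
  case (Suc k)
  obtain f1 f2 where f: "C_k k f1" "C_k k f2"
     "\<And>p. (f has_derivative (\<lambda>(s, y). s * f1 p + y * f2 p)) (at p)" using Suc.prems unfolding C_k.simps by blast
  obtain g1 g2 where g: "C_k k g1" "C_k k g2"
     "\<And>p. (g has_derivative (\<lambda>(s, y). s * g1 p + y * g2 p)) (at p)" using Suc.prems unfolding C_k.simps by blast
  have fg: "C_k k f" "C_k k g" using Suc.prems C_k_Suc_imp by blast+
  have "((\<lambda>p. f p * g p) has_derivative
      (\<lambda>(s, y). s * (f1 p * g p + f p * g1 p) + y * (f2 p * g p + f p * g2 p))) (at p)" for p
    by (rule has_derivative_eq_rhs[OF has_derivative_mult[OF f(3) g(3)]])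
       (auto simp: algebra_simps)
  moreover have "C_k k (\<lambda>p. f1 p * g p + f p * g1 p)" "C_k k (\<lambda>p. f2 p * g p + f p * g2 p)"
    using f g fg by (auto intro!: Suc.IH C_k_add)
  ultimately show ?case unfolding C_k.simps by (intro exI conjI allI)
qed

lemma C_k_zero: "C_k k (\<lambda>p. 0)"
proof (induction k)
  case (Suc k)
  then show ?case by (auto intro!: exI[of _ "\<lambda>p. 0"] simp: case_prod_unfold)
qed auto

lemma C_k_fst: "C_k_real k f \<Longrightarrow> C_k k (\<lambda>p. f (fst p))"
proof (induction k arbitrary: f)
  case 0
  then have "continuous_on UNIV f" by simp
  then show ?case
    by (auto intro!: continuous_on_compose2[of UNIV f UNIV] continuous_intros)
next
  case (Suc k)
  then obtain f' where f': "C_k_real k f'" and d: "\<And>x. (f has_real_derivative f' x) (at x)"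
    by auto
  have "((\<lambda>p. f (fst p)) has_derivative (\<lambda>(s, y). s * f' (fst p) + y * 0)) (at p)" for p :: "real \<times> real"
    by (rule has_derivative_eq_rhs[OF has_derivative_compose[OF _ d[unfolded has_field_derivative_def]]])
       (auto intro!: derivative_eq_intros simp: fun_eq_iff)
  then show ?case
    unfolding C_k.simps by (intro exI conjI allI) (rule Suc.IH[OF f'] C_k_zero | assumption)+
qed

lemma C_k_snd: "C_k_real k f \<Longrightarrow> C_k k (\<lambda>p. f (snd p))"
proof (induction k arbitrary: f)
  case 0
  then have "continuous_on UNIV f" by simp
  then show ?case
    by (auto intro!: continuous_on_compose2[of UNIV f UNIV] continuous_intros)
next
  case (Suc k)
  then obtain f' where f': "C_k_real k f'" and d: "\<And>x. (f has_real_derivative f' x) (at x)"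
    by auto
  have "((\<lambda>p. f (snd p)) has_derivative (\<lambda>(s, y). s * 0 + y * f' (snd p))) (at p)" for p :: "real \<times> real"
    by (rule has_derivative_eq_rhs[OF has_derivative_compose[OF _ d[unfolded has_field_derivative_def]]])
       (auto intro!: derivative_eq_intros simp: fun_eq_iff)
  then show ?case
    unfolding C_k.simps by (intro exI conjI allI) (rule C_k_zero Suc.IH[OF f'] | assumption)+
qed

section \<open>Band-limited waves\<close>

definition wave :: "(real \<Rightarrow> real) \<Rightarrow> real \<Rightarrow> (real \<Rightarrow> complex) \<Rightarrow> real \<times> real \<Rightarrow> complex" where
  "wave q n g p = integral {-n..n} (\<lambda>\<xi>. exp (of_real (fst p * q \<xi>) + \<i> * of_real (snd p * \<xi>)) * g \<xi>)"

lemma wave_integrable: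
  assumes "continuous_on {-n..n} q" "continuous_on {-n..n} g"
  shows "(\<lambda>\<xi>. exp (of_real (a * q \<xi>) + \<i> * of_real (b * \<xi>)) * g \<xi>) integrable_on {-n..n}"
  using assms by (intro integrable_continuous_real continuous_intros)

text \<open>A derivative in s multiplies the amplitude by q(\<xi>), one in x by i \<xi>. So waves
  solve \<partial>_s w = q(D) w and form a class closed under differentiation, which drives the
  induction in \<open>C_k_wave\<close>. Integrating over a compact set of frequencies makes this
  hold for s of either sign.\<close>

lemma wave_has_derivative:
  assumes q: "continuous_on {-n..n} q" and g: "continuous_on {-n..n} g"
  shows "(wave q n g has_derivative
    (\<lambda>(s, y). of_real s * wave q n (\<lambda>\<xi>. of_real (q \<xi>) * g \<xi>) p
       + of_real y * wave q n (\<lambda>\<xi>. \<i> * of_real \<xi> * g \<xi>) p)) (at p)"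
proof -
  let ?e = "\<lambda>p \<xi>. exp (of_real (fst p * q \<xi>) + \<i> * of_real (snd p * \<xi>)) * g \<xi>"
  let ?A = "\<lambda>p \<xi>. exp (of_real (fst p * q \<xi>) + \<i> * of_real (snd p * \<xi>)) * (of_real (q \<xi>) * g \<xi>)"
  let ?B = "\<lambda>p \<xi>. exp (of_real (fst p * q \<xi>) + \<i> * of_real (snd p * \<xi>)) * (\<i> * of_real \<xi> * g \<xi>)"
  let ?D = "\<lambda>p \<xi> (h :: real \<times> real). of_real (fst h) * ?A p \<xi> + of_real (snd h) * ?B p \<xi>"
  \<comment> \<open>\<open>leibniz_rule\<close> wants the derivative of the integrand as a jointly
    continuous family of bounded linear maps, hence the passage through
    \<open>Blinfun\<close>.\<close>
  define fx where "fx p \<xi> = Blinfun (?D p \<xi>)" for p \<xi>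
  have bl: "bounded_linear (?D p \<xi>)" for p \<xi>
    by (rule linear_conv_bounded_linear[THEN iffD1], rule linearI)
       (simp_all add: algebra_simps scaleR_conv_of_real)
  have exponent: "bounded_linear (\<lambda>p :: real \<times> real. complex_of_real (fst p * q \<xi>) + \<i> * of_real (snd p * \<xi>))" for \<xi>
    by (rule linear_conv_bounded_linear[THEN iffD1], rule linearI)
       (simp_all add: algebra_simps scaleR_conv_of_real)
  have fx: "blinfun_apply (fx p \<xi>) = ?D p \<xi>" for p \<xi>
    unfolding fx_def by (rule bounded_linear_Blinfun_apply[OF bl])
  have c: "continuous_on (UNIV \<times> {-n..n}) (\<lambda>x. f (snd x))" if "continuous_on {-n..n} f" 
    for f :: "real \<Rightarrow> 'z::topological_space"
    using that by (auto intro!: continuous_on_compose2[of "{-n..n}" f _ snd] continuous_intros)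
  have "((\<lambda>x. integral (cbox (-n) n) (?e x)) has_derivative integral (cbox (-n) n) (fx p)) (at p within UNIV)"
  proof (rule leibniz_rule)
    fix x :: "real \<times> real" and t :: real
    show "((\<lambda>x. ?e x t) has_derivative blinfun_apply (fx x t)) (at x within UNIV)"
      unfolding fx
      by (rule has_derivative_eq_rhs[OF has_derivative_mult_left[OF has_derivative_compose[OF
            bounded_linear_imp_has_derivative[OF exponent]
            DERIV_exp[unfolded has_field_derivative_def]]]])
         (simp add: fun_eq_iff algebra_simps)
    show "(\<lambda>\<xi>. ?e x \<xi>) integrable_on cbox (- n) n"
      unfolding cbox_interval using wave_integrable[OF q g, of "fst x" "snd x"] by simp
  next
    show "continuous_on (UNIV \<times> cbox (- n) n) (\<lambda>(x, t). fx x t)"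
      unfolding cbox_interval case_prod_unfold
      by (rule continuous_on_blinfun_componentwise)
         (auto simp: fx intro!: continuous_intros c q g)
  qed auto
  moreover have "integral {-n..n} (fx p) h = 
      of_real (fst h) * wave q n (\<lambda>\<xi>. of_real (q \<xi>) * g \<xi>) p
       + of_real (snd h) * wave q n (\<lambda>\<xi>. \<i> * of_real \<xi> * g \<xi>) p" for h
  proof -
    have "continuous_on {-n..n} (fx p)"
      by (rule continuous_on_blinfun_componentwise) (auto simp: fx intro!: continuous_intros q g)
    then have "fx p integrable_on {-n..n}" by (rule integrable_continuous_real)
    then have "integral {-n..n} (fx p) h = integral {-n..n} (\<lambda>\<xi>. fx p \<xi> h)"
      using integral_linear[OF _ blinfun.bounded_linear_left, of "fx p" "{-n..n}" h]
      by (simp add: o_def)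
    also have "\<dots> = integral {-n..n} (\<lambda>\<xi>. of_real (fst h) * ?A p \<xi>) + integral {-n..n} (\<lambda>\<xi>. of_real (snd h) * ?B p \<xi>)"
      unfolding fx
      by (intro integral_add integrable_continuous_real continuous_intros q g)
    finally show ?thesis by (simp add: wave_def)
  qed
  ultimately show ?thesis
    unfolding wave_def[abs_def] by (simp add: cbox_interval case_prod_unfold) (metis (no_types, lifting) ext)
qed

lemma C_k_wave:
  assumes q: "continuous_on {-n..n} q"
  shows "continuous_on {-n..n} g \<Longrightarrow> C_k k (\<lambda>p. Re (wave q n g p))"
proof (induction k arbitrary: g)
  case 0
  then have "continuous_on UNIV (wave q n g)"
    using has_derivative_continuous_on[of UNIV "wave q n g", OF has_derivative_at_withinI[OF wave_has_derivative[OF q]]]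
    by blast
  then show ?case by (auto intro!: continuous_intros)
next
  case (Suc k)
  have "((\<lambda>p. Re (wave q n g p)) has_derivative
    (\<lambda>(s, y). s * Re (wave q n (\<lambda>\<xi>. of_real (q \<xi>) * g \<xi>) p)
       + y * Re (wave q n (\<lambda>\<xi>. \<i> * of_real \<xi> * g \<xi>) p))) (at p)" for p
    by (rule has_derivative_eq_rhs[OF has_derivative_Re[OF wave_has_derivative[OF q Suc.prems]]]) auto
  moreover have "C_k k (\<lambda>p. Re (wave q n (\<lambda>\<xi>. of_real (q \<xi>) * g \<xi>) p))"
    "C_k k (\<lambda>p. Re (wave q n (\<lambda>\<xi>. \<i> * of_real \<xi> * g \<xi>) p))"
    by (intro Suc.IH continuous_intros q Suc.prems)+
  ultimately show ?case unfolding C_k.simps by (intro exI conjI allI)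
qed

section \<open>The Fourier transform on the line\<close>

lemma Cauchy_Schwarz_integral_real:
  fixes f g :: "'a \<Rightarrow> real"
  assumes [measurable]: "f \<in> borel_measurable M" "g \<in> borel_measurable M"
    and f: "integrable M (\<lambda>x. (f x)\<^sup>2)" and g: "integrable M (\<lambda>x. (g x)\<^sup>2)"
  shows "integrable M (\<lambda>x. f x * g x)"
    and "(LINT x|M. f x * g x)\<^sup>2 \<le> (LINT x|M. (f x)\<^sup>2) * (LINT x|M. (g x)\<^sup>2)"
proof -
  show int: "integrable M (\<lambda>x. f x * g x)"
  proof (rule Bochner_Integration.integrable_bound)
    show "integrable M (\<lambda>x. (f x)\<^sup>2 + (g x)\<^sup>2)" using f g by simp
    have "\<bar>a * b\<bar> \<le> a\<^sup>2 + b\<^sup>2" for a b :: real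
    proof -
      have "0 \<le> (\<bar>a\<bar> - \<bar>b\<bar>)\<^sup>2" by simp
      then have "2 * (\<bar>a\<bar> * \<bar>b\<bar>) \<le> a\<^sup>2 + b\<^sup>2" by (simp add: power2_diff)
      then show ?thesis by (simp add: abs_mult) (smt (verit) abs_ge_zero mult_nonneg_nonneg)
    qed
    then show "AE x in M. norm (f x * g x) \<le> norm ((f x)\<^sup>2 + (g x)\<^sup>2)" by auto
  qed simp
  define A B C where "A = (LINT x|M. (f x)\<^sup>2)" and "B = (LINT x|M. f x * g x)"
    and "C = (LINT x|M. (g x)\<^sup>2)"
  \<comment> \<open>Discriminant argument. If C = 0, the value t = (A + 1) / (2 B) would make the
    right side -1, so B = 0; otherwise the minimiser t = B / C gives the claim.\<close>
  have quad: "0 \<le> A - 2 * t * B + t\<^sup>2 * C" for t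
  proof -
    have "0 \<le> (LINT x|M. (f x - t * g x)\<^sup>2)" by simp
    also have "\<dots> = (LINT x|M. ((f x)\<^sup>2 - 2 * t * (f x * g x)) + t\<^sup>2 * (g x)\<^sup>2)"
      by (intro Bochner_Integration.integral_cong refl) (simp add: power2_eq_square algebra_simps)
    also have "\<dots> = A - 2 * t * B + t\<^sup>2 * C"
      using f g int by (simp add: A_def B_def C_def)
    finally show ?thesis .
  qed
  show "B\<^sup>2 \<le> A * C"
  proof (cases "C = 0")
    case True
    have "B = 0"
    proof (rule ccontr)
      assume "B \<noteq> 0"
      then show False using quad[of "(A + 1) / (2 * B)"] True by simp
    qed
    then show ?thesis using True by simp
  next
    case False
    moreover have "C \<ge> 0" by (simp add: C_def)
    ultimately have "C > 0" by simp
    then show ?thesis using quad[of "B / C"] 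
      by (simp add: field_simps power2_eq_square)
  qed
qed

lemma Cauchy_Schwarz_integral:
  fixes f g :: "'a \<Rightarrow> complex"
  assumes [measurable]: "f \<in> borel_measurable M" "g \<in> borel_measurable M"
    and f: "integrable M (\<lambda>x. (norm (f x))\<^sup>2)" and g: "integrable M (\<lambda>x. (norm (g x))\<^sup>2)"
  shows "integrable M (\<lambda>x. f x * g x)"
    and "norm (LINT x|M. f x * g x) \<le> sqrt (LINT x|M. (norm (f x))\<^sup>2) * sqrt (LINT x|M. (norm (g x))\<^sup>2)"
proof -
  note CS = Cauchy_Schwarz_integral_real[of "\<lambda>x. norm (f x)" M "\<lambda>x. norm (g x)", OF _ _ f g, simplified]
  show "integrable M (\<lambda>x. f x * g x)"
    by (rule Bochner_Integration.integrable_bound[OF CS(1)]) (auto simp: norm_mult)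
  have "norm (LINT x|M. f x * g x) \<le> (LINT x|M. norm (f x) * norm (g x))"
    by (rule order_trans[OF integral_norm_bound]) (simp add: norm_mult)
  also have "\<dots> \<le> sqrt ((LINT x|M. (norm (f x))\<^sup>2) * (LINT x|M. (norm (g x))\<^sup>2))"
    by (rule real_le_rsqrt[OF CS(2)])
  finally show "norm (LINT x|M. f x * g x) \<le> sqrt (LINT x|M. (norm (f x))\<^sup>2) * sqrt (LINT x|M. (norm (g x))\<^sup>2)"
    by (simp add: real_sqrt_mult)
qed

text \<open>One transform serves both directions: \<open>fourier\<close> is \<open>ft\<close> at
  -\<xi>, and \<open>inverse_fourier\<close> is \<open>ft\<close> divided by 2 pi. It lives on
  \<open>lborel\<close>, where product measurability and Fubini are at hand; for Borel functions the
  Lebesgue integrals of the statement reduce to it.\<close>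

definition ft :: "(real \<Rightarrow> complex) \<Rightarrow> real \<Rightarrow> complex" where
  "ft G x = (LINT \<xi>|lborel. cis (x * \<xi>) * G \<xi>)"

lemma cis_measurable [measurable]: "cis \<in> borel_measurable borel"
  by (intro borel_measurable_continuous_onI continuous_intros)

lemma cnj_measurable [measurable]: "cnj \<in> borel_measurable borel"
  by (intro borel_measurable_continuous_onI continuous_intros)

lemma ft_measurable [measurable]:
  assumes [measurable]: "G \<in> borel_measurable borel"
  shows "ft G \<in> borel_measurable borel"
  unfolding ft_def[abs_def] by measurable

lemma integrable_cis_mult:
  assumes "integrable lborel G"
  shows "integrable lborel (\<lambda>\<xi>. cis (x * \<xi>) * G \<xi>)"
  by (rule Bochner_Integration.integrable_bound[OF assms])
     (use borel_measurable_integrable[OF assms] in \<open>auto simp: norm_mult\<close>)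

lemma norm_ft_le:
  shows "norm (ft G x) \<le> (LINT \<xi>|lborel. norm (G \<xi>))"
  unfolding ft_def
  by (rule order_trans[OF integral_norm_bound]) (simp add: norm_mult)

lemma ft_continuous:
  assumes "integrable lborel G"
  shows "continuous_on UNIV (ft G)"
proof (intro continuous_at_imp_continuous_on ballI)
  fix x
  note [measurable] = borel_measurable_integrable[OF assms]
  show "isCont (ft G) x"
    unfolding continuous_at_sequentially comp_def ft_def
  proof (intro allI impI)
    fix X :: "nat \<Rightarrow> real" assume X: "X \<longlonglongrightarrow> x"
    show "(\<lambda>n. LINT \<xi>|lborel. cis (X n * \<xi>) * G \<xi>) \<longlonglongrightarrow> (LINT \<xi>|lborel. cis (x * \<xi>) * G \<xi>)"
    proof (rule integral_dominated_convergence[where w = "\<lambda>\<xi>. norm (G \<xi>)"])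
      show "integrable lborel (\<lambda>\<xi>. norm (G \<xi>))" using assms by simp
      have "(\<lambda>n. cis (X n * \<xi>) * G \<xi>) \<longlonglongrightarrow> cis (x * \<xi>) * G \<xi>" for \<xi>
        by (intro tendsto_intros X)
      then show "AE \<xi> in lborel. (\<lambda>n. cis (X n * \<xi>) * G \<xi>) \<longlonglongrightarrow> cis (x * \<xi>) * G \<xi>" by simp
    qed (auto simp: norm_mult)
  qed
qed

text \<open>Fubini, with \<bar>G(\<xi>) k(x)\<bar> as integrable majorant. This symmetry is the
  source of Plancherel, duality and inversion below.\<close>

lemma ft_multiplication_formula:
  assumes G: "integrable lborel G" and k: "integrable lborel k"
  shows "(LINT x|lborel. ft G x * k x) = (LINT \<xi>|lborel. G \<xi> * ft k \<xi>)"
proof -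
  note [measurable] = borel_measurable_integrable[OF G] borel_measurable_integrable[OF k]
  have int: "integrable (lborel \<Otimes>\<^sub>M lborel) (\<lambda>(x, \<xi>). cis (x * \<xi>) * G \<xi> * k x)"
  proof (rule lborel_pair.Fubini_integrable)
    have "(\<lambda>x. (LINT y|lborel. norm (G y)) * norm (k x)) = 
        (\<lambda>x. LINT y|lborel. norm (case (x, y) of (x, \<xi>) \<Rightarrow> cis (x * \<xi>) * G \<xi> * k x))"
      by (simp add: norm_mult)
    then show "integrable lborel (\<lambda>x. LINT y|lborel. norm (case (x, y) of (x, \<xi>) \<Rightarrow> cis (x * \<xi>) * G \<xi> * k x))"
      using k by (metis integrable_mult_right integrable_norm)
    show "AE x in lborel. integrable lborel (\<lambda>y. case (x, y) of (x, \<xi>) \<Rightarrow> cis (x * \<xi>) * G \<xi> * k x)"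
      using integrable_cis_mult[OF G] by auto
  qed measurable
  have "(LINT x|lborel. ft G x * k x) = (LINT x|lborel. LINT \<xi>|lborel. cis (x * \<xi>) * G \<xi> * k x)"
    by (simp add: ft_def)
  also have "\<dots> = (LINT \<xi>|lborel. LINT x|lborel. cis (x * \<xi>) * G \<xi> * k x)"
    by (rule lborel_pair.Fubini_integral[OF int, symmetric])
  also have "\<dots> = (LINT \<xi>|lborel. LINT x|lborel. G \<xi> * (cis (\<xi> * x) * k x))"
    by (simp add: mult_ac)
  also have "\<dots> = (LINT \<xi>|lborel. G \<xi> * ft k \<xi>)"
    by (simp add: ft_def)
  finally show ?thesis .
qed

section \<open>Gaussians, the Plancherel inequality and uniqueness\<close>

lemma gaussian_std:
  "integrable lborel (\<lambda>x. exp (- x\<^sup>2 / 2) :: real)"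
  "ft (\<lambda>x. of_real (exp (- x\<^sup>2 / 2))) t = of_real (sqrt (2 * pi) * exp (- t\<^sup>2 / 2))"
proof -
  have "integrable lborel (\<lambda>x. sqrt (2 * pi) * std_normal_density x)"
    by simp
  then show "integrable lborel (\<lambda>x. exp (- x\<^sup>2 / 2) :: real)"
    by (simp add: std_normal_density_def)
  \<comment> \<open>The transform of the Gaussian is read off from the characteristic function of
    the standard normal distribution.\<close>
  have "char std_normal_distribution t = (LINT x|lborel. std_normal_density x *\<^sub>R iexp (t * x))"
    unfolding char_def by (subst integral_density) (auto simp: normal_density_nonneg)
  also have "\<dots> = (LINT x|lborel. (1 / sqrt (2 * pi)) *\<^sub>R (cis (t * x) * of_real (exp (- x\<^sup>2 / 2))))"
    by (intro Bochner_Integration.integral_cong)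
       (simp_all add: std_normal_density_def cis_conv_exp scaleR_conv_of_real mult_ac)
  finally show "ft (\<lambda>x. of_real (exp (- x\<^sup>2 / 2))) t = of_real (sqrt (2 * pi) * exp (- t\<^sup>2 / 2))"
    unfolding char_std_normal_distribution ft_def integral_scaleR_right
    by (simp add: scaleR_conv_of_real field_simps)
qed

lemma gaussian:
  assumes "\<epsilon> > 0"
  shows "integrable lborel (\<lambda>x. exp (- \<epsilon> * x\<^sup>2 / 2) :: real)"
  "ft (\<lambda>x. of_real (exp (- \<epsilon> * x\<^sup>2 / 2))) t = of_real (sqrt (2 * pi / \<epsilon>) * exp (- t\<^sup>2 / (2 * \<epsilon>)))"
  "(LINT x|lborel. exp (- \<epsilon> * x\<^sup>2 / 2)) = sqrt (2 * pi / \<epsilon>)"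
proof -
  have e: "sqrt \<epsilon> \<noteq> 0" using assms by simp
  have sq: "(sqrt \<epsilon> * x)\<^sup>2 = \<epsilon> * x\<^sup>2" for x using assms by (simp add: power_mult_distrib)
  show int: "integrable lborel (\<lambda>x. exp (- \<epsilon> * x\<^sup>2 / 2) :: real)"
    using lborel_integrable_real_affine[OF gaussian_std(1) e, of 0] by (simp add: sq)
  have ft: "ft (\<lambda>x. of_real (exp (- \<epsilon> * x\<^sup>2 / 2))) t = of_real (sqrt (2 * pi / \<epsilon>) * exp (- t\<^sup>2 / (2 * \<epsilon>)))" for t
  proof -
    have "ft (\<lambda>x. of_real (exp (- x\<^sup>2 / 2))) (t / sqrt \<epsilon>) =
       sqrt \<epsilon> *\<^sub>R (LINT x|lborel. cis (t / sqrt \<epsilon> * (sqrt \<epsilon> * x)) * of_real (exp (- (sqrt \<epsilon> * x)\<^sup>2 / 2)))"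
      unfolding ft_def using assms
      by (subst lborel_integral_real_affine[OF e, where t = 0]) simp
    also have "\<dots> = sqrt \<epsilon> *\<^sub>R ft (\<lambda>x. of_real (exp (- \<epsilon> * x\<^sup>2 / 2))) t"
      using assms unfolding ft_def sq by simp
    finally have "sqrt \<epsilon> *\<^sub>R ft (\<lambda>x. of_real (exp (- \<epsilon> * x\<^sup>2 / 2))) t
        = of_real (sqrt (2 * pi) * exp (- (t / sqrt \<epsilon>)\<^sup>2 / 2))"
      unfolding gaussian_std(2) by simp
    from this have "ft (\<lambda>x. of_real (exp (- \<epsilon> * x\<^sup>2 / 2))) t = 
        (1 / sqrt \<epsilon>) *\<^sub>R of_real (sqrt (2 * pi) * exp (- (t / sqrt \<epsilon>)\<^sup>2 / 2))"
      (is "?l = (1 / sqrt \<epsilon>) *\<^sub>R ?r")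
    proof -
      assume "sqrt \<epsilon> *\<^sub>R ?l = ?r"
      then have "(1 / sqrt \<epsilon>) *\<^sub>R (sqrt \<epsilon> *\<^sub>R ?l) = (1 / sqrt \<epsilon>) *\<^sub>R ?r" by (rule arg_cong)
      then show ?thesis using e by simp
    qed
    also have "\<dots> = of_real (sqrt (2 * pi / \<epsilon>) * exp (- t\<^sup>2 / (2 * \<epsilon>)))"
      using assms by (simp add: scaleR_conv_of_real real_sqrt_divide power_divide field_simps)
    finally show ?thesis .
  qed
  show "ft (\<lambda>x. of_real (exp (- \<epsilon> * x\<^sup>2 / 2))) t = of_real (sqrt (2 * pi / \<epsilon>) * exp (- t\<^sup>2 / (2 * \<epsilon>)))"
    by (rule ft)
  show "(LINT x|lborel. exp (- \<epsilon> * x\<^sup>2 / 2)) = sqrt (2 * pi / \<epsilon>)"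
    using ft[of 0] unfolding ft_def by (simp del: of_real_mult of_real_exp)
qed

text \<open>Schur's argument: 2 a(x) a(y) \<le> a(x)^2 + a(y)^2 separates the variables, and
  translation invariance integrates \<gamma> to the same constant in either of them.\<close>

lemma nn_integral_convolution_quadratic_le:
  fixes a :: "real \<Rightarrow> real"
  assumes [measurable]: "a \<in> borel_measurable borel" "\<gamma> \<in> borel_measurable borel"
    and a: "\<And>x. 0 \<le> a x" and \<gamma>: "\<And>x. 0 \<le> \<gamma> x"
  shows "(\<integral>\<^sup>+x. \<integral>\<^sup>+y. ennreal (a x * a y * \<gamma> (x - y)) \<partial>lborel \<partial>lborel)
    \<le> (\<integral>\<^sup>+x. ennreal ((a x)\<^sup>2) \<partial>lborel) * (\<integral>\<^sup>+x. ennreal (\<gamma> x) \<partial>lborel)"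
proof -
  let ?A = "\<integral>\<^sup>+x. ennreal ((a x)\<^sup>2) \<partial>lborel" and ?C = "\<integral>\<^sup>+x. ennreal (\<gamma> x) \<partial>lborel"
  have sh1: "(\<integral>\<^sup>+y. ennreal (\<gamma> (x - y)) \<partial>lborel) = ?C" for x
    by (subst nn_integral_real_affine[where c="-1" and t=x]) (auto)
  have sh2: "(\<integral>\<^sup>+x. ennreal (\<gamma> (x - y)) \<partial>lborel) = ?C" for y
    by (subst nn_integral_real_affine[where c="1" and t=y]) (auto)
  have half: "a x * a y * c \<le> (a x)\<^sup>2 * (c / 2) + (a y)\<^sup>2 * (c / 2)" if "c \<ge> 0" for x y c
  proof -
    have "0 \<le> (a x - a y)\<^sup>2 * (c / 2)" using that by simp
    then show ?thesis by (simp add: power2_diff algebra_simps)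
  qed
  have "(\<integral>\<^sup>+x. \<integral>\<^sup>+y. ennreal (a x * a y * \<gamma> (x - y)) \<partial>lborel \<partial>lborel)
    \<le> (\<integral>\<^sup>+x. \<integral>\<^sup>+y. ennreal ((a x)\<^sup>2) * (ennreal (1/2) * ennreal (\<gamma> (x - y)))
        + ennreal ((a y)\<^sup>2) * (ennreal (1/2) * ennreal (\<gamma> (x - y))) \<partial>lborel \<partial>lborel)"
  proof (intro nn_integral_mono)
    fix x y
    have "ennreal (a x * a y * \<gamma> (x - y)) \<le> ennreal ((a x)\<^sup>2 * (1/2 * \<gamma> (x - y)) + (a y)\<^sup>2 * (1/2 * \<gamma> (x - y)))"
      using half[OF \<gamma>[of "x - y"], of x y] by (intro ennreal_leI) simp
    also have "\<dots> = ennreal ((a x)\<^sup>2) * (ennreal (1/2) * ennreal (\<gamma> (x - y)))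
        + ennreal ((a y)\<^sup>2) * (ennreal (1/2) * ennreal (\<gamma> (x - y)))"
      using \<gamma>[of "x - y"] by (subst ennreal_plus) (auto simp only: ennreal_mult zero_le_power2 intro!: mult_nonneg_nonneg)
    finally show "ennreal (a x * a y * \<gamma> (x - y)) \<le> \<dots>" .
  qed
  also have "\<dots> = (\<integral>\<^sup>+x. \<integral>\<^sup>+y. ennreal ((a x)\<^sup>2) * (ennreal (1/2) * ennreal (\<gamma> (x - y))) \<partial>lborel \<partial>lborel)
      + (\<integral>\<^sup>+x. \<integral>\<^sup>+y. ennreal ((a y)\<^sup>2) * (ennreal (1/2) * ennreal (\<gamma> (x - y))) \<partial>lborel \<partial>lborel)"
    by (simp add: nn_integral_add)
  also have "(\<integral>\<^sup>+x. \<integral>\<^sup>+y. ennreal ((a y)\<^sup>2) * (ennreal (1/2) * ennreal (\<gamma> (x - y))) \<partial>lborel \<partial>lborel)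
      = (\<integral>\<^sup>+y. \<integral>\<^sup>+x. ennreal ((a y)\<^sup>2) * (ennreal (1/2) * ennreal (\<gamma> (x - y))) \<partial>lborel \<partial>lborel)"
    by (rule lborel_pair.Fubini') measurable
  also have "(\<integral>\<^sup>+y. \<integral>\<^sup>+x. ennreal ((a y)\<^sup>2) * (ennreal (1/2) * ennreal (\<gamma> (x - y))) \<partial>lborel \<partial>lborel)
      = ?A * (ennreal (1/2) * ?C)"
    by (simp add: nn_integral_cmult nn_integral_multc sh2)
  also have "(\<integral>\<^sup>+x. \<integral>\<^sup>+y. ennreal ((a x)\<^sup>2) * (ennreal (1/2) * ennreal (\<gamma> (x - y))) \<partial>lborel \<partial>lborel)
      = ?A * (ennreal (1/2) * ?C)"
    by (simp add: nn_integral_cmult nn_integral_multc sh1)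
  also have "?A * (ennreal (1/2) * ?C) + ?A * (ennreal (1/2) * ?C) = ?A * ?C * (ennreal (1/2) + ennreal (1/2))"
    by (simp add: algebra_simps)
  also have "ennreal (1/2) + ennreal (1/2) = 1"
    by (subst ennreal_plus[symmetric]) auto
  finally show ?thesis by simp
qed

text \<open>With a Gaussian g as extra factor, k = g cnj(\<open>ft G\<close>) is integrable, and the
  multiplication formula turns the left side into the integral of G times \<open>ft k\<close>. The
  latter is bounded by the convolution of \<bar>G\<bar> with \<gamma>, the transform of g, whose
  mass is 2 pi for every \<epsilon>. The Schur bound then gives a constant free of
  \<epsilon>.\<close>

lemma ft_L2_bound_gaussian:
  assumes G: "integrable lborel G" and G2: "integrable lborel (\<lambda>x. (norm (G x))\<^sup>2)" and \<epsilon>: "\<epsilon> > 0"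
  shows "(\<integral>\<^sup>+x. ennreal (exp (- \<epsilon> * x\<^sup>2 / 2) * (norm (ft G x))\<^sup>2) \<partial>lborel)
    \<le> ennreal (2 * pi * (LINT x|lborel. (norm (G x))\<^sup>2))"
proof -
  note [measurable] = borel_measurable_integrable[OF G]
  define g where "g x = exp (- \<epsilon> * x\<^sup>2 / 2)" for x :: real
  define \<gamma> where "\<gamma> z = sqrt (2 * pi / \<epsilon>) * exp (- z\<^sup>2 / (2 * \<epsilon>))" for z :: real
  have g: "integrable lborel g" unfolding g_def[abs_def] by (rule gaussian(1)[OF \<epsilon>])
  have [measurable]: "g \<in> borel_measurable borel" "\<gamma> \<in> borel_measurable borel"
    unfolding g_def[abs_def] \<gamma>_def[abs_def] by measurable
  have ftg: "ft (\<lambda>x. of_real (g x)) z = of_real (\<gamma> z)" for z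
    unfolding g_def \<gamma>_def by (rule gaussian(2)[OF \<epsilon>])
  have \<gamma>0: "\<gamma> z \<ge> 0" for z using \<epsilon> by (simp add: \<gamma>_def)
  have gc: "integrable lborel (\<lambda>x. cis (c * x) * of_real (g x))" for c
    using g by (intro integrable_cis_mult) simp
  have cG: "integrable lborel (\<lambda>x. cnj (G (- x)))"
    using lborel_integrable_real_affine[OF G, of "-1" 0] by simp
  have cnj_ft: "cnj (ft G x) = ft (\<lambda>y. cnj (G (- y))) x" for x
  proof -
    have "cnj (ft G x) = (LINT y|lborel. cnj (cis (x * y) * G y))"
      unfolding ft_def
      by (rule integral_bounded_linear[OF bounded_linear_cnj integrable_cis_mult[OF G], symmetric])
    also have "\<dots> = (LINT y|lborel. cnj (cis (x * (- y)) * G (- y)))"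
      using lborel_integral_real_affine[of "-1" "\<lambda>y. cnj (cis (x * y) * G y)" 0] by simp
    finally show ?thesis by (simp add: ft_def cis_cnj)
  qed
  define k where "k x = of_real (g x) * cnj (ft G x)" for x
  have k: "integrable lborel k"
  proof (rule Bochner_Integration.integrable_bound)
    show "integrable lborel (\<lambda>x. g x * (LINT y|lborel. norm (G y)))" using g by simp
    show "k \<in> borel_measurable lborel" unfolding k_def[abs_def] by measurable
    show "AE x in lborel. norm (k x) \<le> norm (g x * (LINT y|lborel. norm (G y)))"
    proof (intro AE_I2)
      fix x
      have "norm (k x) = g x * norm (ft G x)" by (simp add: k_def norm_mult g_def)
      also have "\<dots> \<le> g x * (LINT y|lborel. norm (G y))"
        by (intro mult_left_mono norm_ft_le) (simp add: g_def)
      finally show "norm (k x) \<le> norm (g x * (LINT y|lborel. norm (G y)))" by simp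
    qed
  qed
  have ftk: "norm (ft k \<xi>) \<le> (LINT y|lborel. norm (G y) * \<gamma> (\<xi> - y))" for \<xi>
  proof -
    have "ft k \<xi> = (LINT x|lborel. ft (\<lambda>y. cnj (G (- y))) x * (cis (\<xi> * x) * of_real (g x)))"
      unfolding ft_def[of k] k_def cnj_ft by (simp add: mult_ac)
    also have "\<dots> = (LINT y|lborel. cnj (G (- y)) * ft (\<lambda>x. cis (\<xi> * x) * of_real (g x)) y)"
      by (rule ft_multiplication_formula[OF cG gc])
    also have "\<dots> = (LINT y|lborel. cnj (G (- y)) * of_real (\<gamma> (\<xi> + y)))"
    proof -
      have "ft (\<lambda>x. cis (\<xi> * x) * of_real (g x)) y = ft (\<lambda>x. of_real (g x)) (\<xi> + y)" for y
        by (simp add: ft_def distrib_right distrib_left cis_mult[symmetric] mult_ac)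
      then show ?thesis by (simp add: ftg)
    qed
    also have "\<dots> = (LINT y|lborel. cnj (G y) * of_real (\<gamma> (\<xi> - y)))"
      using lborel_integral_real_affine[of "-1" "\<lambda>y. cnj (G y) * of_real (\<gamma> (\<xi> - y))" 0] by simp
    finally have "norm (ft k \<xi>) \<le> (LINT y|lborel. norm (cnj (G y) * of_real (\<gamma> (\<xi> - y))))"
      by (metis integral_norm_bound)
    then show ?thesis using \<gamma>0 by (simp add: norm_mult)
  qed
  have \<gamma>i: "integrable lborel \<gamma>" and \<gamma>1: "(LINT z|lborel. \<gamma> z) = 2 * pi"
  proof -
    have e: "1 / \<epsilon> > 0" using \<epsilon> by simp
    have eq: "\<gamma> = (\<lambda>z. sqrt (2 * pi / \<epsilon>) * exp (- (1 / \<epsilon>) * z\<^sup>2 / 2))"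
      by (simp add: \<gamma>_def fun_eq_iff)
    show "integrable lborel \<gamma>" unfolding eq using gaussian(1)[OF e] by (rule integrable_mult_right)
    show "(LINT z|lborel. \<gamma> z) = 2 * pi"
    proof -
      have "2 * pi / \<epsilon> * (2 * pi / (1 / \<epsilon>)) = (2 * pi)\<^sup>2"
        using \<epsilon> by (simp add: power2_eq_square)
      then have "sqrt (2 * pi / \<epsilon>) * sqrt (2 * pi / (1 / \<epsilon>)) = sqrt ((2 * pi)\<^sup>2)"
        by (simp only: real_sqrt_mult[symmetric])
      also have "\<dots> = 2 * pi"
        by (subst real_sqrt_abs) simp
      finally have "sqrt (2 * pi / \<epsilon>) * sqrt (2 * pi / (1 / \<epsilon>)) = 2 * pi" .
      then show ?thesis
        unfolding eq integral_mult_right_zero gaussian(3)[OF e] .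
    qed
  qed
  have bounded: "\<gamma> z \<le> sqrt (2 * pi / \<epsilon>)" for z using \<epsilon> by (simp add: \<gamma>_def mult_left_le)
  have inner: "integrable lborel (\<lambda>y. norm (G y) * \<gamma> (\<xi> - y))" for \<xi>
    by (rule Bochner_Integration.integrable_bound[of _ "\<lambda>y. norm (G y) * sqrt (2 * pi / \<epsilon>)"])
       (use G bounded \<gamma>0 \<epsilon> in \<open>auto intro!: AE_I2 mult_left_mono\<close>)
  have nn: "(\<integral>\<^sup>+x. ennreal (g x * (norm (ft G x))\<^sup>2) \<partial>lborel) = ennreal (LINT x|lborel. g x * (norm (ft G x))\<^sup>2)"
  proof (rule nn_integral_eq_integral)
    have "integrable lborel (\<lambda>x. (LINT y|lborel. norm (G y)) * norm (k x))" using k by simp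
    then show "integrable lborel (\<lambda>x. g x * (norm (ft G x))\<^sup>2)"
      by (rule Bochner_Integration.integrable_bound)
         (auto simp: k_def norm_mult power2_eq_square g_def intro!: AE_I2 mult_mono norm_ft_le)
  qed (simp add: g_def)
  have "of_real (LINT x|lborel. g x * (norm (ft G x))\<^sup>2) = (LINT x|lborel. ft G x * k x)"
    by (subst integral_complex_of_real[symmetric])
       (simp add: k_def mult_ac complex_norm_square del: of_real_power)
  also have "\<dots> = (LINT \<xi>|lborel. G \<xi> * ft k \<xi>)"
    by (rule ft_multiplication_formula[OF G k])
  finally have eq: "of_real (LINT x|lborel. g x * (norm (ft G x))\<^sup>2) = (LINT \<xi>|lborel. G \<xi> * ft k \<xi>)" .
  have "ennreal (LINT x|lborel. g x * (norm (ft G x))\<^sup>2) \<le> ennreal (norm (LINT \<xi>|lborel. G \<xi> * ft k \<xi>))"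
    unfolding eq[symmetric] by (simp add: ennreal_leI)
  also have "\<dots> \<le> (\<integral>\<^sup>+\<xi>. ennreal (norm (G \<xi> * ft k \<xi>)) \<partial>lborel)"
  proof (rule integral_norm_bound_ennreal)
    show "integrable lborel (\<lambda>\<xi>. G \<xi> * ft k \<xi>)"
      by (rule Bochner_Integration.integrable_bound[of _ "\<lambda>\<xi>. norm (G \<xi>) * (LINT y|lborel. norm (k y))"])
         (use G norm_ft_le[of k] k in \<open>auto simp: norm_mult intro!: AE_I2 mult_mono\<close>)
  qed
  also have "\<dots> \<le> (\<integral>\<^sup>+\<xi>. \<integral>\<^sup>+y. ennreal (norm (G \<xi>) * norm (G y) * \<gamma> (\<xi> - y)) \<partial>lborel \<partial>lborel)"
  proof (rule nn_integral_mono)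
    fix \<xi>
    have "ennreal (norm (G \<xi> * ft k \<xi>)) \<le> ennreal (norm (G \<xi>)) * ennreal (LINT y|lborel. norm (G y) * \<gamma> (\<xi> - y))"
      using ftk[of \<xi>] by (subst ennreal_mult[symmetric])
        (auto simp: norm_mult \<gamma>0 intro!: ennreal_leI mult_left_mono)
    also have "ennreal (LINT y|lborel. norm (G y) * \<gamma> (\<xi> - y)) = (\<integral>\<^sup>+y. ennreal (norm (G y) * \<gamma> (\<xi> - y)) \<partial>lborel)"
      by (rule nn_integral_eq_integral[symmetric]) (auto simp: inner \<gamma>0)
    finally show "ennreal (norm (G \<xi> * ft k \<xi>)) \<le> (\<integral>\<^sup>+y. ennreal (norm (G \<xi>) * norm (G y) * \<gamma> (\<xi> - y)) \<partial>lborel)"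
      by (subst (asm) nn_integral_cmult[symmetric])
         (auto simp: ennreal_mult[symmetric] \<gamma>0 mult.assoc)
  qed
  also have "\<dots> \<le> (\<integral>\<^sup>+x. ennreal ((norm (G x))\<^sup>2) \<partial>lborel) * (\<integral>\<^sup>+z. ennreal (\<gamma> z) \<partial>lborel)"
    by (rule nn_integral_convolution_quadratic_le) (auto simp: \<gamma>0)
  also have "\<dots> = ennreal (LINT x|lborel. (norm (G x))\<^sup>2) * ennreal (2 * pi)"
    using G2 \<gamma>i \<gamma>0 \<gamma>1 by (simp add: nn_integral_eq_integral)
  also have "\<dots> = ennreal (2 * pi * (LINT x|lborel. (norm (G x))\<^sup>2))"
    by (simp add: ennreal_mult[symmetric] mult_ac)
  finally show ?thesis using nn unfolding g_def by (simp only:)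
qed

text \<open>Fatou's lemma removes the Gaussian as its parameter 1 / (n + 1) tends to 0. Transforms
  are only ever bounded from above below, so the inequality is the useful half of
  Plancherel.\<close>

lemma ft_L2_bound:
  assumes G: "integrable lborel G" and G2: "integrable lborel (\<lambda>x. (norm (G x))\<^sup>2)"
  shows "integrable lborel (\<lambda>x. (norm (ft G x))\<^sup>2)"
    and "(LINT x|lborel. (norm (ft G x))\<^sup>2) \<le> 2 * pi * (LINT x|lborel. (norm (G x))\<^sup>2)"
proof -
  note [measurable] = borel_measurable_integrable[OF G]
  let ?C = "2 * pi * (LINT x|lborel. (norm (G x))\<^sup>2)"
  have C0: "?C \<ge> 0" by simp
  have "(\<integral>\<^sup>+x. ennreal ((norm (ft G x))\<^sup>2) \<partial>lborel)
     = (\<integral>\<^sup>+x. liminf (\<lambda>n. ennreal (exp (- (1 / Suc n) * x\<^sup>2 / 2) * (norm (ft G x))\<^sup>2)) \<partial>lborel)"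
  proof (intro nn_integral_cong lim_imp_Liminf[symmetric])
    fix x :: real
    have "(\<lambda>n. exp (- (1 / Suc n) * x\<^sup>2 / 2) * (norm (ft G x))\<^sup>2) \<longlonglongrightarrow> exp (- 0 * x\<^sup>2 / 2) * (norm (ft G x))\<^sup>2"
      by (intro tendsto_intros LIMSEQ_inverse_real_of_nat[unfolded inverse_eq_divide]) auto
    then show "(\<lambda>n. ennreal (exp (- (1 / Suc n) * x\<^sup>2 / 2) * (norm (ft G x))\<^sup>2)) \<longlonglongrightarrow> ennreal ((norm (ft G x))\<^sup>2)"
      by (intro tendsto_ennrealI) simp
  qed auto
  also have "\<dots> \<le> liminf (\<lambda>n. \<integral>\<^sup>+x. ennreal (exp (- (1 / Suc n) * x\<^sup>2 / 2) * (norm (ft G x))\<^sup>2) \<partial>lborel)"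
    by (rule nn_integral_liminf) measurable
  also have "\<dots> \<le> limsup (\<lambda>n. \<integral>\<^sup>+x. ennreal (exp (- (1 / Suc n) * x\<^sup>2 / 2) * (norm (ft G x))\<^sup>2) \<partial>lborel)"
    by (rule Liminf_le_Limsup) simp
  also have "\<dots> \<le> ennreal ?C"
    by (rule Limsup_bounded) (intro always_eventually allI ft_L2_bound_gaussian[OF G G2], simp)
  finally have nn: "(\<integral>\<^sup>+x. ennreal ((norm (ft G x))\<^sup>2) \<partial>lborel) \<le> ennreal ?C" .
  show int: "integrable lborel (\<lambda>x. (norm (ft G x))\<^sup>2)"
    by (rule integrableI_bounded) (use le_less_trans[OF nn ennreal_less_top] in auto)
  show "(LINT x|lborel. (norm (ft G x))\<^sup>2) \<le> ?C"
    using nn by (subst (asm) nn_integral_eq_integral[OF int]) (use C0 in auto)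
qed

text \<open>Vanishing at t = 0 says that the positive and negative parts have the same mass I. If I
  > 0, both divided by I are probability densities with equal characteristic functions, and Levy's
  uniqueness theorem identifies them.\<close>

lemma L1_fourier_unique_real:
  fixes g :: "real \<Rightarrow> real"
  assumes g: "integrable lborel g" and zero: "\<And>t. ft (\<lambda>x. of_real (g x)) t = 0"
  shows "AE x in lborel. g x = 0"
proof -
  note [measurable] = borel_measurable_integrable[OF g]
  define p where "p x = max 0 (g x)" for x
  define m where "m x = max 0 (- g x)" for x
  have [measurable]: "p \<in> borel_measurable borel" "m \<in> borel_measurable borel"
    unfolding p_def[abs_def] m_def[abs_def] by measurable
  have pm0: "p x \<ge> 0" "m x \<ge> 0" for x by (auto simp: p_def m_def)
  have g_eq: "g x = p x - m x" for x by (auto simp: p_def m_def max_def)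
  have p: "integrable lborel p" and m: "integrable lborel m"
    using g by (auto simp: p_def[abs_def] m_def[abs_def])
  have eq: "ft (\<lambda>x. of_real (p x)) t = ft (\<lambda>x. of_real (m x)) t" for t
  proof -
    have "ft (\<lambda>x. of_real (g x)) t = ft (\<lambda>x. of_real (p x)) t - ft (\<lambda>x. of_real (m x)) t"
      unfolding ft_def g_eq of_real_diff right_diff_distrib
      by (rule Bochner_Integration.integral_diff) (use p m in \<open>auto intro!: integrable_cis_mult\<close>)
    then show ?thesis using zero by simp
  qed
  define I where "I = (LINT x|lborel. p x)"
  have Im: "I = (LINT x|lborel. m x)"
    using eq[of 0] unfolding ft_def I_def by simp
  have "I \<ge> 0" unfolding I_def by (simp add: pm0)
  show ?thesis
  proof (cases "I = 0")
    case True
    then have "AE x in lborel. p x = 0" "AE x in lborel. m x = 0"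
      using integral_nonneg_eq_0_iff_AE[OF p] integral_nonneg_eq_0_iff_AE[OF m] pm0 Im I_def by auto
    then show ?thesis by eventually_elim (simp add: g_eq)
  next
    case False
    with \<open>I \<ge> 0\<close> have I: "I > 0" by simp
    have dist: "real_distribution (density lborel (\<lambda>x. ennreal (f x / I)))" 
      if [measurable]: "f \<in> borel_measurable borel" and f0: "\<And>x. f x \<ge> 0" and f: "integrable lborel f"
        and fI: "(LINT x|lborel. f x) = I" for f
    proof -
      have "emeasure (density lborel (\<lambda>x. ennreal (f x / I))) UNIV = (\<integral>\<^sup>+x. ennreal (f x / I) \<partial>lborel)"
        by (simp add: emeasure_density)
      also have "\<dots> = ennreal (LINT x|lborel. f x / I)"
        by (rule nn_integral_eq_integral) (use f f0 I in auto)
      also have "\<dots> = 1" using I by (simp add: fI)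
      finally show ?thesis by (auto intro!: real_distribution.intro prob_spaceI real_distribution_axioms.intro)
    qed
    have char: "char (density lborel (\<lambda>x. ennreal (f x / I))) t = ft (\<lambda>x. of_real (f x)) t / of_real I"
      if [measurable]: "f \<in> borel_measurable borel" and f0: "\<And>x. f x \<ge> 0" for f t
    proof -
      have "char (density lborel (\<lambda>x. ennreal (f x / I))) t = (LINT x|lborel. (f x / I) *\<^sub>R iexp (t * x))"
        unfolding char_def using f0 I by (subst integral_density) auto
      also have "\<dots> = (LINT x|lborel. (cis (t * x) * of_real (f x)) / of_real I)"
        by (intro Bochner_Integration.integral_cong) (simp_all add: cis_conv_exp scaleR_conv_of_real mult_ac)
      also have "\<dots> = ft (\<lambda>x. of_real (f x)) t / of_real I"
        by (simp add: ft_def)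
      finally show ?thesis .
    qed
    have "density lborel (\<lambda>x. ennreal (p x / I)) = density lborel (\<lambda>x. ennreal (m x / I))"
      by (rule Levy_uniqueness) (auto intro!: dist simp: pm0 p m I_def[symmetric] Im[symmetric] char eq)
    then have "AE x in lborel. ennreal (p x / I) = ennreal (m x / I)"
      by (intro sigma_finite_measure.density_unique sigma_finite_lborel) auto
    then show ?thesis
      by eventually_elim (use I pm0 in \<open>auto simp: g_eq ennreal_inj\<close>)
  qed
qed

lemma cnj_ft:
  assumes "integrable lborel G"
  shows "cnj (ft G x) = ft (\<lambda>y. cnj (G y)) (- x)"
  unfolding ft_def
  using integral_bounded_linear[OF bounded_linear_cnj integrable_cis_mult[OF assms], of x]
  by (simp add: cis_cnj)

text \<open>The transforms of g and of its conjugate vanish together, so the real case applies to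
  the real and to the imaginary part.\<close>

lemma L1_fourier_unique:
  assumes g: "integrable lborel g" and zero: "\<And>t. ft g t = 0"
  shows "AE x in lborel. g x = 0"
proof -
  have cg: "integrable lborel (\<lambda>x. cnj (g x))" using g by simp
  have zc: "ft (\<lambda>x. cnj (g x)) t = 0" for t
    using cnj_ft[OF g, of "- t"] zero by simp
  have re: "cis (t * x) * of_real (Re (g x)) = (cis (t * x) * g x + cis (t * x) * cnj (g x)) / 2" for t x
    by (simp add: complex_eq_iff)
  have "ft (\<lambda>x. of_real (Re (g x))) t = (ft g t + ft (\<lambda>x. cnj (g x)) t) / 2" for t
    unfolding ft_def re integral_divide_zero
    by (simp only: Bochner_Integration.integral_add[OF integrable_cis_mult[OF g] integrable_cis_mult[OF cg]])
  then have "AE x in lborel. Re (g x) = 0"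
    using g by (intro L1_fourier_unique_real) (auto simp: zero zc)
  moreover have im: "cis (t * x) * of_real (Im (g x)) = (cis (t * x) * g x - cis (t * x) * cnj (g x)) / (2 * \<i>)" for t x
    by (simp add: complex_eq_iff Re_divide Im_divide power2_eq_square)
  have "ft (\<lambda>x. of_real (Im (g x))) t = (ft g t - ft (\<lambda>x. cnj (g x)) t) / (2 * \<i>)" for t
    unfolding ft_def im integral_divide_zero
    by (simp only: Bochner_Integration.integral_diff[OF integrable_cis_mult[OF g] integrable_cis_mult[OF cg]])
  then have "AE x in lborel. Im (g x) = 0"
    using g by (intro L1_fourier_unique_real) (auto simp: zero zc)
  ultimately show ?thesis by eventually_elim (simp add: complex_eq_iff)
qed

section \<open>The Fourier-Plancherel relation and its inversion\<close>

lemma L2_norm_finite_iff: "L2_norm f < \<top> \<longleftrightarrow> f \<in> borel_measurable lebesgue \<and> integrable lebesgue (\<lambda>x. (norm (f x))\<^sup>2)"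
  by (simp add: L2_norm_def)

lemma L2_norm_borel:
  fixes f :: "real \<Rightarrow> 'a::{real_normed_vector, second_countable_topology}"
  assumes [measurable]: "f \<in> borel_measurable borel"
  shows "L2_norm f < \<top> \<longleftrightarrow> integrable lborel (\<lambda>x. (norm (f x))\<^sup>2)"
    and "integrable lborel (\<lambda>x. (norm (f x))\<^sup>2) \<Longrightarrow> L2_norm f = ennreal (sqrt (LINT x|lborel. (norm (f x))\<^sup>2))"
proof -
  have "f \<in> borel_measurable lborel" by simp
  then have m: "f \<in> borel_measurable lebesgue" by (rule measurable_completion)
  show "L2_norm f < \<top> \<longleftrightarrow> integrable lborel (\<lambda>x. (norm (f x))\<^sup>2)"
    using m by (simp add: L2_norm_finite_iff integrable_completion)
  show "L2_norm f = ennreal (sqrt (LINT x|lborel. (norm (f x))\<^sup>2))" if "integrable lborel (\<lambda>x. (norm (f x))\<^sup>2)"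
    using that m by (simp add: L2_norm_def integrable_completion integral_completion)
qed

lemma fourier_eq_ft:
  assumes [measurable]: "f \<in> borel_measurable borel"
  shows "fourier f \<xi> = ft f (- \<xi>)"
  unfolding fourier_def ft_def by (subst integral_completion) (simp_all add: mult.commute)

lemma inverse_fourier_eq_ft:
  assumes [measurable]: "F \<in> borel_measurable borel"
  shows "inverse_fourier F x = ft F x / of_real (2 * pi)"
  unfolding inverse_fourier_def ft_def 
  by (subst integral_completion) (simp_all add: scaleR_conv_of_real)

lemma lborel_integrable_uminus:
  fixes f :: "real \<Rightarrow> 'a::{banach,second_countable_topology}"
  shows "integrable lborel f \<Longrightarrow> integrable lborel (\<lambda>x. f (- x))"
  using lborel_integrable_real_affine[of f "-1" 0] by simp

lemma lborel_integral_uminus: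
  fixes f :: "real \<Rightarrow> 'a::{banach,second_countable_topology}"
  shows "(LINT x|lborel. f (- x)) = (LINT x|lborel. f x)"
  using lborel_integral_real_affine[of "-1" f 0] by simp

text \<open>For truncations of f this is the multiplication formula. As the truncation grows, the
  left side converges by domination, because \<open>ft H\<close> is square integrable, and the right
  side by Cauchy-Schwarz, because the transforms converge to F in \<open>L\<^sup>2\<close>. The
  argument -\<xi> reflects the opposite signs of \<open>fourier\<close> and
  \<open>ft\<close>.\<close>

lemma L2_fourier_duality:
  assumes F: "L2_fourier f F" and [measurable]: "f \<in> borel_measurable borel" "F \<in> borel_measurable borel"
    and H: "integrable lborel H" and H2: "integrable lborel (\<lambda>x. (norm (H x))\<^sup>2)"
  shows "(LINT x|lborel. f x * ft H x) = (LINT \<xi>|lborel. F (- \<xi>) * H \<xi>)"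
proof -
  note [measurable] = borel_measurable_integrable[OF H]
  have f2: "integrable lborel (\<lambda>x. (norm (f x))\<^sup>2)" and F2: "integrable lborel (\<lambda>x. (norm (F x))\<^sup>2)"
    using F by (auto simp: L2_fourier_def L2_norm_borel)
  define fn where "fn n x = indicator {- real n..real n} x *\<^sub>R f x" for n x
  have [measurable]: "fn n \<in> borel_measurable borel" for n
    unfolding fn_def[abs_def] by measurable
  have fn: "integrable lborel (fn n)" for n
  proof -
    have i: "integrable lborel (\<lambda>x. (norm (indicator {- real n..real n} x :: complex))\<^sup>2)"
    proof -
      have "integrable lborel (indicator {- real n..real n} :: real \<Rightarrow> real)"
        by (rule integrable_real_indicator) auto
      moreover have "(norm (indicator {- real n..real n} x :: complex))\<^sup>2 = indicator {- real n..real n} x" for x :: real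
        by (auto simp: indicator_def)
      ultimately show ?thesis by simp
    qed
    have "integrable lborel (\<lambda>x. indicator {- real n..real n} x * f x)"
      by (rule Cauchy_Schwarz_integral(1)[OF _ _ i f2]) auto
    moreover have "fn n = (\<lambda>x. indicator {- real n..real n} x * f x)"
      by (auto simp: fn_def indicator_def)
    ultimately show ?thesis by simp
  qed
  define D where "D n \<xi> = ft (fn n) (- \<xi>) - F \<xi>" for n \<xi>
  have [measurable]: "D n \<in> borel_measurable borel" for n
    unfolding D_def[abs_def] by measurable
  have lim: "(\<lambda>n. L2_norm (D n)) \<longlonglongrightarrow> 0"
  proof -
    have "((\<lambda>R. L2_norm (\<lambda>\<xi>. fourier (\<lambda>x. indicator {-R..R} x *\<^sub>R f x) \<xi> - F \<xi>)) \<longlongrightarrow> 0) at_top"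
      using F by (simp add: L2_fourier_def)
    from filterlim_compose[OF this filterlim_real_sequentially]
    show ?thesis unfolding D_def fn_def by (subst (asm) fourier_eq_ft) auto
  qed
  \<comment> \<open>Convergence of \<open>L2_norm\<close> to 0 forces finiteness, hence
    integrability, from some index on.\<close>
  have D2: "eventually (\<lambda>n. integrable lborel (\<lambda>x. (norm (D n x))\<^sup>2)) sequentially"
    using order_tendstoD(2)[OF lim, of \<top>] by (simp add: L2_norm_borel)
  have sq: "(\<lambda>n. sqrt (LINT x|lborel. (norm (D n x))\<^sup>2)) \<longlonglongrightarrow> 0"
  proof -
    have "(\<lambda>n. ennreal (sqrt (LINT x|lborel. (norm (D n x))\<^sup>2))) \<longlonglongrightarrow> ennreal 0"
      unfolding ennreal_0
      by (rule Lim_transform_eventually[OF lim]) (use D2 in eventually_elim, simp add: L2_norm_borel)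
    then show ?thesis by (subst (asm) tendsto_ennreal_iff) auto
  qed
  have Hm: "integrable lborel (\<lambda>x. H (- x))" and Hm2: "integrable lborel (\<lambda>x. (norm (H (- x)))\<^sup>2)"
    using lborel_integrable_uminus[OF H] lborel_integrable_uminus[OF H2] by auto
  have FH: "integrable lborel (\<lambda>x. F x * H (- x))"
    by (rule Cauchy_Schwarz_integral(1)[OF _ _ F2 Hm2]) auto
  have lim1: "(\<lambda>n. LINT \<xi>|lborel. D n \<xi> * H (- \<xi>)) \<longlonglongrightarrow> 0"
  proof (rule Lim_null_comparison)
    show "(\<lambda>n. sqrt (LINT x|lborel. (norm (D n x))\<^sup>2) * sqrt (LINT x|lborel. (norm (H (- x)))\<^sup>2)) \<longlonglongrightarrow> 0"
      by (rule tendsto_mult_left_zero[OF sq])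
    show "eventually (\<lambda>n. norm (LINT \<xi>|lborel. D n \<xi> * H (- \<xi>)) \<le>
        sqrt (LINT x|lborel. (norm (D n x))\<^sup>2) * sqrt (LINT x|lborel. (norm (H (- x)))\<^sup>2)) sequentially"
      using D2 by eventually_elim (rule Cauchy_Schwarz_integral(2)[OF _ _ _ Hm2]; simp)
  qed
  have ftH2: "integrable lborel (\<lambda>x. (norm (ft H x))\<^sup>2)" by (rule ft_L2_bound(1)[OF H H2])
  have fH: "integrable lborel (\<lambda>x. f x * ft H x)"
    by (rule Cauchy_Schwarz_integral(1)[OF _ _ f2 ftH2]) auto
  have lim2: "(\<lambda>n. LINT x|lborel. fn n x * ft H x) \<longlonglongrightarrow> (LINT x|lborel. f x * ft H x)"
  proof (rule integral_dominated_convergence[where w = "\<lambda>x. norm (f x * ft H x)"])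
    show "integrable lborel (\<lambda>x. norm (f x * ft H x))" using fH by simp
    have "(\<lambda>n. fn n x * ft H x) \<longlonglongrightarrow> f x * ft H x" for x
    proof (rule tendsto_eventually)
      have "eventually (\<lambda>n. \<bar>x\<bar> \<le> real n) sequentially" using real_arch_simple eventually_ge_at_top 
        by (metis (mono_tags, lifting) eventually_sequentially of_nat_le_iff order_trans)
      then show "eventually (\<lambda>n. fn n x * ft H x = f x * ft H x) sequentially"
        by eventually_elim (auto simp: fn_def indicator_def abs_le_iff)
    qed
    then show "AE x in lborel. (\<lambda>n. fn n x * ft H x) \<longlonglongrightarrow> f x * ft H x" by simp
    show "AE x in lborel. norm (fn n x * ft H x) \<le> norm (f x * ft H x)" for n
      by (auto simp: fn_def indicator_def norm_mult)
  qed auto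
  have eq: "(LINT x|lborel. fn n x * ft H x) = (LINT \<xi>|lborel. D n \<xi> * H (- \<xi>)) + (LINT \<xi>|lborel. F \<xi> * H (- \<xi>))" for n
  proof -
    have fH: "integrable lborel (\<lambda>\<xi>. ft (fn n) (- \<xi>) * H (- \<xi>))"
      by (rule Bochner_Integration.integrable_bound[of _ "\<lambda>\<xi>. (LINT y|lborel. norm (fn n y)) * norm (H (- \<xi>))"])
         (use Hm norm_ft_le[of "fn n"] in \<open>auto simp: norm_mult intro!: AE_I2 mult_right_mono\<close>)
    have "(LINT x|lborel. fn n x * ft H x) = (LINT \<xi>|lborel. ft (fn n) \<xi> * H \<xi>)"
      by (rule ft_multiplication_formula[OF fn H, symmetric])
    also have "\<dots> = (LINT \<xi>|lborel. ft (fn n) (- \<xi>) * H (- \<xi>))"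
      by (rule lborel_integral_uminus[symmetric, of "\<lambda>\<xi>. ft (fn n) \<xi> * H \<xi>"])
    also have "\<dots> = (LINT \<xi>|lborel. (D n \<xi> * H (- \<xi>)) + (F \<xi> * H (- \<xi>)))"
      by (simp add: D_def algebra_simps)
    also have "\<dots> = (LINT \<xi>|lborel. D n \<xi> * H (- \<xi>)) + (LINT \<xi>|lborel. F \<xi> * H (- \<xi>))"
    proof (rule Bochner_Integration.integral_add[OF _ FH])
      show "integrable lborel (\<lambda>\<xi>. D n \<xi> * H (- \<xi>))"
        unfolding D_def left_diff_distrib by (intro Bochner_Integration.integrable_diff fH FH)
    qed
    finally show ?thesis .
  qed
  have "(\<lambda>n. LINT x|lborel. fn n x * ft H x) \<longlonglongrightarrow> 0 + (LINT \<xi>|lborel. F \<xi> * H (- \<xi>))"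
    unfolding eq by (intro tendsto_add lim1 tendsto_const)
  then have "(LINT x|lborel. f x * ft H x) = (LINT \<xi>|lborel. F \<xi> * H (- \<xi>))"
    using LIMSEQ_unique[OF lim2] by simp
  then show ?thesis
    using lborel_integral_uminus[of "\<lambda>\<xi>. F \<xi> * H (- \<xi>)"] by simp
qed

text \<open>Translated Gaussians have modulated Gaussians as transforms; testing with them probes,
  at each frequency \<eta>, the transform of a function multiplied by a Gaussian.\<close>

lemma gaussian_modulated:
  "integrable lborel (\<lambda>\<xi>. complex_of_real (exp (- (\<xi> - \<eta>)\<^sup>2 / 2)))"
  "integrable lborel (\<lambda>\<xi>. (norm (complex_of_real (exp (- (\<xi> - \<eta>)\<^sup>2 / 2))))\<^sup>2)"
  "ft (\<lambda>\<xi>. of_real (exp (- (\<xi> - \<eta>)\<^sup>2 / 2))) x = cis (x * \<eta>) * of_real (sqrt (2 * pi) * exp (- x\<^sup>2 / 2))"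
proof -
  have g: "integrable lborel (\<lambda>\<xi>. exp (- (\<xi> - \<eta>)\<^sup>2 / 2))"
    using lborel_integrable_real_affine[OF gaussian_std(1), of 1 "- \<eta>"] by simp
  then show "integrable lborel (\<lambda>\<xi>. complex_of_real (exp (- (\<xi> - \<eta>)\<^sup>2 / 2)))" by simp
  show "integrable lborel (\<lambda>\<xi>. (norm (complex_of_real (exp (- (\<xi> - \<eta>)\<^sup>2 / 2))))\<^sup>2)"
  proof (rule Bochner_Integration.integrable_bound[OF g])
    have "(norm (complex_of_real (exp (- (\<xi> - \<eta>)\<^sup>2 / 2))))\<^sup>2 \<le> exp (- (\<xi> - \<eta>)\<^sup>2 / 2)" for \<xi>
      by (simp only: norm_of_real abs_exp_cancel power2_eq_square) (rule mult_left_le, auto)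
    then show "AE x in lborel. norm ((norm (complex_of_real (exp (- (x - \<eta>)\<^sup>2 / 2))))\<^sup>2) \<le> norm (exp (- (x - \<eta>)\<^sup>2 / 2))"
      by simp
  qed simp
  have "ft (\<lambda>\<xi>. of_real (exp (- (\<xi> - \<eta>)\<^sup>2 / 2))) x 
      = (LINT \<xi>|lborel. cis (x * (\<eta> + 1 * \<xi>)) * of_real (exp (- ((\<eta> + 1 * \<xi>) - \<eta>)\<^sup>2 / 2)))"
    unfolding ft_def by (subst lborel_integral_real_affine[of 1 _ \<eta>]) simp_all
  also have "\<dots> = (LINT \<xi>|lborel. cis (x * \<eta>) * (cis (x * \<xi>) * of_real (exp (- \<xi>\<^sup>2 / 2))))"
    by (simp add: distrib_left distrib_right cis_mult[symmetric] mult_ac)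
  also have "\<dots> = cis (x * \<eta>) * ft (\<lambda>\<xi>. of_real (exp (- \<xi>\<^sup>2 / 2))) x"
    by (simp add: ft_def)
  finally show "ft (\<lambda>\<xi>. of_real (exp (- (\<xi> - \<eta>)\<^sup>2 / 2))) x = cis (x * \<eta>) * of_real (sqrt (2 * pi) * exp (- x\<^sup>2 / 2))"
    unfolding gaussian_std(2) .
qed

text \<open>Multiplying by the Gaussian g makes the difference v of the two sides integrable, so
  that uniqueness in \<open>L\<^sup>1\<close> applies to g v. Its transform at \<eta> vanishes:
  duality for f and the multiplication formula for \<open>ft F\<close>, both tested with a Gaussian
  centred at \<eta>, give the same number up to the factor 2 pi.\<close>

lemma fourier_inversion_AE:
  assumes F: "L2_fourier f F" and [measurable]: "f \<in> borel_measurable borel" "F \<in> borel_measurable borel"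
    and F1: "integrable lborel F"
  shows "AE x in lborel. f x = ft F x / of_real (2 * pi)"
proof -
  have f2: "integrable lborel (\<lambda>x. (norm (f x))\<^sup>2)"
    using F by (auto simp: L2_fourier_def L2_norm_borel)
  define v where "v x = f x - ft F x / of_real (2 * pi)" for x
  define g where "g x = exp (- x\<^sup>2 / 2)" for x :: real
  have [measurable]: "g \<in> borel_measurable borel" "v \<in> borel_measurable borel"
    unfolding g_def[abs_def] v_def[abs_def] by measurable
  have g1: "integrable lborel (\<lambda>x. complex_of_real (g x))" 
    and g2: "integrable lborel (\<lambda>x. (norm (complex_of_real (g x)))\<^sup>2)"
    using gaussian_modulated(1,2)[of 0] by (simp_all add: g_def)
  have fg: "integrable lborel (\<lambda>x. of_real (g x) * f x)"
    by (rule Cauchy_Schwarz_integral(1)[OF _ _ g2 f2]) auto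
  have Fg: "integrable lborel (\<lambda>x. of_real (g x) * (ft F x / of_real (2 * pi)))"
    by (rule Bochner_Integration.integrable_bound[of _ "\<lambda>x. complex_of_real (g x) * of_real ((LINT y|lborel. norm (F y)) / (2 * pi))"])
       (use g1 norm_ft_le[of F] in \<open>auto simp: norm_mult norm_divide g_def intro!: AE_I2 mult_left_mono divide_right_mono\<close>)
  have int: "integrable lborel (\<lambda>x. of_real (g x) * v x)"
    unfolding v_def right_diff_distrib by (intro Bochner_Integration.integrable_diff fg Fg)
  have "ft (\<lambda>x. of_real (g x) * v x) \<eta> = 0" for \<eta>
  proof -
    define h where "h \<xi> = complex_of_real (exp (- (\<xi> - \<eta>)\<^sup>2 / 2))" for \<xi>
    have h: "integrable lborel h" "integrable lborel (\<lambda>x. (norm (h x))\<^sup>2)"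
      unfolding h_def[abs_def] by (rule gaussian_modulated)+
    have fth: "ft h x = of_real (sqrt (2 * pi)) * (cis (\<eta> * x) * of_real (g x))" for x
      unfolding h_def gaussian_modulated(3) g_def by (simp add: mult_ac)
    have s: "of_real (sqrt (2 * pi)) \<noteq> (0::complex)" by simp
    have cg: "integrable lborel (\<lambda>x. cis (\<eta> * x) * of_real (g x))"
      by (intro integrable_cis_mult g1)
    have "of_real (sqrt (2 * pi)) * (LINT x|lborel. cis (\<eta> * x) * (of_real (g x) * f x)) = (LINT x|lborel. f x * ft h x)"
      unfolding fth by (subst integral_mult_right_zero[symmetric]) (simp add: mult_ac)
    also have "\<dots> = (LINT \<xi>|lborel. F (- \<xi>) * h \<xi>)"
      by (rule L2_fourier_duality[OF F _ _ h]) auto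
    finally have 1: "of_real (sqrt (2 * pi)) * (LINT x|lborel. cis (\<eta> * x) * (of_real (g x) * f x)) = (LINT \<xi>|lborel. F (- \<xi>) * h \<xi>)" .
    have hft: "ft (\<lambda>x. cis (\<eta> * x) * of_real (g x)) \<xi> = of_real (sqrt (2 * pi)) * h (- \<xi>)" for \<xi>
    proof -
      have "ft (\<lambda>x. cis (\<eta> * x) * of_real (g x)) \<xi> = ft (\<lambda>x. of_real (g x)) (\<xi> + \<eta>)"
        unfolding ft_def by (simp add: distrib_right distrib_left cis_mult[symmetric] mult_ac)
      then show ?thesis
        unfolding g_def gaussian_std(2) h_def by (simp add: power2_eq_square algebra_simps)
    qed
    have "(LINT x|lborel. ft F x * (cis (\<eta> * x) * of_real (g x))) = (LINT \<xi>|lborel. F \<xi> * (of_real (sqrt (2 * pi)) * h (- \<xi>)))"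
      unfolding hft[symmetric] by (rule ft_multiplication_formula[OF F1 cg])
    also have "\<dots> = of_real (sqrt (2 * pi)) * (LINT \<xi>|lborel. F \<xi> * h (- \<xi>))"
      by (subst integral_mult_right_zero[symmetric]) (simp add: mult_ac)
    also have "(LINT \<xi>|lborel. F \<xi> * h (- \<xi>)) = (LINT \<xi>|lborel. F (- \<xi>) * h \<xi>)"
      using lborel_integral_uminus[of "\<lambda>\<xi>. F \<xi> * h (- \<xi>)"] by simp
    also have "\<dots> = of_real (sqrt (2 * pi)) * (LINT x|lborel. cis (\<eta> * x) * (of_real (g x) * f x))"
      by (rule 1[symmetric])
    finally have "(LINT x|lborel. ft F x * (cis (\<eta> * x) * of_real (g x))) 
       = of_real (sqrt (2 * pi)) * (of_real (sqrt (2 * pi)) * (LINT x|lborel. cis (\<eta> * x) * (of_real (g x) * f x)))" .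
    also have "\<dots> = of_real (2 * pi) * (LINT x|lborel. cis (\<eta> * x) * (of_real (g x) * f x))"
      unfolding mult.assoc[symmetric] of_real_mult[symmetric] by simp
    finally have 2: "(LINT x|lborel. ft F x * (cis (\<eta> * x) * of_real (g x))) / of_real (2 * pi)
       = (LINT x|lborel. cis (\<eta> * x) * (of_real (g x) * f x))" by simp
    have "ft (\<lambda>x. of_real (g x) * v x) \<eta> = (LINT x|lborel. cis (\<eta> * x) * (of_real (g x) * f x)
          - cis (\<eta> * x) * (of_real (g x) * (ft F x / of_real (2 * pi))))"
      unfolding ft_def[of _ \<eta>] v_def by (simp add: right_diff_distrib)
    also have "\<dots> = (LINT x|lborel. cis (\<eta> * x) * (of_real (g x) * f x))
         - (LINT x|lborel. cis (\<eta> * x) * (of_real (g x) * (ft F x / of_real (2 * pi))))"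
      by (intro Bochner_Integration.integral_diff integrable_cis_mult fg Fg)
    also have "(LINT x|lborel. cis (\<eta> * x) * (of_real (g x) * (ft F x / of_real (2 * pi))))
        = (LINT x|lborel. ft F x * (cis (\<eta> * x) * of_real (g x))) / of_real (2 * pi)"
      by (subst integral_divide_zero[symmetric]) (simp add: mult_ac)
    finally show ?thesis unfolding 2 by simp
  qed
  then have "AE x in lborel. of_real (g x) * v x = 0"
    by (rule L1_fourier_unique[OF int])
  then show ?thesis by eventually_elim (simp add: g_def v_def)
qed

section \<open>The dispersion symbol\<close>

lemma tanh_DERIV: "(tanh has_real_derivative 1 - (tanh x)\<^sup>2) (at x)"
proof -
  have "cosh x \<noteq> 0" by (metis cosh_real_nonzero)
  then show ?thesis by (auto intro!: derivative_eq_intros)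
qed

lemma tanh_sq_le_1: "(tanh (x::real))\<^sup>2 \<le> 1"
  using tanh_real_lt_1[of x] tanh_real_gt_neg1[of x] by (simp add: abs_square_le_1)

lemma tanh_upper: assumes "0 \<le> x" shows "tanh x \<le> (x::real)"
proof -
  have "(\<lambda>x. x - tanh x) 0 \<le> (\<lambda>x. x - tanh x) x"
    by (rule DERIV_nonneg_imp_nondecreasing[OF assms])
       (auto intro!: exI derivative_eq_intros tanh_DERIV)
  then show ?thesis by simp
qed

lemma tanh_derivative_bound: assumes "0 \<le> x" shows "x * (1 - (tanh x)\<^sup>2) \<le> tanh (x::real)"
proof -
  have "(\<lambda>x. tanh x - x * (1 - (tanh x)\<^sup>2)) 0 \<le> (\<lambda>x. tanh x - x * (1 - (tanh x)\<^sup>2)) x"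
  proof (rule DERIV_nonneg_imp_nondecreasing[OF assms])
    fix y :: real assume "0 \<le> y" "y \<le> x"
    have "((\<lambda>x. tanh x - x * (1 - (tanh x)\<^sup>2)) has_real_derivative 2 * y * tanh y * (1 - (tanh y)\<^sup>2)) (at y)"
      by (auto intro!: derivative_eq_intros tanh_DERIV simp: algebra_simps)
    moreover have "0 \<le> 2 * y * tanh y * (1 - (tanh y)\<^sup>2)"
      using \<open>0 \<le> y\<close> tanh_sq_le_1[of y] by simp
    ultimately show "\<exists>z. ((\<lambda>x. tanh x - x * (1 - (tanh x)\<^sup>2)) has_real_derivative z) (at y) \<and> 0 \<le> z" by blast
  qed
  then show ?thesis by simp
qed

text \<open>This makes x tanh x at least x^2 / (1 + x), which is quadratic at 0 and linear at
  infinity, the two regimes of the symbol.\<close>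

lemma tanh_lower: assumes "0 \<le> x" shows "x \<le> (1 + x) * tanh (x::real)"
proof -
  have "(\<lambda>x. (1 + x) * tanh x - x) 0 \<le> (\<lambda>x. (1 + x) * tanh x - x) x"
  proof (rule DERIV_nonneg_imp_nondecreasing[OF assms])
    fix y :: real assume "0 \<le> y" "y \<le> x"
    have "((\<lambda>x. (1 + x) * tanh x - x) has_real_derivative tanh y * (1 - tanh y) + y * (1 - (tanh y)\<^sup>2)) (at y)"
      by (auto intro!: derivative_eq_intros tanh_DERIV simp: algebra_simps power2_eq_square)
    moreover have "0 \<le> tanh y * (1 - tanh y) + y * (1 - (tanh y)\<^sup>2)"
      using \<open>0 \<le> y\<close> tanh_sq_le_1[of y] tanh_real_lt_1[of y] by simp
    ultimately show "\<exists>z. ((\<lambda>x. (1 + x) * tanh x - x) has_real_derivative z) (at y) \<and> 0 \<le> z" by blast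
  qed
  then show ?thesis by simp
qed

text \<open>The symbol p, with \<bar>\<xi>\<bar> moved under the root: the quotient tanh \<xi> /
  \<xi> and its exceptional value at 0 disappear, and continuity becomes immediate.\<close>

definition psym :: "real \<Rightarrow> real" where
  "psym \<xi> = sqrt ((1 + \<xi>\<^sup>2) * (\<xi> * tanh \<xi>))"

lemma xtanh_nonneg: "0 \<le> \<xi> * tanh (\<xi>::real)"
  by (cases "0 \<le> \<xi>") (auto simp: mult_nonneg_nonneg mult_nonpos_nonpos)

lemma xtanh_abs: "\<xi> * tanh (\<xi>::real) = \<bar>\<xi>\<bar> * tanh \<bar>\<xi>\<bar>"
  by (cases "0 \<le> \<xi>") auto

lemma psym_sq: "(psym \<xi>)\<^sup>2 = (1 + \<xi>\<^sup>2) * (\<bar>\<xi>\<bar> * tanh \<bar>\<xi>\<bar>)"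
proof -
  have "(psym \<xi>)\<^sup>2 = (1 + \<xi>\<^sup>2) * (\<xi> * tanh \<xi>)"
    unfolding psym_def using xtanh_nonneg[of \<xi>] by (intro real_sqrt_pow2 mult_nonneg_nonneg[OF _ xtanh_nonneg]) simp
  then show ?thesis by (simp only: xtanh_abs[of \<xi>])
qed

lemma psym_nonneg: "0 \<le> psym \<xi>"
  unfolding psym_def using xtanh_nonneg[of \<xi>] by simp

lemma psym_minus [simp]: "psym (- \<xi>) = psym \<xi>"
  by (simp add: psym_def)

lemma psym_0 [simp]: "psym 0 = 0"
  by (simp add: psym_def)

lemma psym_continuous [continuous_intros]: "continuous_on A f \<Longrightarrow> continuous_on A (\<lambda>x. psym (f x))"
  unfolding psym_def by (intro continuous_intros) (auto simp: cosh_real_nonzero)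

lemma psym_measurable [measurable]: "psym \<in> borel_measurable borel"
  by (intro borel_measurable_continuous_onI continuous_intros)

lemma psym_symbol: "frac_laplacian_symbol (1/2) \<xi> * M_symbol \<xi> = psym \<xi>"
proof (cases "\<xi> = 0")
  case False
  have "\<bar>\<xi>\<bar> * sqrt ((1 + \<xi>\<^sup>2) * (tanh \<xi> / \<xi>)) = sqrt (\<xi>\<^sup>2) * sqrt ((1 + \<xi>\<^sup>2) * (tanh \<xi> / \<xi>))"
    by simp
  also have "\<dots> = sqrt (\<xi>\<^sup>2 * ((1 + \<xi>\<^sup>2) * (tanh \<xi> / \<xi>)))"
    by (simp only: real_sqrt_mult)
  also have "\<xi>\<^sup>2 * ((1 + \<xi>\<^sup>2) * (tanh \<xi> / \<xi>)) = (1 + \<xi>\<^sup>2) * (\<xi> * tanh \<xi>)"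
    using False by (simp add: field_simps power2_eq_square)
  finally show ?thesis using False by (simp add: frac_laplacian_symbol_def M_symbol_def psym_def)
qed (simp add: frac_laplacian_symbol_def)

text \<open>By \<open>tanh_lower\<close>, p^2 (1 + x) \<ge> (1 + x^2) x^2, and (1 + x)^2 \<le> 2 (1
  + x^2) does the rest. Growth of order \<bar>\<xi>\<bar>^{3/2} is what the decay estimates below
  rest on; the bound also holds near 0, where p is of the larger order \<bar>\<xi>\<bar>.\<close>

lemma psym_lower: "\<bar>\<xi>\<bar> ^ 3 / 2 \<le> (psym \<xi>)\<^sup>2"
proof -
  define x where "x = \<bar>\<xi>\<bar>"
  have x: "x \<ge> 0" by (simp add: x_def)
  have sq: "(1 + x)\<^sup>2 \<le> 2 * (1 + x\<^sup>2)"
    using sum_squares_bound[of 1 x] by (simp add: power2_eq_square algebra_simps)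
  have "x ^ 3 / 2 * (1 + x) \<le> x ^ 2 / 2 * (1 + x)\<^sup>2"
    using x by (simp add: power2_eq_square power3_eq_cube algebra_simps mult_left_mono)
  also have "\<dots> \<le> x ^ 2 * (1 + x\<^sup>2)"
    using mult_left_mono[OF sq, of "x\<^sup>2 / 2"] by (simp add: algebra_simps)
  also have "\<dots> = (1 + x\<^sup>2) * x * x" by (simp add: power2_eq_square)
  also have "\<dots> \<le> (1 + x\<^sup>2) * x * ((1 + x) * tanh x)"
    by (intro mult_left_mono tanh_lower x mult_nonneg_nonneg) auto
  finally have "x ^ 3 / 2 * (1 + x) \<le> ((1 + x\<^sup>2) * (x * tanh x)) * (1 + x)" by (simp add: mult_ac)
  then have "x ^ 3 / 2 \<le> (1 + x\<^sup>2) * (x * tanh x)"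
    using x by (simp only: mult_le_cancel_right)
  then show ?thesis unfolding psym_sq x_def by simp
qed

lemma psym_upper: "(psym \<xi>)\<^sup>2 \<le> \<xi>\<^sup>2 + \<bar>\<xi>\<bar> ^ 3"
proof -
  define x where "x = \<bar>\<xi>\<bar>"
  have x: "x \<ge> 0" by (simp add: x_def)
  have "(1 + x\<^sup>2) * (x * tanh x) = x * tanh x + x ^ 3 * tanh x"
    by (simp add: power2_eq_square power3_eq_cube algebra_simps)
  also have "\<dots> \<le> x * x + x ^ 3 * 1"
    using x tanh_upper[OF x] tanh_real_lt_1[of x] by (intro add_mono mult_left_mono) auto
  finally show ?thesis unfolding psym_sq x_def by (simp add: power2_eq_square)
qed

lemma psym_le: "psym \<xi> \<le> 1 + \<xi>\<^sup>2"
proof -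
  have "(psym \<xi>)\<^sup>2 \<le> (1 + \<xi>\<^sup>2) * (1 + \<xi>\<^sup>2)"
    unfolding psym_sq
  proof (intro mult_left_mono)
    have "\<bar>\<xi>\<bar> * tanh \<bar>\<xi>\<bar> \<le> \<bar>\<xi>\<bar> * \<bar>\<xi>\<bar>" by (intro mult_left_mono tanh_upper) auto
    then show "\<bar>\<xi>\<bar> * tanh \<bar>\<xi>\<bar> \<le> 1 + \<xi>\<^sup>2" by (simp add: power2_eq_square)
  qed simp
  then have "(psym \<xi>)\<^sup>2 \<le> (1 + \<xi>\<^sup>2)\<^sup>2" by (simp only: power2_eq_square)
  then show ?thesis by (rule power2_le_imp_le) simp
qed

lemma psym_pos: "\<xi> \<noteq> 0 \<Longrightarrow> 0 < psym \<xi>"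
proof -
  assume "\<xi> \<noteq> 0"
  then have "0 < \<bar>\<xi>\<bar> ^ 3 / 2" by simp
  then have "0 < (psym \<xi>)\<^sup>2" using psym_lower[of \<xi>] by linarith
  then show ?thesis using psym_nonneg[of \<xi>] by (auto simp: less_le)
qed

text \<open>Derivative of p for \<xi> > 0. At 0 the symbol behaves like \<bar>\<xi>\<bar> and has a
  corner, so later arguments differentiate on the half-line and use evenness.\<close>

definition psym' :: "real \<Rightarrow> real" where
  "psym' \<xi> = ((1 + 3 * \<xi>\<^sup>2) * tanh \<xi> + (1 + \<xi>\<^sup>2) * (\<xi> * (1 - (tanh \<xi>)\<^sup>2))) / (2 * psym \<xi>)"

lemma psym'_measurable [measurable]: "psym' \<in> borel_measurable borel"
proof -
  have [measurable]: "(tanh :: real \<Rightarrow> real) \<in> borel_measurable borel"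
    by (intro borel_measurable_continuous_onI continuous_intros) (auto simp: cosh_real_nonzero)
  show ?thesis unfolding psym'_def[abs_def] by measurable
qed

lemma psym_DERIV:
  assumes "\<xi> > 0"
  shows "(psym has_real_derivative psym' \<xi>) (at \<xi>)"
proof -
  have pos: "(1 + \<xi>\<^sup>2) * (\<xi> * tanh \<xi>) > 0"
    using assms by (intro mult_pos_pos) (auto simp: add_pos_nonneg)
  have d: "((\<lambda>\<xi>. (1 + \<xi>\<^sup>2) * (\<xi> * tanh \<xi>)) has_real_derivative
     (1 + 3 * \<xi>\<^sup>2) * tanh \<xi> + (1 + \<xi>\<^sup>2) * (\<xi> * (1 - (tanh \<xi>)\<^sup>2))) (at \<xi>)"
    by (auto intro!: derivative_eq_intros tanh_DERIV simp: algebra_simps power2_eq_square)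
  show ?thesis
    unfolding psym_def[abs_def] psym'_def
    by (rule DERIV_cong[OF DERIV_chain2[OF DERIV_real_sqrt[OF pos] d]]) (simp add: psym_def field_simps)
qed

text \<open>\<open>tanh_derivative_bound\<close> gives \<xi> p' \<le> 2 p, and
  \<open>psym_upper\<close> bounds p^2 by \<xi>^2 (1 + \<xi>); dividing by \<xi>^2 leaves a bound
  that stays finite at 0.\<close>

lemma psym'_bounds:
  assumes "\<xi> > 0"
  shows "0 \<le> psym' \<xi>" and "(psym' \<xi>)\<^sup>2 \<le> 4 * (1 + \<xi>)"
proof -
  have p: "psym \<xi> > 0" using assms psym_pos by simp
  have t: "tanh \<xi> > 0" using assms by simp
  let ?N = "(1 + 3 * \<xi>\<^sup>2) * tanh \<xi> + (1 + \<xi>\<^sup>2) * (\<xi> * (1 - (tanh \<xi>)\<^sup>2))"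
  have N0: "0 \<le> ?N"
    using assms tanh_sq_le_1[of \<xi>] t by (intro add_nonneg_nonneg mult_nonneg_nonneg) auto
  then show 0: "0 \<le> psym' \<xi>" unfolding psym'_def using p by simp
  have "?N \<le> (1 + 3 * \<xi>\<^sup>2) * tanh \<xi> + (1 + \<xi>\<^sup>2) * tanh \<xi>"
    using tanh_derivative_bound[of \<xi>] assms by (intro add_left_mono mult_left_mono) auto
  also have "\<dots> \<le> 4 * ((1 + \<xi>\<^sup>2) * tanh \<xi>)"
    using t by (simp add: algebra_simps)
  finally have "\<xi> * ?N \<le> \<xi> * (4 * ((1 + \<xi>\<^sup>2) * tanh \<xi>))"
    by (rule mult_left_mono) (use assms in simp)
  also have "\<dots> = 4 * ((1 + \<xi>\<^sup>2) * (\<bar>\<xi>\<bar> * tanh \<bar>\<xi>\<bar>))"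
    using assms by simp
  finally have N: "\<xi> * ?N \<le> 4 * (psym \<xi>)\<^sup>2" by (simp only: psym_sq)
  have "\<xi> * psym' \<xi> = \<xi> * ?N / (2 * psym \<xi>)" by (simp add: psym'_def)
  also have "\<dots> \<le> 4 * (psym \<xi>)\<^sup>2 / (2 * psym \<xi>)"
    using N p by (intro divide_right_mono) auto
  also have "\<dots> = 2 * psym \<xi>" using p by (simp add: power2_eq_square)
  finally have "(\<xi> * psym' \<xi>)\<^sup>2 \<le> (2 * psym \<xi>)\<^sup>2"
    using 0 assms by (intro power_mono) auto
  also have "\<dots> \<le> 4 * (\<xi>\<^sup>2 + \<xi> ^ 3)" using psym_upper[of \<xi>] assms by (simp add: power_mult_distrib)
  also have "\<dots> = \<xi>\<^sup>2 * (4 * (1 + \<xi>))" by (simp add: power2_eq_square power3_eq_cube algebra_simps)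
  finally show "(psym' \<xi>)\<^sup>2 \<le> 4 * (1 + \<xi>)"
    using assms by (simp add: power_mult_distrib)
qed

lemma integrable_one_plus_abs_powr:
  assumes "a > 1"
  shows "integrable lborel (\<lambda>x::real. (1 + \<bar>x\<bar>) powr (- a))"
proof -
  let ?f = "\<lambda>x::real. (1 + \<bar>x\<bar>) powr (- a)"
  let ?F = "\<lambda>x::real. (1 + x) powr (1 - a) / (1 - a)"
  have nn: "(\<integral>\<^sup>+x. ennreal (?f x) * indicator {0..} x \<partial>lborel) = ennreal (0 - ?F 0)"
  proof (rule nn_integral_FTC_atLeast)
    fix x :: real assume "0 \<le> x"
    have d: "((\<lambda>x. 1 + x) has_real_derivative 1) (at x)" by (auto intro!: derivative_eq_intros)
    have "((\<lambda>x. (1 + x) powr (1 - a)) has_real_derivative (1 - a) * (1 + x) powr (1 - a - of_nat 1) * 1) (at x)"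
      by (rule DERIV_fun_powr[OF d]) (use \<open>0 \<le> x\<close> in simp)
    from DERIV_cdivide[OF this, of "1 - a"] show "DERIV ?F x :> ?f x"
      using assms \<open>0 \<le> x\<close> by simp
    show "0 \<le> ?f x" by simp
  next
    show "?f \<in> borel_measurable borel" by measurable
  next
    have "((\<lambda>x::real. (1 + x) powr (1 - a)) \<longlongrightarrow> 0) at_top"
      by (rule tendsto_neg_powr[OF _ filterlim_tendsto_add_at_top[OF tendsto_const filterlim_ident]]) (use assms in simp)
    then show "(?F \<longlongrightarrow> 0) at_top" by (rule tendsto_divide_zero)
  qed
  have i1: "integrable lborel (\<lambda>x. indicator {0..} x * ?f x)"
  proof (rule integrableI_bounded)
    have "(\<integral>\<^sup>+x. ennreal (norm (indicator {0..} x * ?f x)) \<partial>lborel) = (\<integral>\<^sup>+x. ennreal (?f x) * indicator {0..} x \<partial>lborel)"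
      by (intro nn_integral_cong) (auto simp: indicator_def)
    then show "(\<integral>\<^sup>+x. ennreal (norm (indicator {0..} x * ?f x)) \<partial>lborel) < \<infinity>" using nn by simp
  qed measurable
  have i2: "integrable lborel (\<lambda>x. indicator {0..} (- x) * ?f (- x))"
    using lborel_integrable_real_affine[OF i1, of "-1" 0] by simp
  show ?thesis
  proof (rule Bochner_Integration.integrable_bound[OF Bochner_Integration.integrable_add[OF i1 i2]])
    have "norm (?f x) \<le> norm (indicator {0..} x * ?f x + indicator {0..} (- x) * ?f (- x))" for x
      by (cases "0 \<le> x"; cases "x = 0") (simp_all add: indicator_def)
    then show "AE x in lborel. norm (?f x) \<le> norm (indicator {0..} x * ?f x + indicator {0..} (- x) * ?f (- x))"
      by simp
  qed measurable
qed

section \<open>The kernel of the linear evolution\<close>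

text \<open>Cube of e^z \<ge> 1 + z at z = (1 + y) / 3 - 1. The third power is chosen so that one
  factor 1 + y can be lost to the derivative of the symbol, and the inverse square that remains is
  integrable.\<close>

lemma exp_bound_cubic: "exp (1 - y) \<le> 27 / (1 + y) ^ 3" if "0 \<le> y" for y :: real
proof -
  have "((1 + y) / 3) ^ 3 \<le> (exp ((1 + y) / 3 - 1)) ^ 3"
    using exp_ge_add_one_self[of "(1 + y) / 3 - 1"] that by (intro power_mono) auto
  also have "\<dots> = exp (y - 2)"
    by (simp add: exp_of_nat_mult[symmetric] algebra_simps)
  also have "\<dots> \<le> exp (y - 1)" by simp
  finally have "(1 + y) ^ 3 \<le> 27 * exp (y - 1)" by (simp add: power_divide)
  then have "(1 + y) ^ 3 * exp (1 - y) \<le> 27 * exp (y - 1) * exp (1 - y)"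
    by (rule mult_right_mono) simp
  also have "\<dots> = 27" by (simp add: mult.assoc exp_add[symmetric])
  finally show ?thesis using that by (simp add: pos_le_divide_eq mult.commute)
qed

text \<open>Time is written as m^3, so that the natural length t^{2/3} is the polynomial m^2. With y
  = m^2 \<bar>\<xi>\<bar>, \<open>psym_lower\<close> gives (2 m^3 p)^2 \<ge> 2 y^3, which dominates
  (y - 1)^2 once y > 1.\<close>

lemma exp_psym_bound:
  assumes "0 \<le> m"
  shows "exp (- (2 * (m ^ 3 * psym \<xi>))) \<le> 27 / (1 + m\<^sup>2 * \<bar>\<xi>\<bar>) ^ 3"
proof -
  define y where "y = m\<^sup>2 * \<bar>\<xi>\<bar>"
  have y: "0 \<le> y" by (simp add: y_def)
  have "y - 1 \<le> 2 * (m ^ 3 * psym \<xi>)"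
  proof (cases "y \<le> 1")
    case True
    have "0 \<le> m ^ 3 * psym \<xi>" using assms psym_nonneg by simp
    with True show ?thesis by linarith
  next
    case False
    have "(y - 1)\<^sup>2 \<le> y\<^sup>2" using False by (intro power_mono) auto
    also have "\<dots> \<le> 2 * y ^ 3"
    proof -
      have "y\<^sup>2 * 1 \<le> y\<^sup>2 * (2 * y)" using False by (intro mult_left_mono) auto
      then show ?thesis by (simp add: power2_eq_square power3_eq_cube mult_ac)
    qed
    also have "\<dots> = 4 * (m ^ 3)\<^sup>2 * (\<bar>\<xi>\<bar> ^ 3 / 2)"
      by (simp add: y_def power_mult_distrib power_mult[symmetric] mult_ac)
    also have "\<dots> \<le> 4 * (m ^ 3)\<^sup>2 * (psym \<xi>)\<^sup>2"
      by (intro mult_left_mono psym_lower) simp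
    also have "\<dots> = (2 * (m ^ 3 * psym \<xi>))\<^sup>2" by (simp add: power_mult_distrib)
    finally show ?thesis
      by (rule power2_le_imp_le) (use assms psym_nonneg in simp)
  qed
  then have "exp (- (2 * (m ^ 3 * psym \<xi>))) \<le> exp (1 - y)" by simp
  also have "\<dots> \<le> 27 / (1 + y) ^ 3" by (rule exp_bound_cubic[OF y])
  finally show ?thesis by (simp add: y_def)
qed

section \<open>The truncated symbol and its derivative\<close>

definition tent :: "real \<Rightarrow> real \<Rightarrow> real" where
  "tent n \<xi> = max 0 (1 - \<bar>\<xi>\<bar> / n)"

lemma tent_nonneg: "0 \<le> tent n \<xi>" by (simp add: tent_def)
lemma tent_le_1: "n > 0 \<Longrightarrow> tent n \<xi> \<le> 1" by (simp add: tent_def)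
lemma tent_outside: "n > 0 \<Longrightarrow> \<bar>\<xi>\<bar> \<ge> n \<Longrightarrow> tent n \<xi> = 0" by (simp add: tent_def)
lemma tent_nonzero: "n > 0 \<Longrightarrow> tent n \<xi> \<noteq> 0 \<Longrightarrow> \<bar>\<xi>\<bar> < n"
  using tent_outside by force
lemma tent_minus [simp]: "tent n (- \<xi>) = tent n \<xi>" by (simp add: tent_def)
lemma tent_measurable [measurable]: "tent n \<in> borel_measurable borel"
  unfolding tent_def[abs_def] by measurable
lemma tent_continuous: "n > 0 \<Longrightarrow> continuous_on A (tent n)"
  unfolding tent_def[abs_def] by (intro continuous_intros) auto

text \<open>Symbol of e^{-t p(D)} cut off to frequencies below n. The cutoff \<open>tent\<close> is
  merely Lipschitz: continuity is all that \<open>wave\<close> asks of an amplitude, and one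
  derivative is all that the kernel bound uses. The compact support admits negative t as
  well.\<close>

definition heat :: "real \<Rightarrow> real \<Rightarrow> real \<Rightarrow> real" where
  "heat n t \<xi> = exp (- (t * psym \<xi>)) * tent n \<xi>"

lemma heat_measurable [measurable]: "heat n t \<in> borel_measurable borel"
  unfolding heat_def[abs_def] by measurable

lemma heat_nonneg: "0 \<le> heat n t \<xi>"
  by (simp add: heat_def tent_nonneg)

lemma integrable_bounded_support:
  fixes f :: "real \<Rightarrow> 'a::{banach, second_countable_topology}"
  assumes [measurable]: "f \<in> borel_measurable borel"
    and B: "\<And>x. norm (f x) \<le> B" and supp: "\<And>x. \<bar>x\<bar> > n \<Longrightarrow> f x = 0"
  shows "integrable lborel f"
proof (rule Bochner_Integration.integrable_bound)
  show "integrable lborel (\<lambda>x. B * indicator {-n..n} x :: real)"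
    by (intro integrable_mult_right integrable_real_indicator) (auto simp: emeasure_lborel_Icc_eq)
  have "norm (f x) \<le> norm (B * indicator {-n..n} x :: real)" for x
  proof (cases "\<bar>x\<bar> \<le> n")
    case True
    then have "x \<in> {-n..n}" by auto
    then show ?thesis using order_trans[OF B abs_ge_self] by simp
  qed (use supp in simp)
  then show "AE x in lborel. norm (f x) \<le> norm (B * indicator {-n..n} x :: real)" by simp
qed simp

lemma heat_le_1: "0 < n \<Longrightarrow> 0 \<le> t \<Longrightarrow> heat n t \<xi> \<le> 1"
  unfolding heat_def using psym_nonneg[of \<xi>] tent_nonneg[of n \<xi>] tent_le_1[of n \<xi>]
  by (intro mult_le_one) auto

lemma heat_integrable: "0 < n \<Longrightarrow> 0 \<le> t \<Longrightarrow> integrable lborel (heat n t)"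
  by (rule integrable_bounded_support[of _ 1 n])
     (use heat_nonneg heat_le_1 in \<open>auto simp: heat_def tent_outside\<close>)

lemma heat_sq_integrable: "0 < n \<Longrightarrow> 0 \<le> t \<Longrightarrow> integrable lborel (\<lambda>\<xi>. (heat n t \<xi>)\<^sup>2)"
  by (rule integrable_bounded_support[of _ 1 n])
     (use heat_nonneg heat_le_1 in \<open>auto simp: heat_def tent_outside abs_le_square_iff[of _ 1, simplified] intro!: power_le_one\<close>)

text \<open>Set to zero off (0, n): \<open>heat\<close> is even with a corner at 0, and the
  integration by parts takes place on this half of its support.\<close>

definition heat' :: "real \<Rightarrow> real \<Rightarrow> real \<Rightarrow> real" where
  "heat' n t \<xi> = (if 0 < \<xi> \<and> \<xi> < n then
     - (t * psym' \<xi>) * exp (- (t * psym \<xi>)) * (1 - \<xi> / n) - exp (- (t * psym \<xi>)) / n else 0)"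

lemma heat'_measurable [measurable]: "heat' n t \<in> borel_measurable borel"
  unfolding heat'_def[abs_def] by measurable

lemma heat_DERIV:
  assumes "0 < \<xi>" "\<xi> < n"
  shows "(heat n t has_real_derivative heat' n t \<xi>) (at \<xi>)"
proof -
  have "((\<lambda>\<xi>. exp (- (t * psym \<xi>)) * (1 - \<xi> / n)) has_real_derivative heat' n t \<xi>) (at \<xi>)"
    using assms psym_DERIV[OF assms(1)]
    by (auto intro!: derivative_eq_intros simp: heat'_def field_simps)
  moreover have ev: "eventually (\<lambda>\<xi>. exp (- (t * psym \<xi>)) * (1 - \<xi> / n) = heat n t \<xi>) (nhds \<xi>)"
  proof (rule eventually_mono[OF eventually_nhds_in_open[of "{0<..<n}"]])
    fix x assume "x \<in> {0<..<n}"
    then show "exp (- (t * psym x)) * (1 - x / n) = heat n t x"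
      by (auto simp: heat_def tent_def max_def field_simps)
  qed (use assms in auto)
  ultimately show ?thesis using DERIV_cong_ev[OF refl ev refl] by simp
qed

text \<open>The derivative has one term from p' and one from the slope 1 / n of the cutoff; (a +
  b)^2 \<le> 2 a^2 + 2 b^2 together with (p')^2 \<le> 4 (1 + \<xi>) gives the constants 8 and
  2.\<close>

lemma heat'_sq_bound:
  assumes n: "0 < n" and t: "0 \<le> t"
  shows "(heat' n t \<xi>)\<^sup>2 \<le> (8 * t\<^sup>2 * (1 + \<bar>\<xi>\<bar>) + 2 / n\<^sup>2) * exp (- (2 * (t * psym \<xi>)))"
proof (cases "0 < \<xi> \<and> \<xi> < n")
  case True
  define a where "a = t * psym' \<xi> * (1 - \<xi> / n)"
  have a: "0 \<le> a" "a \<le> t * psym' \<xi>"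
    unfolding a_def using True t psym'_bounds(1)[of \<xi>] n by (auto simp: mult_left_le)
  have "a\<^sup>2 \<le> (t * psym' \<xi>)\<^sup>2" using a by (intro power_mono)
  also have "\<dots> \<le> t\<^sup>2 * (4 * (1 + \<bar>\<xi>\<bar>))"
    unfolding power_mult_distrib using psym'_bounds(2)[of \<xi>] True by (intro mult_left_mono) auto
  finally have a2: "a\<^sup>2 \<le> t\<^sup>2 * (4 * (1 + \<bar>\<xi>\<bar>))" .
  have "(a + 1 / n)\<^sup>2 \<le> 2 * a\<^sup>2 + 2 * (1 / n)\<^sup>2"
    using sum_squares_bound[of a "1 / n"] by (simp add: power2_sum)
  also have "\<dots> \<le> 8 * t\<^sup>2 * (1 + \<bar>\<xi>\<bar>) + 2 / n\<^sup>2"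
    using a2 by (simp add: power_divide algebra_simps)
  finally have b: "(a + 1 / n)\<^sup>2 \<le> 8 * t\<^sup>2 * (1 + \<bar>\<xi>\<bar>) + 2 / n\<^sup>2" .
  have "heat' n t \<xi> = - ((a + 1 / n) * exp (- (t * psym \<xi>)))"
    using True by (simp add: heat'_def a_def algebra_simps)
  then have "(heat' n t \<xi>)\<^sup>2 = (a + 1 / n)\<^sup>2 * exp (- (2 * (t * psym \<xi>)))"
    by (simp add: power_mult_distrib exp_double[symmetric])
  also have "\<dots> \<le> (8 * t\<^sup>2 * (1 + \<bar>\<xi>\<bar>) + 2 / n\<^sup>2) * exp (- (2 * (t * psym \<xi>)))"
    using b by (rule mult_right_mono) simp
  finally show ?thesis .
next
  case False
  then show ?thesis by (auto simp: heat'_def)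
qed

lemma heat'_bounded:
  assumes n: "0 < n" and t: "0 \<le> t"
  shows "\<bar>heat' n t \<xi>\<bar> \<le> sqrt (8 * t\<^sup>2 * (1 + n) + 2 / n\<^sup>2)"
proof (cases "0 < \<xi> \<and> \<xi> < n")
  case True
  have "(heat' n t \<xi>)\<^sup>2 \<le> (8 * t\<^sup>2 * (1 + \<bar>\<xi>\<bar>) + 2 / n\<^sup>2) * exp (- (2 * (t * psym \<xi>)))"
    by (rule heat'_sq_bound[OF assms])
  also have "\<dots> \<le> (8 * t\<^sup>2 * (1 + n) + 2 / n\<^sup>2) * 1"
    using True t psym_nonneg[of \<xi>] by (intro mult_mono add_mono mult_left_mono) auto
  finally show ?thesis by (simp add: real_le_rsqrt)
qed (use n in \<open>auto simp: heat'_def\<close>)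

lemma heat'_integrable:
  assumes n: "0 < n" and t: "0 \<le> t"
  shows "integrable lborel (heat' n t)" "integrable lborel (\<lambda>\<xi>. (heat' n t \<xi>)\<^sup>2)"
proof -
  show "integrable lborel (heat' n t)"
    by (rule integrable_bounded_support[of _ "sqrt (8 * t\<^sup>2 * (1 + n) + 2 / n\<^sup>2)" n])
       (use heat'_bounded[OF assms] in \<open>auto simp: heat'_def\<close>)
  show "integrable lborel (\<lambda>\<xi>. (heat' n t \<xi>)\<^sup>2)"
  proof (rule integrable_bounded_support[of _ "(sqrt (8 * t\<^sup>2 * (1 + n) + 2 / n\<^sup>2))\<^sup>2" n])
    fix \<xi>
    show "norm ((heat' n t \<xi>)\<^sup>2) \<le> (sqrt (8 * t\<^sup>2 * (1 + n) + 2 / n\<^sup>2))\<^sup>2"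
      using heat'_bounded[OF assms, of \<xi>] n by (simp only: real_norm_def abs_power2 power2_abs[of "heat' n t \<xi>", symmetric]) (intro power_mono, auto)
  qed (auto simp: heat'_def)
qed

text \<open>Integration by parts of the half-line transform on [0, n]. The boundary contribution is
  -1, which is real, so it disappears from imaginary parts. What remains is x times the real part of
  the half-line transform, and by evenness of \<open>heat\<close> twice that real part is the full
  transform. Thus the corner at 0 does no harm.\<close>

lemma ft_heat_times:
  assumes n: "0 < n" and t: "0 \<le> t"
  shows "\<bar>x\<bar> * norm (ft (\<lambda>\<xi>. of_real (heat n t \<xi>)) x) \<le> 2 * norm (ft (\<lambda>\<xi>. of_real (heat' n t \<xi>)) x)"
proof -
  define P where "P \<xi> = complex_of_real (indicator {0..n} \<xi> * heat n t \<xi>)" for \<xi>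
  have [measurable]: "P \<in> borel_measurable borel" unfolding P_def[abs_def] by measurable
  have P: "integrable lborel P"
    by (rule integrable_bounded_support[of _ 1 n])
       (use heat_nonneg heat_le_1[OF assms] n in \<open>auto simp: P_def indicator_def\<close>)
  have Pm: "integrable lborel (\<lambda>\<xi>. P (- \<xi>))" by (rule lborel_integrable_uminus[OF P])
  have "AE \<xi> in lborel. \<xi> \<noteq> (0::real)" by (rule AE_lborel_singleton)
  then have "ft (\<lambda>\<xi>. of_real (heat n t \<xi>)) x = (LINT \<xi>|lborel. cis (x * \<xi>) * P \<xi> + cis (x * \<xi>) * P (- \<xi>))"
    unfolding ft_def
  proof (intro integral_cong_AE)
    show "AE \<xi> in lborel. cis (x * \<xi>) * complex_of_real (heat n t \<xi>) = cis (x * \<xi>) * P \<xi> + cis (x * \<xi>) * P (- \<xi>)"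
      using AE_lborel_singleton[of 0]
      by eventually_elim (use n in \<open>auto simp: P_def heat_def indicator_def dest!: tent_nonzero[OF n]\<close>)
  qed auto
  also have "\<dots> = ft P x + ft (\<lambda>\<xi>. P (- \<xi>)) x"
    unfolding ft_def by (intro Bochner_Integration.integral_add integrable_cis_mult P Pm)
  also have "ft (\<lambda>\<xi>. P (- \<xi>)) x = cnj (ft P x)"
  proof -
    have "ft (\<lambda>\<xi>. P (- \<xi>)) x = ft P (- x)"
      unfolding ft_def using lborel_integral_uminus[of "\<lambda>\<xi>. cis (x * \<xi>) * P (- \<xi>)"] by simp
    also have "\<dots> = cnj (ft P x)"
    proof -
      have "(\<lambda>y. cnj (P y)) = P" by (auto simp: P_def fun_eq_iff)
      then show ?thesis unfolding cnj_ft[OF P] by simp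
    qed
    finally show ?thesis .
  qed
  finally have k: "ft (\<lambda>\<xi>. of_real (heat n t \<xi>)) x = of_real (2 * Re (ft P x))"
    by (simp add: complex_add_cnj)
  have cis_d: "((\<lambda>\<xi>. cis (x * \<xi>)) has_vector_derivative \<i> * of_real x * cis (x * \<xi>)) (at \<xi>)" for \<xi>
    by (auto intro!: derivative_eq_intros simp: has_vector_derivative_def fun_eq_iff scaleR_conv_of_real)
  let ?f = "\<lambda>\<xi>. cis (x * \<xi>) * of_real (heat n t \<xi>)"
  let ?g = "\<lambda>\<xi>. cis (x * \<xi>) * of_real (heat' n t \<xi>) + \<i> * of_real x * cis (x * \<xi>) * of_real (heat n t \<xi>)"
  \<comment> \<open>The derivative is available only inside (0, n), hence the interior form of the
    fundamental theorem, with continuity up to the ends.\<close>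
  have HK: "(?g has_integral ?f n - ?f 0) {0..n}"
  proof (rule fundamental_theorem_of_calculus_interior)
    show "continuous_on {0..n} ?f"
      unfolding heat_def by (intro continuous_intros tent_continuous n)
    fix \<xi> assume "\<xi> \<in> {0<..<n}"
    then have "(heat n t has_real_derivative heat' n t \<xi>) (at \<xi>)" by (intro heat_DERIV) auto
    then have d: "((\<lambda>\<xi>. complex_of_real (heat n t \<xi>)) has_vector_derivative of_real (heat' n t \<xi>)) (at \<xi>)"
      by (intro has_vector_derivative_of_real) (simp add: has_real_derivative_iff_has_vector_derivative)
    show "(?f has_vector_derivative ?g \<xi>) (at \<xi>)"
      by (rule has_vector_derivative_mult[OF cis_d d])
  qed (use n in simp)
  have H': "integrable lborel (\<lambda>\<xi>. complex_of_real (heat' n t \<xi>))"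
    using heat'_integrable[OF assms] by simp
  have cH': "integrable lborel (\<lambda>\<xi>. cis (x * \<xi>) * complex_of_real (heat' n t \<xi>))"
    by (rule integrable_cis_mult[OF H'])
  have cP: "integrable lborel (\<lambda>\<xi>. \<i> * of_real x * (cis (x * \<xi>) * P \<xi>))"
    by (intro integrable_mult_right integrable_cis_mult P)
  have int: "integrable lborel (\<lambda>\<xi>. cis (x * \<xi>) * of_real (heat' n t \<xi>) + \<i> * of_real x * (cis (x * \<xi>) * P \<xi>))" (is "integrable _ ?h")
    by (intro Bochner_Integration.integrable_add cH' cP)
  have "(?h has_integral integral\<^sup>L lborel ?h) UNIV"
    by (rule has_integral_integral_lborel[OF int])
  moreover have "(?h has_integral (?f n - ?f 0)) UNIV"
  proof -
    have "((\<lambda>\<xi>. if \<xi> \<in> {0..n} then ?g \<xi> else 0) has_integral ?f n - ?f 0) UNIV"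
      using HK by (subst has_integral_restrict_UNIV) 
    moreover have "(\<lambda>\<xi>. if \<xi> \<in> {0..n} then ?g \<xi> else 0) = ?h"
      by (auto simp: fun_eq_iff P_def heat'_def indicator_def)
    ultimately show ?thesis by simp
  qed
  ultimately have "integral\<^sup>L lborel ?h = ?f n - ?f 0" by (rule has_integral_unique)
  also have "\<dots> = - 1"
    using n by (simp add: heat_def tent_outside) (simp add: tent_def)
  also have "integral\<^sup>L lborel ?h = ft (\<lambda>\<xi>. of_real (heat' n t \<xi>)) x + \<i> * of_real x * ft P x"
    unfolding ft_def by (subst Bochner_Integration.integral_add[OF cH' cP]) simp
  finally have "Im (ft (\<lambda>\<xi>. of_real (heat' n t \<xi>)) x + \<i> * of_real x * ft P x) = Im (- 1)" by simp
  then have "x * Re (ft P x) = - Im (ft (\<lambda>\<xi>. of_real (heat' n t \<xi>)) x)" by simp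
  then have "\<bar>x * Re (ft P x)\<bar> \<le> norm (ft (\<lambda>\<xi>. of_real (heat' n t \<xi>)) x)"
    using abs_Im_le_cmod[of "ft (\<lambda>\<xi>. of_real (heat' n t \<xi>)) x"] by simp
  then show ?thesis unfolding k norm_of_real by (simp add: abs_mult)
qed

lemma inverse_square_integral:
  assumes "\<mu> > 0"
  shows "integrable lborel (\<lambda>x::real. 1 / (1 + \<mu> * \<bar>x\<bar>)\<^sup>2)"
    and "(LINT x|lborel. 1 / (1 + \<mu> * \<bar>x\<bar>)\<^sup>2) = (LINT x|lborel. 1 / (1 + \<bar>x\<bar>)\<^sup>2) / \<mu>"
proof -
  have eq: "(1 + \<bar>x\<bar>) powr (- 2) = 1 / (1 + \<bar>x\<bar>)\<^sup>2" for x :: real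
    by (simp add: powr_minus powr_numeral divide_inverse)
  have int: "integrable lborel (\<lambda>x::real. 1 / (1 + \<bar>x\<bar>)\<^sup>2)"
    using integrable_one_plus_abs_powr[of 2] unfolding eq by simp
  have abs: "\<bar>\<mu> * x\<bar> = \<mu> * \<bar>x\<bar>" for x using assms by (simp add: abs_mult)
  show "integrable lborel (\<lambda>x::real. 1 / (1 + \<mu> * \<bar>x\<bar>)\<^sup>2)"
    using lborel_integrable_real_affine[OF int, of \<mu> 0] assms by (simp add: abs_mult)
  have "(LINT x|lborel. 1 / (1 + \<bar>x\<bar>)\<^sup>2) = \<mu> * (LINT x|lborel. 1 / (1 + \<mu> * \<bar>x\<bar>)\<^sup>2)"
    using assms by (subst lborel_integral_real_affine[of \<mu> _ 0]) (simp_all add: abs_mult)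
  then show "(LINT x|lborel. 1 / (1 + \<mu> * \<bar>x\<bar>)\<^sup>2) = (LINT x|lborel. 1 / (1 + \<bar>x\<bar>)\<^sup>2) / \<mu>"
    using assms by simp
qed

text \<open>With \<open>\<mu> = t\<^bsup>2/3\<^esup>\<close>, the natural width of the kernel, the weighted arithmetic-geometric mean
  inequality \<open>2\<bar>k\<bar> \<le> \<mu>\<inverse> (1 + \<bar>x\<bar>/\<mu>)\<^sup>-\<^sup>2 + \<mu> (1 + \<bar>x\<bar>/\<mu>)\<^sup>2 k\<^sup>2\<close> reduces the \<open>L\<^sup>1\<close> bound to \<open>L\<^sup>2\<close> bounds
  of \<open>k\<close> and \<open>x k\<close>.\<close>

lemma heat_kernel_L1_bound:
  assumes m: "0 < m" and n: "1 / m\<^sup>2 \<le> n"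
  defines "J \<equiv> (LINT x|lborel. 1 / (1 + \<bar>x::real\<bar>)\<^sup>2)"
  shows "integrable lborel (ft (\<lambda>\<xi>. of_real (heat n (m ^ 3) \<xi>)))"
    and "(LINT x|lborel. norm (ft (\<lambda>\<xi>. of_real (heat n (m ^ 3) \<xi>)) x)) \<le> J + 54 * pi * J + 432 * pi * J * (4 * m\<^sup>2 + 5)"
proof -
  define \<mu> where "\<mu> = m\<^sup>2"
  have \<mu>: "0 < \<mu>" using m by (simp add: \<mu>_def)
  have n0: "0 < n" using n m by (meson divide_pos_pos less_le_trans zero_less_one zero_less_power)
  \<comment> \<open>The band edge lies beyond the natural frequency 1 / \<mu>, so the slope 1 / n of
    the cutoff costs no more than the evolution itself.\<close>
  have n\<mu>: "1 / n\<^sup>2 \<le> \<mu>\<^sup>2"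
  proof -
    have "1 \<le> \<mu> * n" using n m by (simp add: \<mu>_def field_simps)
    then have "1\<^sup>2 \<le> (\<mu> * n)\<^sup>2" by (intro power_mono) auto
    then show ?thesis using n0 by (simp add: power_mult_distrib field_simps)
  qed
  define t where "t = m ^ 3"
  have t: "0 \<le> t" using m by (simp add: t_def)
  have t2: "t\<^sup>2 = \<mu> ^ 3" by (simp add: t_def \<mu>_def power_mult[symmetric])
  define k where "k = ft (\<lambda>\<xi>. of_real (heat n t \<xi>))"
  define l where "l = ft (\<lambda>\<xi>. of_real (heat' n t \<xi>))"
  have [measurable]: "k \<in> borel_measurable borel" "l \<in> borel_measurable borel"
    unfolding k_def l_def by measurable
  have h1: "integrable lborel (\<lambda>\<xi>. complex_of_real (heat n t \<xi>))"
    and h2: "integrable lborel (\<lambda>\<xi>. (norm (complex_of_real (heat n t \<xi>)))\<^sup>2)"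
    using heat_integrable[OF n0 t] heat_sq_integrable[OF n0 t] by auto
  have h1': "integrable lborel (\<lambda>\<xi>. complex_of_real (heat' n t \<xi>))"
    and h2': "integrable lborel (\<lambda>\<xi>. (norm (complex_of_real (heat' n t \<xi>)))\<^sup>2)"
    using heat'_integrable[OF n0 t] by auto
  have k2: "integrable lborel (\<lambda>x. (norm (k x))\<^sup>2)" and l2: "integrable lborel (\<lambda>x. (norm (l x))\<^sup>2)"
    unfolding k_def l_def by (rule ft_L2_bound[OF h1 h2] ft_L2_bound[OF h1' h2'])+
  have e: "exp (- (2 * (t * psym \<xi>))) \<le> 27 / (1 + \<mu> * \<bar>\<xi>\<bar>) ^ 3" for \<xi>
    using exp_psym_bound[of m \<xi>] m by (simp add: t_def \<mu>_def)
  have J0: "0 \<le> J" unfolding J_def by simp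
  have pos: "0 < 1 + \<mu> * \<bar>\<xi>\<bar>" for \<xi> using \<mu> by (simp add: add_pos_nonneg)
  have cube: "27 / (1 + \<mu> * \<bar>\<xi>\<bar>) ^ 3 * (1 + \<mu> * \<bar>\<xi>\<bar>) = 27 * (1 / (1 + \<mu> * \<bar>\<xi>\<bar>)\<^sup>2)" for \<xi>
  proof -
    have "27 / c ^ 3 * c = 27 * (1 / c\<^sup>2)" if "c > 0" for c :: real
      using that by (simp add: power2_eq_square power3_eq_cube)
    then show ?thesis using pos by blast
  qed
  \<comment> \<open>The constant 54 pi is the Plancherel factor 2 pi times the 27 of
    \<open>exp_psym_bound\<close>. For k one factor 1 + \<mu> \<bar>\<xi>\<bar> is given away; for l
    it pays for the growth of (p')^2.\<close>
  have kb: "(LINT x|lborel. (norm (k x))\<^sup>2) \<le> 54 * pi * J / \<mu>"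
  proof -
    have "(LINT \<xi>|lborel. (norm (complex_of_real (heat n t \<xi>)))\<^sup>2) \<le> (LINT \<xi>|lborel. 27 * (1 / (1 + \<mu> * \<bar>\<xi>\<bar>)\<^sup>2))"
    proof (rule integral_mono[OF h2])
      show "integrable lborel (\<lambda>\<xi>. 27 * (1 / (1 + \<mu> * \<bar>\<xi>\<bar>)\<^sup>2))"
        by (intro integrable_mult_right inverse_square_integral \<mu>)
      fix \<xi>
      have "(norm (complex_of_real (heat n t \<xi>)))\<^sup>2 = exp (- (2 * (t * psym \<xi>))) * (tent n \<xi>)\<^sup>2"
        unfolding norm_of_real power2_abs by (simp add: heat_def power_mult_distrib exp_double[symmetric])
      also have "\<dots> \<le> exp (- (2 * (t * psym \<xi>))) * 1"
        using tent_nonneg[of n \<xi>] tent_le_1[OF n0, of \<xi>] by (intro mult_left_mono power_le_one) auto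
      also have "\<dots> \<le> 27 / (1 + \<mu> * \<bar>\<xi>\<bar>) ^ 3 * 1" using e[of \<xi>] by simp
      also have "\<dots> \<le> 27 / (1 + \<mu> * \<bar>\<xi>\<bar>) ^ 3 * (1 + \<mu> * \<bar>\<xi>\<bar>)"
        using \<mu> pos[of \<xi>] by (intro mult_left_mono) auto
      finally show "(norm (complex_of_real (heat n t \<xi>)))\<^sup>2 \<le> 27 * (1 / (1 + \<mu> * \<bar>\<xi>\<bar>)\<^sup>2)"
        unfolding cube .
    qed
    also have "\<dots> = 27 * (J / \<mu>)"
      unfolding integral_mult_right_zero inverse_square_integral(2)[OF \<mu>] J_def by simp
    finally have "2 * pi * (LINT \<xi>|lborel. (norm (complex_of_real (heat n t \<xi>)))\<^sup>2) \<le> 2 * pi * (27 * (J / \<mu>))"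
      by (rule mult_left_mono) simp
    from order_trans[OF ft_L2_bound(2)[OF h1 h2] this] show ?thesis unfolding k_def by simp
  qed
  have lb: "(LINT x|lborel. (norm (l x))\<^sup>2) \<le> 54 * pi * (8 * \<mu> + 10) * J * \<mu>"
  proof -
    have "(LINT \<xi>|lborel. (norm (complex_of_real (heat' n t \<xi>)))\<^sup>2) \<le> 
        (LINT \<xi>|lborel. (8 * \<mu> ^ 3 + 10 * \<mu>\<^sup>2) * (27 * (1 / (1 + \<mu> * \<bar>\<xi>\<bar>)\<^sup>2)))"
    proof (rule integral_mono[OF h2'])
      show "integrable lborel (\<lambda>\<xi>. (8 * \<mu> ^ 3 + 10 * \<mu>\<^sup>2) * (27 * (1 / (1 + \<mu> * \<bar>\<xi>\<bar>)\<^sup>2)))"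
        by (intro integrable_mult_right inverse_square_integral \<mu>)
      fix \<xi>
      have c0: "0 \<le> 8 * \<mu> ^ 3 + 10 * \<mu>\<^sup>2" using \<mu> by simp
      have "(norm (complex_of_real (heat' n t \<xi>)))\<^sup>2 \<le> (8 * t\<^sup>2 * (1 + \<bar>\<xi>\<bar>) + 2 / n\<^sup>2) * exp (- (2 * (t * psym \<xi>)))"
        using heat'_sq_bound[OF n0 t, of \<xi>] by simp
      also have "8 * t\<^sup>2 * (1 + \<bar>\<xi>\<bar>) + 2 / n\<^sup>2 \<le> (8 * \<mu> ^ 3 + 10 * \<mu>\<^sup>2) * (1 + \<mu> * \<bar>\<xi>\<bar>)"
      proof -
        have "8 * t\<^sup>2 * (1 + \<bar>\<xi>\<bar>) + 2 / n\<^sup>2 \<le> 8 * \<mu> ^ 3 + 8 * \<mu>\<^sup>2 * (\<mu> * \<bar>\<xi>\<bar>) + 2 * \<mu>\<^sup>2"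
        proof -
          have "8 * t\<^sup>2 * (1 + \<bar>\<xi>\<bar>) = 8 * \<mu> ^ 3 + 8 * \<mu>\<^sup>2 * (\<mu> * \<bar>\<xi>\<bar>)"
            unfolding t2 by (simp add: power2_eq_square power3_eq_cube algebra_simps)
          moreover have "2 / n\<^sup>2 \<le> 2 * \<mu>\<^sup>2" using n\<mu> by simp
          ultimately show ?thesis by linarith
        qed
        also have "\<dots> \<le> (8 * \<mu> ^ 3 + 10 * \<mu>\<^sup>2) * (1 + \<mu> * \<bar>\<xi>\<bar>)"
        proof -
          have "0 \<le> 8 * \<mu> ^ 3 * (\<mu> * \<bar>\<xi>\<bar>) + 2 * \<mu>\<^sup>2 * (\<mu> * \<bar>\<xi>\<bar>)" using \<mu> by simp
          then show ?thesis by (simp add: algebra_simps)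
        qed
        finally show ?thesis .
      qed
      then have "(8 * t\<^sup>2 * (1 + \<bar>\<xi>\<bar>) + 2 / n\<^sup>2) * exp (- (2 * (t * psym \<xi>))) 
        \<le> ((8 * \<mu> ^ 3 + 10 * \<mu>\<^sup>2) * (1 + \<mu> * \<bar>\<xi>\<bar>)) * (27 / (1 + \<mu> * \<bar>\<xi>\<bar>) ^ 3)"
        using c0 pos[of \<xi>] by (intro mult_mono e mult_nonneg_nonneg) auto
      also have "\<dots> = (8 * \<mu> ^ 3 + 10 * \<mu>\<^sup>2) * (27 * (1 / (1 + \<mu> * \<bar>\<xi>\<bar>)\<^sup>2))"
        unfolding cube[symmetric] by (simp only: mult_ac)
      finally show "(norm (complex_of_real (heat' n t \<xi>)))\<^sup>2 \<le> (8 * \<mu> ^ 3 + 10 * \<mu>\<^sup>2) * (27 * (1 / (1 + \<mu> * \<bar>\<xi>\<bar>)\<^sup>2))" .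
    qed
    also have "\<dots> = (8 * \<mu> ^ 3 + 10 * \<mu>\<^sup>2) * (27 * (J / \<mu>))"
      unfolding integral_mult_right_zero inverse_square_integral(2)[OF \<mu>] J_def by simp
    also have "\<dots> = 27 * (8 * \<mu> + 10) * J * \<mu>"
      using \<mu> by (simp add: field_simps power2_eq_square power3_eq_cube)
    finally have "2 * pi * (LINT \<xi>|lborel. (norm (complex_of_real (heat' n t \<xi>)))\<^sup>2) \<le> 2 * pi * (27 * (8 * \<mu> + 10) * J * \<mu>)"
      by (rule mult_left_mono) simp
    also have "\<dots> = 54 * pi * (8 * \<mu> + 10) * J * \<mu>" by simp
    finally show ?thesis unfolding l_def by (rule order_trans[OF ft_L2_bound(2)[OF h1' h2']])
  qed
  \<comment> \<open>Majorant of \<bar>k\<bar>: the inequality announced above, halved, with (1 +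
    \<bar>x\<bar>/\<mu>)^2 \<le> 2 + 2 x^2/\<mu>^2 and \<bar>x k\<bar> \<le> 2 \<bar>l\<bar>
    inserted. The first term is left without the factor 1/2.\<close>
  define b where "b x = (1 / \<mu>) * (1 / (1 + (1 / \<mu>) * \<bar>x\<bar>)\<^sup>2) + \<mu> * (norm (k x))\<^sup>2 + 4 / \<mu> * (norm (l x))\<^sup>2" for x
  have i1: "integrable lborel (\<lambda>x::real. 1 / (1 + (1 / \<mu>) * \<bar>x\<bar>)\<^sup>2)"
    by (rule inverse_square_integral) (use \<mu> in simp)
  have bi: "integrable lborel b"
    unfolding b_def[abs_def] by (intro Bochner_Integration.integrable_add integrable_mult_right i1 k2 l2)
  have kle: "norm (k x) \<le> b x" for x
  proof -
    define w where "w = 1 + (1 / \<mu>) * \<bar>x\<bar>"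
    have w: "0 < w" unfolding w_def using \<mu> by (simp add: add_pos_nonneg)
    have w2: "w\<^sup>2 \<le> 2 + 2 / \<mu>\<^sup>2 * x\<^sup>2"
      using sum_squares_bound[of 1 "(1 / \<mu>) * \<bar>x\<bar>"] by (simp add: w_def power2_sum power_divide)
    have "2 * (1 / w) * (\<mu> * (w * norm (k x))) \<le> (1 / w)\<^sup>2 + (\<mu> * (w * norm (k x)))\<^sup>2"
      by (rule sum_squares_bound)
    then have "2 * \<mu> * norm (k x) \<le> 1 / w\<^sup>2 + \<mu>\<^sup>2 * (w\<^sup>2 * (norm (k x))\<^sup>2)"
      using w by (simp add: power_mult_distrib power_divide field_simps)
    also have "\<mu>\<^sup>2 * (w\<^sup>2 * (norm (k x))\<^sup>2) \<le> \<mu>\<^sup>2 * ((2 + 2 / \<mu>\<^sup>2 * x\<^sup>2) * (norm (k x))\<^sup>2)"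
      using w2 by (intro mult_left_mono mult_right_mono) auto
    also have "\<dots> = 2 * \<mu>\<^sup>2 * (norm (k x))\<^sup>2 + 2 * (\<bar>x\<bar> * norm (k x))\<^sup>2"
      using \<mu> by (simp add: algebra_simps power_mult_distrib)
    also have "(\<bar>x\<bar> * norm (k x))\<^sup>2 \<le> (2 * norm (l x))\<^sup>2"
      unfolding k_def l_def by (intro power_mono ft_heat_times[OF n0 t]) simp
    finally have "2 * \<mu> * norm (k x) \<le> 1 / w\<^sup>2 + 2 * \<mu>\<^sup>2 * (norm (k x))\<^sup>2 + 2 * (2 * norm (l x))\<^sup>2"
      by simp
    then have "2 * \<mu> * norm (k x) \<le> 2 * (1 / w\<^sup>2) + 2 * \<mu>\<^sup>2 * (norm (k x))\<^sup>2 + 2 * (2 * norm (l x))\<^sup>2"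
      by (rule order_trans) (simp add: divide_right_mono)
    also have "\<dots> = 2 * \<mu> * b x"
      using \<mu> unfolding b_def w_def[symmetric] by (simp add: field_simps power2_eq_square)
    finally show ?thesis using \<mu> by simp
  qed
  show int: "integrable lborel (ft (\<lambda>\<xi>. of_real (heat n (m ^ 3) \<xi>)))"
    unfolding t_def[symmetric] k_def[symmetric]
    by (rule Bochner_Integration.integrable_bound[OF bi]) (use kle in \<open>auto intro: order_trans[OF _ abs_ge_self]\<close>)
  have "(LINT x|lborel. norm (ft (\<lambda>\<xi>. of_real (heat n (m ^ 3) \<xi>)) x)) \<le> (LINT x|lborel. b x)"
    using int kle unfolding t_def[symmetric] k_def[symmetric] by (intro integral_mono bi) auto
  also have "\<dots> = (1 / \<mu>) * (J / (1 / \<mu>)) + \<mu> * (LINT x|lborel. (norm (k x))\<^sup>2) + 4 / \<mu> * (LINT x|lborel. (norm (l x))\<^sup>2)"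
  proof -
    have a: "integrable lborel (\<lambda>x::real. (1 / \<mu>) * (1 / (1 + (1 / \<mu>) * \<bar>x\<bar>)\<^sup>2))"
      and b: "integrable lborel (\<lambda>x. \<mu> * (norm (k x))\<^sup>2)" and c: "integrable lborel (\<lambda>x. 4 / \<mu> * (norm (l x))\<^sup>2)"
      by (intro integrable_mult_right i1 k2 l2)+
    have \<mu>': "0 < 1 / \<mu>" using \<mu> by simp
    show ?thesis
      unfolding b_def Bochner_Integration.integral_add[OF Bochner_Integration.integrable_add[OF a b] c]
        Bochner_Integration.integral_add[OF a b] integral_mult_right_zero inverse_square_integral(2)[OF \<mu>'] J_def ..
  qed
  also have "\<dots> \<le> (1 / \<mu>) * (J / (1 / \<mu>)) + \<mu> * (54 * pi * J / \<mu>) + 4 / \<mu> * (54 * pi * (8 * \<mu> + 10) * J * \<mu>)"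
    using \<mu> by (intro add_mono mult_left_mono kb lb) auto
  also have "\<dots> = J + 54 * pi * J + 432 * pi * J * (4 * m\<^sup>2 + 5)"
    using \<mu> by (simp add: \<mu>_def[symmetric] field_simps)
  finally show "(LINT x|lborel. norm (ft (\<lambda>\<xi>. of_real (heat n (m ^ 3) \<xi>)) x)) \<le> J + 54 * pi * J + 432 * pi * J * (4 * m\<^sup>2 + 5)" .
qed

text \<open>The preceding bound increases with m, so its value at m = \<open>root 3 T\<close> covers
  all times up to T; the admissible bands recede to infinity as t tends to 0.\<close>

lemma heat_kernel_L1_uniform:
  obtains C where "0 \<le> C"
    "\<And>t n. 0 < t \<Longrightarrow> t \<le> T \<Longrightarrow> 1 / (root 3 t)\<^sup>2 \<le> n \<Longrightarrow>
       integrable lborel (ft (\<lambda>\<xi>. of_real (heat n t \<xi>))) \<and>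
       (LINT x|lborel. norm (ft (\<lambda>\<xi>. of_real (heat n t \<xi>)) x)) \<le> C"
proof -
  define J where "J = (LINT x|lborel. 1 / (1 + \<bar>x::real\<bar>)\<^sup>2)"
  have J0: "0 \<le> J" unfolding J_def by simp
  define C where "C = J + 54 * pi * J + 432 * pi * J * (4 * (root 3 T)\<^sup>2 + 5)"
  have "0 \<le> C" unfolding C_def using J0 by simp
  moreover have "integrable lborel (ft (\<lambda>\<xi>. of_real (heat n t \<xi>))) \<and>
       (LINT x|lborel. norm (ft (\<lambda>\<xi>. of_real (heat n t \<xi>)) x)) \<le> C" 
    if t: "0 < t" "t \<le> T" and n: "1 / (root 3 t)\<^sup>2 \<le> n" for t n
  proof -
    have m: "0 < root 3 t" and tm: "root 3 t ^ 3 = t" using t by auto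
    have "(root 3 t)\<^sup>2 \<le> (root 3 T)\<^sup>2" using t m by (intro power_mono) auto
    then have "J + 54 * pi * J + 432 * pi * J * (4 * (root 3 t)\<^sup>2 + 5) \<le> C"
      unfolding C_def using J0 by (intro add_mono mult_left_mono) auto
    then show ?thesis using heat_kernel_L1_bound[OF m n] unfolding tm J_def by linarith
  qed
  ultimately show thesis by (rule that)
qed

section \<open>Cutoffs\<close>

text \<open>The primitive of b minus its final value vanishes after \<beta>, and a smooth step
  between -1 and 0 makes the support compact without touching positive times. As time factor of a
  test function it makes the weak identity, which knows nothing about single times, speak of the
  average of the solution against b.\<close>

lemma time_cutoff:
  fixes b :: "real \<Rightarrow> real"
  assumes \<alpha>: "0 < \<alpha>" "\<alpha> < \<beta>" and b: "smooth_real b"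
    and b01: "\<And>s. 0 \<le> b s" "\<And>s. b s \<le> 1"
    and supp: "\<And>s. s \<le> \<alpha> \<Longrightarrow> b s = 0" "\<And>s. \<beta> \<le> s \<Longrightarrow> b s = 0"
  obtains a where "smooth_real a" "\<And>s. s \<le> -1 \<Longrightarrow> a s = 0" "\<And>s. \<beta> \<le> s \<Longrightarrow> a s = 0"
    "\<And>s. 0 < s \<Longrightarrow> (a has_real_derivative b s) (at s)" "\<And>s. \<bar>a s\<bar> \<le> \<beta> - \<alpha>"
proof -
  define A where "A x = integral {0..x} b" for x
  have cb: "continuous_on UNIV b" by (rule smooth_real_continuous[OF b])
  have A0: "A x = 0" if "x \<le> \<alpha>" for x
  proof -
    have "integral {0..x} b = integral {0..x} (\<lambda>x. 0)"
      by (rule integral_cong) (use that supp in auto)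
    then show ?thesis by (simp add: A_def)
  qed
  have dA: "(A has_real_derivative b x) (at x)" for x
  proof (cases "x < \<alpha>")
    case True
    have ev: "eventually (\<lambda>y. 0 = A y) (nhds x)"
      by (rule eventually_mono[OF eventually_nhds_in_open[of "{..<\<alpha>}" x]]) (use True A0 in auto)
    have "((\<lambda>y. 0) has_real_derivative b x) (at x)" using True supp(1)[of x] by simp
    then show ?thesis using DERIV_cong_ev[OF refl ev refl] by simp
  next
    case False
    then have x: "0 < x" using \<alpha> by simp
    have "((\<lambda>u. integral {0..u} b) has_vector_derivative b x) (at x within {0..x + 1})"
      by (rule integral_has_vector_derivative) (use cb x in \<open>auto intro: continuous_on_subset\<close>)
    then have "(A has_vector_derivative b x) (at x within {0<..<x + 1})"
      unfolding A_def[abs_def] by (rule has_vector_derivative_within_subset) auto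
    then have "(A has_vector_derivative b x) (at x)"
      by (subst (asm) has_vector_derivative_within_open) (use x in auto)
    then show ?thesis by (simp add: has_real_derivative_iff_has_vector_derivative)
  qed
  have sA: "smooth_real A" by (rule smooth_realI_deriv[OF b dA])
  have mono: "A x \<le> A y" if "x \<le> y" for x y
    by (rule DERIV_nonneg_imp_nondecreasing[OF that]) (use dA b01 in blast)
  have A\<beta>: "A s = A \<beta>" if "\<beta> \<le> s" for s
  proof (cases "s = \<beta>")
    case False
    then have "\<beta> < s" using that by simp
    then obtain z where z: "z > \<beta>" "A s - A \<beta> = (s - \<beta>) * b z"
      using MVT2[of \<beta> s A b, OF _ dA] by blast
    then show ?thesis using supp(2)[of z] by simp
  qed simp
  have A\<beta>le: "A \<beta> \<le> \<beta> - \<alpha>"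
  proof -
    obtain z where z: "A \<beta> - A \<alpha> = (\<beta> - \<alpha>) * b z" using MVT2[of \<alpha> \<beta> A b] \<alpha> dA by auto
    also have "\<dots> \<le> (\<beta> - \<alpha>) * 1" using \<alpha> b01 by (intro mult_left_mono) auto
    finally show ?thesis using A0[of \<alpha>] by simp
  qed
  have rng: "0 \<le> A s" "A s \<le> A \<beta>" for s
    using mono[of "min s \<alpha>" s] A0[of "min s \<alpha>"] mono[of s \<beta>] A\<beta>[of s] by (auto simp: not_le) (metis le_cases order_refl)
  define a where "a s = (A s + (- A \<beta>)) * smooth_step (1 * s + 1)" for s
  show thesis
  proof (rule that[of a])
    show "smooth_real a"
      unfolding a_def[abs_def]
      by (rule smooth_real_mult[OF smooth_real_add[OF sA smooth_real_const] smooth_real_affine[OF smooth_smooth_step]])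
    show "a s = 0" if "s \<le> -1" for s using that by (simp add: a_def smooth_step_eq_0)
    show "a s = 0" if "\<beta> \<le> s" for s using A\<beta>[OF that] by (simp add: a_def)
    show "\<bar>a s\<bar> \<le> \<beta> - \<alpha>" for s
    proof -
      have "\<bar>a s\<bar> = \<bar>A s - A \<beta>\<bar> * smooth_step (s + 1)"
        using smooth_step_bounds(1)[of "s + 1"] by (simp add: a_def abs_mult)
      also have "\<dots> \<le> \<bar>A s - A \<beta>\<bar> * 1" by (intro mult_left_mono smooth_step_bounds) simp
      also have "\<dots> \<le> \<beta> - \<alpha>" using rng[of s] A\<beta>le by simp
      finally show ?thesis .
    qed
    show "(a has_real_derivative b s) (at s)" if "0 < s" for s
    proof -
      have ev: "eventually (\<lambda>y. A y + (- A \<beta>) = a y) (nhds s)"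
        by (rule eventually_mono[OF eventually_nhds_in_open[of "{0<..}" s]])
           (use that in \<open>auto simp: a_def smooth_step_eq_1\<close>)
      have "((\<lambda>y. A y + (- A \<beta>)) has_real_derivative b s) (at s)"
        using dA[of s] by (auto intro!: derivative_eq_intros)
      then show ?thesis using DERIV_cong_ev[OF refl ev refl] by simp
    qed
  qed
qed

section \<open>Approximate indicators in time and space\<close>

definition bump :: "real \<Rightarrow> real \<Rightarrow> nat \<Rightarrow> real \<Rightarrow> real" where
  "bump \<alpha> \<beta> k s = smooth_step (real (Suc k) * (s - \<alpha>)) * smooth_step (real (Suc k) * (\<beta> - s))"

lemma smooth_bump: "smooth_real (bump \<alpha> \<beta> k)"
proof -
  have 1: "smooth_real (\<lambda>s. smooth_step (real (Suc k) * s + - (real (Suc k) * \<alpha>)))"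
    by (rule smooth_real_affine[OF smooth_smooth_step])
  have 2: "smooth_real (\<lambda>s. smooth_step (- real (Suc k) * s + real (Suc k) * \<beta>))"
    by (rule smooth_real_affine[OF smooth_smooth_step])
  show ?thesis
    using smooth_real_mult[OF 1 2] unfolding bump_def[abs_def] by (simp add: algebra_simps)
qed

lemma bump_bounds: "0 \<le> bump \<alpha> \<beta> k s" "bump \<alpha> \<beta> k s \<le> 1"
  unfolding bump_def by (auto intro!: mult_nonneg_nonneg mult_le_one smooth_step_bounds)

lemma bump_outside: "s \<le> \<alpha> \<Longrightarrow> bump \<alpha> \<beta> k s = 0" "\<beta> \<le> s \<Longrightarrow> bump \<alpha> \<beta> k s = 0"
proof -
  show "bump \<alpha> \<beta> k s = 0" if "s \<le> \<alpha>"
    using smooth_step_eq_0[of "real (Suc k) * (s - \<alpha>)"] that by (simp add: bump_def mult_nonneg_nonpos)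
  show "bump \<alpha> \<beta> k s = 0" if "\<beta> \<le> s"
    using smooth_step_eq_0[of "real (Suc k) * (\<beta> - s)"] that by (simp add: bump_def mult_nonneg_nonpos)
qed

lemma bump_tendsto: "(\<lambda>k. bump \<alpha> \<beta> k s) \<longlonglongrightarrow> indicator {\<alpha><..<\<beta>} s"
proof (cases "\<alpha> < s \<and> s < \<beta>")
  case True
  define d where "d = min (s - \<alpha>) (\<beta> - s)"
  have d: "d > 0" using True by (simp add: d_def)
  have "eventually (\<lambda>k. 1 / d \<le> real k) sequentially"
    using filterlim_real_sequentially by (simp add: filterlim_at_top)
  then have "eventually (\<lambda>k. bump \<alpha> \<beta> k s = 1) sequentially"
  proof eventually_elim
    case (elim k)
    have "1 \<le> real k * d" using elim d by (simp add: field_simps)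
    also have "\<dots> \<le> real (Suc k) * d" using d by (intro mult_right_mono) auto
    finally have 1: "1 \<le> real (Suc k) * d" .
    have d2: "d \<le> s - \<alpha>" "d \<le> \<beta> - s" by (simp_all add: d_def)
    have "1 \<le> real (Suc k) * (s - \<alpha>)"
      by (rule order_trans[OF 1 mult_left_mono[OF d2(1)]]) simp
    moreover have "1 \<le> real (Suc k) * (\<beta> - s)"
      by (rule order_trans[OF 1 mult_left_mono[OF d2(2)]]) simp
    ultimately show ?case by (simp add: bump_def smooth_step_eq_1 del: of_nat_Suc)
  qed
  then show ?thesis using True by (simp add: tendsto_eventually)
next
  case False
  then have "bump \<alpha> \<beta> k s = 0" for k using bump_outside by (meson not_le)
  then show ?thesis using False by simp
qed

definition space_cutoff :: "real \<Rightarrow> real" where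
  "space_cutoff x = smooth_step (x + 2) * smooth_step (2 - x)"

lemma smooth_space_cutoff: "smooth_real space_cutoff"
proof -
  have 1: "smooth_real (\<lambda>s. smooth_step (1 * s + 2))" and 2: "smooth_real (\<lambda>s. smooth_step ((-1) * s + 2))"
    by (rule smooth_real_affine[OF smooth_smooth_step])+
  show ?thesis
    using smooth_real_mult[OF 1 2] unfolding space_cutoff_def[abs_def] by (simp add: algebra_simps)
qed

lemma space_cutoff_bounds: "0 \<le> space_cutoff x" "space_cutoff x \<le> 1"
  unfolding space_cutoff_def by (auto intro!: mult_nonneg_nonneg mult_le_one smooth_step_bounds)

lemma space_cutoff_eq_0: "2 \<le> \<bar>x\<bar> \<Longrightarrow> space_cutoff x = 0"
  unfolding space_cutoff_def by (cases "0 \<le> x") (auto simp: smooth_step_eq_0)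

lemma space_cutoff_eq_1: "\<bar>x\<bar> \<le> 1 \<Longrightarrow> space_cutoff x = 1"
  unfolding space_cutoff_def by (auto simp: smooth_step_eq_1 abs_le_iff)

section \<open>Transforms of smooth compactly supported functions\<close>

lemma smooth_real_measurable: "smooth_real f \<Longrightarrow> f \<in> borel_measurable borel"
  by (intro borel_measurable_continuous_onI smooth_real_continuous)

lemma smooth_compact_support_bounded:
  assumes f: "smooth_real f" and supp: "\<And>x. c \<le> \<bar>x\<bar> \<Longrightarrow> f x = 0"
  obtains B where "0 \<le> B" "\<And>x. \<bar>f x\<bar> \<le> B"
proof -
  have "continuous_on {-c..c} f" using smooth_real_continuous[OF f] continuous_on_subset by blast
  then have "compact (f ` {-c..c})" by (intro compact_continuous_image) auto
  then obtain B where B: "\<And>y. y \<in> f ` {-c..c} \<Longrightarrow> norm y \<le> B"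
    using compact_imp_bounded bounded_iff by metis
  have "\<bar>f x\<bar> \<le> max B 0" for x
  proof (cases "c \<le> \<bar>x\<bar>")
    case False
    then have "x \<in> {-c..c}" by auto
    then show ?thesis using B[of "f x"] by auto
  qed (use supp in simp)
  then show thesis using that[of "max B 0"] by simp
qed

lemma smooth_compact_support_integrable:
  assumes f: "smooth_real f" and supp: "\<And>x. c \<le> \<bar>x\<bar> \<Longrightarrow> f x = 0"
  shows "integrable lborel f"
proof -
  obtain B where B: "0 \<le> B" "\<And>x. \<bar>f x\<bar> \<le> B" using smooth_compact_support_bounded[OF assms] by blast
  show ?thesis
  proof (rule Bochner_Integration.integrable_bound)
    show "integrable lborel (\<lambda>x. B * indicator {-c..c} x :: real)"
      by (intro integrable_mult_right integrable_real_indicator) (auto simp: emeasure_lborel_Icc_eq)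
    show "f \<in> borel_measurable lborel" using smooth_real_measurable[OF f] by simp
    have "norm (f x) \<le> norm (B * indicator {-c..c} x :: real)" for x
    proof (cases "c \<le> \<bar>x\<bar>")
      case False
      then have "x \<in> {-c..c}" by auto
      then show ?thesis using B by simp
    qed (use supp in simp)
    then show "AE x in lborel. norm (f x) \<le> norm (B * indicator {-c..c} x :: real)" by simp
  qed
qed

text \<open>Integration by parts without boundary terms: the transform of f' is -i z times that of
  f. One power of z is gained per step, so the induction passes from f to f', and k = 0 is the
  trivial \<open>L\<^sup>1\<close> bound.\<close>

lemma ft_smooth_decay:
  assumes "smooth_real f" "\<And>x. c \<le> \<bar>x\<bar> \<Longrightarrow> f x = 0"
  shows "\<exists>C. \<forall>z. \<bar>z\<bar> ^ k * norm (ft (\<lambda>x. of_real (f x)) z) \<le> C"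
  using assms
proof (induction k arbitrary: f c)
  case 0
  show ?case using norm_ft_le by auto
next
  case (Suc k)
  obtain f' where f': "smooth_real f'" and d: "\<And>x. (f has_real_derivative f' x) (at x)"
    using smooth_real_deriv[OF Suc.prems(1)] by blast
  \<comment> \<open>Enlarged by one so that \<bar>x\<bar> \<ge> c' lies inside the open set where f
    vanishes identically; the maximum with 0 makes c' positive.\<close>
  define c' where "c' = max c 0 + 1"
  have f'0: "f' x = 0" if "c' \<le> \<bar>x\<bar>" for x
  proof -
    have ev: "eventually (\<lambda>y. 0 = f y) (nhds x)"
      by (rule eventually_mono[OF eventually_nhds_in_open[of "{y. c < \<bar>y\<bar>}" x]])
         (use that Suc.prems(2) in \<open>auto simp: c'_def intro!: open_Collect_less continuous_intros\<close>)
    have "((\<lambda>y. 0) has_real_derivative f' x) (at x)"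
      using d[of x] DERIV_cong_ev[OF refl ev refl] by simp
    then show ?thesis using DERIV_unique[OF _ DERIV_const] by blast
  qed
  obtain C where C: "\<And>z. \<bar>z\<bar> ^ k * norm (ft (\<lambda>x. of_real (f' x)) z) \<le> C"
    using Suc.IH[OF f' f'0] by blast
  have f0: "f x = 0" if "c' \<le> \<bar>x\<bar>" for x using Suc.prems(2)[of x] that by (simp add: c'_def)
  have c'0: "0 < c'" by (simp add: c'_def)
  have parts: "ft (\<lambda>x. of_real (f' x)) z = - \<i> * of_real z * ft (\<lambda>x. of_real (f x)) z" for z
  proof -
    let ?h = "\<lambda>x. cis (z * x) * of_real (f' x) + \<i> * of_real z * (cis (z * x) * of_real (f x))"
    have cis_d: "((\<lambda>x. cis (z * x)) has_vector_derivative \<i> * of_real z * cis (z * x)) (at x)" for x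
      by (auto intro!: derivative_eq_intros simp: has_vector_derivative_def fun_eq_iff scaleR_conv_of_real)
    have fd: "((\<lambda>x. complex_of_real (f x)) has_vector_derivative of_real (f' x)) (at x)" for x
      using d[of x] by (intro has_vector_derivative_of_real) (simp add: has_real_derivative_iff_has_vector_derivative)
    have vd: "((\<lambda>x. cis (z * x) * of_real (f x)) has_vector_derivative ?h x) (at x)" for x
      using has_vector_derivative_mult[OF cis_d fd] by (simp add: mult.assoc)
    have "(?h has_integral cis (z * c') * of_real (f c') - cis (z * (- c')) * of_real (f (- c'))) {-c'..c'}"
      by (rule fundamental_theorem_of_calculus)
         (use c'0 vd in \<open>auto intro: has_vector_derivative_at_within\<close>)
    then have "(?h has_integral 0) {-c'..c'}" using f0 c'0 by simp
    then have "((\<lambda>x. if x \<in> {-c'..c'} then ?h x else 0) has_integral 0) UNIV"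
      by (subst has_integral_restrict_UNIV)
    moreover have "(\<lambda>x. if x \<in> {-c'..c'} then ?h x else 0) = ?h"
      using f0 f'0 by (auto simp: fun_eq_iff)
    ultimately have h0: "(?h has_integral 0) UNIV" by simp
    have i1: "integrable lborel (\<lambda>x. cis (z * x) * complex_of_real (f' x))"
      using smooth_compact_support_integrable[OF f' f'0] by (intro integrable_cis_mult) simp
    have i2: "integrable lborel (\<lambda>x. \<i> * of_real z * (cis (z * x) * complex_of_real (f x)))"
      using smooth_compact_support_integrable[OF Suc.prems(1) f0] by (intro integrable_mult_right integrable_cis_mult) simp
    have "integral\<^sup>L lborel ?h = 0"
      using has_integral_unique[OF has_integral_integral_lborel[OF Bochner_Integration.integrable_add[OF i1 i2]] h0] .
    then have "ft (\<lambda>x. of_real (f' x)) z + \<i> * of_real z * ft (\<lambda>x. of_real (f x)) z = 0"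
      unfolding ft_def by (subst (asm) Bochner_Integration.integral_add[OF i1 i2]) simp
    then show ?thesis by (simp add: eq_neg_iff_add_eq_0)
  qed
  have "\<bar>z\<bar> ^ Suc k * norm (ft (\<lambda>x. of_real (f x)) z) \<le> C" for z
    using C[of z] unfolding parts by (simp add: norm_mult mult_ac)
  then show ?case by blast
qed

lemma ft_smooth_integrable:
  assumes f: "smooth_real f" "\<And>x. c \<le> \<bar>x\<bar> \<Longrightarrow> f x = 0"
  shows "integrable lborel (\<lambda>z. (1 + z\<^sup>2)\<^sup>2 * norm (ft (\<lambda>x. of_real (f x)) z))"
    and "integrable lborel (ft (\<lambda>x. of_real (f x)))"
proof -
  have [measurable]: "f \<in> borel_measurable borel" by (rule smooth_real_measurable[OF f(1)])
  obtain C0 where C0: "\<And>z. \<bar>z\<bar> ^ 0 * norm (ft (\<lambda>x. of_real (f x)) z) \<le> C0" using ft_smooth_decay[OF f] by blast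
  \<comment> \<open>Order 6: four powers pay for the weight (1 + z^2)^2 and two for integrability at
    infinity.\<close>
  obtain C6 where C6: "\<And>z. \<bar>z\<bar> ^ 6 * norm (ft (\<lambda>x. of_real (f x)) z) \<le> C6" using ft_smooth_decay[OF f] by blast
  have bnd: "(1 + z\<^sup>2)\<^sup>2 * norm (ft (\<lambda>x. of_real (f x)) z) \<le> 8 * (C0 + C6) * (1 + \<bar>z\<bar>) powr (- 2)" for z
  proof -
    let ?X = "norm (ft (\<lambda>x. of_real (f x)) z)"
    define w where "w = \<bar>z\<bar>"
    have w: "0 \<le> w" by (simp add: w_def)
    have "(1 + w)\<^sup>2 \<le> 2 * (1 + w\<^sup>2)"
      using sum_squares_bound[of 1 w] by (simp add: power2_eq_square algebra_simps)
    then have "(1 + w\<^sup>2)\<^sup>2 * (1 + w)\<^sup>2 \<le> (1 + w\<^sup>2)\<^sup>2 * (2 * (1 + w\<^sup>2))" by (intro mult_left_mono) auto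
    also have "\<dots> = 2 * (1 + w\<^sup>2) ^ 3" by (simp add: power2_eq_square power3_eq_cube)
    also have "(1 + w\<^sup>2) ^ 3 \<le> 4 * (1 + w ^ 6)"
    proof -
      \<comment> \<open>Both factors have the same sign; expanding gives w^2 + w^4 \<le> 1 + w^6,
        which absorbs the mixed terms of the cube.\<close>
      have "0 \<le> (1 - w\<^sup>2) * (1 - (w\<^sup>2)\<^sup>2)"
      proof (cases "w\<^sup>2 \<le> 1")
        case True
        then have "(w\<^sup>2)\<^sup>2 \<le> 1" by (intro power_le_one[of "w\<^sup>2"]) auto
        with True show ?thesis by simp
      next
        case False
        then have "1 \<le> (w\<^sup>2)\<^sup>2" by (intro one_le_power[of "w\<^sup>2"]) auto
        with False show ?thesis by (intro mult_nonpos_nonpos) auto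
      qed
      then have "w\<^sup>2 + (w\<^sup>2)\<^sup>2 \<le> 1 + (w\<^sup>2) ^ 3" by (simp add: algebra_simps power3_eq_cube power2_eq_square)
      moreover have "(1 + w\<^sup>2) ^ 3 = 1 + 3 * (w\<^sup>2 + (w\<^sup>2)\<^sup>2) + (w\<^sup>2) ^ 3" by (simp add: power3_eq_cube power2_eq_square algebra_simps)
      ultimately show ?thesis by (simp add: power_mult[symmetric])
    qed
    finally have "(1 + w\<^sup>2)\<^sup>2 * (1 + w)\<^sup>2 \<le> 8 * (1 + w ^ 6)" by simp
    then have "(1 + w\<^sup>2)\<^sup>2 * (1 + w)\<^sup>2 * ?X \<le> 8 * (1 + w ^ 6) * ?X" by (rule mult_right_mono) simp
    also have "\<dots> \<le> 8 * (C0 + C6)" using C0[of z] C6[of z] by (simp add: algebra_simps w_def)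
    finally have "(1 + w\<^sup>2)\<^sup>2 * ?X * (1 + w)\<^sup>2 \<le> 8 * (C0 + C6)" by (simp add: mult_ac)
    then have "(1 + w\<^sup>2)\<^sup>2 * ?X \<le> 8 * (C0 + C6) / (1 + w)\<^sup>2"
      using w by (subst pos_le_divide_eq) auto
    then show ?thesis by (simp add: w_def powr_minus powr_numeral divide_inverse)
  qed
  show i: "integrable lborel (\<lambda>z. (1 + z\<^sup>2)\<^sup>2 * norm (ft (\<lambda>x. of_real (f x)) z))"
  proof (rule Bochner_Integration.integrable_bound)
    show "integrable lborel (\<lambda>z::real. 8 * (C0 + C6) * (1 + \<bar>z\<bar>) powr (- 2))"
      by (intro integrable_mult_right integrable_one_plus_abs_powr) simp
  qed (use bnd in \<open>auto intro!: AE_I2 order_trans[OF _ abs_ge_self]\<close>)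
  show "integrable lborel (ft (\<lambda>x. of_real (f x)))"
  proof (rule Bochner_Integration.integrable_bound[OF i])
    have "1 * norm (ft (\<lambda>x. of_real (f x)) z) \<le> (1 + z\<^sup>2)\<^sup>2 * norm (ft (\<lambda>x. of_real (f x)) z)" for z
      by (intro mult_right_mono one_le_power) auto
    then show "AE z in lborel. norm (ft (\<lambda>x. of_real (f x)) z) \<le> norm ((1 + z\<^sup>2)\<^sup>2 * norm (ft (\<lambda>x. of_real (f x)) z))"
      by simp
  qed simp
qed

text \<open>Inversion at the single point 0 by Gaussian summation: the multiplication formula turns
  the damped integral into an average of f against Gaussians that concentrate at 0. Applied to the
  spatial cutoff, it says that its transform has total mass 2 pi.\<close>

lemma ft_integral_eq:
  assumes f1: "integrable lborel f" and B: "\<And>x. norm (f x) \<le> B" and cont: "isCont f 0"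
    and X: "integrable lborel (ft f)"
  shows "(LINT z|lborel. ft f z) = of_real (2 * pi) * f 0"
proof -
  note [measurable] = borel_measurable_integrable[OF f1]
  define e where "e k = 1 / real (Suc k)" for k
  have e: "e k > 0" for k by (simp add: e_def)
  have e0: "e \<longlonglongrightarrow> 0" unfolding e_def by (rule LIMSEQ_Suc) (rule lim_1_over_n)
  have lim1: "(\<lambda>k. LINT z|lborel. ft f z * of_real (exp (- e k * z\<^sup>2 / 2))) \<longlonglongrightarrow> (LINT z|lborel. ft f z)"
  proof (rule integral_dominated_convergence[where w = "\<lambda>z. norm (ft f z)"])
    have "(\<lambda>k. ft f z * of_real (exp (- e k * z\<^sup>2 / 2))) \<longlonglongrightarrow> ft f z * of_real (exp (- 0 * z\<^sup>2 / 2))" for z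
      by (intro tendsto_intros e0) auto
    then show "AE z in lborel. (\<lambda>k. ft f z * of_real (exp (- e k * z\<^sup>2 / 2))) \<longlonglongrightarrow> ft f z" by simp
    show "AE z in lborel. norm (ft f z * of_real (exp (- e k * z\<^sup>2 / 2))) \<le> norm (ft f z)" for k
      using e[of k] by (auto intro!: AE_I2 simp: norm_mult mult_left_le)
  qed (use X in auto)
  have eq: "(LINT z|lborel. ft f z * of_real (exp (- e k * z\<^sup>2 / 2))) 
      = of_real (sqrt (2 * pi)) * (LINT y|lborel. f (sqrt (e k) * y) * of_real (exp (- y\<^sup>2 / 2)))" for k
  proof -
    have s: "sqrt (e k) > 0" using e by simp
    have s2: "(sqrt (e k) * y)\<^sup>2 = e k * y\<^sup>2" for y using e[of k] by (simp add: power_mult_distrib)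
    have "(LINT z|lborel. ft f z * of_real (exp (- e k * z\<^sup>2 / 2))) 
      = (LINT x|lborel. f x * of_real (sqrt (2 * pi / e k) * exp (- x\<^sup>2 / (2 * e k))))"
      unfolding gaussian(2)[OF e, symmetric]
      by (rule ft_multiplication_formula[OF f1]) (use gaussian(1)[OF e] in simp)
    also have "\<dots> = sqrt (e k) *\<^sub>R (LINT y|lborel. f (sqrt (e k) * y) * of_real (sqrt (2 * pi / e k) * exp (- y\<^sup>2 / 2)))"
      using s e[of k] by (subst lborel_integral_real_affine[of "sqrt (e k)" _ 0]) (simp_all add: s2)
    also have "\<dots> = (LINT y|lborel. sqrt (e k) *\<^sub>R (f (sqrt (e k) * y) * of_real (sqrt (2 * pi / e k) * exp (- y\<^sup>2 / 2))))"
      by simp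
    also have "\<dots> = (LINT y|lborel. of_real (sqrt (2 * pi)) * (f (sqrt (e k) * y) * of_real (exp (- y\<^sup>2 / 2))))"
      using s by (intro Bochner_Integration.integral_cong) (simp_all add: scaleR_conv_of_real real_sqrt_divide)
    finally show ?thesis by simp
  qed
  have lim2: "(\<lambda>k. LINT y|lborel. f (sqrt (e k) * y) * of_real (exp (- y\<^sup>2 / 2))) \<longlonglongrightarrow> (LINT y|lborel. f 0 * of_real (exp (- y\<^sup>2 / 2)))"
  proof (rule integral_dominated_convergence[where w = "\<lambda>y. B * exp (- y\<^sup>2 / 2)"])
    show "integrable lborel (\<lambda>y. B * exp (- y\<^sup>2 / 2))" by (intro integrable_mult_right gaussian_std)
    have "(\<lambda>k. sqrt (e k) * y) \<longlonglongrightarrow> sqrt 0 * y" for y by (intro tendsto_intros e0)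
    then have "(\<lambda>k. f (sqrt (e k) * y)) \<longlonglongrightarrow> f 0" for y
      by (intro isCont_tendsto_compose[OF cont]) simp
    then show "AE y in lborel. (\<lambda>k. f (sqrt (e k) * y) * of_real (exp (- y\<^sup>2 / 2))) \<longlonglongrightarrow> f 0 * of_real (exp (- y\<^sup>2 / 2))"
      by (intro AE_I2 tendsto_mult tendsto_const)
    show "AE y in lborel. norm (f (sqrt (e k) * y) * of_real (exp (- y\<^sup>2 / 2))) \<le> B * exp (- y\<^sup>2 / 2)" for k
      using B by (auto intro!: AE_I2 mult_right_mono simp: norm_mult)
  qed auto
  have "(LINT y|lborel. f 0 * of_real (exp (- y\<^sup>2 / 2))) = f 0 * of_real (sqrt (2 * pi))"
  proof -
    have "(LINT y|lborel. f 0 * complex_of_real (exp (- y\<^sup>2 / 2))) = f 0 * of_real (LINT y|lborel. exp (- y\<^sup>2 / 2))"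
      by (simp only: integral_mult_right_zero integral_complex_of_real)
    also have "(LINT y|lborel. exp (- y\<^sup>2 / 2)) = sqrt (2 * pi)" using gaussian(3)[of 1] by simp
    finally show ?thesis .
  qed
  with lim2 have "(\<lambda>k. of_real (sqrt (2 * pi)) * (LINT y|lborel. f (sqrt (e k) * y) * of_real (exp (- y\<^sup>2 / 2)))) 
      \<longlonglongrightarrow> of_real (sqrt (2 * pi)) * (f 0 * of_real (sqrt (2 * pi)))" by (simp only: tendsto_mult_left)
  then have "(LINT z|lborel. ft f z) = of_real (sqrt (2 * pi)) * (f 0 * of_real (sqrt (2 * pi)))"
    using LIMSEQ_unique[OF lim1] unfolding eq by blast
  also have "\<dots> = of_real (sqrt (2 * pi) * sqrt (2 * pi)) * f 0" by (simp only: of_real_mult mult_ac)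
  also have "sqrt (2 * pi) * sqrt (2 * pi) = 2 * pi" by simp
  finally show ?thesis .
qed

section \<open>The quadratic term\<close>

lemma powr_sq: "(a powr b)\<^sup>2 = a powr (2 * b)" for a b :: real
  by (cases "a = 0") (simp_all add: powr_power mult.commute)

text \<open>The exponent \<open>1/4 - \<epsilon>\<close> is what remains of the derivative once \<open>3/4 + \<epsilon>\<close> of it has been
  moved to \<open>u\<^sup>2\<close>; the weight is then square integrable in time because \<open>\<bar>\<zeta>\<bar>\<^bsup>1/2 - 2\<epsilon>\<^esup> / p(\<zeta>)\<close> is
  integrable at infinity.\<close>

definition weight :: "real \<Rightarrow> real \<Rightarrow> real \<Rightarrow> real" where
  "weight \<epsilon> \<tau> \<zeta> = \<bar>\<zeta>\<bar> powr (1/4 - \<epsilon>) * exp (- (\<tau> * psym \<zeta>))"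

lemma weight_measurable [measurable]: "(\<lambda>(\<tau>, \<zeta>). weight \<epsilon> \<tau> \<zeta>) \<in> borel_measurable (borel \<Otimes>\<^sub>M borel)"
  unfolding weight_def by measurable

text \<open>The bound T serves low frequencies, where p may vanish, and the bound 1 / c serves high
  ones.\<close>

lemma nn_integral_exp_interval:
  assumes c: "0 \<le> c" and T: "0 \<le> T"
  shows "(\<integral>\<^sup>+\<tau>. ennreal (exp (- (c * \<tau>))) * indicator {0..T} \<tau> \<partial>lborel) \<le> ennreal T"
    and "0 < c \<Longrightarrow> (\<integral>\<^sup>+\<tau>. ennreal (exp (- (c * \<tau>))) * indicator {0..T} \<tau> \<partial>lborel) \<le> ennreal (1 / c)"
proof -
  have "(\<integral>\<^sup>+\<tau>. ennreal (exp (- (c * \<tau>))) * indicator {0..T} \<tau> \<partial>lborel) \<le> (\<integral>\<^sup>+\<tau>. indicator {0..T} \<tau> \<partial>lborel)"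
    using c by (intro nn_integral_mono) (auto simp: indicator_def ennreal_le_1)
  also have "\<dots> = ennreal T" using T by simp
  finally show "(\<integral>\<^sup>+\<tau>. ennreal (exp (- (c * \<tau>))) * indicator {0..T} \<tau> \<partial>lborel) \<le> ennreal T" .
  show "(\<integral>\<^sup>+\<tau>. ennreal (exp (- (c * \<tau>))) * indicator {0..T} \<tau> \<partial>lborel) \<le> ennreal (1 / c)" if c: "0 < c"
  proof -
    have "(\<integral>\<^sup>+\<tau>. ennreal (exp (- (c * \<tau>))) * indicator {0..T} \<tau> \<partial>lborel) 
       = ennreal (- exp (- (c * T)) / c - (- exp (- (c * 0)) / c))"
    proof (rule nn_integral_has_integral_lebesgue')
      have "((\<lambda>\<tau>. - exp (- (c * \<tau>)) / c) has_vector_derivative exp (- (c * \<tau>))) (at \<tau> within {0..T})" for \<tau>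
        using c by (auto intro!: derivative_eq_intros simp: has_real_derivative_iff_has_vector_derivative[symmetric])
      then show "((\<lambda>\<tau>. exp (- (c * \<tau>))) has_integral - exp (- (c * T)) / c - (- exp (- (c * 0)) / c)) {0..T}"
        by (intro fundamental_theorem_of_calculus T)
    qed auto
    also have "\<dots> \<le> ennreal (1 / c)"
      using c by (intro ennreal_leI) (simp add: field_simps)
    finally show ?thesis .
  qed
qed

text \<open>Tonelli integrates in \<tau> first. With p of order \<bar>\<zeta>\<bar>^{3/2} at
  infinity, \<bar>\<zeta>\<bar>^{-1 - 2\<epsilon>} remains, integrable there because \<epsilon> > 0;
  and \<epsilon> < 1/4 keeps the weight bounded near 0.\<close>

lemma weight_integral_bound:
  assumes \<epsilon>: "0 < \<epsilon>" "\<epsilon> < 1/4" and T: "0 < T"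
  obtains C where "0 \<le> C"
    "(\<integral>\<^sup>+\<tau>. (\<integral>\<^sup>+\<zeta>. ennreal ((weight \<epsilon> \<tau> \<zeta>)\<^sup>2) \<partial>lborel) * indicator {0..T} \<tau> \<partial>lborel) \<le> ennreal C"
proof -
  define q where "q = 1/2 - 2 * \<epsilon>"
  have q: "0 < q" using \<epsilon> by (simp add: q_def)
  have sq: "(weight \<epsilon> \<tau> \<zeta>)\<^sup>2 = \<bar>\<zeta>\<bar> powr q * exp (- (2 * psym \<zeta> * \<tau>))" for \<tau> \<zeta>
    by (simp add: weight_def power_mult_distrib powr_sq q_def algebra_simps exp_double[symmetric])
  \<comment> \<open>One majorant for both regimes: as 2^{1 + 2\<epsilon>} \<le> 4, it dominates 1
    for \<bar>\<zeta>\<bar> \<le> 1 and the power \<bar>\<zeta>\<bar>^{-1 - 2\<epsilon>} beyond; the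
    factor T + 1 covers both T and 1.\<close>
  let ?g = "\<lambda>\<zeta>::real. (T + 1) * (4 * (1 + \<bar>\<zeta>\<bar>) powr (- (1 + 2 * \<epsilon>)))"
  have g: "integrable lborel ?g"
    by (intro integrable_mult_right integrable_one_plus_abs_powr) (use \<epsilon> in simp)
  have pw: "ennreal (\<bar>\<zeta>\<bar> powr q) * (\<integral>\<^sup>+\<tau>. ennreal (exp (- (2 * psym \<zeta> * \<tau>))) * indicator {0..T} \<tau> \<partial>lborel) \<le> ennreal (?g \<zeta>)" for \<zeta>
  proof -
    have two: "1 \<le> 4 * (1 + \<bar>\<zeta>\<bar>) powr (- (1 + 2 * \<epsilon>))" if "\<bar>\<zeta>\<bar> \<le> 1"
    proof -
      have "(1 + \<bar>\<zeta>\<bar>) powr (1 + 2 * \<epsilon>) \<le> 2 powr (1 + 2 * \<epsilon>)" using that \<epsilon> by (intro powr_mono2) auto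
      also have "\<dots> \<le> 2 powr 2" using \<epsilon> by (intro powr_mono) auto
      also have "\<dots> = 4" by simp
      finally have "(1 + \<bar>\<zeta>\<bar>) powr (1 + 2 * \<epsilon>) \<le> 4" .
      moreover have "0 < (1 + \<bar>\<zeta>\<bar>) powr (1 + 2 * \<epsilon>)" by (simp add: add_pos_nonneg)
      ultimately show ?thesis unfolding powr_minus by (simp add: field_simps)
    qed
    show ?thesis
    proof (cases "\<bar>\<zeta>\<bar> \<le> 1")
      case True
      have "\<bar>\<zeta>\<bar> powr q \<le> 1" using powr_mono2[of q "\<bar>\<zeta>\<bar>" 1] True q by simp
      then have "ennreal (\<bar>\<zeta>\<bar> powr q) * (\<integral>\<^sup>+\<tau>. ennreal (exp (- (2 * psym \<zeta> * \<tau>))) * indicator {0..T} \<tau> \<partial>lborel) \<le> ennreal 1 * ennreal T"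
        using psym_nonneg[of \<zeta>] T by (intro mult_mono nn_integral_exp_interval ennreal_leI) auto
      also have "\<dots> = ennreal (T * 1)" using T by simp
      also have "\<dots> \<le> ennreal ((T + 1) * (4 * (1 + \<bar>\<zeta>\<bar>) powr (- (1 + 2 * \<epsilon>))))"
        using two[OF True] T by (intro ennreal_leI mult_mono) auto
      finally show ?thesis .
    next
      case False
      define z where "z = \<bar>\<zeta>\<bar>"
      have z: "1 < z" using False by (simp add: z_def)
      have p: "0 < psym \<zeta>" using z by (intro psym_pos) (auto simp: z_def)
      have "z powr (3/2) \<le> 2 * psym \<zeta>"
      proof (rule power2_le_imp_le)
        have "(z powr (3/2))\<^sup>2 = z ^ 3" using z by (simp add: powr_sq powr_numeral)
        also have "\<dots> \<le> 2 * (psym \<zeta>)\<^sup>2" using psym_lower[of \<zeta>] by (simp add: z_def)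
        also have "\<dots> \<le> (2 * psym \<zeta>)\<^sup>2" by (simp add: power_mult_distrib)
        finally show "(z powr (3/2))\<^sup>2 \<le> (2 * psym \<zeta>)\<^sup>2" .
      qed (use p in simp)
      then have inv: "1 / (2 * psym \<zeta>) \<le> z powr (- (3/2))"
        using z p by (simp add: powr_minus field_simps)
      have "ennreal (\<bar>\<zeta>\<bar> powr q) * (\<integral>\<^sup>+\<tau>. ennreal (exp (- (2 * psym \<zeta> * \<tau>))) * indicator {0..T} \<tau> \<partial>lborel) 
          \<le> ennreal (z powr q) * ennreal (1 / (2 * psym \<zeta>))"
        unfolding z_def using p T by (intro mult_left_mono nn_integral_exp_interval(2)) auto
      also have "\<dots> = ennreal (z powr q * (1 / (2 * psym \<zeta>)))" using p by (simp add: ennreal_mult[symmetric])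
      also have "\<dots> \<le> ennreal ((T + 1) * (4 * (1 + z) powr (- (1 + 2 * \<epsilon>))))"
      proof (rule ennreal_leI)
        have "z powr q * (1 / (2 * psym \<zeta>)) \<le> z powr q * z powr (- (3/2))" by (intro mult_left_mono inv) simp
        also have "\<dots> = z powr (- (1 + 2 * \<epsilon>))" by (simp add: powr_add[symmetric] q_def)
        also have "\<dots> \<le> 4 * (1 + z) powr (- (1 + 2 * \<epsilon>))"
        proof -
          have "(1 + z) powr (1 + 2 * \<epsilon>) \<le> (2 * z) powr (1 + 2 * \<epsilon>)" using z \<epsilon> by (intro powr_mono2) auto
          also have "\<dots> = 2 powr (1 + 2 * \<epsilon>) * z powr (1 + 2 * \<epsilon>)" using z by (simp add: powr_mult)
          also have "\<dots> \<le> 2 powr 2 * z powr (1 + 2 * \<epsilon>)" using \<epsilon> by (intro mult_right_mono powr_mono) auto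
          finally have "(1 + z) powr (1 + 2 * \<epsilon>) \<le> 4 * z powr (1 + 2 * \<epsilon>)" by simp
          moreover have "0 < z powr (1 + 2 * \<epsilon>)" "0 < (1 + z) powr (1 + 2 * \<epsilon>)" using z by auto
          ultimately show ?thesis unfolding powr_minus by (simp add: field_simps)
        qed
        also have "\<dots> \<le> (T + 1) * (4 * (1 + z) powr (- (1 + 2 * \<epsilon>)))" using T by (simp add: algebra_simps)
        finally show "z powr q * (1 / (2 * psym \<zeta>)) \<le> (T + 1) * (4 * (1 + z) powr (- (1 + 2 * \<epsilon>)))" .
      qed
      finally show ?thesis unfolding z_def .
    qed
  qed
  have "(\<integral>\<^sup>+\<tau>. (\<integral>\<^sup>+\<zeta>. ennreal ((weight \<epsilon> \<tau> \<zeta>)\<^sup>2) \<partial>lborel) * indicator {0..T} \<tau> \<partial>lborel)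
      = (\<integral>\<^sup>+\<tau>. \<integral>\<^sup>+\<zeta>. ennreal ((weight \<epsilon> \<tau> \<zeta>)\<^sup>2) * indicator {0..T} \<tau> \<partial>lborel \<partial>lborel)"
    by (intro nn_integral_cong) (simp add: nn_integral_multc)
  also have "\<dots> = (\<integral>\<^sup>+\<zeta>. \<integral>\<^sup>+\<tau>. ennreal ((weight \<epsilon> \<tau> \<zeta>)\<^sup>2) * indicator {0..T} \<tau> \<partial>lborel \<partial>lborel)"
    by (rule lborel_pair.Fubini') measurable
  also have "\<dots> = (\<integral>\<^sup>+\<zeta>. ennreal (\<bar>\<zeta>\<bar> powr q) * (\<integral>\<^sup>+\<tau>. ennreal (exp (- (2 * psym \<zeta> * \<tau>))) * indicator {0..T} \<tau> \<partial>lborel) \<partial>lborel)"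
    unfolding sq by (intro nn_integral_cong, subst nn_integral_cmult[symmetric]) (auto simp: ennreal_mult mult.assoc)
  also have "\<dots> \<le> (\<integral>\<^sup>+\<zeta>. ennreal (?g \<zeta>) \<partial>lborel)"
    by (intro nn_integral_mono pw)
  also have "\<dots> = ennreal (LINT \<zeta>|lborel. ?g \<zeta>)"
    by (rule nn_integral_eq_integral[OF g]) (use T in simp)
  finally show thesis by (intro that[of "LINT \<zeta>|lborel. ?g \<zeta>"]) (use T in auto)
qed

section \<open>Sobolev weights and convolutions\<close>

lemma nn_integral_Cauchy_Schwarz:
  fixes a b :: "'a \<Rightarrow> real"
  assumes [measurable]: "a \<in> borel_measurable M" "b \<in> borel_measurable M"
    and a: "integrable M (\<lambda>x. (a x)\<^sup>2)" and b: "integrable M (\<lambda>x. (b x)\<^sup>2)"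
    and nn: "\<And>x. 0 \<le> a x" "\<And>x. 0 \<le> b x"
  shows "(\<integral>\<^sup>+x. ennreal (a x * b x) \<partial>M) \<le> ennreal (sqrt (LINT x|M. (a x)\<^sup>2) * sqrt (LINT x|M. (b x)\<^sup>2))"
proof -
  have "(\<integral>\<^sup>+x. ennreal (a x * b x) \<partial>M) = ennreal (LINT x|M. a x * b x)"
    by (rule nn_integral_eq_integral) (use Cauchy_Schwarz_integral_real(1)[OF _ _ a b] nn in auto)
  also have "\<dots> \<le> ennreal (sqrt ((LINT x|M. (a x)\<^sup>2) * (LINT x|M. (b x)\<^sup>2)))"
    by (intro ennreal_leI real_le_rsqrt Cauchy_Schwarz_integral_real(2)[OF _ _ a b]) auto
  finally show ?thesis by (simp add: real_sqrt_mult)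
qed

text \<open>The fractional Leibniz rule at the level of symbols: \<bar>\<xi> - \<eta>\<bar> is at
  most twice the larger of \<bar>\<xi>\<bar> and \<bar>\<eta>\<bar>, so s derivatives of a product
  fall on one factor at a time. With s \<le> 1 the constant 2^s is at most 2.\<close>

lemma bracket_bound:
  fixes \<xi> \<eta> s :: real
  assumes "0 \<le> s" "s \<le> 1"
  shows "\<bar>\<xi> - \<eta>\<bar> powr s \<le> 2 * ((1 + \<xi>\<^sup>2) powr (s / 2) + (1 + \<eta>\<^sup>2) powr (s / 2))"
proof -
  define m where "m = max \<bar>\<xi>\<bar> \<bar>\<eta>\<bar>"
  have abs_le: "\<bar>x\<bar> powr s \<le> (1 + x\<^sup>2) powr (s / 2)" for x :: real
  proof -
    have "\<bar>x\<bar> powr s = (\<bar>x\<bar> powr 2) powr (s / 2)" by (subst powr_powr) simp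
    also have "\<bar>x\<bar> powr 2 = x\<^sup>2" by (cases "x = 0") (simp_all add: powr_numeral)
    also have "(x\<^sup>2) powr (s / 2) \<le> (1 + x\<^sup>2) powr (s / 2)" using assms by (intro powr_mono2) auto
    finally show ?thesis .
  qed
  have "\<bar>\<xi> - \<eta>\<bar> powr s \<le> (2 * m) powr s" using assms by (intro powr_mono2) (auto simp: m_def)
  also have "\<dots> = 2 powr s * m powr s" by (simp add: powr_mult m_def)
  also have "\<dots> \<le> 2 powr 1 * m powr s" using assms by (intro mult_right_mono powr_mono) auto
  also have "m powr s \<le> \<bar>\<xi>\<bar> powr s + \<bar>\<eta>\<bar> powr s" by (auto simp: m_def max_def)
  also have "\<dots> \<le> (1 + \<xi>\<^sup>2) powr (s / 2) + (1 + \<eta>\<^sup>2) powr (s / 2)" by (intro add_mono abs_le)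
  finally show ?thesis by simp
qed

text \<open>Cauchy-Schwarz against (1 + \<xi>^2)^{-3/8}, whose square decays like
  \<bar>\<xi>\<bar>^{-3/2} and is integrable. For s \<ge> 3/4 the weight of order s compensates this
  factor, so one constant serves every s.\<close>

lemma L1_le_sobolev:
  obtains c where "0 \<le> c"
    "\<And>F s. F \<in> borel_measurable borel \<Longrightarrow> 3/4 \<le> s \<Longrightarrow>
       integrable lborel (\<lambda>\<xi>. ((1 + \<xi>\<^sup>2) powr (s / 2) * norm (F \<xi> :: complex))\<^sup>2) \<Longrightarrow>
       integrable lborel F \<and>
       (LINT \<xi>|lborel. norm (F \<xi>)) \<le> c * sqrt (LINT \<xi>|lborel. ((1 + \<xi>\<^sup>2) powr (s / 2) * norm (F \<xi>))\<^sup>2)"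
proof -
  let ?w = "\<lambda>\<xi>::real. (1 + \<xi>\<^sup>2) powr (- (3 / 8))"
  have w2: "integrable lborel (\<lambda>\<xi>. (?w \<xi>)\<^sup>2)"
  proof (rule Bochner_Integration.integrable_bound)
    show "integrable lborel (\<lambda>\<xi>::real. 2 * (1 + \<bar>\<xi>\<bar>) powr (- (3/2)))"
      by (intro integrable_mult_right integrable_one_plus_abs_powr) simp
    have "(?w \<xi>)\<^sup>2 \<le> 2 * (1 + \<bar>\<xi>\<bar>) powr (- (3/2))" for \<xi> :: real
    proof -
      have "(1 + \<bar>\<xi>\<bar>)\<^sup>2 \<le> 2 * (1 + \<xi>\<^sup>2)"
        using sum_squares_bound[of 1 "\<bar>\<xi>\<bar>"] by (simp add: power2_eq_square algebra_simps)
      then have "((1 + \<bar>\<xi>\<bar>)\<^sup>2) powr (3/4) \<le> (2 * (1 + \<xi>\<^sup>2)) powr (3/4)" by (intro powr_mono2) auto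
      also have "\<dots> = 2 powr (3/4) * (1 + \<xi>\<^sup>2) powr (3/4)" by (rule powr_mult)
      also have "\<dots> \<le> 2 powr 1 * (1 + \<xi>\<^sup>2) powr (3/4)" by (intro mult_right_mono powr_mono) auto
      finally have "((1 + \<bar>\<xi>\<bar>)\<^sup>2) powr (3/4) \<le> 2 * (1 + \<xi>\<^sup>2) powr (3/4)" by simp
      moreover have "((1 + \<bar>\<xi>\<bar>)\<^sup>2) powr (3/4) = (1 + \<bar>\<xi>\<bar>) powr (3/2)"
      proof -
        have p2: "(1 + \<bar>\<xi>\<bar>)\<^sup>2 = (1 + \<bar>\<xi>\<bar>) powr 2" by (simp add: add_pos_nonneg)
        show ?thesis unfolding p2 powr_powr by simp
      qed
      moreover have "(?w \<xi>)\<^sup>2 = (1 + \<xi>\<^sup>2) powr (- (3/4))" by (simp add: powr_sq)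
      moreover have "0 < (1 + \<xi>\<^sup>2) powr (3/4)" "0 < (1 + \<bar>\<xi>\<bar>) powr (3/2)"
        by (simp_all add: add_pos_nonneg) (metis add_pos_nonneg less_irrefl zero_le_power2 zero_less_one)
      ultimately show ?thesis by (simp add: powr_minus field_simps)
    qed
    then show "AE \<xi> in lborel. norm ((?w \<xi>)\<^sup>2) \<le> norm (2 * (1 + \<bar>\<xi>\<bar>) powr (- (3/2)))" by simp
  qed simp
  define c where "c = sqrt (LINT \<xi>|lborel. (?w \<xi>)\<^sup>2)"
  have "0 \<le> c" by (simp add: c_def)
  moreover have "integrable lborel F \<and>
       (LINT \<xi>|lborel. norm (F \<xi>)) \<le> c * sqrt (LINT \<xi>|lborel. ((1 + \<xi>\<^sup>2) powr (s / 2) * norm (F \<xi>))\<^sup>2)"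
    if [measurable]: "F \<in> borel_measurable borel" and s: "3/4 \<le> s"
      and F: "integrable lborel (\<lambda>\<xi>. ((1 + \<xi>\<^sup>2) powr (s / 2) * norm (F \<xi> :: complex))\<^sup>2)" for F s
  proof -
    have i: "integrable lborel (\<lambda>\<xi>. ?w \<xi> * ((1 + \<xi>\<^sup>2) powr (s / 2) * norm (F \<xi>)))"
      and le: "(LINT \<xi>|lborel. ?w \<xi> * ((1 + \<xi>\<^sup>2) powr (s / 2) * norm (F \<xi>)))\<^sup>2 
        \<le> (LINT \<xi>|lborel. (?w \<xi>)\<^sup>2) * (LINT \<xi>|lborel. ((1 + \<xi>\<^sup>2) powr (s / 2) * norm (F \<xi>))\<^sup>2)"
      by (rule Cauchy_Schwarz_integral_real[OF _ _ w2 F]; simp)+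
    have pw: "norm (F \<xi>) \<le> ?w \<xi> * ((1 + \<xi>\<^sup>2) powr (s / 2) * norm (F \<xi>))" for \<xi>
    proof -
      have "1 \<le> (1 + \<xi>\<^sup>2) powr (- (3/8) + s / 2)" using s by (intro ge_one_powr_ge_zero) auto
      then have "1 * norm (F \<xi>) \<le> (1 + \<xi>\<^sup>2) powr (- (3/8) + s / 2) * norm (F \<xi>)" by (rule mult_right_mono) simp
      then show ?thesis by (simp only: powr_add mult_1 mult.assoc)
    qed
    have F1: "integrable lborel F"
      by (rule Bochner_Integration.integrable_bound[OF i]) (use pw in \<open>auto intro!: AE_I2 order_trans[OF _ abs_ge_self]\<close>)
    have "(LINT \<xi>|lborel. norm (F \<xi>)) \<le> (LINT \<xi>|lborel. ?w \<xi> * ((1 + \<xi>\<^sup>2) powr (s / 2) * norm (F \<xi>)))"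
      using F1 pw by (intro integral_mono i) auto
    also have "\<dots> \<le> sqrt ((LINT \<xi>|lborel. (?w \<xi>)\<^sup>2) * (LINT \<xi>|lborel. ((1 + \<xi>\<^sup>2) powr (s / 2) * norm (F \<xi>))\<^sup>2))"
      by (rule real_le_rsqrt[OF le])
    finally show ?thesis using F1 by (simp add: c_def real_sqrt_mult)
  qed
  ultimately show thesis by (rule that)
qed

definition conv :: "(real \<Rightarrow> complex) \<Rightarrow> (real \<Rightarrow> complex) \<Rightarrow> real \<Rightarrow> complex" where
  "conv F G \<xi> = (LINT \<eta>|lborel. F \<eta> * G (\<xi> - \<eta>))"

lemma conv_measurable [measurable]:
  assumes [measurable]: "F \<in> borel_measurable borel" "G \<in> borel_measurable borel"
  shows "conv F G \<in> borel_measurable borel"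
  unfolding conv_def[abs_def] by measurable

lemma conv_product_integrable:
  fixes F G :: "real \<Rightarrow> complex"
  assumes F: "integrable lborel F" and G: "integrable lborel G"
  shows "integrable (lborel \<Otimes>\<^sub>M lborel) (\<lambda>(\<eta>, \<xi>). F \<eta> * G (\<xi> - \<eta>))"
proof (rule lborel_pair.Fubini_integrable)
  note [measurable] = borel_measurable_integrable[OF F] borel_measurable_integrable[OF G]
  have sh: "integrable lborel (\<lambda>\<xi>. G (\<xi> - \<eta>))" for \<eta>
    using lborel_integrable_real_affine[OF G, of 1 "- \<eta>"] by simp
  have sh2: "(LINT \<xi>|lborel. norm (G (\<xi> - \<eta>))) = (LINT \<xi>|lborel. norm (G \<xi>))" for \<eta>
    using lborel_integral_real_affine[of 1 "\<lambda>\<xi>. norm (G (\<xi> - \<eta>))" \<eta>] by simp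
  show "(\<lambda>(\<eta>, \<xi>). F \<eta> * G (\<xi> - \<eta>)) \<in> borel_measurable (lborel \<Otimes>\<^sub>M lborel)" by measurable
  have "integrable lborel (\<lambda>\<eta>. norm (F \<eta>) * (LINT \<xi>|lborel. norm (G \<xi>)))" using F by simp
  then show "integrable lborel (\<lambda>\<eta>. LINT \<xi>|lborel. norm (case (\<eta>, \<xi>) of (\<eta>, \<xi>) \<Rightarrow> F \<eta> * G (\<xi> - \<eta>)))"
    by (simp add: norm_mult sh2)
  show "AE \<eta> in lborel. integrable lborel (\<lambda>\<xi>. case (\<eta>, \<xi>) of (\<eta>, \<xi>) \<Rightarrow> F \<eta> * G (\<xi> - \<eta>))"
    using sh by auto
qed

lemma conv_integrable:
  assumes F: "integrable lborel F" and G: "integrable lborel G"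
  shows "integrable lborel (conv F G)"
  using lborel_pair.integrable_snd[OF conv_product_integrable[OF assms]]
  by (simp add: conv_def[abs_def])

lemma ft_conv:
  assumes F: "integrable lborel F" and G: "integrable lborel G"
  shows "ft (conv F G) x = ft F x * ft G x"
proof -
  note [measurable] = borel_measurable_integrable[OF F] borel_measurable_integrable[OF G]
  have cF: "integrable lborel (\<lambda>\<eta>. cis (x * \<eta>) * F \<eta>)" and cG: "integrable lborel (\<lambda>\<eta>. cis (x * \<eta>) * G \<eta>)"
    by (rule integrable_cis_mult[OF F], rule integrable_cis_mult[OF G])
  have eq: "cis (x * \<xi>) * (F \<eta> * G (\<xi> - \<eta>)) = (cis (x * \<eta>) * F \<eta>) * (cis (x * (\<xi> - \<eta>)) * G (\<xi> - \<eta>))" for \<xi> \<eta>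
  proof -
    have "cis (x * \<xi>) = cis (x * \<eta>) * cis (x * (\<xi> - \<eta>))" by (simp add: cis_mult algebra_simps)
    then show ?thesis by (simp add: mult_ac)
  qed
  have "ft (conv F G) x = (LINT \<xi>|lborel. LINT \<eta>|lborel. cis (x * \<xi>) * (F \<eta> * G (\<xi> - \<eta>)))"
    unfolding ft_def conv_def by simp
  also have "\<dots> = (LINT \<xi>|lborel. LINT \<eta>|lborel. (cis (x * \<eta>) * F \<eta>) * (cis (x * (\<xi> - \<eta>)) * G (\<xi> - \<eta>)))"
    unfolding eq ..
  also have "\<dots> = (LINT \<eta>|lborel. LINT \<xi>|lborel. (cis (x * \<eta>) * F \<eta>) * (cis (x * (\<xi> - \<eta>)) * G (\<xi> - \<eta>)))"
    by (rule lborel_pair.Fubini_integral) (rule conv_product_integrable[OF cF cG])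
  also have "\<dots> = (LINT \<eta>|lborel. (cis (x * \<eta>) * F \<eta>) * ft G x)"
  proof -
    have "(LINT \<xi>|lborel. cis (x * (\<xi> - \<eta>)) * G (\<xi> - \<eta>)) = ft G x" for \<eta>
      unfolding ft_def using lborel_integral_real_affine[of 1 "\<lambda>\<xi>. cis (x * (\<xi> - \<eta>)) * G (\<xi> - \<eta>)" \<eta>] by simp
    then show ?thesis by simp
  qed
  also have "\<dots> = ft F x * ft G x" unfolding ft_def by simp
  finally show ?thesis .
qed

text \<open>The convolution is bounded as well as integrable, hence square integrable;
  \<open>L2_fourier_duality\<close> asks for both kinds of integrability.\<close>

lemma conv_L2:
  assumes F: "integrable lborel F" and G: "integrable lborel G" and B: "\<And>x. norm (G x) \<le> B"
  shows "integrable lborel (\<lambda>x. (norm (conv F G x))\<^sup>2)"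
proof (rule Bochner_Integration.integrable_bound)
  note [measurable] = borel_measurable_integrable[OF F] borel_measurable_integrable[OF G]
  let ?C = "B * (LINT \<eta>|lborel. norm (F \<eta>))"
  show "integrable lborel (\<lambda>x. ?C * norm (conv F G x))" using conv_integrable[OF F G] by simp
  have le: "norm (conv F G x) \<le> ?C" for x
  proof -
    have i: "integrable lborel (\<lambda>\<eta>. F \<eta> * G (x - \<eta>))"
      by (rule Bochner_Integration.integrable_bound[of _ "\<lambda>\<eta>. B * norm (F \<eta>)"])
         (use F B in \<open>auto intro!: AE_I2 order_trans[OF _ abs_ge_self] mult_left_mono simp: norm_mult mult.commute[of B]\<close>)
    have "norm (conv F G x) \<le> (LINT \<eta>|lborel. norm (F \<eta> * G (x - \<eta>)))"
      unfolding conv_def by (rule integral_norm_bound)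
    also have "\<dots> \<le> (LINT \<eta>|lborel. B * norm (F \<eta>))"
    proof (rule integral_mono[OF integrable_norm[OF i]])
      show "integrable lborel (\<lambda>\<eta>. B * norm (F \<eta>))" using F by simp
      show "norm (F \<eta> * G (x - \<eta>)) \<le> B * norm (F \<eta>)" for \<eta>
        unfolding norm_mult mult.commute[of B] by (intro mult_left_mono B) simp
    qed
    finally show ?thesis by simp
  qed
  have "(norm (conv F G x))\<^sup>2 \<le> ?C * norm (conv F G x)" for x
    unfolding power2_eq_square by (intro mult_right_mono le) simp
  from order_trans[OF this abs_ge_self]
  show "AE x in lborel. norm ((norm (conv F G x))\<^sup>2) \<le> norm (?C * norm (conv F G x))"
    by (intro AE_I2) (simp only: real_norm_def abs_power2)
qed (use F G in measurable)

lemma nn_integral_iterated_lincomb: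
  fixes P Q :: "real \<Rightarrow> real \<Rightarrow> ennreal"
  assumes [measurable]: "(\<lambda>(x, y). P x y) \<in> borel_measurable (lborel \<Otimes>\<^sub>M lborel)"
    "(\<lambda>(x, y). Q x y) \<in> borel_measurable (lborel \<Otimes>\<^sub>M lborel)"
  shows "(\<integral>\<^sup>+x. \<integral>\<^sup>+y. c * P x y + d * Q x y \<partial>lborel \<partial>lborel) =
    c * (\<integral>\<^sup>+x. \<integral>\<^sup>+y. P x y \<partial>lborel \<partial>lborel) + d * (\<integral>\<^sup>+x. \<integral>\<^sup>+y. Q x y \<partial>lborel \<partial>lborel)"
proof -
  have m: "P x \<in> borel_measurable lborel" "Q x \<in> borel_measurable lborel" for x
    by measurable
  have M: "(\<lambda>x. \<integral>\<^sup>+y. P x y \<partial>lborel) \<in> borel_measurable lborel" "(\<lambda>x. \<integral>\<^sup>+y. Q x y \<partial>lborel) \<in> borel_measurable lborel"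
    by measurable
  have "(\<integral>\<^sup>+y. c * P x y + d * Q x y \<partial>lborel) = c * (\<integral>\<^sup>+y. P x y \<partial>lborel) + d * (\<integral>\<^sup>+y. Q x y \<partial>lborel)" for x
    by (subst nn_integral_add) (auto simp: nn_integral_cmult m)
  then show ?thesis
    by (simp only:) (subst nn_integral_add, auto simp: nn_integral_cmult M)
qed

text \<open>One factor f is replaced by \<open>ft F\<close> / (2 pi), so that f^2 times
  \<open>ft G\<close> becomes f times the transform of the convolution of F and G; duality then
  yields the double integral of F(-\<xi>) F(\<eta>) G(\<xi> - \<eta>). In the bound for G, the power
  3/4 + \<epsilon> of \<bar>\<xi> - \<eta>\<bar> goes to F(-\<xi>) or to F(\<eta>), and the rest
  forms \<open>weight\<close>. In either term one F is measured in \<open>L\<^sup>1\<close>, while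
  the other, weighted one and \<open>weight\<close> are measured in
  \<open>L\<^sup>2\<close>.\<close>

lemma quadratic_form_bound:
  assumes \<epsilon>: "0 < \<epsilon>" "\<epsilon> < 1/4"
  obtains C where "0 \<le> C"
    "\<And>(f :: real \<Rightarrow> real) F G \<tau>. f \<in> borel_measurable borel \<Longrightarrow> F \<in> borel_measurable borel \<Longrightarrow>
      L2_fourier (\<lambda>x. of_real (f x)) F \<Longrightarrow>
      integrable lborel (\<lambda>\<xi>. ((1 + \<xi>\<^sup>2) powr ((3/4 + \<epsilon>) / 2) * norm (F \<xi>))\<^sup>2) \<Longrightarrow>
      integrable lborel G \<Longrightarrow> (\<exists>B. \<forall>\<xi>. norm (G \<xi>) \<le> B) \<Longrightarrow>
      (\<And>\<xi>. norm (G \<xi>) \<le> \<bar>\<xi>\<bar> * exp (- (\<tau> * psym \<xi>))) \<Longrightarrow>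
      integrable lborel (\<lambda>\<zeta>. (weight \<epsilon> \<tau> \<zeta>)\<^sup>2) \<Longrightarrow>
      norm (LINT x|lborel. of_real ((f x)\<^sup>2) * ft G x) \<le>
        C * (LINT \<xi>|lborel. ((1 + \<xi>\<^sup>2) powr ((3/4 + \<epsilon>) / 2) * norm (F \<xi>))\<^sup>2) * sqrt (LINT \<zeta>|lborel. (weight \<epsilon> \<tau> \<zeta>)\<^sup>2)"
proof -
  obtain c where c: "0 \<le> c" and L1: "\<And>F s. F \<in> borel_measurable borel \<Longrightarrow> 3/4 \<le> s \<Longrightarrow>
       integrable lborel (\<lambda>\<xi>. ((1 + \<xi>\<^sup>2) powr (s / 2) * norm (F \<xi> :: complex))\<^sup>2) \<Longrightarrow>
       integrable lborel F \<and>
       (LINT \<xi>|lborel. norm (F \<xi>)) \<le> c * sqrt (LINT \<xi>|lborel. ((1 + \<xi>\<^sup>2) powr (s / 2) * norm (F \<xi>))\<^sup>2)"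
    by (rule L1_le_sobolev) (rule that; assumption)
  define s where "s = 3/4 + \<epsilon>"
  have s: "3/4 \<le> s" "0 \<le> s" "s \<le> 1" using \<epsilon> by (auto simp: s_def)
  \<comment> \<open>The 2 of \<open>bracket_bound\<close> for each of two terms, the constant c of
    the \<open>L\<^sup>1\<close> bound, and 1 / (2 pi) from inversion.\<close>
  define C where "C = 4 * c / (2 * pi)"
  have C: "0 \<le> C" using c by (simp add: C_def)
  have main: "norm (LINT x|lborel. of_real ((f x)\<^sup>2) * ft G x) \<le>
        C * (LINT \<xi>|lborel. ((1 + \<xi>\<^sup>2) powr (s / 2) * norm (F \<xi>))\<^sup>2) * sqrt (LINT \<zeta>|lborel. (weight \<epsilon> \<tau> \<zeta>)\<^sup>2)"
    if [measurable]: "f \<in> borel_measurable borel" "F \<in> borel_measurable borel"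
      and LF: "L2_fourier (\<lambda>x. of_real (f x)) F"
      and F2: "integrable lborel (\<lambda>\<xi>. ((1 + \<xi>\<^sup>2) powr (s / 2) * norm (F \<xi>))\<^sup>2)"
      and G: "integrable lborel G" and GB: "\<And>\<xi>. norm (G \<xi>) \<le> B"
      and Gle: "\<And>\<xi>. norm (G \<xi>) \<le> \<bar>\<xi>\<bar> * exp (- (\<tau> * psym \<xi>))"
      and w2: "integrable lborel (\<lambda>\<zeta>. (weight \<epsilon> \<tau> \<zeta>)\<^sup>2)"
    for f :: "real \<Rightarrow> real" and F G :: "real \<Rightarrow> complex" and \<tau> B
  proof -
    note [measurable] = borel_measurable_integrable[OF G]
    define N where "N = sqrt (LINT \<xi>|lborel. ((1 + \<xi>\<^sup>2) powr (s / 2) * norm (F \<xi>))\<^sup>2)"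
    define \<Omega> where "\<Omega> = sqrt (LINT \<zeta>|lborel. (weight \<epsilon> \<tau> \<zeta>)\<^sup>2)"
    define A where "A \<xi> = (1 + \<xi>\<^sup>2) powr (s / 2) * norm (F \<xi>)" for \<xi>
    have N0: "0 \<le> N" and \<Omega>0: "0 \<le> \<Omega>" by (simp_all add: N_def \<Omega>_def)
    have F1: "integrable lborel F" and FN: "(LINT \<xi>|lborel. norm (F \<xi>)) \<le> c * N"
      using L1[OF _ s(1) F2] unfolding N_def by auto
    have [measurable]: "weight \<epsilon> \<tau> \<in> borel_measurable borel"
      unfolding weight_def[abs_def] by measurable
    have [measurable]: "A \<in> borel_measurable borel" unfolding A_def[abs_def] by measurable
    define K where "K = conv F G"
    have [measurable]: "K \<in> borel_measurable borel" unfolding K_def by measurable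
    have inv: "AE x in lborel. of_real (f x) = ft F x / of_real (2 * pi)"
      by (rule fourier_inversion_AE[OF LF _ _ F1]) auto
    have "(LINT x|lborel. of_real ((f x)\<^sup>2) * ft G x) = (LINT x|lborel. of_real (f x) * ft K x / of_real (2 * pi))"
    proof (rule integral_cong_AE)
      show "AE x in lborel. complex_of_real ((f x)\<^sup>2) * ft G x = of_real (f x) * ft K x / of_real (2 * pi)"
        using inv
      proof eventually_elim
        case (elim x)
        have "complex_of_real ((f x)\<^sup>2) * ft G x = of_real (f x) * (of_real (f x) * ft G x)"
          by (simp add: power2_eq_square)
        also have "\<dots> = of_real (f x) * (ft F x / of_real (2 * pi) * ft G x)" unfolding elim ..
        also have "\<dots> = of_real (f x) * ft K x / of_real (2 * pi)"
          unfolding K_def ft_conv[OF F1 G] by simp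
        finally show ?case .
      qed
    qed measurable
    also have "\<dots> = (LINT x|lborel. of_real (f x) * ft K x) / of_real (2 * pi)" by simp
    also have "(LINT x|lborel. of_real (f x) * ft K x) = (LINT \<xi>|lborel. F (- \<xi>) * K \<xi>)"
      unfolding K_def by (rule L2_fourier_duality[OF LF _ _ conv_integrable[OF F1 G] conv_L2[OF F1 G GB]]) auto
    finally have eq: "norm (LINT x|lborel. of_real ((f x)\<^sup>2) * ft G x) = norm (LINT \<xi>|lborel. F (- \<xi>) * K \<xi>) / (2 * pi)"
      by (simp add: norm_divide)
    have shift_w: "integrable lborel (\<lambda>\<xi>. (weight \<epsilon> \<tau> (\<xi> - \<eta>))\<^sup>2)"
        "(LINT \<xi>|lborel. (weight \<epsilon> \<tau> (\<xi> - \<eta>))\<^sup>2) = \<Omega>\<^sup>2" 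
        "integrable lborel (\<lambda>\<eta>. (weight \<epsilon> \<tau> (\<xi> - \<eta>))\<^sup>2)"
        "(LINT \<eta>|lborel. (weight \<epsilon> \<tau> (\<xi> - \<eta>))\<^sup>2) = \<Omega>\<^sup>2" for \<xi> \<eta>
      using lborel_integrable_real_affine[OF w2, of 1 "- \<eta>"] lborel_integrable_real_affine[OF w2, of "-1" \<xi>]
        lborel_integral_real_affine[of 1 "\<lambda>\<xi>. (weight \<epsilon> \<tau> \<xi>)\<^sup>2" "- \<eta>"] lborel_integral_real_affine[of "-1" "\<lambda>\<xi>. (weight \<epsilon> \<tau> \<xi>)\<^sup>2" \<xi>]
      by (simp_all add: \<Omega>_def)
    have A2: "integrable lborel (\<lambda>\<xi>. (A \<xi>)\<^sup>2)" "(LINT \<xi>|lborel. (A \<xi>)\<^sup>2) = N\<^sup>2"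
      using F2 by (simp_all add: A_def N_def)
    have A2m: "integrable lborel (\<lambda>\<xi>. (A (- \<xi>))\<^sup>2)" "(LINT \<xi>|lborel. (A (- \<xi>))\<^sup>2) = N\<^sup>2"
      using lborel_integrable_uminus[OF A2(1)] lborel_integral_uminus[of "\<lambda>\<xi>. (A \<xi>)\<^sup>2"] A2(2) by simp_all
    have A0: "0 \<le> A \<xi>" for \<xi> by (simp add: A_def)
    have W0: "0 \<le> weight \<epsilon> \<tau> \<xi>" for \<xi> by (simp add: weight_def)
    have pw: "norm (F (- \<xi>) * (F \<eta> * G (\<xi> - \<eta>))) 
       \<le> 2 * (norm (F \<eta>) * (A (- \<xi>) * weight \<epsilon> \<tau> (\<xi> - \<eta>))) + 2 * (norm (F (- \<xi>)) * (A \<eta> * weight \<epsilon> \<tau> (\<xi> - \<eta>)))" for \<xi> \<eta>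
    proof -
      have "norm (G (\<xi> - \<eta>)) \<le> \<bar>\<xi> - \<eta>\<bar> * exp (- (\<tau> * psym (\<xi> - \<eta>)))" by (rule Gle)
      also have "\<bar>\<xi> - \<eta>\<bar> = \<bar>\<xi> - \<eta>\<bar> powr s * \<bar>\<xi> - \<eta>\<bar> powr (1/4 - \<epsilon>)"
        by (cases "\<xi> = \<eta>") (auto simp: powr_add[symmetric] s_def)
      also have "\<bar>\<xi> - \<eta>\<bar> powr s * \<bar>\<xi> - \<eta>\<bar> powr (1/4 - \<epsilon>) * exp (- (\<tau> * psym (\<xi> - \<eta>))) = \<bar>\<xi> - \<eta>\<bar> powr s * weight \<epsilon> \<tau> (\<xi> - \<eta>)"
        by (simp add: weight_def)
      also have "\<dots> \<le> 2 * ((1 + \<xi>\<^sup>2) powr (s / 2) + (1 + \<eta>\<^sup>2) powr (s / 2)) * weight \<epsilon> \<tau> (\<xi> - \<eta>)"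
        by (intro mult_right_mono bracket_bound s W0)
      finally have "norm (F (- \<xi>)) * norm (F \<eta>) * norm (G (\<xi> - \<eta>)) \<le> norm (F (- \<xi>)) * norm (F \<eta>) * 
          (2 * ((1 + \<xi>\<^sup>2) powr (s / 2) + (1 + \<eta>\<^sup>2) powr (s / 2)) * weight \<epsilon> \<tau> (\<xi> - \<eta>))"
        by (rule mult_left_mono) simp
      then show ?thesis by (simp add: norm_mult A_def algebra_simps)
    qed
    have F1n: "(\<integral>\<^sup>+\<eta>. ennreal (norm (F \<eta>)) \<partial>lborel) \<le> ennreal (c * N)"
      by (subst nn_integral_eq_integral) (use F1 FN in \<open>auto intro!: ennreal_leI\<close>)
    have F1m: "(\<integral>\<^sup>+\<xi>. ennreal (norm (F (- \<xi>))) \<partial>lborel) \<le> ennreal (c * N)"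
      using F1n nn_integral_real_affine[of "\<lambda>\<eta>. ennreal (norm (F \<eta>))" "-1" 0] by simp
    have t1: "(\<integral>\<^sup>+\<xi>. ennreal (A (- \<xi>) * weight \<epsilon> \<tau> (\<xi> - \<eta>)) \<partial>lborel) \<le> ennreal (N * \<Omega>)" for \<eta>
      using nn_integral_Cauchy_Schwarz[OF _ _ A2m(1) shift_w(1)[of \<eta>]] A0 W0 N0 \<Omega>0
      by (simp add: A2m(2) shift_w(2))
    have t2: "(\<integral>\<^sup>+\<eta>. ennreal (A \<eta> * weight \<epsilon> \<tau> (\<xi> - \<eta>)) \<partial>lborel) \<le> ennreal (N * \<Omega>)" for \<xi>
      using nn_integral_Cauchy_Schwarz[OF _ _ A2(1) shift_w(3)[of \<xi>]] A0 W0 N0 \<Omega>0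
      by (simp add: A2(2) shift_w(4))
    have FK: "integrable lborel (\<lambda>\<xi>. F (- \<xi>) * K \<xi>)"
    proof (rule Cauchy_Schwarz_integral(1))
      show "integrable lborel (\<lambda>\<xi>. (norm (K \<xi>))\<^sup>2)" unfolding K_def by (rule conv_L2[OF F1 G GB])
      have "integrable lborel (\<lambda>\<xi>. (norm (F \<xi>))\<^sup>2)"
        using LF L2_norm_borel(1)[of F] by (simp add: L2_fourier_def)
      then show "integrable lborel (\<lambda>\<xi>. (norm (F (- \<xi>)))\<^sup>2)" by (rule lborel_integrable_uminus)
    qed measurable
    have "ennreal (norm (LINT \<xi>|lborel. F (- \<xi>) * K \<xi>)) \<le> (\<integral>\<^sup>+\<xi>. ennreal (norm (F (- \<xi>) * K \<xi>)) \<partial>lborel)"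
      by (rule integral_norm_bound_ennreal[OF FK])
    also have "\<dots> \<le> (\<integral>\<^sup>+\<xi>. \<integral>\<^sup>+\<eta>. ennreal (norm (F (- \<xi>) * (F \<eta> * G (\<xi> - \<eta>)))) \<partial>lborel \<partial>lborel)"
    proof (rule nn_integral_mono)
      fix \<xi>
      have i: "integrable lborel (\<lambda>\<eta>. F (- \<xi>) * (F \<eta> * G (\<xi> - \<eta>)))"
        by (intro integrable_mult_right, rule Bochner_Integration.integrable_bound[of _ "\<lambda>\<eta>. B * norm (F \<eta>)"])
           (use F1 GB in \<open>auto intro!: AE_I2 order_trans[OF _ abs_ge_self] mult_left_mono simp: norm_mult mult.commute[of B]\<close>)
      have FK_eq: "F (- \<xi>) * K \<xi> = (LINT \<eta>|lborel. F (- \<xi>) * (F \<eta> * G (\<xi> - \<eta>)))" by (simp add: K_def conv_def)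
      show "ennreal (norm (F (- \<xi>) * K \<xi>)) \<le> (\<integral>\<^sup>+\<eta>. ennreal (norm (F (- \<xi>) * (F \<eta> * G (\<xi> - \<eta>)))) \<partial>lborel)"
        unfolding FK_eq by (rule integral_norm_bound_ennreal[OF i])
    qed
    also have "\<dots> \<le> (\<integral>\<^sup>+\<xi>. \<integral>\<^sup>+\<eta>. ennreal 2 * (ennreal (norm (F \<eta>)) * ennreal (A (- \<xi>) * weight \<epsilon> \<tau> (\<xi> - \<eta>)))
         + ennreal 2 * (ennreal (norm (F (- \<xi>))) * ennreal (A \<eta> * weight \<epsilon> \<tau> (\<xi> - \<eta>))) \<partial>lborel \<partial>lborel)"
    proof (intro nn_integral_mono)
      fix \<xi> \<eta>
      have nn: "0 \<le> norm (F \<eta>) * (A (- \<xi>) * weight \<epsilon> \<tau> (\<xi> - \<eta>))" "0 \<le> norm (F (- \<xi>)) * (A \<eta> * weight \<epsilon> \<tau> (\<xi> - \<eta>))"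
        using A0 W0 by (auto intro!: mult_nonneg_nonneg)
      have "ennreal (norm (F (- \<xi>) * (F \<eta> * G (\<xi> - \<eta>)))) \<le> ennreal (2 * (norm (F \<eta>) * (A (- \<xi>) * weight \<epsilon> \<tau> (\<xi> - \<eta>))) 
          + 2 * (norm (F (- \<xi>)) * (A \<eta> * weight \<epsilon> \<tau> (\<xi> - \<eta>))))"
        by (intro ennreal_leI pw)
      also have "\<dots> = ennreal (2 * (norm (F \<eta>) * (A (- \<xi>) * weight \<epsilon> \<tau> (\<xi> - \<eta>)))) + ennreal (2 * (norm (F (- \<xi>)) * (A \<eta> * weight \<epsilon> \<tau> (\<xi> - \<eta>))))"
        using nn by (intro ennreal_plus) auto
      also have "\<dots> = ennreal 2 * (ennreal (norm (F \<eta>)) * ennreal (A (- \<xi>) * weight \<epsilon> \<tau> (\<xi> - \<eta>)))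
         + ennreal 2 * (ennreal (norm (F (- \<xi>))) * ennreal (A \<eta> * weight \<epsilon> \<tau> (\<xi> - \<eta>)))"
        using nn A0 W0 by (simp only: ennreal_mult norm_ge_zero zero_le_numeral mult_nonneg_nonneg)
      finally show "ennreal (norm (F (- \<xi>) * (F \<eta> * G (\<xi> - \<eta>)))) \<le> \<dots>" .
    qed
    also have "\<dots> = ennreal 2 * (\<integral>\<^sup>+\<xi>. \<integral>\<^sup>+\<eta>. (ennreal (norm (F \<eta>)) * ennreal (A (- \<xi>) * weight \<epsilon> \<tau> (\<xi> - \<eta>))) \<partial>lborel \<partial>lborel)
         + ennreal 2 * (\<integral>\<^sup>+\<xi>. \<integral>\<^sup>+\<eta>. (ennreal (norm (F (- \<xi>))) * ennreal (A \<eta> * weight \<epsilon> \<tau> (\<xi> - \<eta>))) \<partial>lborel \<partial>lborel)"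
      by (rule nn_integral_iterated_lincomb) measurable
    \<comment> \<open>The order is exchanged in this term so that Cauchy-Schwarz acts in the
      variable of the weighted factor and the \<open>L\<^sup>1\<close> factor is integrated
      last.\<close>
    also have "(\<integral>\<^sup>+\<xi>. \<integral>\<^sup>+\<eta>. (ennreal (norm (F \<eta>)) * ennreal (A (- \<xi>) * weight \<epsilon> \<tau> (\<xi> - \<eta>))) \<partial>lborel \<partial>lborel)
        = (\<integral>\<^sup>+\<eta>. \<integral>\<^sup>+\<xi>. (ennreal (norm (F \<eta>)) * ennreal (A (- \<xi>) * weight \<epsilon> \<tau> (\<xi> - \<eta>))) \<partial>lborel \<partial>lborel)"
      by (rule lborel_pair.Fubini') measurable
    also have "\<dots> = (\<integral>\<^sup>+\<eta>. ennreal (norm (F \<eta>)) * (\<integral>\<^sup>+\<xi>. ennreal (A (- \<xi>) * weight \<epsilon> \<tau> (\<xi> - \<eta>)) \<partial>lborel) \<partial>lborel)"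
      by (simp add: nn_integral_cmult)
    also have "\<dots> \<le> (\<integral>\<^sup>+\<eta>. ennreal (norm (F \<eta>)) * ennreal (N * \<Omega>) \<partial>lborel)"
      by (intro nn_integral_mono mult_left_mono t1) simp
    also have "\<dots> = (\<integral>\<^sup>+\<eta>. ennreal (norm (F \<eta>)) \<partial>lborel) * ennreal (N * \<Omega>)"
      by (simp add: nn_integral_multc)
    also have "\<dots> \<le> ennreal (c * N) * ennreal (N * \<Omega>)" by (intro mult_right_mono F1n) simp
    also have "(\<integral>\<^sup>+\<xi>. \<integral>\<^sup>+\<eta>. (ennreal (norm (F (- \<xi>))) * ennreal (A \<eta> * weight \<epsilon> \<tau> (\<xi> - \<eta>))) \<partial>lborel \<partial>lborel)
        \<le> ennreal (c * N) * ennreal (N * \<Omega>)"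
    proof -
      have "(\<integral>\<^sup>+\<xi>. \<integral>\<^sup>+\<eta>. (ennreal (norm (F (- \<xi>))) * ennreal (A \<eta> * weight \<epsilon> \<tau> (\<xi> - \<eta>))) \<partial>lborel \<partial>lborel)
        = (\<integral>\<^sup>+\<xi>. ennreal (norm (F (- \<xi>))) * (\<integral>\<^sup>+\<eta>. ennreal (A \<eta> * weight \<epsilon> \<tau> (\<xi> - \<eta>)) \<partial>lborel) \<partial>lborel)"
        by (simp add: nn_integral_cmult)
      also have "\<dots> \<le> (\<integral>\<^sup>+\<xi>. ennreal (norm (F (- \<xi>))) * ennreal (N * \<Omega>) \<partial>lborel)"
        by (intro nn_integral_mono mult_left_mono t2) simp
      also have "\<dots> = (\<integral>\<^sup>+\<xi>. ennreal (norm (F (- \<xi>))) \<partial>lborel) * ennreal (N * \<Omega>)"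
        by (simp add: nn_integral_multc)
      also have "\<dots> \<le> ennreal (c * N) * ennreal (N * \<Omega>)" by (intro mult_right_mono F1m) simp
      finally show ?thesis .
    qed
    finally have "ennreal (norm (LINT \<xi>|lborel. F (- \<xi>) * K \<xi>)) \<le> ennreal 2 * (ennreal (c * N) * ennreal (N * \<Omega>)) + ennreal 2 * (ennreal (c * N) * ennreal (N * \<Omega>))"
      by (simp add: add_mono mult_left_mono)
    also have "\<dots> = ennreal (4 * c * N\<^sup>2 * \<Omega>)"
    proof -
      define w where "w = c * N * (N * \<Omega>)"
      have w: "0 \<le> w" using c N0 \<Omega>0 by (simp add: w_def)
      have v: "ennreal (c * N) * ennreal (N * \<Omega>) = ennreal w"
        unfolding w_def by (rule ennreal_mult[symmetric]) (use c N0 \<Omega>0 in simp_all)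
      have "ennreal 2 * ennreal w = ennreal (2 * w)" by (rule ennreal_mult[symmetric]) (use w in simp_all)
      moreover have "ennreal (2 * w) + ennreal (2 * w) = ennreal (2 * w + 2 * w)"
        by (rule ennreal_plus[symmetric]) (use w in simp_all)
      moreover have "2 * w + 2 * w = 4 * c * N\<^sup>2 * \<Omega>" by (simp add: w_def power2_eq_square)
      ultimately show ?thesis unfolding v by simp
    qed
    finally have "norm (LINT \<xi>|lborel. F (- \<xi>) * K \<xi>) \<le> 4 * c * N\<^sup>2 * \<Omega>"
      using c N0 \<Omega>0 by (subst (asm) ennreal_le_iff) auto
    then have "norm (LINT x|lborel. of_real ((f x)\<^sup>2) * ft G x) \<le> 4 * c * N\<^sup>2 * \<Omega> / (2 * pi)"
      unfolding eq by (rule divide_right_mono) simp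
    also have "4 * c * N\<^sup>2 * \<Omega> / (2 * pi) = C * N\<^sup>2 * \<Omega>" by (simp add: C_def)
    also have "N\<^sup>2 = (LINT \<xi>|lborel. ((1 + \<xi>\<^sup>2) powr (s / 2) * norm (F \<xi>))\<^sup>2)"
      unfolding N_def by (rule real_sqrt_pow2) simp
    finally show ?thesis unfolding \<Omega>_def .
  qed
  show thesis
  proof (rule that[OF C])
    fix f :: "real \<Rightarrow> real" and F G :: "real \<Rightarrow> complex" and \<tau>
    assume a: "f \<in> borel_measurable borel" "F \<in> borel_measurable borel" "L2_fourier (\<lambda>x. of_real (f x)) F"
      "integrable lborel (\<lambda>\<xi>. ((1 + \<xi>\<^sup>2) powr ((3/4 + \<epsilon>) / 2) * norm (F \<xi>))\<^sup>2)" "integrable lborel G"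
      and "\<exists>B. \<forall>\<xi>. norm (G \<xi>) \<le> B"
      and b: "\<And>\<xi>. norm (G \<xi>) \<le> \<bar>\<xi>\<bar> * exp (- (\<tau> * psym \<xi>))" "integrable lborel (\<lambda>\<zeta>. (weight \<epsilon> \<tau> \<zeta>)\<^sup>2)"
    then obtain B where B: "\<And>\<xi>. norm (G \<xi>) \<le> B" by blast
    show "norm (LINT x|lborel. of_real ((f x)\<^sup>2) * ft G x) \<le>
        C * (LINT \<xi>|lborel. ((1 + \<xi>\<^sup>2) powr ((3/4 + \<epsilon>) / 2) * norm (F \<xi>))\<^sup>2) * sqrt (LINT \<zeta>|lborel. (weight \<epsilon> \<tau> \<zeta>)\<^sup>2)"
      by (rule main[unfolded s_def, OF a B b])
  qed
qed

section \<open>Truncated waves\<close>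

lemma bounded_support_facts:
  fixes G :: "real \<Rightarrow> complex"
  assumes [measurable]: "G \<in> borel_measurable borel" and n: "0 < n"
    and B: "\<And>\<xi>. norm (G \<xi>) \<le> B" and supp: "\<And>\<xi>. n < \<bar>\<xi>\<bar> \<Longrightarrow> G \<xi> = 0"
  shows "integrable lborel G" "integrable lborel (\<lambda>\<xi>. (norm (G \<xi>))\<^sup>2)"
    "norm (ft G x) \<le> 2 * n * B"
    "integrable lborel (\<lambda>x. (norm (ft G x))\<^sup>2)"
    "sqrt (LINT x|lborel. (norm (ft G x))\<^sup>2) \<le> sqrt (4 * pi * n) * B"
proof -
  have B0: "0 \<le> B" using norm_ge_zero B by (rule order_trans)
  show G: "integrable lborel G" by (rule integrable_bounded_support[OF _ B supp]) simp
  show G2: "integrable lborel (\<lambda>\<xi>. (norm (G \<xi>))\<^sup>2)"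
    by (rule integrable_bounded_support[of _ "B\<^sup>2" n]) (use B supp in \<open>auto intro!: power_mono\<close>)
  have ii: "integrable lborel (\<lambda>\<xi>::real. c * indicator {-n..n} \<xi> :: real)" for c
    by (intro integrable_mult_right integrable_real_indicator) (auto simp: emeasure_lborel_Icc_eq)
  have iv: "(LINT \<xi>|lborel. c * indicator {-n..n} \<xi>) = 2 * n * (c::real)" for c
    using n by simp
  have "(LINT \<xi>|lborel. norm (G \<xi>)) \<le> (LINT \<xi>|lborel. B * indicator {-n..n} \<xi>)"
    using G by (intro integral_mono ii integrable_norm) (use B supp B0 in \<open>auto simp: indicator_def abs_le_iff not_le\<close>)
  then show "norm (ft G x) \<le> 2 * n * B"
    unfolding iv using norm_ft_le[of G x] by linarith
  show "integrable lborel (\<lambda>x. (norm (ft G x))\<^sup>2)" by (rule ft_L2_bound(1)[OF G G2])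
  have "(LINT \<xi>|lborel. (norm (G \<xi>))\<^sup>2) \<le> (LINT \<xi>|lborel. B\<^sup>2 * indicator {-n..n} \<xi>)"
  proof (intro integral_mono ii G2)
    fix \<xi>
    show "(norm (G \<xi>))\<^sup>2 \<le> B\<^sup>2 * indicator {-n..n} \<xi>"
    proof (cases "\<bar>\<xi>\<bar> \<le> n")
      case True
      then have "\<xi> \<in> {-n..n}" by auto
      then show ?thesis using power_mono[OF B norm_ge_zero, of \<xi> 2] by simp
    qed (use supp in auto)
  qed
  then have "2 * pi * (LINT \<xi>|lborel. (norm (G \<xi>))\<^sup>2) \<le> 2 * pi * (2 * n * B\<^sup>2)"
    unfolding iv by (rule mult_left_mono) simp
  then have "(LINT x|lborel. (norm (ft G x))\<^sup>2) \<le> 4 * pi * n * B\<^sup>2"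
  proof -
    assume "2 * pi * (LINT \<xi>|lborel. (norm (G \<xi>))\<^sup>2) \<le> 2 * pi * (2 * n * B\<^sup>2)"
    from order_trans[OF ft_L2_bound(2)[OF G G2] this] show ?thesis by (simp add: mult_ac)
  qed
  then have "sqrt (LINT x|lborel. (norm (ft G x))\<^sup>2) \<le> sqrt (4 * pi * n * B\<^sup>2)" by (rule real_sqrt_le_mono)
  also have "\<dots> = sqrt (4 * pi * n) * B" using B0 by (simp add: real_sqrt_mult)
  finally show "sqrt (LINT x|lborel. (norm (ft G x))\<^sup>2) \<le> sqrt (4 * pi * n) * B" .
qed

text \<open>Links the gauge integral, convenient for differentiation under the integral sign, with
  the Lebesgue integral in which all estimates are made.\<close>

lemma wave_eq_ft:
  assumes q: "continuous_on UNIV q" and g: "continuous_on UNIV g"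
    and supp: "\<And>\<xi>. n < \<bar>\<xi>\<bar> \<Longrightarrow> g \<xi> = 0"
  shows "wave q n g (s, x) = ft (\<lambda>\<xi>. of_real (exp (s * q \<xi>)) * g \<xi>) x"
proof -
  let ?h = "\<lambda>\<xi>. exp (of_real (s * q \<xi>) + \<i> * of_real (x * \<xi>)) * g \<xi>"
  have c: "continuous_on A ?h" for A
    by (intro continuous_intros continuous_on_subset[OF q] continuous_on_subset[OF g]) auto
  have si: "set_integrable lborel {-n..n} ?h"
    unfolding set_integrable_def by (rule borel_integrable_compact) (use c in auto)
  have "wave q n g (s, x) = integral {-n..n} ?h" by (simp add: wave_def)
  also have "\<dots> = (LINT \<xi>:{-n..n}|lborel. ?h \<xi>)"
    by (rule set_borel_integral_eq_integral(2)[OF si, symmetric])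
  also have "\<dots> = ft (\<lambda>\<xi>. of_real (exp (s * q \<xi>)) * g \<xi>) x"
    unfolding ft_def set_lebesgue_integral_def
  proof (intro Bochner_Integration.integral_cong refl)
    fix \<xi>
    have "exp (of_real (s * q \<xi>) + \<i> * of_real (x * \<xi>)) = of_real (exp (s * q \<xi>)) * cis (x * \<xi>)"
      by (simp only: exp_add exp_of_real cis_conv_exp)
    then show "indicator {-n..n} \<xi> *\<^sub>R ?h \<xi> = cis (x * \<xi>) * (of_real (exp (s * q \<xi>)) * g \<xi>)"
      using supp[of \<xi>] by (auto simp: indicator_def abs_le_iff not_le mult_ac)
  qed
  finally show ?thesis .
qed

text \<open>Test functions are real valued, and so is a wave with hermitian amplitude.
  Multiplication by the even symbol p or by i \<xi> preserves this symmetry.\<close>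

lemma ft_hermitian_real:
  assumes H: "integrable lborel H" and herm: "\<And>\<xi>. cnj (H \<xi>) = H (- \<xi>)"
  shows "of_real (Re (ft H x)) = ft H x"
proof -
  have "cnj (ft H x) = ft (\<lambda>\<xi>. H (- \<xi>)) (- x)" unfolding cnj_ft[OF H] herm ..
  also have "\<dots> = ft H x"
    unfolding ft_def using lborel_integral_uminus[of "\<lambda>\<xi>. cis (x * \<xi>) * H \<xi>"] by simp
  finally show ?thesis by (simp add: complex_eq_iff)
qed

text \<open>Amplitude whose transform in x is the kernel of the truncated e^{-t p(D)} centred at y
  (see \<open>mode_ft_shift\<close>); at t = 0 it is an approximate Dirac mass at y, up to the
  factor 2 pi.\<close>

definition mode :: "real \<Rightarrow> real \<Rightarrow> real \<Rightarrow> real \<Rightarrow> complex" where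
  "mode n y t \<xi> = of_real (heat n t \<xi>) * cis (- (y * \<xi>))"

lemma heat_joint_measurable [measurable]:
  "(\<lambda>(t, \<xi>). heat n t \<xi>) \<in> borel_measurable (borel \<Otimes>\<^sub>M borel)"
  unfolding heat_def by measurable

lemma mode_joint_measurable [measurable]:
  "(\<lambda>(t, \<xi>). mode n y t \<xi>) \<in> borel_measurable (borel \<Otimes>\<^sub>M borel)"
  unfolding mode_def by measurable

lemma mode_measurable [measurable]: "mode n y t \<in> borel_measurable borel"
  unfolding mode_def[abs_def] by measurable

lemma mode_continuous: "0 < n \<Longrightarrow> continuous_on A (mode n y t)"
  unfolding mode_def heat_def by (intro continuous_intros tent_continuous)

lemma mode_outside: "0 < n \<Longrightarrow> n < \<bar>\<xi>\<bar> \<Longrightarrow> mode n y t \<xi> = 0"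
  by (simp add: mode_def heat_def tent_outside)

lemma mode_hermitian: "cnj (mode n y t \<xi>) = mode n y t (- \<xi>)"
  by (simp add: mode_def heat_def cis_cnj)

lemma norm_mode: "norm (mode n y t \<xi>) = heat n t \<xi>"
  by (simp add: mode_def norm_mult heat_nonneg)

lemma psym_le_support: "\<bar>\<xi>\<bar> \<le> n \<Longrightarrow> psym \<xi> \<le> 1 + n\<^sup>2"
  using psym_le[of \<xi>] power_mono[of "\<bar>\<xi>\<bar>" n 2] by simp

text \<open>Both signs of t occur, since the wave is defined after the time of its datum as well.
  The truncation makes the growth harmless: p \<le> 1 + n^2 on the band, and the constant may depend
  on n.\<close>

lemma norm_mode_le:
  assumes n: "0 < n" and t: "\<bar>t\<bar> \<le> L"
  shows "norm (mode n y t \<xi>) \<le> exp (L * (1 + n\<^sup>2))"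
proof (cases "\<bar>\<xi>\<bar> \<le> n")
  case True
  have "- (t * psym \<xi>) \<le> L * (1 + n\<^sup>2)"
  proof -
    have "- (t * psym \<xi>) \<le> \<bar>t\<bar> * psym \<xi>" using psym_nonneg[of \<xi>] mult_right_mono[of "- t" "\<bar>t\<bar>" "psym \<xi>"] by simp
    also have "\<dots> \<le> L * (1 + n\<^sup>2)" using t psym_le_support[OF True] psym_nonneg[of \<xi>] by (intro mult_mono) auto
    finally show ?thesis .
  qed
  then have "exp (- (t * psym \<xi>)) * tent n \<xi> \<le> exp (L * (1 + n\<^sup>2)) * 1"
    by (intro mult_mono tent_le_1 tent_nonneg n) auto
  then show ?thesis unfolding norm_mode heat_def by simp
qed (use mode_outside[OF n] in simp)

section \<open>The spatial cutoff on the Fourier side\<close>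

lemma integrable_inverse_one_plus_sq: "integrable lborel (\<lambda>x::real. 1 / (1 + x\<^sup>2))"
proof (rule Bochner_Integration.integrable_bound)
  show "integrable lborel (\<lambda>x::real. 2 * (1 + \<bar>x\<bar>) powr (- 2))"
    by (intro integrable_mult_right integrable_one_plus_abs_powr) simp
  have "1 / (1 + x\<^sup>2) \<le> 2 * (1 + \<bar>x\<bar>) powr (- 2)" for x :: real
  proof -
    have p: "0 < 1 + x\<^sup>2" "0 < (1 + \<bar>x\<bar>)\<^sup>2" by (simp_all add: add_pos_nonneg)
    have "(1 + \<bar>x\<bar>)\<^sup>2 \<le> 2 * (1 + x\<^sup>2)"
      using sum_squares_bound[of 1 "\<bar>x\<bar>"] by (simp add: power2_eq_square algebra_simps)
    then have "2 / (2 * (1 + x\<^sup>2)) \<le> 2 / (1 + \<bar>x\<bar>)\<^sup>2"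
      by (rule divide_left_mono) (use p in \<open>simp_all only: mult_pos_pos zero_less_numeral zero_le_numeral\<close>)
    moreover have "2 / (2 * c) = 1 / c" for c :: real by simp
    ultimately have "1 / (1 + x\<^sup>2) \<le> 2 / (1 + \<bar>x\<bar>)\<^sup>2" by (simp only:)
    moreover have "(1 + \<bar>x\<bar>) powr (- 2) = 1 / (1 + \<bar>x\<bar>)\<^sup>2"
      by (simp add: powr_minus powr_numeral divide_inverse)
    ultimately show ?thesis by simp
  qed
  then show "AE x in lborel. norm (1 / (1 + (x::real)\<^sup>2)) \<le> norm (2 * (1 + \<bar>x\<bar>) powr (- 2) :: real)"
    by (intro AE_I2) (simp add: abs_of_nonneg)
qed measurable

definition cutoff_ft :: "real \<Rightarrow> complex" where
  "cutoff_ft = ft (\<lambda>x. of_real (space_cutoff x))"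

lemma space_cutoff_measurable [measurable]: "space_cutoff \<in> borel_measurable borel"
  by (rule smooth_real_measurable[OF smooth_space_cutoff])

lemma cutoff_ft_measurable [measurable]: "cutoff_ft \<in> borel_measurable borel"
  unfolding cutoff_ft_def by measurable

lemma space_cutoff_integrable: "integrable lborel space_cutoff"
  by (rule smooth_compact_support_integrable[OF smooth_space_cutoff]) (rule space_cutoff_eq_0)

lemma cutoff_ft_integrable:
  "integrable lborel (\<lambda>z. (1 + z\<^sup>2)\<^sup>2 * norm (cutoff_ft z))" "integrable lborel cutoff_ft"
  unfolding cutoff_ft_def by (rule ft_smooth_integrable[OF smooth_space_cutoff], rule space_cutoff_eq_0, assumption)+

lemma cutoff_ft_integral: "(LINT z|lborel. cutoff_ft z) = of_real (2 * pi)"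
proof -
  have "(LINT z|lborel. cutoff_ft z) = of_real (2 * pi) * of_real (space_cutoff 0)"
    unfolding cutoff_ft_def
  proof (rule ft_integral_eq)
    show "integrable lborel (\<lambda>x. complex_of_real (space_cutoff x))"
      using space_cutoff_integrable by simp
    show "norm (complex_of_real (space_cutoff x)) \<le> 1" for x using space_cutoff_bounds[of x] by simp
    show "isCont (\<lambda>x. complex_of_real (space_cutoff x)) 0"
      using smooth_real_continuous[OF smooth_space_cutoff] by (intro continuous_intros) (simp add: continuous_on_eq_continuous_at)
    show "integrable lborel (ft (\<lambda>x. complex_of_real (space_cutoff x)))"
      using cutoff_ft_integrable(2) by (simp add: cutoff_ft_def)
  qed
  then show ?thesis by (simp add: space_cutoff_eq_1)
qed

text \<open>Effect of the factor \<chi>(x/R) on the transform (see \<open>fourier_cutoff\<close>):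
  an average of H over distances of order 1 / R, with total mass 2 pi. The result is no longer
  band-limited, so its decay has to be established.\<close>

definition smear :: "real \<Rightarrow> (real \<Rightarrow> complex) \<Rightarrow> real \<Rightarrow> complex" where
  "smear R H \<xi> = (LINT z|lborel. H (\<xi> + z / R) * cutoff_ft z)"

text \<open>The multiplication formula with k the modulated cutoff, whose transform is R times that
  of \<chi>, dilated by R and centred at \<xi>.\<close>

lemma fourier_cutoff:
  assumes R: "0 < R" and H: "integrable lborel H"
  shows "fourier (\<lambda>x. of_real (space_cutoff (x / R)) * ft H x) \<xi> = smear R H \<xi>"
proof -
  note [measurable] = borel_measurable_integrable[OF H]
  have Ri: "1 / R \<noteq> 0" using R by simp
  define k where "k x = cis (- (\<xi> * x)) * complex_of_real (space_cutoff (x / R))" for x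
  have k: "integrable lborel k"
  proof -
    have "integrable lborel (\<lambda>x. complex_of_real (space_cutoff (0 + (1 / R) * x)))"
      using lborel_integrable_real_affine[OF space_cutoff_integrable Ri, of 0] by simp
    from integrable_cis_mult[OF this, of "- \<xi>"] show ?thesis by (simp add: k_def[abs_def])
  qed
  have ftk: "ft k \<eta> = of_real R * cutoff_ft (R * (\<eta> - \<xi>))" for \<eta>
  proof -
    have "ft k \<eta> = (LINT x|lborel. cis ((\<eta> - \<xi>) * x) * of_real (space_cutoff (x / R)))"
      unfolding ft_def k_def mult.assoc[symmetric] by (simp add: cis_mult algebra_simps)
    also have "\<dots> = R *\<^sub>R (LINT x|lborel. cis ((\<eta> - \<xi>) * (R * x)) * of_real (space_cutoff (R * x / R)))"
      using R by (subst lborel_integral_real_affine[of R _ 0]) simp_all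
    also have "\<dots> = of_real R * cutoff_ft (R * (\<eta> - \<xi>))"
      using R by (simp add: cutoff_ft_def ft_def scaleR_conv_of_real mult_ac)
    finally show ?thesis .
  qed
  have "fourier (\<lambda>x. of_real (space_cutoff (x / R)) * ft H x) \<xi> = (LINT x|lborel. ft H x * k x)"
    by (subst fourier_eq_ft) (simp_all add: ft_def[of _ "- \<xi>"] k_def mult_ac)
  also have "\<dots> = (LINT \<eta>|lborel. H \<eta> * ft k \<eta>)" by (rule ft_multiplication_formula[OF H k])
  also have "\<dots> = (1 / R) *\<^sub>R (LINT z|lborel. H (\<xi> + (1 / R) * z) * ft k (\<xi> + (1 / R) * z))"
    using R by (subst lborel_integral_real_affine[of "1 / R" _ \<xi>]) simp_all
  also have "\<dots> = (1 / R) *\<^sub>R (LINT z|lborel. of_real R * (H (\<xi> + z / R) * cutoff_ft z))"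
    using R by (simp add: ftk mult_ac)
  also have "\<dots> = smear R H \<xi>" using R by (simp add: smear_def scaleR_conv_of_real)
  finally show ?thesis .
qed

lemma smear_joint_measurable:
  assumes [measurable]: "(\<lambda>(s, \<xi>). H s \<xi>) \<in> borel_measurable (borel \<Otimes>\<^sub>M borel)"
  shows "(\<lambda>(s, \<xi>). smear R (H s) \<xi>) \<in> borel_measurable (borel \<Otimes>\<^sub>M borel)"
  unfolding smear_def by measurable

lemma ft_joint_measurable:
  assumes [measurable]: "(\<lambda>(s, \<xi>). H s \<xi>) \<in> borel_measurable (borel \<Otimes>\<^sub>M borel)"
  shows "(\<lambda>(s, x). ft (H s) x) \<in> borel_measurable (borel \<Otimes>\<^sub>M borel)"
  unfolding ft_def by measurable

text \<open>If \<xi> + z/R lies in the band and R \<ge> 1, then \<xi>^2 \<le> 2 n^2 + 2 z^2, so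
  powers of \<xi> are charged to the rapidly decaying transform of \<chi>, uniformly in R. Order
  four is chosen so that multiplication by p \<le> 1 + \<xi>^2 leaves a function in
  \<open>L\<^sup>1\<close> and \<open>L\<^sup>2\<close>.\<close>

lemma smear_bound:
  assumes [measurable]: "H \<in> borel_measurable borel" and n: "0 < n" and R: "1 \<le> R"
    and B: "\<And>\<xi>. norm (H \<xi>) \<le> B" and supp: "\<And>\<xi>. n < \<bar>\<xi>\<bar> \<Longrightarrow> H \<xi> = 0"
  shows "integrable lborel (\<lambda>z. H (\<xi> + z / R) * cutoff_ft z)"
    and "(1 + \<xi>\<^sup>2)\<^sup>2 * norm (smear R H \<xi>) \<le> B * (4 * (1 + n\<^sup>2)\<^sup>2 * (LINT z|lborel. (1 + z\<^sup>2)\<^sup>2 * norm (cutoff_ft z)))"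
proof -
  have B0: "0 \<le> B" using norm_ge_zero B by (rule order_trans)
  show i: "integrable lborel (\<lambda>z. H (\<xi> + z / R) * cutoff_ft z)"
  proof (rule Bochner_Integration.integrable_bound)
    show "integrable lborel (\<lambda>z. B * norm (cutoff_ft z))" using cutoff_ft_integrable(2) by simp
    show "AE z in lborel. norm (H (\<xi> + z / R) * cutoff_ft z) \<le> norm (B * norm (cutoff_ft z))"
      using B0 B by (intro AE_I2) (simp add: norm_mult mult_right_mono)
  qed measurable
  have pw: "(1 + \<xi>\<^sup>2)\<^sup>2 * norm (H (\<xi> + z / R)) \<le> B * (4 * (1 + n\<^sup>2)\<^sup>2 * (1 + z\<^sup>2)\<^sup>2)" for z
  proof (cases "\<bar>\<xi> + z / R\<bar> \<le> n")
    case True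
    have zR: "(z / R)\<^sup>2 \<le> z\<^sup>2"
    proof -
      have "\<bar>z / R\<bar> \<le> \<bar>z\<bar>" using R mult_right_mono[of 1 R "\<bar>z\<bar>"] by (simp add: field_simps)
      then show ?thesis by (simp only: abs_le_square_iff)
    qed
    have "\<xi>\<^sup>2 = ((\<xi> + z / R) + (- (z / R)))\<^sup>2" by simp
    also have "\<dots> \<le> 2 * (\<xi> + z / R)\<^sup>2 + 2 * (z / R)\<^sup>2"
      using sum_squares_bound[of "\<xi> + z / R" "- (z / R)"] unfolding power2_sum by simp
    also have "\<dots> \<le> 2 * n\<^sup>2 + 2 * z\<^sup>2"
      using zR power_mono[OF True, of 2] by simp
    finally have "\<xi>\<^sup>2 \<le> 2 * n\<^sup>2 + 2 * z\<^sup>2" .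
    moreover have "2 * ((1 + n\<^sup>2) * (1 + z\<^sup>2)) = 2 + 2 * n\<^sup>2 + 2 * z\<^sup>2 + 2 * (n\<^sup>2 * z\<^sup>2)" by (simp add: algebra_simps)
    moreover have "0 \<le> n\<^sup>2 * z\<^sup>2" by simp
    ultimately have "1 + \<xi>\<^sup>2 \<le> 2 * ((1 + n\<^sup>2) * (1 + z\<^sup>2))" by linarith
    then have "(1 + \<xi>\<^sup>2)\<^sup>2 \<le> (2 * ((1 + n\<^sup>2) * (1 + z\<^sup>2)))\<^sup>2" by (intro power_mono) auto
    also have "\<dots> = 4 * (1 + n\<^sup>2)\<^sup>2 * (1 + z\<^sup>2)\<^sup>2" by (simp add: power_mult_distrib)
    finally have "(1 + \<xi>\<^sup>2)\<^sup>2 * norm (H (\<xi> + z / R)) \<le> (4 * (1 + n\<^sup>2)\<^sup>2 * (1 + z\<^sup>2)\<^sup>2) * B"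
      by (intro mult_mono B) auto
    then show ?thesis by (simp add: mult.commute)
  next
    case False
    then show ?thesis using supp[of "\<xi> + z / R"] B0 by simp
  qed
  have "(1 + \<xi>\<^sup>2)\<^sup>2 * norm (smear R H \<xi>) \<le> (1 + \<xi>\<^sup>2)\<^sup>2 * (LINT z|lborel. norm (H (\<xi> + z / R) * cutoff_ft z))"
    unfolding smear_def by (intro mult_left_mono integral_norm_bound) simp
  also have "\<dots> = (LINT z|lborel. (1 + \<xi>\<^sup>2)\<^sup>2 * norm (H (\<xi> + z / R) * cutoff_ft z))" by simp
  also have "\<dots> \<le> (LINT z|lborel. (B * (4 * (1 + n\<^sup>2)\<^sup>2)) * ((1 + z\<^sup>2)\<^sup>2 * norm (cutoff_ft z)))"
  proof (rule integral_mono)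
    show "integrable lborel (\<lambda>z. (1 + \<xi>\<^sup>2)\<^sup>2 * norm (H (\<xi> + z / R) * cutoff_ft z))" using i by simp
    show "integrable lborel (\<lambda>z. (B * (4 * (1 + n\<^sup>2)\<^sup>2)) * ((1 + z\<^sup>2)\<^sup>2 * norm (cutoff_ft z)))"
      by (intro integrable_mult_right cutoff_ft_integrable)
    fix z
    show "(1 + \<xi>\<^sup>2)\<^sup>2 * norm (H (\<xi> + z / R) * cutoff_ft z) \<le> (B * (4 * (1 + n\<^sup>2)\<^sup>2)) * ((1 + z\<^sup>2)\<^sup>2 * norm (cutoff_ft z))"
      using mult_right_mono[OF pw[of z] norm_ge_zero[of "cutoff_ft z"]] by (simp only: norm_mult mult_ac)
  qed
  finally show "(1 + \<xi>\<^sup>2)\<^sup>2 * norm (smear R H \<xi>) \<le> B * (4 * (1 + n\<^sup>2)\<^sup>2 * (LINT z|lborel. (1 + z\<^sup>2)\<^sup>2 * norm (cutoff_ft z)))"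
    by (simp add: mult.assoc)
qed

lemma smear_tendsto:
  assumes H: "continuous_on UNIV H" and B: "\<And>\<xi>. norm (H \<xi>) \<le> B"
  shows "(\<lambda>k. smear (real (Suc k)) H \<xi>) \<longlonglongrightarrow> of_real (2 * pi) * H \<xi>"
proof -
  have [measurable]: "H \<in> borel_measurable borel" using H by (rule borel_measurable_continuous_onI)
  have B0: "0 \<le> B" using norm_ge_zero B by (rule order_trans)
  have "(\<lambda>k. LINT z|lborel. H (\<xi> + z / real (Suc k)) * cutoff_ft z) \<longlonglongrightarrow> (LINT z|lborel. H \<xi> * cutoff_ft z)"
  proof (rule integral_dominated_convergence[where w = "\<lambda>z. B * norm (cutoff_ft z)"])
    show "integrable lborel (\<lambda>z. B * norm (cutoff_ft z))" using cutoff_ft_integrable(2) by simp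
    show "AE z in lborel. norm (H (\<xi> + z / real (Suc k)) * cutoff_ft z) \<le> B * norm (cutoff_ft z)" for k
      using B by (intro AE_I2) (simp add: norm_mult mult_right_mono)
    have "(\<lambda>k. z / real (Suc k)) \<longlonglongrightarrow> 0" for z :: real
      by (rule LIMSEQ_Suc[OF tendsto_divide_0[OF tendsto_const]]) (auto intro: filterlim_at_top_imp_at_infinity filterlim_real_sequentially)
    then have lim: "(\<lambda>k. \<xi> + z / real (Suc k)) \<longlonglongrightarrow> \<xi> + 0" for z by (rule tendsto_add[OF tendsto_const])
    have "isCont H \<xi>" using H by (simp add: continuous_on_eq_continuous_at)
    then have "(\<lambda>k. H (\<xi> + z / real (Suc k))) \<longlonglongrightarrow> H \<xi>" for z
      by (rule isCont_tendsto_compose) (use lim[of z] in simp)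
    then show "AE z in lborel. (\<lambda>k. H (\<xi> + z / real (Suc k)) * cutoff_ft z) \<longlonglongrightarrow> H \<xi> * cutoff_ft z"
      by (intro AE_I2 tendsto_mult tendsto_const)
  qed measurable
  then show ?thesis by (simp add: smear_def cutoff_ft_integral mult.commute)
qed

section \<open>Duhamel formula in weak form\<close>

lemma deriv_zero_outside:
  assumes d: "\<And>x. (f has_real_derivative f' x) (at x)" and f: "\<And>x. c \<le> \<bar>x\<bar> \<Longrightarrow> f x = 0" and x: "c < \<bar>x\<bar>"
  shows "f' x = (0::real)"
proof -
  have ev: "eventually (\<lambda>y. 0 = f y) (nhds x)"
    by (rule eventually_mono[OF eventually_nhds_in_open[of "{y. c < \<bar>y\<bar>}" x]])
       (use x f in \<open>auto intro!: open_Collect_less continuous_intros\<close>)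
  have "((\<lambda>y. 0) has_real_derivative f' x) (at x)"
    using d[of x] DERIV_cong_ev[OF refl ev refl] by simp
  then show ?thesis using DERIV_unique[OF _ DERIV_const] by blast
qed

lemma space_cutoff_derivative:
  obtains \<chi>' X where "\<And>x. (space_cutoff has_real_derivative \<chi>' x) (at x)" "\<chi>' \<in> borel_measurable borel"
    "0 \<le> X" "\<And>x. \<bar>\<chi>' x\<bar> \<le> X"
proof -
  obtain \<chi>' where s: "smooth_real \<chi>'" and d: "\<And>x. (space_cutoff has_real_derivative \<chi>' x) (at x)"
    using smooth_real_deriv[OF smooth_space_cutoff] by blast
  have "\<chi>' x = 0" if "3 \<le> \<bar>x\<bar>" for x
    by (rule deriv_zero_outside[OF d, of 2]) (use that space_cutoff_eq_0 in auto)
  then obtain X where "0 \<le> X" "\<And>x. \<bar>\<chi>' x\<bar> \<le> X"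
    using smooth_compact_support_bounded[OF s] by blast
  then show thesis using that[OF d smooth_real_measurable[OF s]] by blast
qed

text \<open>A solution given by Borel representatives, with the \<open>L\<^sup>2\<close> bound at
  every time rather than at almost every time. Modification on null sets, at the end, brings the
  general case to this one.\<close>

locale weak_flow =
  fixes u0 :: "real \<Rightarrow> real" and u :: "real \<Rightarrow> real \<Rightarrow> real" and M :: real
  assumes u_joint [measurable]: "(\<lambda>(t, x). u t x) \<in> borel_measurable (borel \<Otimes>\<^sub>M borel)"
    and u0_meas [measurable]: "u0 \<in> borel_measurable borel"
    and u_int: "\<And>t. integrable lborel (\<lambda>x. (u t x)\<^sup>2)"
    and u_M: "\<And>t. (LINT x|lborel. (u t x)\<^sup>2) \<le> M\<^sup>2"
    and M: "0 \<le> M"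
    and u0_int: "integrable lborel (\<lambda>x. (u0 x)\<^sup>2)"
    and weak: "weak_solution u0 u"
begin

lemma u_meas [measurable]: "u t \<in> borel_measurable borel"
  by measurable

lemma u_pair:
  fixes g :: "real \<Rightarrow> complex"
  assumes [measurable]: "g \<in> borel_measurable borel" and g: "integrable lborel (\<lambda>x. (norm (g x))\<^sup>2)"
  shows "integrable lborel (\<lambda>x. of_real (u s x) * g x)"
    and "norm (LINT x|lborel. of_real (u s x) * g x) \<le> M * sqrt (LINT x|lborel. (norm (g x))\<^sup>2)"
proof -
  have u2: "integrable lborel (\<lambda>x. (norm (complex_of_real (u s x)))\<^sup>2)" using u_int[of s] by simp
  have um: "(\<lambda>x. complex_of_real (u s x)) \<in> borel_measurable lborel" by simp
  have gm: "g \<in> borel_measurable lborel" by simp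
  show "integrable lborel (\<lambda>x. of_real (u s x) * g x)"
    by (rule Cauchy_Schwarz_integral(1)[OF um gm u2 g])
  have "norm (LINT x|lborel. of_real (u s x) * g x) \<le> sqrt (LINT x|lborel. (norm (complex_of_real (u s x)))\<^sup>2) * sqrt (LINT x|lborel. (norm (g x))\<^sup>2)"
    by (rule Cauchy_Schwarz_integral(2)[OF um gm u2 g])
  also have "\<dots> \<le> M * sqrt (LINT x|lborel. (norm (g x))\<^sup>2)"
  proof (rule mult_right_mono)
    show "sqrt (LINT x|lborel. (norm (complex_of_real (u s x)))\<^sup>2) \<le> M"
      using real_sqrt_le_mono[OF u_M[of s]] M by simp
  qed simp
  finally show "norm (LINT x|lborel. of_real (u s x) * g x) \<le> M * sqrt (LINT x|lborel. (norm (g x))\<^sup>2)" .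
qed

lemma u_quad:
  assumes [measurable]: "g \<in> borel_measurable borel" and g: "\<And>x. norm (g x :: complex) \<le> C"
  shows "integrable lborel (\<lambda>x. of_real ((u s x)\<^sup>2) * g x)"
    and "norm (LINT x|lborel. of_real ((u s x)\<^sup>2) * g x) \<le> M\<^sup>2 * C"
proof -
  have C: "0 \<le> C" using norm_ge_zero g by (rule order_trans)
  have le: "norm (of_real ((u s x)\<^sup>2) * g x) \<le> (u s x)\<^sup>2 * C" for x
    unfolding norm_mult norm_of_real abs_power2 using g[of x] by (intro mult_left_mono) simp_all
  have i: "integrable lborel (\<lambda>x. (u s x)\<^sup>2 * C)" using u_int by simp
  show int: "integrable lborel (\<lambda>x. of_real ((u s x)\<^sup>2) * g x)"
    by (rule Bochner_Integration.integrable_bound[OF i]) (use order_trans[OF le abs_ge_self] in auto)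
  have "norm (LINT x|lborel. of_real ((u s x)\<^sup>2) * g x) \<le> (LINT x|lborel. norm (of_real ((u s x)\<^sup>2) * g x))"
    by (rule integral_norm_bound)
  also have "\<dots> \<le> (LINT x|lborel. (u s x)\<^sup>2 * C)"
    by (rule integral_mono[OF integrable_norm[OF int] i le])
  also have "\<dots> \<le> M\<^sup>2 * C" using u_M[of s] C by (simp add: mult_right_mono)
  finally show "norm (LINT x|lborel. of_real ((u s x)\<^sup>2) * g x) \<le> M\<^sup>2 * C" .
qed

text \<open>For the test functions a(s) \<chi>(x/R) w(s, x), the term with \<partial>_s w = p(D) w
  and the operator term cancel up to a cutoff error that vanishes as R tends to infinity. What
  survives is the derivative b of a paired with w, the quadratic term with \<partial>_x w, and the
  initial datum. A bound uniform in R up to time L allows dominated convergence in time.\<close>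

lemma weak_identity:
  fixes a b :: "real \<Rightarrow> real" and n y t L A1 B1 :: real
  assumes n: "0 < n" and L: "0 < L" and a: "smooth_real a" and aL: "\<And>s. L \<le> \<bar>s\<bar> \<Longrightarrow> a s = 0"
    and b_meas [measurable]: "b \<in> borel_measurable borel"
    and da: "\<And>s. 0 < s \<Longrightarrow> (a has_real_derivative b s) (at s)"
    and bL: "\<And>s. L \<le> s \<Longrightarrow> b s = 0" and b1: "\<And>s. \<bar>b s\<bar> \<le> B1" and a1: "\<And>s. \<bar>a s\<bar> \<le> A1"
  shows "(LINT s|lborel. indicator {0<..} s *\<^sub>R
      (of_real (b s) * (LINT x|lborel. of_real (u s x) * ft (mode n y (t - s)) x)
       - of_real (a s / 2) * (LINT x|lborel. of_real ((u s x)\<^sup>2) * ft (\<lambda>\<xi>. \<i> * of_real \<xi> * mode n y (t - s) \<xi>) x)))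
     + of_real (a 0) * (LINT x|lborel. of_real (u0 x) * ft (mode n y t) x) = 0"
proof -
  define H where "H s = mode n y (t - s)" for s
  \<comment> \<open>W(s) is the wave w(s), V(s) = p(D) w(s) its derivative in s, and D(s) its
    derivative in x.\<close>
  define W where "W s = ft (H s)" for s
  define V where "V s = ft (\<lambda>\<xi>. of_real (psym \<xi>) * H s \<xi>)" for s
  define D where "D s = ft (\<lambda>\<xi>. \<i> * of_real \<xi> * H s \<xi>)" for s
  define R where "R k = real (Suc k)" for k
  have R: "0 < R k" "1 \<le> R k" for k by (auto simp: R_def)
  \<comment> \<open>Up to the factor a(s), this is the transform of the operator applied to the test
    function.\<close>
  define G2 where "G2 k s \<xi> = of_real (psym \<xi>) * smear (R k) (H s) \<xi>" for k s \<xi>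
  obtain \<chi>' X where d\<chi>: "\<And>x. (space_cutoff has_real_derivative \<chi>' x) (at x)" and \<chi>'m [measurable]: "\<chi>' \<in> borel_measurable borel"
    and X: "0 \<le> X" "\<And>x. \<bar>\<chi>' x\<bar> \<le> X" using space_cutoff_derivative by metis
  have am [measurable]: "a \<in> borel_measurable borel" by (rule smooth_real_measurable[OF a])
  have Hj [measurable]: "(\<lambda>(s, \<xi>). H s \<xi>) \<in> borel_measurable (borel \<Otimes>\<^sub>M borel)"
    unfolding H_def by measurable
  have Hm [measurable]: "H s \<in> borel_measurable borel" for s unfolding H_def by measurable
  have Wj [measurable]: "(\<lambda>(s, x). W s x) \<in> borel_measurable (borel \<Otimes>\<^sub>M borel)"
    unfolding W_def by (rule ft_joint_measurable) measurable
  have Vj [measurable]: "(\<lambda>(s, x). V s x) \<in> borel_measurable (borel \<Otimes>\<^sub>M borel)"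
    unfolding V_def by (rule ft_joint_measurable) measurable
  have Dj [measurable]: "(\<lambda>(s, x). D s x) \<in> borel_measurable (borel \<Otimes>\<^sub>M borel)"
    unfolding D_def by (rule ft_joint_measurable) measurable
  have Sj [measurable]: "(\<lambda>(s, \<xi>). smear (R k) (H s) \<xi>) \<in> borel_measurable (borel \<Otimes>\<^sub>M borel)" for k
    by (rule smear_joint_measurable) measurable
  have G2j [measurable]: "(\<lambda>(s, \<xi>). G2 k s \<xi>) \<in> borel_measurable (borel \<Otimes>\<^sub>M borel)" for k
    unfolding G2_def by measurable
  have fG2j [measurable]: "(\<lambda>(s, x). ft (G2 k s) x) \<in> borel_measurable (borel \<Otimes>\<^sub>M borel)" for k
    by (rule ft_joint_measurable) measurable
  have Wm [measurable]: "W s \<in> borel_measurable borel" for s unfolding W_def by measurable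
  have Vm [measurable]: "V s \<in> borel_measurable borel" for s unfolding V_def by measurable
  have Dm [measurable]: "D s \<in> borel_measurable borel" for s unfolding D_def by measurable
  have Sm [measurable]: "smear (R k) (H s) \<in> borel_measurable borel" for k s
    unfolding smear_def[abs_def] by measurable
  have G2m [measurable]: "G2 k s \<in> borel_measurable borel" for k s
    unfolding G2_def[abs_def] by measurable

  have Hsupp: "H s \<xi> = 0" if "n < \<bar>\<xi>\<bar>" for s \<xi> unfolding H_def by (rule mode_outside[OF n that])
  have H_bounded: "\<exists>B. \<forall>\<xi>. norm (H s \<xi>) \<le> B" for s
    unfolding H_def using norm_mode_le[OF n order_refl] by blast
  have H1: "integrable lborel (H s)" for s
    using H_bounded[of s] bounded_support_facts(1)[OF Hm n _ Hsupp] by blast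

  define g where "g = mode n y t"
  have gc: "continuous_on A g" for A unfolding g_def by (rule mode_continuous[OF n])
  have pc: "continuous_on A psym" for A by (intro continuous_intros)
  \<comment> \<open>Multiplying by e^{s p} moves the amplitude from time t to t - s, so the solution
    of \<partial>_s w = p(D) w with datum at t has amplitude \<open>H s\<close>.\<close>
  have gH: "of_real (exp (s * psym \<xi>)) * g \<xi> = H s \<xi>" for s \<xi>
  proof -
    have "exp (s * psym \<xi>) * exp (- (t * psym \<xi>)) = exp (- ((t - s) * psym \<xi>))"
      by (simp add: exp_add[symmetric] algebra_simps)
    then have "exp (s * psym \<xi>) * heat n t \<xi> = heat n (t - s) \<xi>"
      unfolding heat_def mult.assoc[symmetric] by simp
    then have "of_real (exp (s * psym \<xi>)) * complex_of_real (heat n t \<xi>) = of_real (heat n (t - s) \<xi>)"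
      by (simp only: of_real_mult[symmetric])
    then show ?thesis unfolding g_def H_def mode_def mult.assoc[symmetric] by simp
  qed
  have g_out: "g \<xi> = 0" if "n < \<bar>\<xi>\<bar>" for \<xi> unfolding g_def by (rule mode_outside[OF n that])
  have waveW: "wave psym n g (s, x) = W s x" for s x
    unfolding W_def by (subst wave_eq_ft[OF pc gc g_out]) (simp_all add: gH)
  have waveV: "wave psym n (\<lambda>\<xi>. of_real (psym \<xi>) * g \<xi>) (s, x) = V s x" for s x
  proof -
    have "wave psym n (\<lambda>\<xi>. of_real (psym \<xi>) * g \<xi>) (s, x) = ft (\<lambda>\<xi>. of_real (exp (s * psym \<xi>)) * (of_real (psym \<xi>) * g \<xi>)) x"
      by (rule wave_eq_ft[OF pc]) (use g_out in \<open>auto intro!: continuous_intros pc gc\<close>)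
    also have "(\<lambda>\<xi>. of_real (exp (s * psym \<xi>)) * (of_real (psym \<xi>) * g \<xi>)) = (\<lambda>\<xi>. of_real (psym \<xi>) * H s \<xi>)"
      unfolding gH[symmetric] by (simp only: mult_ac)
    finally show ?thesis unfolding V_def .
  qed
  have waveD: "wave psym n (\<lambda>\<xi>. \<i> * of_real \<xi> * g \<xi>) (s, x) = D s x" for s x
  proof -
    have "wave psym n (\<lambda>\<xi>. \<i> * of_real \<xi> * g \<xi>) (s, x) = ft (\<lambda>\<xi>. of_real (exp (s * psym \<xi>)) * (\<i> * of_real \<xi> * g \<xi>)) x"
      by (rule wave_eq_ft[OF pc]) (use g_out in \<open>auto intro!: continuous_intros gc\<close>)
    also have "(\<lambda>\<xi>. of_real (exp (s * psym \<xi>)) * (\<i> * of_real \<xi> * g \<xi>)) = (\<lambda>\<xi>. \<i> * of_real \<xi> * H s \<xi>)"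
      unfolding gH[symmetric] by (simp only: mult_ac)
    finally show ?thesis unfolding D_def .
  qed
  have Hherm: "cnj (H s \<xi>) = H s (- \<xi>)" for s \<xi> unfolding H_def by (rule mode_hermitian)
  have pH1: "integrable lborel (\<lambda>\<xi>. of_real (psym \<xi>) * H s \<xi>)" and dH1: "integrable lborel (\<lambda>\<xi>. \<i> * of_real \<xi> * H s \<xi>)" for s
  proof -
    obtain B where B: "\<And>\<xi>. norm (H s \<xi>) \<le> B" using H_bounded by blast
    then have B0: "0 \<le> B" using norm_ge_zero order_trans by blast
    have "norm (of_real (psym \<xi>) * H s \<xi>) \<le> (1 + n\<^sup>2) * B" for \<xi>
      using Hsupp[of \<xi> s] psym_le_support[of \<xi> n] psym_nonneg[of \<xi>] B[of \<xi>] B0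
      by (cases "n < \<bar>\<xi>\<bar>") (auto simp: norm_mult intro!: mult_mono)
    then show "integrable lborel (\<lambda>\<xi>. of_real (psym \<xi>) * H s \<xi>)"
      by (rule integrable_bounded_support[of _ _ n, rotated]) (auto simp: Hsupp)
    have "norm (\<i> * of_real \<xi> * H s \<xi>) \<le> n * B" for \<xi>
      using Hsupp[of \<xi> s] B[of \<xi>] B0 n
      by (cases "n < \<bar>\<xi>\<bar>") (auto simp: norm_mult intro!: mult_mono)
    then show "integrable lborel (\<lambda>\<xi>. \<i> * of_real \<xi> * H s \<xi>)"
      by (rule integrable_bounded_support[of _ _ n, rotated]) (auto simp: Hsupp)
  qed
  have Wr: "of_real (Re (W s x)) = W s x" for s x unfolding W_def by (rule ft_hermitian_real[OF H1 Hherm])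
  have Vr: "of_real (Re (V s x)) = V s x" for s x unfolding V_def
    by (rule ft_hermitian_real[OF pH1]) (simp add: Hherm)
  have Dr: "of_real (Re (D s x)) = D s x" for s x unfolding D_def
    by (rule ft_hermitian_real[OF dH1]) (simp add: Hherm)

  \<comment> \<open>The test function has to be real and smooth on the plane: \<open>wave\<close>
    provides the smoothness, and by \<open>Wr\<close> taking the real part changes nothing.\<close>
  define \<phi> where "\<phi> k p = a (fst p) * space_cutoff (snd p / R k) * Re (wave psym n g p)" for k p
  have \<phi>_eq: "\<phi> k (s, x) = a s * space_cutoff (x / R k) * Re (W s x)" for k s x by (simp add: \<phi>_def waveW)
  have test: "test_function (\<phi> k)" for k
    unfolding test_function_def
  proof
    have \<chi>R: "smooth_real (\<lambda>x. space_cutoff (x / R k))"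
      using smooth_real_affine[OF smooth_space_cutoff, of "1 / R k" 0] by simp
    show "\<forall>j. C_k j (\<phi> k)"
      unfolding \<phi>_def using a \<chi>R unfolding smooth_real_def
      by (intro allI C_k_mult C_k_fst C_k_snd C_k_wave pc gc) auto
    have "{p. \<phi> k p \<noteq> 0} \<subseteq> cbox (- L) L \<times> cbox (- (2 * R k)) (2 * R k)"
    proof
      fix p assume "p \<in> {p. \<phi> k p \<noteq> 0}"
      then have "a (fst p) \<noteq> 0" "space_cutoff (snd p / R k) \<noteq> 0" by (auto simp: \<phi>_def)
      then have 1: "\<bar>fst p\<bar> < L" and "\<bar>snd p / R k\<bar> < 2" using aL space_cutoff_eq_0 by (meson not_le)+
      then have 2: "\<bar>snd p\<bar> < 2 * R k" using R[of k] by (simp add: field_simps)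
      show "p \<in> cbox (- L) L \<times> cbox (- (2 * R k)) (2 * R k)" using 1 2 by (cases p) auto
    qed
    then have "bounded {p. \<phi> k p \<noteq> 0}" by (rule bounded_subset[rotated]) (intro bounded_Times bounded_cbox)
    then show "compact (closure {p. \<phi> k p \<noteq> 0})" by simp
  qed
  have dW: "((\<lambda>s. Re (W s x)) has_real_derivative Re (V s x)) (at s)" for s x
  proof -
    have "((\<lambda>s. (s, x)) has_derivative (\<lambda>h. (h, 0))) (at s)" by (auto intro!: derivative_eq_intros)
    from has_derivative_Re[OF has_derivative_compose[OF this wave_has_derivative[OF pc gc, of n]]]
    show ?thesis unfolding waveW waveV has_field_derivative_def
      by (rule has_derivative_eq_rhs) (simp add: fun_eq_iff)
  qed
  have dWx: "((\<lambda>x. Re (W s x)) has_real_derivative Re (D s x)) (at x)" for s x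
  proof -
    have "((\<lambda>x. (s, x)) has_derivative (\<lambda>h. (0, h))) (at x)" by (auto intro!: derivative_eq_intros)
    from has_derivative_Re[OF has_derivative_compose[OF this wave_has_derivative[OF pc gc, of n]]]
    show ?thesis unfolding waveW waveD has_field_derivative_def
      by (rule has_derivative_eq_rhs) (simp add: fun_eq_iff)
  qed
  have \<phi>t: "complex_of_real (deriv (\<lambda>s. \<phi> k (s, x)) s) = of_real (space_cutoff (x / R k)) * (of_real (b s) * W s x + of_real (a s) * V s x)"
    if "0 < s" for k s x
  proof -
    have "((\<lambda>s. a s * Re (W s x) * space_cutoff (x / R k)) has_real_derivative (b s * Re (W s x) + Re (V s x) * a s) * space_cutoff (x / R k)) (at s)"
      by (rule DERIV_cmult_right[OF DERIV_mult[OF da[OF that] dW]])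
    then have "((\<lambda>s. \<phi> k (s, x)) has_real_derivative (b s * Re (W s x) + Re (V s x) * a s) * space_cutoff (x / R k)) (at s)"
      unfolding \<phi>_eq by (simp only: mult_ac)
    from DERIV_imp_deriv[OF this] show ?thesis by (simp add: Wr Vr mult_ac)
  qed
  have \<phi>x: "complex_of_real (deriv (\<lambda>x. \<phi> k (s, x)) x) = of_real (a s) * (of_real (\<chi>' (x / R k) / R k) * W s x + of_real (space_cutoff (x / R k)) * D s x)"
    for k s x
  proof -
    have d1: "((\<lambda>x. space_cutoff (x / R k)) has_real_derivative \<chi>' (x / R k) * (1 / R k)) (at x)"
      by (rule DERIV_chain2[OF d\<chi>]) (use R(1)[of k] in \<open>auto intro!: derivative_eq_intros\<close>)
    have "((\<lambda>x. a s * (space_cutoff (x / R k) * Re (W s x))) has_real_derivative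
        a s * (\<chi>' (x / R k) * (1 / R k) * Re (W s x) + Re (D s x) * space_cutoff (x / R k))) (at x)"
      by (rule DERIV_cmult[OF DERIV_mult[OF d1 dWx]])
    then have "((\<lambda>x. \<phi> k (s, x)) has_real_derivative
        a s * (\<chi>' (x / R k) * (1 / R k) * Re (W s x) + Re (D s x) * space_cutoff (x / R k))) (at x)"
      unfolding \<phi>_eq by (simp only: mult_ac)
    from DERIV_imp_deriv[OF this] show ?thesis by (simp add: Wr Dr mult_ac)
  qed
  have \<phi>m: "multiplier (\<lambda>\<xi>. frac_laplacian_symbol (1/2) \<xi> * M_symbol \<xi>) (\<lambda>y. complex_of_real (\<phi> k (s, y))) x
      = of_real (a s / (2 * pi)) * ft (G2 k s) x" for k s x
  proof -
    have eq: "(\<lambda>y. complex_of_real (\<phi> k (s, y))) = (\<lambda>y. of_real (a s) * (of_real (space_cutoff (y / R k)) * ft (H s) y))"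
      using Wr[of s] unfolding \<phi>_eq W_def by (simp add: fun_eq_iff)
    have "fourier (\<lambda>y. complex_of_real (\<phi> k (s, y))) \<xi> = of_real (a s) * fourier (\<lambda>y. of_real (space_cutoff (y / R k)) * ft (H s) y) \<xi>" for \<xi>
      unfolding eq fourier_def by (subst integral_mult_right_zero[symmetric]) (simp only: mult_ac)
    then have f: "fourier (\<lambda>y. complex_of_real (\<phi> k (s, y))) \<xi> = of_real (a s) * smear (R k) (H s) \<xi>" for \<xi>
      unfolding fourier_cutoff[OF R(1) H1] .
    have "multiplier (\<lambda>\<xi>. frac_laplacian_symbol (1/2) \<xi> * M_symbol \<xi>) (\<lambda>y. complex_of_real (\<phi> k (s, y))) x
       = ft (\<lambda>\<xi>. of_real (a s) * G2 k s \<xi>) x / of_real (2 * pi)"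
      unfolding multiplier_def f psym_symbol
      by (subst inverse_fourier_eq_ft) (simp_all add: G2_def mult_ac)
    also have "ft (\<lambda>\<xi>. of_real (a s) * G2 k s \<xi>) x = of_real (a s) * ft (G2 k s) x"
      unfolding ft_def by (subst integral_mult_right_zero[symmetric]) (simp only: mult_ac)
    finally show ?thesis by simp
  qed

  \<comment> \<open>The integrand of the weak formulation, with b in place of the derivative of a;
    the two agree for s > 0.\<close>
  define J where "J k s x = of_real (u s x) * (of_real (space_cutoff (x / R k)) * (of_real (b s) * W s x + of_real (a s) * V s x))
      - of_real (u s x) * (of_real (a s / (2 * pi)) * ft (G2 k s) x)
      - of_real ((u s x)\<^sup>2 / 2) * (of_real (a s) * (of_real (\<chi>' (x / R k) / R k) * W s x + of_real (space_cutoff (x / R k)) * D s x))" for k s x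
  have Jj [measurable]: "(\<lambda>(s, x). J k s x) \<in> borel_measurable (borel \<Otimes>\<^sub>M borel)" for k
    unfolding J_def by measurable
  have Jm [measurable]: "J k s \<in> borel_measurable borel" for k s by measurable
  define F where "F k s = (LINT x|lborel. J k s x)" for k s
  have Fm [measurable]: "F k \<in> borel_measurable borel" for k unfolding F_def by measurable
  define c where "c k = (LINT x|lborel. complex_of_real (u0 x) * (of_real (a 0 * space_cutoff (x / R k)) * W 0 x))" for k

  have id: "(LINT s|lborel. indicator {0<..} s *\<^sub>R F k s) + c k = 0" for k
  proof -
    have inner: "(LINT x|lebesgue.
           (complex_of_real (u s x * deriv (\<lambda>s. \<phi> k (s, x)) s)
          - complex_of_real (u s x) *
              multiplier (\<lambda>\<xi>. frac_laplacian_symbol (1/2) \<xi> * M_symbol \<xi>)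
                (\<lambda>y. complex_of_real (\<phi> k (s, y))) x
          - complex_of_real ((u s x)\<^sup>2 / 2 * deriv (\<lambda>y. \<phi> k (s, y)) x))) = F k s" if "0 < s" for s
    proof -
      have "(complex_of_real (u s x * deriv (\<lambda>s. \<phi> k (s, x)) s)
          - complex_of_real (u s x) *
              multiplier (\<lambda>\<xi>. frac_laplacian_symbol (1/2) \<xi> * M_symbol \<xi>)
                (\<lambda>y. complex_of_real (\<phi> k (s, y))) x
          - complex_of_real ((u s x)\<^sup>2 / 2 * deriv (\<lambda>y. \<phi> k (s, y)) x)) = J k s x" for x
        unfolding of_real_mult[of "u s x"] of_real_mult[of "(u s x)\<^sup>2 / 2"] \<phi>t[OF that] \<phi>x \<phi>m J_def ..
      then show ?thesis unfolding F_def by (simp add: integral_completion)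
    qed
    have "(LINT s|lebesgue_on {0<..}. LINT x|lebesgue.
           (complex_of_real (u s x * deriv (\<lambda>s. \<phi> k (s, x)) s)
          - complex_of_real (u s x) *
              multiplier (\<lambda>\<xi>. frac_laplacian_symbol (1/2) \<xi> * M_symbol \<xi>)
                (\<lambda>y. complex_of_real (\<phi> k (s, y))) x
          - complex_of_real ((u s x)\<^sup>2 / 2 * deriv (\<lambda>y. \<phi> k (s, y)) x))) = (LINT s|lebesgue_on {0<..}. F k s)"
      by (rule Bochner_Integration.integral_cong[OF refl], rule inner) simp
    also have "\<dots> = (LINT s|lebesgue. indicator {0<..} s *\<^sub>R F k s)"
      by (rule integral_restrict_space) simp
    also have "\<dots> = (LINT s|lborel. indicator {0<..} s *\<^sub>R F k s)"
      by (rule integral_completion) measurable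
    finally have 1: "(LINT s|lebesgue_on {0<..}. LINT x|lebesgue.
           (complex_of_real (u s x * deriv (\<lambda>s. \<phi> k (s, x)) s)
          - complex_of_real (u s x) *
              multiplier (\<lambda>\<xi>. frac_laplacian_symbol (1/2) \<xi> * M_symbol \<xi>)
                (\<lambda>y. complex_of_real (\<phi> k (s, y))) x
          - complex_of_real ((u s x)\<^sup>2 / 2 * deriv (\<lambda>y. \<phi> k (s, y)) x))) = (LINT s|lborel. indicator {0<..} s *\<^sub>R F k s)" .
    have "complex_of_real (LINT x|lebesgue. u0 x * \<phi> k (0, x)) = (LINT x|lebesgue. complex_of_real (u0 x * \<phi> k (0, x)))"
      by (rule integral_complex_of_real[symmetric])
    also have "\<dots> = (LINT x|lebesgue. complex_of_real (u0 x) * (of_real (a 0 * space_cutoff (x / R k)) * W 0 x))"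
      using Wr[of 0] by (simp add: \<phi>_eq mult_ac)
    also have "\<dots> = c k" unfolding c_def by (rule integral_completion) measurable
    finally have 2: "complex_of_real (LINT x|lebesgue. u0 x * \<phi> k (0, x)) = c k" .
    show ?thesis using weak test[of k] unfolding weak_solution_def 1[symmetric] 2[symmetric] by blast
  qed

  define BH where "BH = exp ((\<bar>t\<bar> + L) * (1 + n\<^sup>2))"
  have BH0: "0 \<le> BH" by (simp add: BH_def)
  have HB: "norm (H s \<xi>) \<le> BH" if "\<bar>s\<bar> \<le> L" for s \<xi>
    unfolding H_def BH_def by (rule norm_mode_le[OF n]) (use that in simp)
  have pHB: "norm (of_real (psym \<xi>) * H s \<xi>) \<le> (1 + n\<^sup>2) * BH" if "\<bar>s\<bar> \<le> L" for s \<xi>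
    using Hsupp[of \<xi> s] psym_le_support[of \<xi> n] psym_nonneg[of \<xi>] HB[OF that, of \<xi>] BH0
    by (cases "n < \<bar>\<xi>\<bar>") (auto simp: norm_mult intro!: mult_mono)
  have dHB: "norm (\<i> * of_real \<xi> * H s \<xi>) \<le> n * BH" if "\<bar>s\<bar> \<le> L" for s \<xi>
    using Hsupp[of \<xi> s] HB[OF that, of \<xi>] BH0 n
    by (cases "n < \<bar>\<xi>\<bar>") (auto simp: norm_mult intro!: mult_mono)
  have pHsupp: "of_real (psym \<xi>) * H s \<xi> = 0" and dHsupp: "\<i> * of_real \<xi> * H s \<xi> = 0" if "n < \<bar>\<xi>\<bar>" for s \<xi>
    using Hsupp[OF that] by auto
  have pHm: "(\<lambda>\<xi>. of_real (psym \<xi>) * H s \<xi>) \<in> borel_measurable borel" and dHm: "(\<lambda>\<xi>. \<i> * of_real \<xi> * H s \<xi>) \<in> borel_measurable borel" for s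
    by measurable
  note Wf = bounded_support_facts[OF Hm n HB Hsupp, folded W_def]
  note Vf = bounded_support_facts[OF pHm n pHB pHsupp, folded V_def]
  note Df = bounded_support_facts[OF dHm n dHB dHsupp, folded D_def]

  define CX where "CX = 4 * (1 + n\<^sup>2)\<^sup>2 * (LINT z|lborel. (1 + z\<^sup>2)\<^sup>2 * norm (cutoff_ft z))"
  define C2 where "C2 = BH * CX"
  have C20: "0 \<le> C2" unfolding C2_def CX_def by (intro mult_nonneg_nonneg BH0) auto
  have G2B: "norm (G2 k s \<xi>) \<le> C2 * (1 / (1 + \<xi>\<^sup>2))" if "\<bar>s\<bar> \<le> L" for k s \<xi>
  proof -
    have p: "0 < 1 + \<xi>\<^sup>2" by (simp add: add_pos_nonneg)
    have "(1 + \<xi>\<^sup>2)\<^sup>2 * norm (smear (R k) (H s) \<xi>) \<le> C2"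
      unfolding C2_def CX_def by (rule smear_bound(2)[OF Hm n R(2) HB[OF that] Hsupp])
    moreover have "(1 + \<xi>\<^sup>2) * norm (G2 k s \<xi>) \<le> (1 + \<xi>\<^sup>2)\<^sup>2 * norm (smear (R k) (H s) \<xi>)"
      unfolding G2_def norm_mult power2_eq_square[of "1 + \<xi>\<^sup>2"] mult.assoc
      using psym_le[of \<xi>] psym_nonneg[of \<xi>] p by (intro mult_left_mono mult_right_mono) auto
    ultimately have "(1 + \<xi>\<^sup>2) * norm (G2 k s \<xi>) \<le> C2" by linarith
    then show ?thesis using p by (simp add: pos_le_divide_eq mult.commute)
  qed
  have q_le: "(1 / (1 + \<xi>\<^sup>2))\<^sup>2 \<le> 1 / (1 + \<xi>\<^sup>2)" for \<xi> :: real
    unfolding power2_eq_square[of "1 / (1 + \<xi>\<^sup>2)"] by (rule mult_left_le) (auto simp: add_pos_nonneg)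
  have G2sq: "(norm (G2 k s \<xi>))\<^sup>2 \<le> C2\<^sup>2 * (1 / (1 + \<xi>\<^sup>2))" if "\<bar>s\<bar> \<le> L" for k s \<xi>
  proof -
    have "(norm (G2 k s \<xi>))\<^sup>2 \<le> (C2 * (1 / (1 + \<xi>\<^sup>2)))\<^sup>2" by (intro power_mono G2B that) simp
    also have "\<dots> \<le> C2\<^sup>2 * (1 / (1 + \<xi>\<^sup>2))"
      unfolding power_mult_distrib by (intro mult_left_mono q_le) simp
    finally show ?thesis .
  qed
  note q_int = integrable_inverse_one_plus_sq
  have G21: "integrable lborel (G2 k s)" if "\<bar>s\<bar> \<le> L" for k s
    by (rule Bochner_Integration.integrable_bound[OF integrable_mult_right[OF q_int, of C2]])
       (use order_trans[OF G2B[OF that] abs_ge_self] in auto)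
  have G22: "integrable lborel (\<lambda>\<xi>. (norm (G2 k s \<xi>))\<^sup>2)" if "\<bar>s\<bar> \<le> L" for k s
    by (rule Bochner_Integration.integrable_bound[OF integrable_mult_right[OF q_int, of "C2\<^sup>2"]])
       (use order_trans[OF G2sq[OF that] abs_ge_self] in auto)
  define K2 where "K2 = sqrt (2 * pi * (LINT \<xi>|lborel. C2\<^sup>2 * (1 / (1 + \<xi>\<^sup>2))))"
  have K2: "sqrt (LINT x|lborel. (norm (ft (G2 k s) x))\<^sup>2) \<le> K2" if "\<bar>s\<bar> \<le> L" for k s
  proof -
    have "(LINT x|lborel. (norm (ft (G2 k s) x))\<^sup>2) \<le> 2 * pi * (LINT \<xi>|lborel. (norm (G2 k s \<xi>))\<^sup>2)"
      by (rule ft_L2_bound(2)[OF G21[OF that] G22[OF that]])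
    also have "\<dots> \<le> 2 * pi * (LINT \<xi>|lborel. C2\<^sup>2 * (1 / (1 + \<xi>\<^sup>2)))"
      by (intro mult_left_mono integral_mono[OF G22[OF that] integrable_mult_right[OF q_int] G2sq[OF that]]) simp
    finally show ?thesis unfolding K2_def by (rule real_sqrt_le_mono)
  qed

  have cW2: "integrable lborel (\<lambda>x. (norm (of_real (space_cutoff (x / R k)) * h x))\<^sup>2)"
     "sqrt (LINT x|lborel. (norm (of_real (space_cutoff (x / R k)) * h x))\<^sup>2) \<le> sqrt (LINT x|lborel. (norm (h x))\<^sup>2)"
    if [measurable]: "h \<in> borel_measurable borel" and h: "integrable lborel (\<lambda>x. (norm (h x))\<^sup>2)" for k and h :: "real \<Rightarrow> complex"
  proof -
    have le: "(norm (of_real (space_cutoff (x / R k)) * h x))\<^sup>2 \<le> (norm (h x))\<^sup>2" for x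
      unfolding norm_mult norm_of_real using space_cutoff_bounds[of "x / R k"]
      by (intro power_mono mult_left_le_one_le) auto
    show i: "integrable lborel (\<lambda>x. (norm (of_real (space_cutoff (x / R k)) * h x))\<^sup>2)"
      by (rule Bochner_Integration.integrable_bound[OF h]) (use le in auto)
    show "sqrt (LINT x|lborel. (norm (of_real (space_cutoff (x / R k)) * h x))\<^sup>2) \<le> sqrt (LINT x|lborel. (norm (h x))\<^sup>2)"
      by (intro real_sqrt_le_mono integral_mono[OF i h le])
  qed
  have cut_lim: "(\<lambda>k. space_cutoff (x / R k)) \<longlonglongrightarrow> 1" for x
  proof (rule tendsto_eventually)
    have "eventually (\<lambda>k. \<bar>x\<bar> \<le> real k) sequentially"
      using filterlim_real_sequentially by (simp add: filterlim_at_top)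
    then show "eventually (\<lambda>k. space_cutoff (x / R k) = 1) sequentially"
    proof eventually_elim
      case (elim k)
      then have "\<bar>x / R k\<bar> \<le> 1" using R[of k] by (simp add: R_def field_simps)
      then show ?case by (rule space_cutoff_eq_1)
    qed
  qed
  have cut_int_lim: "(\<lambda>k. LINT x|lborel. f x * (of_real (space_cutoff (x / R k)) * h x)) \<longlonglongrightarrow> (LINT x|lborel. f x * h x)"
    if [measurable]: "f \<in> borel_measurable borel" "h \<in> borel_measurable borel" and fh: "integrable lborel (\<lambda>x. f x * h x)"
    for f h :: "real \<Rightarrow> complex"
  proof (rule integral_dominated_convergence[where w = "\<lambda>x. norm (f x * h x)"])
    show "integrable lborel (\<lambda>x. norm (f x * h x))" using fh by simp
    have "(\<lambda>k. f x * (of_real (space_cutoff (x / R k)) * h x)) \<longlonglongrightarrow> f x * (of_real 1 * h x)" for x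
      by (intro tendsto_intros cut_lim)
    then show "AE x in lborel. (\<lambda>k. f x * (of_real (space_cutoff (x / R k)) * h x)) \<longlonglongrightarrow> f x * h x" by simp
    have "norm (f x * (of_real (space_cutoff (x / R k)) * h x)) \<le> norm (f x * h x)" for k x
      unfolding norm_mult norm_of_real using space_cutoff_bounds[of "x / R k"]
      by (intro mult_left_mono mult_left_le_one_le) auto
    then show "AE x in lborel. norm (f x * (of_real (space_cutoff (x / R k)) * h x)) \<le> norm (f x * h x)" for k by simp
  qed measurable

  define Wp where "Wp s = (LINT x|lborel. of_real (u s x) * W s x)" for s
  define Vp where "Vp s = (LINT x|lborel. of_real (u s x) * V s x)" for s
  define Q where "Q s = (LINT x|lborel. of_real ((u s x)\<^sup>2) * D s x)" for s
  \<comment> \<open>I1 and I2 come from the time derivative, I3 from the operator, I4 from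
    differentiating the cutoff and I5 from differentiating w in x.\<close>
  define I1 where "I1 k s = (LINT x|lborel. of_real (u s x) * (of_real (space_cutoff (x / R k)) * W s x))" for k s
  define I2 where "I2 k s = (LINT x|lborel. of_real (u s x) * (of_real (space_cutoff (x / R k)) * V s x))" for k s
  define I3 where "I3 k s = (LINT x|lborel. of_real (u s x) * ft (G2 k s) x)" for k s
  define I4 where "I4 k s = (LINT x|lborel. of_real ((u s x)\<^sup>2) * (of_real (\<chi>' (x / R k) / R k) * W s x))" for k s
  define I5 where "I5 k s = (LINT x|lborel. of_real ((u s x)\<^sup>2) * (of_real (space_cutoff (x / R k)) * D s x))" for k s

  \<comment> \<open>Differentiating the cutoff gains 1 / R, which makes I4 vanish in the limit
    although u^2 is merely integrable.\<close>
  have chiW: "norm (of_real (\<chi>' (x / R k) / R k) * W s x) \<le> X / R k * (2 * n * BH)" if "\<bar>s\<bar> \<le> L" for k s x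
    unfolding norm_mult norm_of_real using X R[of k]
    by (intro mult_mono Wf(3)[OF that]) (auto simp: divide_right_mono)
  have chiD: "norm (of_real (space_cutoff (x / R k)) * D s x) \<le> 2 * n * (n * BH)" if "\<bar>s\<bar> \<le> L" for k s x
  proof -
    have "norm (of_real (space_cutoff (x / R k)) * D s x) \<le> 1 * norm (D s x)"
      unfolding norm_mult norm_of_real using space_cutoff_bounds[of "x / R k"] by (intro mult_right_mono) auto
    then show ?thesis using Df(3)[OF that, of x] by simp
  qed
  have decomp: "F k s = of_real (b s) * I1 k s + of_real (a s) * I2 k s - of_real (a s / (2 * pi)) * I3 k s - of_real (a s / 2) * (I4 k s + I5 k s)"
    if s: "\<bar>s\<bar> \<le> L" for k s
  proof -
    have i1: "integrable lborel (\<lambda>x. of_real (u s x) * (of_real (space_cutoff (x / R k)) * W s x))"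
      by (rule u_pair(1)) (use cW2(1)[OF Wm Wf(4)[OF s]] in measurable)
    have i2: "integrable lborel (\<lambda>x. of_real (u s x) * (of_real (space_cutoff (x / R k)) * V s x))"
      by (rule u_pair(1)) (use cW2(1)[OF Vm Vf(4)[OF s]] in measurable)
    have i3: "integrable lborel (\<lambda>x. of_real (u s x) * ft (G2 k s) x)"
      by (rule u_pair(1)[OF _ ft_L2_bound(1)[OF G21[OF s] G22[OF s]]]) measurable
    have i4: "integrable lborel (\<lambda>x. of_real ((u s x)\<^sup>2) * (of_real (\<chi>' (x / R k) / R k) * W s x))"
      by (rule u_quad(1)[OF _ chiW[OF s]]) measurable
    have i5: "integrable lborel (\<lambda>x. of_real ((u s x)\<^sup>2) * (of_real (space_cutoff (x / R k)) * D s x))"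
      by (rule u_quad(1)[OF _ chiD[OF s]]) measurable
    have "J k s x = of_real (b s) * (of_real (u s x) * (of_real (space_cutoff (x / R k)) * W s x))
       + of_real (a s) * (of_real (u s x) * (of_real (space_cutoff (x / R k)) * V s x))
       - of_real (a s / (2 * pi)) * (of_real (u s x) * ft (G2 k s) x)
       - of_real (a s / 2) * (of_real ((u s x)\<^sup>2) * (of_real (\<chi>' (x / R k) / R k) * W s x) + of_real ((u s x)\<^sup>2) * (of_real (space_cutoff (x / R k)) * D s x))" for x
      unfolding J_def by (simp add: algebra_simps)
    then have "F k s = (LINT x|lborel. of_real (b s) * (of_real (u s x) * (of_real (space_cutoff (x / R k)) * W s x))
       + of_real (a s) * (of_real (u s x) * (of_real (space_cutoff (x / R k)) * V s x))
       - of_real (a s / (2 * pi)) * (of_real (u s x) * ft (G2 k s) x)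
       - of_real (a s / 2) * (of_real ((u s x)\<^sup>2) * (of_real (\<chi>' (x / R k) / R k) * W s x) + of_real ((u s x)\<^sup>2) * (of_real (space_cutoff (x / R k)) * D s x)))"
      unfolding F_def by (rule Bochner_Integration.integral_cong[OF refl])
    also have "\<dots> = of_real (b s) * I1 k s + of_real (a s) * I2 k s - of_real (a s / (2 * pi)) * I3 k s - of_real (a s / 2) * (I4 k s + I5 k s)"
      unfolding I1_def I2_def I3_def I4_def I5_def
      by (simp only: Bochner_Integration.integral_diff Bochner_Integration.integral_add integral_mult_right_zero
          Bochner_Integration.integrable_diff Bochner_Integration.integrable_add integrable_mult_right i1 i2 i3 i4 i5)
    finally show ?thesis .
  qed
  define K where "K = B1 * (M * (sqrt (4 * pi * n) * BH)) + A1 * (M * (sqrt (4 * pi * n) * ((1 + n\<^sup>2) * BH)))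
      + A1 / (2 * pi) * (M * K2) + A1 / 2 * (M\<^sup>2 * (X * (2 * n * BH)) + M\<^sup>2 * (2 * n * (n * BH)))"
  have A10: "0 \<le> A1" and B10: "0 \<le> B1" using a1[of 0] b1[of 0] by linarith+
  have FB: "norm (F k s) \<le> K" if s: "\<bar>s\<bar> \<le> L" for k s
  proof -
    have 1: "norm (I1 k s) \<le> M * (sqrt (4 * pi * n) * BH)"
      unfolding I1_def
      by (rule order_trans[OF u_pair(2) mult_left_mono[OF order_trans[OF cW2(2) Wf(5)] M]])
         (use cW2(1)[OF Wm Wf(4)[OF s]] Wf(4)[OF s] s in measurable)
    have 2: "norm (I2 k s) \<le> M * (sqrt (4 * pi * n) * ((1 + n\<^sup>2) * BH))"
      unfolding I2_def
      by (rule order_trans[OF u_pair(2) mult_left_mono[OF order_trans[OF cW2(2) Vf(5)] M]])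
         (use cW2(1)[OF Vm Vf(4)[OF s]] Vf(4)[OF s] s in measurable)
    have 3: "norm (I3 k s) \<le> M * K2"
      unfolding I3_def
      by (rule order_trans[OF u_pair(2)[OF _ ft_L2_bound(1)[OF G21[OF s] G22[OF s]]] mult_left_mono[OF K2[OF s] M]]) measurable
    have 4: "norm (I4 k s) \<le> M\<^sup>2 * (X * (2 * n * BH))"
    proof -
      have "norm (I4 k s) \<le> M\<^sup>2 * (X / R k * (2 * n * BH))"
        unfolding I4_def by (rule u_quad(2)[OF _ chiW[OF s]]) measurable
      also have "\<dots> \<le> M\<^sup>2 * (X / 1 * (2 * n * BH))"
        using X R[of k] n BH0 by (intro mult_left_mono mult_right_mono divide_left_mono) auto
      finally show ?thesis by simp
    qed
    have 5: "norm (I5 k s) \<le> M\<^sup>2 * (2 * n * (n * BH))"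
      unfolding I5_def by (rule u_quad(2)[OF _ chiD[OF s]]) measurable
    have "norm (F k s) \<le> norm (of_real (b s) * I1 k s) + norm (of_real (a s) * I2 k s) + norm (of_real (a s / (2 * pi)) * I3 k s) + norm (of_real (a s / 2) * (I4 k s + I5 k s))"
      unfolding decomp[OF s] by (intro order_trans[OF norm_triangle_ineq4] add_mono norm_triangle_ineq order_refl)
    also have "\<dots> \<le> K"
      unfolding K_def norm_mult norm_of_real abs_divide
      using a1[of s] b1[of s] A10 B10 M
      by (intro add_mono mult_mono 1 2 3 order_trans[OF norm_triangle_ineq add_mono[OF 4 5]]) (auto simp: divide_right_mono)
    finally show ?thesis .
  qed
  have lim: "(\<lambda>k. F k s) \<longlonglongrightarrow> of_real (b s) * Wp s - of_real (a s / 2) * Q s" if s: "\<bar>s\<bar> \<le> L" for s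
  proof -
    have 1: "(\<lambda>k. I1 k s) \<longlonglongrightarrow> Wp s" unfolding I1_def Wp_def
      by (rule cut_int_lim) (use u_pair(1)[OF Wm Wf(4)[OF s]] in measurable)
    have 2: "(\<lambda>k. I2 k s) \<longlonglongrightarrow> Vp s" unfolding I2_def Vp_def
      by (rule cut_int_lim) (use u_pair(1)[OF Vm Vf(4)[OF s]] in measurable)
    have 5: "(\<lambda>k. I5 k s) \<longlonglongrightarrow> Q s" unfolding I5_def Q_def
      by (rule cut_int_lim) (use u_quad(1)[OF Dm Df(3)[OF s]] in measurable)
    have 4: "(\<lambda>k. I4 k s) \<longlonglongrightarrow> 0"
    proof (rule Lim_null_comparison)
      show "eventually (\<lambda>k. norm (I4 k s) \<le> M\<^sup>2 * (X / R k * (2 * n * BH))) sequentially"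
        unfolding I4_def by (intro always_eventually allI u_quad(2)[OF _ chiW[OF s]]) measurable
      have "(\<lambda>k. X / R k) \<longlonglongrightarrow> 0"
        unfolding R_def by (rule LIMSEQ_Suc[OF tendsto_divide_0[OF tendsto_const]]) (auto intro: filterlim_at_top_imp_at_infinity filterlim_real_sequentially)
      then show "(\<lambda>k. M\<^sup>2 * (X / R k * (2 * n * BH))) \<longlonglongrightarrow> 0"
        by (intro tendsto_mult_right_zero tendsto_mult_left_zero)
    qed
    \<comment> \<open>Since u(s) is only known to be square integrable, the transforms have to
      converge in \<open>L\<^sup>2\<close>. The difference E tends to 0 pointwise by
      \<open>smear_tendsto\<close>, under the square integrable majorant \<open>CE\<close> / (1 +
      \<xi>^2), and the Plancherel inequality carries this over to x.\<close>
    have 3: "(\<lambda>k. I3 k s) \<longlonglongrightarrow> of_real (2 * pi) * Vp s"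
    proof -
      define E where "E k \<xi> = G2 k s \<xi> - of_real (2 * pi) * (of_real (psym \<xi>) * H s \<xi>)" for k \<xi>
      have Em [measurable]: "E k \<in> borel_measurable borel" for k unfolding E_def[abs_def] by measurable
      have pH: "norm (of_real (psym \<xi>) * H s \<xi>) \<le> (1 + n\<^sup>2) * ((1 + n\<^sup>2) * BH) * (1 / (1 + \<xi>\<^sup>2))" for \<xi>
      proof (cases "n < \<bar>\<xi>\<bar>")
        case True
        then show ?thesis using Hsupp[OF True] BH0 by (simp add: add_pos_nonneg)
      next
        case False
        then have "\<xi>\<^sup>2 \<le> n\<^sup>2" using power_mono[of "\<bar>\<xi>\<bar>" n 2] by simp
        then have 1: "1 \<le> (1 + n\<^sup>2) * (1 / (1 + \<xi>\<^sup>2))" by (simp add: add_pos_nonneg)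
        have "norm (of_real (psym \<xi>) * H s \<xi>) \<le> 1 * ((1 + n\<^sup>2) * BH)" using pHB[OF s] by simp
        also have "\<dots> \<le> ((1 + n\<^sup>2) * (1 / (1 + \<xi>\<^sup>2))) * ((1 + n\<^sup>2) * BH)"
          using 1 BH0 by (intro mult_right_mono) auto
        finally show ?thesis by (simp add: mult_ac)
      qed
      define CE where "CE = C2 + 2 * pi * ((1 + n\<^sup>2) * ((1 + n\<^sup>2) * BH))"
      have EB: "norm (E k \<xi>) \<le> CE * (1 / (1 + \<xi>\<^sup>2))" for k \<xi>
      proof -
        have "norm (E k \<xi>) \<le> norm (G2 k s \<xi>) + 2 * pi * norm (of_real (psym \<xi>) * H s \<xi>)"
          unfolding E_def by (rule order_trans[OF norm_triangle_ineq4]) (simp add: norm_mult)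
        also have "\<dots> \<le> C2 * (1 / (1 + \<xi>\<^sup>2)) + 2 * pi * ((1 + n\<^sup>2) * ((1 + n\<^sup>2) * BH) * (1 / (1 + \<xi>\<^sup>2)))"
          by (intro add_mono G2B[OF s] mult_left_mono pH) simp
        also have "\<dots> = CE * (1 / (1 + \<xi>\<^sup>2))" by (simp add: CE_def algebra_simps add_divide_distrib)
        finally show ?thesis .
      qed
      have Esq: "(norm (E k \<xi>))\<^sup>2 \<le> CE\<^sup>2 * (1 / (1 + \<xi>\<^sup>2))" for k \<xi>
      proof -
        have "(norm (E k \<xi>))\<^sup>2 \<le> (CE * (1 / (1 + \<xi>\<^sup>2)))\<^sup>2" by (intro power_mono EB) simp
        also have "\<dots> \<le> CE\<^sup>2 * (1 / (1 + \<xi>\<^sup>2))"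
          unfolding power_mult_distrib by (intro mult_left_mono q_le) simp
        finally show ?thesis .
      qed
      have E1: "integrable lborel (E k)" for k
        unfolding E_def by (intro Bochner_Integration.integrable_diff G21[OF s] integrable_mult_right pH1)
      have E2: "integrable lborel (\<lambda>\<xi>. (norm (E k \<xi>))\<^sup>2)" for k
        by (rule Bochner_Integration.integrable_bound[OF integrable_mult_right[OF q_int, of "CE\<^sup>2"]])
           (use order_trans[OF Esq abs_ge_self] in auto)
      have Elim: "(\<lambda>k. LINT \<xi>|lborel. (norm (E k \<xi>))\<^sup>2) \<longlonglongrightarrow> (LINT \<xi>|(lborel :: real measure). 0 :: real)"
      proof (rule integral_dominated_convergence[where w = "\<lambda>\<xi>. CE\<^sup>2 * (1 / (1 + \<xi>\<^sup>2))"])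
        show "integrable lborel (\<lambda>\<xi>. CE\<^sup>2 * (1 / (1 + \<xi>\<^sup>2)))" by (rule integrable_mult_right[OF q_int])
        have "(\<lambda>k. E k \<xi>) \<longlonglongrightarrow> of_real (psym \<xi>) * (of_real (2 * pi) * H s \<xi>) - of_real (2 * pi) * (of_real (psym \<xi>) * H s \<xi>)" for \<xi>
          unfolding E_def G2_def R_def
          by (intro tendsto_diff tendsto_mult tendsto_const smear_tendsto[OF _ HB[OF s]]) (simp add: H_def mode_continuous[OF n])
        then have "(\<lambda>k. E k \<xi>) \<longlonglongrightarrow> 0" for \<xi> by (simp add: mult_ac)
        then have "(\<lambda>k. (norm (E k \<xi>))\<^sup>2) \<longlonglongrightarrow> 0" for \<xi>
          using tendsto_power[OF tendsto_norm, of "\<lambda>k. E k \<xi>" 0 sequentially 2] by simp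
        then show "AE \<xi> in lborel. (\<lambda>k. (norm (E k \<xi>))\<^sup>2) \<longlonglongrightarrow> 0" by simp
        show "AE \<xi> in lborel. norm ((norm (E k \<xi>))\<^sup>2) \<le> CE\<^sup>2 * (1 / (1 + \<xi>\<^sup>2))" for k using Esq by simp
      qed measurable
      have diff: "I3 k s - of_real (2 * pi) * Vp s = (LINT x|lborel. of_real (u s x) * ft (E k) x)" for k
      proof -
        have i3: "integrable lborel (\<lambda>x. of_real (u s x) * ft (G2 k s) x)"
          by (rule u_pair(1)[OF _ ft_L2_bound(1)[OF G21[OF s] G22[OF s]]]) measurable
        have iv: "integrable lborel (\<lambda>x. of_real (2 * pi) * (of_real (u s x) * V s x))"
          by (rule integrable_mult_right[OF u_pair(1)[OF Vm Vf(4)[OF s]]])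
        have "ft (E k) x = ft (G2 k s) x - of_real (2 * pi) * V s x" for x
        proof -
          have c: "integrable lborel (\<lambda>\<xi>. of_real (2 * pi) * (cis (x * \<xi>) * (of_real (psym \<xi>) * H s \<xi>)))"
            by (intro integrable_mult_right integrable_cis_mult pH1)
          have "ft (E k) x = (LINT \<xi>|lborel. cis (x * \<xi>) * G2 k s \<xi> - of_real (2 * pi) * (cis (x * \<xi>) * (of_real (psym \<xi>) * H s \<xi>)))"
            unfolding ft_def E_def by (simp add: algebra_simps)
          also have "\<dots> = ft (G2 k s) x - of_real (2 * pi) * V s x"
            unfolding V_def ft_def Bochner_Integration.integral_diff[OF integrable_cis_mult[OF G21[OF s]] c] integral_mult_right_zero ..
          finally show ?thesis .
        qed
        then have "of_real (u s x) * ft (E k) x = of_real (u s x) * ft (G2 k s) x - of_real (2 * pi) * (of_real (u s x) * V s x)" for x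
          by (simp only: right_diff_distrib mult.left_commute)
        then have "(LINT x|lborel. of_real (u s x) * ft (E k) x) = (LINT x|lborel. of_real (u s x) * ft (G2 k s) x - of_real (2 * pi) * (of_real (u s x) * V s x))"
          by (simp only:)
        also have "\<dots> = I3 k s - of_real (2 * pi) * Vp s"
          unfolding I3_def Vp_def Bochner_Integration.integral_diff[OF i3 iv] integral_mult_right_zero ..
        finally show ?thesis by simp
      qed
      have "(\<lambda>k. I3 k s - of_real (2 * pi) * Vp s) \<longlonglongrightarrow> 0"
      proof (rule Lim_null_comparison)
        have "norm (I3 k s - of_real (2 * pi) * Vp s) \<le> M * sqrt (2 * pi * (LINT \<xi>|lborel. (norm (E k \<xi>))\<^sup>2))" for k
        proof -
          have "norm (I3 k s - of_real (2 * pi) * Vp s) \<le> M * sqrt (LINT x|lborel. (norm (ft (E k) x))\<^sup>2)"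
            unfolding diff by (rule u_pair(2)[OF _ ft_L2_bound(1)[OF E1 E2]]) measurable
          also have "\<dots> \<le> M * sqrt (2 * pi * (LINT \<xi>|lborel. (norm (E k \<xi>))\<^sup>2))"
            by (intro mult_left_mono real_sqrt_le_mono ft_L2_bound(2)[OF E1 E2] M)
          finally show ?thesis .
        qed
        then show "eventually (\<lambda>k. norm (I3 k s - of_real (2 * pi) * Vp s) \<le> M * sqrt (2 * pi * (LINT \<xi>|lborel. (norm (E k \<xi>))\<^sup>2))) sequentially"
          by simp
        have "(\<lambda>k. M * sqrt (2 * pi * (LINT \<xi>|lborel. (norm (E k \<xi>))\<^sup>2))) \<longlonglongrightarrow> M * sqrt (2 * pi * (LINT \<xi>|(lborel :: real measure). (0::real)))"
          by (intro tendsto_mult tendsto_const tendsto_real_sqrt Elim)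
        then show "(\<lambda>k. M * sqrt (2 * pi * (LINT \<xi>|lborel. (norm (E k \<xi>))\<^sup>2))) \<longlonglongrightarrow> 0" by simp
      qed
      then show ?thesis by (rule LIM_zero_cancel)
    qed
    have "(\<lambda>k. F k s) \<longlonglongrightarrow> of_real (b s) * Wp s + of_real (a s) * Vp s - of_real (a s / (2 * pi)) * (of_real (2 * pi) * Vp s) - of_real (a s / 2) * (0 + Q s)"
      unfolding decomp[OF s] by (intro tendsto_intros 1 2 3 4 5)
    \<comment> \<open>The limits of the I2 term and of the operator term cancel: this is the
      backward equation at work.\<close>
    moreover have "of_real (a s / (2 * pi)) * (of_real (2 * pi) * Vp s) = of_real (a s) * Vp s"
      by simp
    ultimately show ?thesis by simp
  qed
  have F0: "F k s = 0" if "L < s" for k s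
    using aL[of s] bL[of s] that L unfolding F_def J_def by simp
  have main_lim: "(\<lambda>k. LINT s|lborel. indicator {0<..} s *\<^sub>R F k s) \<longlonglongrightarrow> (LINT s|lborel. indicator {0<..} s *\<^sub>R (of_real (b s) * Wp s - of_real (a s / 2) * Q s))"
  proof (rule integral_dominated_convergence[where w = "\<lambda>s. K * indicator {0..L} s"])
    show "(\<lambda>s. indicator {0<..} s *\<^sub>R (of_real (b s) * Wp s - of_real (a s / 2) * Q s)) \<in> borel_measurable lborel"
      unfolding Wp_def Q_def by measurable
    show "integrable lborel (\<lambda>s. K * indicator {0..L} s :: real)"
      by (intro integrable_mult_right integrable_real_indicator) (auto simp: emeasure_lborel_Icc_eq)
    show "AE s in lborel. (\<lambda>k. indicator {0<..} s *\<^sub>R F k s) \<longlonglongrightarrow> indicator {0<..} s *\<^sub>R (of_real (b s) * Wp s - of_real (a s / 2) * Q s)"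
    proof (intro AE_I2)
      fix s
      show "(\<lambda>k. indicator {0<..} s *\<^sub>R F k s) \<longlonglongrightarrow> indicator {0<..} s *\<^sub>R (of_real (b s) * Wp s - of_real (a s / 2) * Q s)"
      proof (cases "0 < s \<and> s \<le> L")
        case True
        then show ?thesis by (intro tendsto_scaleR tendsto_const lim) auto
      next
        case False
        then show ?thesis using F0[of s] aL[of s] bL[of s] L by (auto simp: indicator_def)
      qed
    qed
    show "AE s in lborel. norm (indicator {0<..} s *\<^sub>R F k s) \<le> K * indicator {0..L} s" for k
    proof (intro AE_I2)
      fix s
      show "norm (indicator {0<..} s *\<^sub>R F k s) \<le> K * indicator {0..L} s"
      proof (cases "0 < s \<and> s \<le> L")
        case True
        then show ?thesis using FB[of s k] by simp
      next
        case False
        then show ?thesis using F0[of s k] FB[of 0 k] L order_trans[OF norm_ge_zero FB[of 0 k]] by (auto simp: indicator_def)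
      qed
    qed
  qed measurable
  have c_lim: "c \<longlonglongrightarrow> of_real (a 0) * (LINT x|lborel. of_real (u0 x) * W 0 x)"
  proof -
    have u02: "integrable lborel (\<lambda>x. (norm (complex_of_real (u0 x)))\<^sup>2)" using u0_int by simp
    have i: "integrable lborel (\<lambda>x. of_real (u0 x) * (of_real (a 0) * W 0 x))"
    proof -
      have "integrable lborel (\<lambda>x. of_real (u0 x) * W 0 x)"
        by (rule Cauchy_Schwarz_integral(1)[OF _ _ u02 Wf(4)]) (use L in auto)
      then have "integrable lborel (\<lambda>x. of_real (a 0) * (of_real (u0 x) * W 0 x))" by (rule integrable_mult_right)
      then show ?thesis by (simp only: mult_ac)
    qed
    have "(\<lambda>k. LINT x|lborel. of_real (u0 x) * (of_real (space_cutoff (x / R k)) * (of_real (a 0) * W 0 x))) \<longlonglongrightarrow> (LINT x|lborel. of_real (u0 x) * (of_real (a 0) * W 0 x))"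
      by (rule cut_int_lim) (use i in measurable)
    moreover have "(LINT x|lborel. of_real (u0 x) * (of_real (a 0) * W 0 x)) = of_real (a 0) * (LINT x|lborel. of_real (u0 x) * W 0 x)"
      by (subst integral_mult_right_zero[symmetric]) (simp only: mult_ac)
    moreover have "c = (\<lambda>k. LINT x|lborel. of_real (u0 x) * (of_real (space_cutoff (x / R k)) * (of_real (a 0) * W 0 x)))"
      by (rule ext) (simp only: c_def of_real_mult mult_ac)
    ultimately show ?thesis by (simp only:)
  qed
  have "(\<lambda>k. (LINT s|lborel. indicator {0<..} s *\<^sub>R F k s) + c k) \<longlonglongrightarrow>
    (LINT s|lborel. indicator {0<..} s *\<^sub>R (of_real (b s) * Wp s - of_real (a s / 2) * Q s)) + of_real (a 0) * (LINT x|lborel. of_real (u0 x) * W 0 x)"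
    by (intro tendsto_add main_lim c_lim)
  then have "(LINT s|lborel. indicator {0<..} s *\<^sub>R (of_real (b s) * Wp s - of_real (a s / 2) * Q s)) + of_real (a 0) * (LINT x|lborel. of_real (u0 x) * W 0 x) = 0"
    unfolding id by (rule LIMSEQ_unique[OF tendsto_const, symmetric])
  then show ?thesis unfolding Wp_def Q_def W_def D_def H_def by simp
qed

end

text \<open>Lebesgue differentiation along the intervals [s, s + h]. Only intervals with closure
  inside (0, t) enter, because these are the ones that the time cutoffs can reach.\<close>

lemma AE_norm_le_of_interval_averages:
  fixes f :: "real \<Rightarrow> complex"
  assumes [measurable]: "f \<in> borel_measurable borel" and B: "\<And>s. s \<in> {0<..<t} \<Longrightarrow> norm (f s) \<le> B"
    and avg: "\<And>\<alpha> \<beta>. 0 < \<alpha> \<Longrightarrow> \<alpha> < \<beta> \<Longrightarrow> \<beta> < t \<Longrightarrow>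
      norm (LINT s|lborel. indicator {\<alpha><..<\<beta>} s *\<^sub>R f s) \<le> C * (\<beta> - \<alpha>)"
  shows "AE s in lborel. s \<in> {0<..<t} \<longrightarrow> norm (f s) \<le> C"
proof (cases "0 < t")
  case t: True
  define g where "g s = indicator {0<..<t} s *\<^sub>R f s" for s
  have [measurable]: "g \<in> borel_measurable borel" unfolding g_def[abs_def] by measurable
  have "norm (f (t / 2)) \<le> B" by (rule B) (use t in simp)
  then have B0: "0 \<le> B" using norm_ge_zero order_trans by blast
  have g: "integrable lborel g"
    by (rule integrable_bounded_support[of _ B t]) (use B B0 in \<open>auto simp: g_def indicator_def\<close>)
  have si: "set_integrable lborel S g" if "S \<in> sets borel" for S
    unfolding set_integrable_def by (rule integrable_mult_indicator[OF _ g]) (use that in simp)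
  have "g integrable_on cbox a b" for a b
    by (rule set_borel_integral_eq_integral(1)[OF si]) simp
  then obtain N where N: "negligible N"
    and leb: "\<And>x e. x \<notin> N \<Longrightarrow> 0 < e \<Longrightarrow> \<exists>d>0. \<forall>h. 0 < h \<and> h < d \<longrightarrow> 
        norm (integral (cbox x (x + h *\<^sub>R One)) g /\<^sub>R h ^ DIM(real) - g x) < e"
    using integrable_ccontinuous_explicit[of g] by blast
  have main: "norm (f s) \<le> C" if s: "s \<in> {0<..<t}" and sN: "s \<notin> N" for s
  proof (rule field_le_epsilon)
    fix e :: real assume e: "0 < e"
    obtain d where d: "0 < d" and dh: "\<And>h. 0 < h \<Longrightarrow> h < d \<Longrightarrow> norm (integral (cbox s (s + h *\<^sub>R One)) g /\<^sub>R h ^ DIM(real) - g s) < e"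
      using leb[OF sN e] by blast
    define h where "h = min d (t - s) / 2"
    have h: "0 < h" "h < d" "s + h < t" using d s by (auto simp: h_def min_def field_simps)
    have "integral {s..s + h} g = (LINT x:{s..s + h}|lborel. g x)"
      by (rule set_borel_integral_eq_integral(2)[OF si, symmetric]) simp
    also have "\<dots> = (LINT x|lborel. indicator {s<..<s + h} x *\<^sub>R f x)"
      unfolding set_lebesgue_integral_def
    proof (rule integral_cong_AE)
      have "AE x in lborel. x \<noteq> s" "AE x in lborel. x \<noteq> s + h" by (rule AE_lborel_singleton)+
      then show "AE x in lborel. indicator {s..s + h} x *\<^sub>R g x = indicator {s<..<s + h} x *\<^sub>R f x"
        by eventually_elim (use s h in \<open>auto simp: g_def indicator_def\<close>)
    qed measurable
    finally have "norm (integral {s..s + h} g) \<le> C * h"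
      using avg[of s "s + h"] s h by simp
    then have le: "norm (integral {s..s + h} g /\<^sub>R h) \<le> C" using h by (simp add: field_simps)
    have "norm (integral {s..s + h} g /\<^sub>R h - g s) < e" using dh[OF h(1,2)] by simp
    then have "norm (g s) \<le> C + e" using le norm_triangle_sub[of "g s" "integral {s..s + h} g /\<^sub>R h"]
      by (simp add: norm_minus_commute)
    then show "norm (f s) \<le> C + e" using s by (simp add: g_def)
  qed
  have "N \<in> null_sets lebesgue" using N by (simp add: negligible_iff_null_sets)
  then have "AE s in lebesgue. s \<notin> N" by (rule AE_not_in)
  then have "AE s in lborel. s \<notin> N" by (simp add: AE_completion_iff)
  then show ?thesis by eventually_elim (use main in blast)
qed auto

section \<open>The Duhamel bound for almost every time\<close>

context weak_flow
begin

text \<open>Integral of u(s) against the backward wave whose datum at time t is concentrated at y.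
  As t decreases to s and n grows, it approaches 2 pi u(s, y), expressed as the inverting integral
  in \<open>pairing_limit\<close>.\<close>

definition pairing :: "real \<Rightarrow> real \<Rightarrow> real \<Rightarrow> real \<Rightarrow> complex" where
  "pairing n y t s = (LINT x|lborel. of_real (u s x) * ft (mode n y (t - s)) x)"

text \<open>The quadratic Duhamel term at time s, with the space derivative moved onto the
  wave.\<close>

definition flux :: "real \<Rightarrow> real \<Rightarrow> real \<Rightarrow> real \<Rightarrow> complex" where
  "flux n y t s = (LINT x|lborel. of_real ((u s x)\<^sup>2) * ft (\<lambda>\<xi>. \<i> * of_real \<xi> * mode n y (t - s) \<xi>) x)"

lemma pairing_measurable [measurable]: "pairing n y t \<in> borel_measurable borel"
proof -
  have [measurable]: "(\<lambda>(s, x). ft (mode n y (t - s)) x) \<in> borel_measurable (borel \<Otimes>\<^sub>M borel)"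
    by (rule ft_joint_measurable) measurable
  show ?thesis unfolding pairing_def[abs_def] by measurable
qed

lemma flux_measurable [measurable]: "flux n y t \<in> borel_measurable borel"
proof -
  have [measurable]: "(\<lambda>(s, x). ft (\<lambda>\<xi>. \<i> * of_real \<xi> * mode n y (t - s) \<xi>) x) \<in> borel_measurable (borel \<Otimes>\<^sub>M borel)"
    by (rule ft_joint_measurable) measurable
  show ?thesis unfolding flux_def[abs_def] by measurable
qed

lemma pairing_bounded:
  assumes n: "0 < n" and s: "\<bar>t - s\<bar> \<le> L"
  shows "norm (pairing n y t s) \<le> M * (sqrt (4 * pi * n) * exp (L * (1 + n\<^sup>2)))"
proof -
  note f = bounded_support_facts[OF mode_measurable n norm_mode_le[OF n s] mode_outside[OF n]]
  have "norm (pairing n y t s) \<le> M * sqrt (LINT x|lborel. (norm (ft (mode n y (t - s)) x))\<^sup>2)"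
    unfolding pairing_def by (rule u_pair(2)[OF ft_measurable[OF mode_measurable] f(4)])
  also have "\<dots> \<le> M * (sqrt (4 * pi * n) * exp (L * (1 + n\<^sup>2)))"
    by (rule mult_left_mono[OF f(5) M])
  finally show ?thesis .
qed

text \<open>In \<open>weak_identity\<close> the flux and the initial datum both carry a factor a,
  and \<open>time_cutoff\<close> bounds \<bar>a\<bar> by \<beta> - \<alpha>. Letting b tend to the
  indicator of (\<alpha>, \<beta>), the average of the pairing over this interval is at most c0 + q0
  / 2, whatever the interval, and differentiation of the integral concludes.\<close>

lemma pairing_bound_AE:
  assumes n: "0 < n" and t: "0 < t"
    and c0: "norm (LINT x|lborel. of_real (u0 x) * ft (mode n y t) x) \<le> c0"
    and q0: "(\<integral>\<^sup>+s. ennreal (norm (flux n y t s)) * indicator {0..t} s \<partial>lborel) \<le> ennreal q0" and q00: "0 \<le> q0"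
  shows "AE s in lborel. s \<in> {0<..<t} \<longrightarrow> norm (pairing n y t s) \<le> c0 + q0 / 2"
proof (rule AE_norm_le_of_interval_averages)
  define KW where "KW = M * (sqrt (4 * pi * n) * exp (t * (1 + n\<^sup>2)))"
  show "pairing n y t \<in> borel_measurable borel" by measurable
  show KW: "norm (pairing n y t s) \<le> KW" if "s \<in> {0<..<t}" for s
    unfolding KW_def by (rule pairing_bounded[OF n]) (use that in auto)
  have KW0: "0 \<le> KW" unfolding KW_def using M n by simp
  have fl: "integrable lborel (\<lambda>s. indicator {0..t} s *\<^sub>R flux n y t s)"
  proof (rule integrableI_bounded)
    have "(\<integral>\<^sup>+s. ennreal (norm (indicator {0..t} s *\<^sub>R flux n y t s)) \<partial>lborel) = (\<integral>\<^sup>+s. ennreal (norm (flux n y t s)) * indicator {0..t} s \<partial>lborel)"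
      by (intro nn_integral_cong) (auto simp: indicator_def)
    then show "(\<integral>\<^sup>+s. ennreal (norm (indicator {0..t} s *\<^sub>R flux n y t s)) \<partial>lborel) < \<infinity>"
      using le_less_trans[OF q0 ennreal_less_top] by simp
  qed measurable
  have fl_le: "(LINT s|lborel. norm (indicator {0..t} s *\<^sub>R flux n y t s)) \<le> q0"
  proof -
    have "ennreal (LINT s|lborel. norm (indicator {0..t} s *\<^sub>R flux n y t s)) = (\<integral>\<^sup>+s. ennreal (norm (indicator {0..t} s *\<^sub>R flux n y t s)) \<partial>lborel)"
      by (rule nn_integral_eq_integral[OF integrable_norm[OF fl], symmetric]) simp
    also have "\<dots> = (\<integral>\<^sup>+s. ennreal (norm (flux n y t s)) * indicator {0..t} s \<partial>lborel)"
      by (intro nn_integral_cong) (auto simp: indicator_def)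
    also note q0
    finally show ?thesis using q00 by (simp only: ennreal_le_iff)
  qed
  fix \<alpha> \<beta> :: real assume \<alpha>\<beta>: "0 < \<alpha>" "\<alpha> < \<beta>" "\<beta> < t"
  have bnd: "norm (LINT s|lborel. of_real (bump \<alpha> \<beta> k s) * pairing n y t s) \<le> (c0 + q0 / 2) * (\<beta> - \<alpha>)" for k
  proof -
    let ?b = "bump \<alpha> \<beta> k"
    have bm [measurable]: "?b \<in> borel_measurable borel" by (rule smooth_real_measurable[OF smooth_bump])
    obtain a where a: "smooth_real a" and a0: "\<And>s. s \<le> -1 \<Longrightarrow> a s = 0" "\<And>s. \<beta> \<le> s \<Longrightarrow> a s = 0"
      and da: "\<And>s. 0 < s \<Longrightarrow> (a has_real_derivative ?b s) (at s)" and ab: "\<And>s. \<bar>a s\<bar> \<le> \<beta> - \<alpha>"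
    proof (rule time_cutoff[OF \<alpha>\<beta>(1,2) smooth_bump[of \<alpha> \<beta> k] bump_bounds[of \<alpha> \<beta> k]])
      show "bump \<alpha> \<beta> k s = 0" if "s \<le> \<alpha>" for s using that by (rule bump_outside(1))
      show "bump \<alpha> \<beta> k s = 0" if "\<beta> \<le> s" for s using that by (rule bump_outside(2))
    qed (rule that; assumption)
    have am [measurable]: "a \<in> borel_measurable borel" by (rule smooth_real_measurable[OF a])
    \<comment> \<open>L = t + 1 covers the support of a, which lies between -1 and \<beta> <
      t.\<close>
    have aL: "a s = 0" if "t + 1 \<le> \<bar>s\<bar>" for s using a0[of s] that \<alpha>\<beta> t by (cases "0 \<le> s") auto
    have bL: "?b s = 0" if "t + 1 \<le> s" for s using bump_outside(2)[of \<beta> s] that \<alpha>\<beta> by simp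
    have b1: "\<bar>?b s\<bar> \<le> 1" for s using bump_bounds[of \<alpha> \<beta> k s] by simp
    have id: "(LINT s|lborel. indicator {0<..} s *\<^sub>R (of_real (?b s) * pairing n y t s - of_real (a s / 2) * flux n y t s))
       + of_real (a 0) * (LINT x|lborel. of_real (u0 x) * ft (mode n y t) x) = 0"
      unfolding pairing_def flux_def
      by (rule weak_identity[where L = "t + 1", OF n _ a aL bm da bL b1 ab]) (use t in simp_all)
    have i1: "integrable lborel (\<lambda>s. of_real (?b s) * pairing n y t s)"
    proof (rule integrable_bounded_support[of _ KW t])
      show "norm (of_real (?b s) * pairing n y t s) \<le> KW" for s
      proof (cases "s \<in> {\<alpha><..<\<beta>}")
        case True
        then have "norm (of_real (?b s) * pairing n y t s) \<le> 1 * KW"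
          unfolding norm_mult norm_of_real using KW[of s] \<alpha>\<beta> by (intro mult_mono b1) auto
        then show ?thesis by simp
      next
        case False
        then have "?b s = 0" using bump_outside by (meson greaterThanLessThan_iff not_le)
        then show ?thesis using KW0 by simp
      qed
      show "of_real (?b s) * pairing n y t s = 0" if "t < \<bar>s\<bar>" for s
      proof -
        have "s \<le> \<alpha> \<or> \<beta> \<le> s" using that \<alpha>\<beta> by (cases "0 \<le> s") auto
        then show ?thesis using bump_outside[of s \<alpha> \<beta> k] bump_outside[of \<beta> s \<alpha> k] by auto
      qed
    qed measurable
    have i2: "integrable lborel (\<lambda>s. of_real (indicator {0<..} s * a s / 2) * (indicator {0..t} s *\<^sub>R flux n y t s))"
    proof (rule Bochner_Integration.integrable_bound[OF integrable_mult_right[OF integrable_norm[OF fl], of "\<beta> - \<alpha>"]])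
      have "norm (of_real (indicator {0<..} s * a s / 2) * (indicator {0..t} s *\<^sub>R flux n y t s)) \<le> (\<beta> - \<alpha>) * norm (indicator {0..t} s *\<^sub>R flux n y t s)" for s
        unfolding norm_mult[of "of_real _"] norm_of_real
        using ab[of s] by (intro mult_right_mono) (auto simp: indicator_def)
      from order_trans[OF this abs_ge_self]
      show "AE s in lborel. norm (of_real (indicator {0<..} s * a s / 2) * (indicator {0..t} s *\<^sub>R flux n y t s)) \<le> norm ((\<beta> - \<alpha>) * norm (indicator {0..t} s *\<^sub>R flux n y t s))"
        by (simp only: real_norm_def AE_I2)
    qed measurable
    have eq: "indicator {0<..} s *\<^sub>R (of_real (?b s) * pairing n y t s - of_real (a s / 2) * flux n y t s)
       = of_real (?b s) * pairing n y t s - of_real (indicator {0<..} s * a s / 2) * (indicator {0..t} s *\<^sub>R flux n y t s)" for s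
    proof (cases "0 < s")
      case True
      then show ?thesis using a0(2)[of s] \<alpha>\<beta> by (cases "s \<le> t") (auto simp: indicator_def)
    next
      case False
      then show ?thesis using bump_outside(1)[of s \<alpha> \<beta> k] \<alpha>\<beta> by (auto simp: indicator_def)
    qed
    have "(LINT s|lborel. of_real (?b s) * pairing n y t s) =
        (LINT s|lborel. of_real (indicator {0<..} s * a s / 2) * (indicator {0..t} s *\<^sub>R flux n y t s))
        - of_real (a 0) * (LINT x|lborel. of_real (u0 x) * ft (mode n y t) x)"
      using id unfolding eq Bochner_Integration.integral_diff[OF i1 i2] by (simp add: algebra_simps)
    then have "norm (LINT s|lborel. of_real (?b s) * pairing n y t s) \<le>
        norm (LINT s|lborel. of_real (indicator {0<..} s * a s / 2) * (indicator {0..t} s *\<^sub>R flux n y t s))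
        + norm (of_real (a 0) * (LINT x|lborel. of_real (u0 x) * ft (mode n y t) x))"
      by (simp only: norm_triangle_ineq4)
    also have "norm (of_real (a 0) * (LINT x|lborel. of_real (u0 x) * ft (mode n y t) x)) \<le> (\<beta> - \<alpha>) * c0"
      unfolding norm_mult norm_of_real using \<alpha>\<beta> by (intro mult_mono ab c0) auto
    also have "norm (LINT s|lborel. of_real (indicator {0<..} s * a s / 2) * (indicator {0..t} s *\<^sub>R flux n y t s))
       \<le> (LINT s|lborel. norm (of_real (indicator {0<..} s * a s / 2) * (indicator {0..t} s *\<^sub>R flux n y t s)))"
      by (rule integral_norm_bound)
    also have "\<dots> \<le> (LINT s|lborel. (\<beta> - \<alpha>) / 2 * norm (indicator {0..t} s *\<^sub>R flux n y t s))"
    proof (rule integral_mono[OF integrable_norm[OF i2] integrable_mult_right[OF integrable_norm[OF fl]]])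
      fix s
      show "norm (of_real (indicator {0<..} s * a s / 2) * (indicator {0..t} s *\<^sub>R flux n y t s)) \<le> (\<beta> - \<alpha>) / 2 * norm (indicator {0..t} s *\<^sub>R flux n y t s)"
        unfolding norm_mult[of "of_real _"] norm_of_real
        using ab[of s] \<alpha>\<beta> by (intro mult_right_mono) (auto simp: indicator_def)
    qed
    also have "\<dots> = (\<beta> - \<alpha>) / 2 * (LINT s|lborel. norm (indicator {0..t} s *\<^sub>R flux n y t s))"
      by (rule integral_mult_right_zero)
    also have "\<dots> \<le> (\<beta> - \<alpha>) / 2 * q0" using \<alpha>\<beta> by (intro mult_left_mono fl_le) auto
    finally show ?thesis by (simp add: algebra_simps)
  qed
  have lim: "(\<lambda>k. LINT s|lborel. of_real (bump \<alpha> \<beta> k s) * pairing n y t s) \<longlonglongrightarrow> (LINT s|lborel. indicator {\<alpha><..<\<beta>} s *\<^sub>R pairing n y t s)"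
  proof (rule integral_dominated_convergence[where w = "\<lambda>s. KW * indicator {\<alpha>..\<beta>} s"])
    show "integrable lborel (\<lambda>s. KW * indicator {\<alpha>..\<beta>} s :: real)"
      by (intro integrable_mult_right integrable_real_indicator) (auto simp: emeasure_lborel_Icc_eq)
    have bm [measurable]: "bump \<alpha> \<beta> k \<in> borel_measurable borel" for k by (rule smooth_real_measurable[OF smooth_bump])
    show "(\<lambda>s. of_real (bump \<alpha> \<beta> k s) * pairing n y t s) \<in> borel_measurable lborel" for k by measurable
    have "(\<lambda>k. of_real (bump \<alpha> \<beta> k s) * pairing n y t s) \<longlonglongrightarrow> of_real (indicator {\<alpha><..<\<beta>} s) * pairing n y t s" for s
      by (intro tendsto_mult tendsto_of_real bump_tendsto tendsto_const)
    then show "AE s in lborel. (\<lambda>k. of_real (bump \<alpha> \<beta> k s) * pairing n y t s) \<longlonglongrightarrow> indicator {\<alpha><..<\<beta>} s *\<^sub>R pairing n y t s"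
      by (simp add: scaleR_conv_of_real)
    show "AE s in lborel. norm (of_real (bump \<alpha> \<beta> k s) * pairing n y t s) \<le> KW * indicator {\<alpha>..\<beta>} s" for k
    proof (rule AE_I2)
      fix s
      show "norm (of_real (bump \<alpha> \<beta> k s) * pairing n y t s) \<le> KW * indicator {\<alpha>..\<beta>} s"
      proof (cases "s \<in> {\<alpha><..<\<beta>}")
        case True
        have "norm (of_real (bump \<alpha> \<beta> k s) * pairing n y t s) \<le> 1 * KW"
          unfolding norm_mult norm_of_real using KW[of s] True \<alpha>\<beta> bump_bounds[of \<alpha> \<beta> k s] by (intro mult_mono) auto
        then show ?thesis using True by simp
      next
        case False
        then have "bump \<alpha> \<beta> k s = 0" using bump_outside by (meson greaterThanLessThan_iff not_le)
        then show ?thesis using KW0 by simp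
      qed
    qed
  qed measurable
  show "norm (LINT s|lborel. indicator {\<alpha><..<\<beta>} s *\<^sub>R pairing n y t s) \<le> (c0 + q0 / 2) * (\<beta> - \<alpha>)"
    by (rule LIMSEQ_le_const2[OF tendsto_norm[OF lim]]) (use bnd in blast)
qed

end

section \<open>Bounds for the weak solution\<close>

lemma measurable_lebesgue_cong_AE:
  assumes f: "f \<in> borel_measurable lebesgue" and eq: "AE x in lebesgue. f x = g x"
  shows "g \<in> borel_measurable lebesgue"
proof (rule measurableI)
  fix A :: "'b set" assume A: "A \<in> sets borel"
  have "f -` A \<inter> space lebesgue \<in> sets lebesgue" by (rule measurable_sets[OF f A])
  moreover have "AE x in lebesgue. (x \<in> f -` A \<inter> space lebesgue) \<longleftrightarrow> (x \<in> g -` A \<inter> space lebesgue)"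
    using eq by eventually_elim auto
  ultimately show "g -` A \<inter> space lebesgue \<in> sets lebesgue"
    using completion.in_sets_AE by blast
qed auto

lemma measurable_lebesgue_iff_AE:
  assumes eq: "AE x in lebesgue. f x = g x"
  shows "f \<in> borel_measurable lebesgue \<longleftrightarrow> g \<in> borel_measurable lebesgue"
proof -
  have "AE x in lebesgue. g x = f x" using eq by eventually_elim simp
  then show ?thesis using measurable_lebesgue_cong_AE eq by blast
qed

text \<open>Completeness makes f and g measurable together; if neither is, both integrals take the
  default value 0.\<close>

lemma integral_lebesgue_cong_AE:
  fixes f g :: "'a::euclidean_space \<Rightarrow> 'b::{banach, second_countable_topology}"
  assumes eq: "AE x in lebesgue. f x = g x"
  shows "(LINT x|lebesgue. f x) = (LINT x|lebesgue. g x)"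
    and "integrable lebesgue f \<longleftrightarrow> integrable lebesgue g"
proof -
  have "(LINT x|lebesgue. f x) = (LINT x|lebesgue. g x) \<and> (integrable lebesgue f \<longleftrightarrow> integrable lebesgue g)"
  proof (cases "f \<in> borel_measurable lebesgue")
    case True
    then have g: "g \<in> borel_measurable lebesgue" using measurable_lebesgue_cong_AE[OF _ eq] by blast
    show ?thesis using integral_cong_AE[OF True g eq] integrable_cong_AE[OF True g eq] by simp
  next
    case False
    then have "g \<notin> borel_measurable lebesgue" using measurable_lebesgue_iff_AE[OF eq] by blast
    then have "\<not> integrable lebesgue f" "\<not> integrable lebesgue g" using False borel_measurable_integrable by blast+
    then show ?thesis by (simp add: not_integrable_integral_eq)
  qed
  then show "(LINT x|lebesgue. f x) = (LINT x|lebesgue. g x)" "integrable lebesgue f \<longleftrightarrow> integrable lebesgue g"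
    by blast+
qed

lemma L2_norm_cong_AE:
  fixes f g :: "real \<Rightarrow> 'b::real_normed_vector"
  assumes eq: "AE x in lebesgue. f x = g x"
  shows "L2_norm f = L2_norm g"
proof -
  have sq: "AE x in lebesgue. (norm (f x))\<^sup>2 = (norm (g x))\<^sup>2" using eq by eventually_elim simp
  show ?thesis
    unfolding L2_norm_def measurable_lebesgue_iff_AE[OF eq] integral_lebesgue_cong_AE[OF sq] ..
qed

lemma fourier_cong_AE:
  assumes eq: "AE x in lebesgue. f x = g x"
  shows "fourier f \<xi> = fourier g \<xi>"
  unfolding fourier_def by (rule integral_lebesgue_cong_AE) (use eq in eventually_elim, simp)

lemma L2_fourier_cong_AE:
  assumes f: "AE x in lebesgue. f x = f' x" and F: "AE x in lebesgue. F x = F' x"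
  shows "L2_fourier f F \<longleftrightarrow> L2_fourier f' F'"
proof -
  have fo: "fourier (\<lambda>x. indicator {-R..R} x *\<^sub>R f x) \<xi> = fourier (\<lambda>x. indicator {-R..R} x *\<^sub>R f' x) \<xi>" for R \<xi>
    by (rule fourier_cong_AE) (use f in eventually_elim, simp)
  have "L2_norm (\<lambda>\<xi>. fourier (\<lambda>x. indicator {-R..R} x *\<^sub>R f' x) \<xi> - F \<xi>) = L2_norm (\<lambda>\<xi>. fourier (\<lambda>x. indicator {-R..R} x *\<^sub>R f' x) \<xi> - F' \<xi>)" for R
    by (rule L2_norm_cong_AE) (use F in eventually_elim, simp)
  then show ?thesis unfolding L2_fourier_def fo L2_norm_cong_AE[OF f] L2_norm_cong_AE[OF F] by simp
qed

lemma sobolev_norm_cong_AE: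
  assumes "AE x in lebesgue. f x = g x"
  shows "sobolev_norm s f = sobolev_norm s g"
proof -
  have "AE x in lebesgue. complex_of_real (f x) = complex_of_real (g x)" using assms by eventually_elim simp
  then have "L2_fourier (\<lambda>x. complex_of_real (f x)) F = L2_fourier (\<lambda>x. complex_of_real (g x)) F" for F
    by (rule L2_fourier_cong_AE) simp
  then have "{F. L2_fourier (\<lambda>x. complex_of_real (f x)) F} = {F. L2_fourier (\<lambda>x. complex_of_real (g x)) F}"
    by (rule Collect_cong)
  then show ?thesis unfolding sobolev_norm_def by (simp only:)
qed

lemma lebesgue_measurable_complex_borel:
  fixes F :: "real \<Rightarrow> complex"
  assumes F: "F \<in> borel_measurable lebesgue"
  obtains F' where "F' \<in> borel_measurable borel" "AE x in lebesgue. F x = F' x"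
proof -
  have "(\<lambda>x. Re (F x)) \<in> borel_measurable lebesgue" "(\<lambda>x. Im (F x)) \<in> borel_measurable lebesgue"
    using F by measurable
  then obtain r i where r: "r \<in> borel_measurable lborel" "AE x in lborel. Re (F x) = r x"
    and i: "i \<in> borel_measurable lborel" "AE x in lborel. Im (F x) = i x"
    using completion_ex_borel_measurable_real by metis
  have [measurable]: "r \<in> borel_measurable borel" "i \<in> borel_measurable borel" using r i by auto
  have "AE x in lborel. F x = complex_of_real (r x) + \<i> * complex_of_real (i x)"
    using r(2) i(2) by eventually_elim (simp add: complex_eq_iff)
  then show thesis
    by (intro that[of "\<lambda>x. complex_of_real (r x) + \<i> * complex_of_real (i x)"]) (auto simp: AE_completion_iff)
qed

text \<open>The infimum is bounded from below by testing Borel transforms with finite weighted norm: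
  a Lebesgue measurable F has a Borel version, and an infinite norm is trivially large. In this form
  nothing has to be said about the infimum being attained.\<close>

lemma sobolev_norm_ge:
  assumes [measurable]: "f \<in> borel_measurable borel"
    and ge: "\<And>F. F \<in> borel_measurable borel \<Longrightarrow> L2_fourier (\<lambda>x. of_real (f x)) F \<Longrightarrow>
      integrable lborel (\<lambda>\<xi>. ((1 + \<xi>\<^sup>2) powr (s / 2) * norm (F \<xi>))\<^sup>2) \<Longrightarrow>
      c \<le> ennreal (sqrt (LINT \<xi>|lborel. ((1 + \<xi>\<^sup>2) powr (s / 2) * norm (F \<xi>))\<^sup>2))"
  shows "c \<le> sobolev_norm s f"
  unfolding sobolev_norm_def
proof (rule INF_greatest)
  fix F assume "F \<in> {F. L2_fourier (\<lambda>x. complex_of_real (f x)) F}"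
  then have F: "L2_fourier (\<lambda>x. complex_of_real (f x)) F" by simp
  then have "F \<in> borel_measurable lebesgue" by (simp add: L2_fourier_def L2_norm_finite_iff)
  then obtain F' where [measurable]: "F' \<in> borel_measurable borel" and eq: "AE x in lebesgue. F x = F' x"
    by (rule lebesgue_measurable_complex_borel)
  have F': "L2_fourier (\<lambda>x. complex_of_real (f x)) F'"
    using L2_fourier_cong_AE[OF _ eq, of "\<lambda>x. complex_of_real (f x)" "\<lambda>x. complex_of_real (f x)"] F by simp
  define h where "h \<xi> = (1 + \<xi>\<^sup>2) powr (s / 2) *\<^sub>R F' \<xi>" for \<xi>
  have [measurable]: "h \<in> borel_measurable borel" unfolding h_def[abs_def] by measurable
  have hn: "(norm (h \<xi>))\<^sup>2 = ((1 + \<xi>\<^sup>2) powr (s / 2) * norm (F' \<xi>))\<^sup>2" for \<xi> by (simp add: h_def)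
  have eqn: "L2_norm (\<lambda>\<xi>. (1 + \<xi>\<^sup>2) powr (s / 2) *\<^sub>R F \<xi>) = L2_norm h"
    unfolding h_def by (rule L2_norm_cong_AE) (use eq in eventually_elim, simp)
  show "c \<le> L2_norm (\<lambda>\<xi>. (1 + \<xi>\<^sup>2) powr (s / 2) *\<^sub>R F \<xi>)"
  proof (cases "L2_norm h < \<top>")
    case True
    then have i: "integrable lborel (\<lambda>\<xi>. (norm (h \<xi>))\<^sup>2)" using L2_norm_borel(1)[of h] by simp
    have "L2_norm h = ennreal (sqrt (LINT \<xi>|lborel. (norm (h \<xi>))\<^sup>2))"
      using L2_norm_borel(2)[OF _ i] by simp
    then show ?thesis unfolding eqn hn using ge[OF _ F'] i[unfolded hn] by simp
  next
    case False
    then show ?thesis unfolding eqn by (simp add: not_less top_unique)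
  qed
qed

text \<open>If no such F existed, \<open>sobolev_norm_ge\<close> would hold vacuously with c =
  \<top>.\<close>

lemma sobolev_norm_finiteD:
  assumes f: "f \<in> borel_measurable borel" and "sobolev_norm s f < \<top>"
  obtains F where "F \<in> borel_measurable borel" "L2_fourier (\<lambda>x. of_real (f x)) F"
    "integrable lborel (\<lambda>\<xi>. ((1 + \<xi>\<^sup>2) powr (s / 2) * norm (F \<xi>))\<^sup>2)"
proof (rule ccontr)
  assume "\<not> thesis"
  then have "\<top> \<le> sobolev_norm s f"
    by (intro sobolev_norm_ge[OF f]) (use that in blast)+
  then show False using assms(2) by simp
qed

lemma mode_ft_shift: "ft (mode n y t) x = ft (\<lambda>\<xi>. of_real (heat n t \<xi>)) (x - y)"
proof -
  have "cis (x * \<xi>) * mode n y t \<xi> = cis ((x - y) * \<xi>) * of_real (heat n t \<xi>)" for \<xi>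
  proof -
    have "cis (x * \<xi>) * cis (- (y * \<xi>)) = cis ((x - y) * \<xi>)" by (simp add: cis_mult left_diff_distrib)
    then show ?thesis unfolding mode_def by (metis mult.assoc mult.commute)
  qed
  then show ?thesis by (simp add: ft_def)
qed

section \<open>Bounds for the Duhamel terms\<close>

context weak_flow
begin

lemma initial_term_bound:
  assumes B: "\<And>x. \<bar>u0 x\<bar> \<le> B"
    and k: "integrable lborel (ft (\<lambda>\<xi>. of_real (heat n t \<xi>)))"
      "(LINT x|lborel. norm (ft (\<lambda>\<xi>. of_real (heat n t \<xi>)) x)) \<le> C"
  shows "norm (LINT x|lborel. of_real (u0 x) * ft (mode n y t) x) \<le> B * C"
proof -
  let ?k = "ft (\<lambda>\<xi>. of_real (heat n t \<xi>))"
  have B0: "0 \<le> B" using B[of 0] by linarith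
  have ks: "integrable lborel (\<lambda>x. ?k (x - y))"
    using lborel_integrable_real_affine[OF k(1), of 1 "- y"] by simp
  have le: "norm (of_real (u0 x) * ?k (x - y)) \<le> B * norm (?k (x - y))" for x
    unfolding norm_mult norm_of_real by (intro mult_right_mono B) simp
  have i: "integrable lborel (\<lambda>x. of_real (u0 x) * ?k (x - y))"
  proof (rule Bochner_Integration.integrable_bound[OF integrable_mult_right[OF integrable_norm[OF ks], of B]])
    have [measurable]: "(\<lambda>x. ?k (x - y)) \<in> borel_measurable lborel" using ks by (rule borel_measurable_integrable)
    show "(\<lambda>x. of_real (u0 x) * ?k (x - y)) \<in> borel_measurable lborel" by measurable
  qed (use order_trans[OF le abs_ge_self] in simp)
  have "norm (LINT x|lborel. of_real (u0 x) * ft (mode n y t) x) \<le> (LINT x|lborel. norm (of_real (u0 x) * ?k (x - y)))"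
    unfolding mode_ft_shift by (rule integral_norm_bound)
  also have "\<dots> \<le> (LINT x|lborel. B * norm (?k (x - y)))"
    by (rule integral_mono[OF integrable_norm[OF i] integrable_mult_right[OF integrable_norm[OF ks]] le])
  also have "\<dots> = B * (LINT x|lborel. norm (?k (x - y)))" by (rule integral_mult_right_zero)
  also have "(LINT x|lborel. norm (?k (x - y))) = (LINT x|lborel. norm (?k x))"
    using lborel_integral_real_affine[of 1 "\<lambda>x. norm (?k x)" "- y"] by simp
  also have "B * \<dots> \<le> B * C" by (rule mult_left_mono[OF k(2) B0])
  finally show ?thesis .
qed

text \<open>\<open>quadratic_form_bound\<close> gives C l w, with l the squared Sobolev norm and w
  the \<open>L\<^sup>2\<close> norm of \<open>weight\<close>; then l w \<le> l^2 + w^2 separates the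
  two. The square of l is the fourth power of the Sobolev norm, which is where the exponent 4 in
  time is used.\<close>

lemma flux_bound:
  assumes \<epsilon>: "0 < \<epsilon>" "\<epsilon> < 1/4"
  obtains C where "0 < C"
    "\<And>n y t r. 0 < n \<Longrightarrow> r \<le> t \<Longrightarrow> ennreal (norm (flux n y t r) / C)
       \<le> (\<integral>\<^sup>+\<zeta>. ennreal ((weight \<epsilon> (t - r) \<zeta>)\<^sup>2) \<partial>lborel) + (sobolev_norm (3/4 + \<epsilon>) (u r)) ^ 4"
proof (rule quadratic_form_bound[OF \<epsilon>])
  fix C :: real assume C: "0 \<le> C" and qf: "\<And>(f :: real \<Rightarrow> real) F G \<tau>. f \<in> borel_measurable borel \<Longrightarrow> F \<in> borel_measurable borel \<Longrightarrow>
      L2_fourier (\<lambda>x. of_real (f x)) F \<Longrightarrow>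
      integrable lborel (\<lambda>\<xi>. ((1 + \<xi>\<^sup>2) powr ((3/4 + \<epsilon>) / 2) * norm (F \<xi>))\<^sup>2) \<Longrightarrow>
      integrable lborel G \<Longrightarrow> (\<exists>B. \<forall>\<xi>. norm (G \<xi>) \<le> B) \<Longrightarrow>
      (\<And>\<xi>. norm (G \<xi>) \<le> \<bar>\<xi>\<bar> * exp (- (\<tau> * psym \<xi>))) \<Longrightarrow>
      integrable lborel (\<lambda>\<zeta>. (weight \<epsilon> \<tau> \<zeta>)\<^sup>2) \<Longrightarrow>
      norm (LINT x|lborel. of_real ((f x)\<^sup>2) * ft G x) \<le>
        C * (LINT \<xi>|lborel. ((1 + \<xi>\<^sup>2) powr ((3/4 + \<epsilon>) / 2) * norm (F \<xi>))\<^sup>2) * sqrt (LINT \<zeta>|lborel. (weight \<epsilon> \<tau> \<zeta>)\<^sup>2)"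
  show thesis
  \<comment> \<open>C may be 0, and the estimate is divided by the constant.\<close>
  proof (rule that[of "C + 1"])
    show "0 < C + 1" using C by simp
    fix n y t r :: real assume n: "0 < n" and r: "r \<le> t"
    let ?v = "\<integral>\<^sup>+\<zeta>. ennreal ((weight \<epsilon> (t - r) \<zeta>)\<^sup>2) \<partial>lborel"
    define N where "N = sobolev_norm (3/4 + \<epsilon>) (u r)"
    define x where "x = norm (flux n y t r) / (C + 1)"
    define G where "G \<xi> = \<i> * of_real \<xi> * mode n y (t - r) \<xi>" for \<xi>
    have [measurable]: "G \<in> borel_measurable borel" unfolding G_def[abs_def] by measurable
    have [measurable]: "weight \<epsilon> (t - r) \<in> borel_measurable borel" unfolding weight_def[abs_def] by measurable
    have Gn: "norm (G \<xi>) = \<bar>\<xi>\<bar> * heat n (t - r) \<xi>" for \<xi> by (simp add: G_def norm_mult norm_mode)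
    have Gb: "norm (G \<xi>) \<le> n" for \<xi>
    proof (cases "n < \<bar>\<xi>\<bar>")
      case True
      then show ?thesis using n by (simp add: G_def mode_outside)
    next
      case False
      then have "\<bar>\<xi>\<bar> * heat n (t - r) \<xi> \<le> n * 1"
        using n r by (intro mult_mono heat_le_1 heat_nonneg) auto
      then show ?thesis by (simp add: Gn)
    qed
    have G1: "integrable lborel G"
      by (rule bounded_support_facts(1)[OF _ n Gb]) (simp_all add: G_def mode_outside[OF n])
    have Gle: "norm (G \<xi>) \<le> \<bar>\<xi>\<bar> * exp (- ((t - r) * psym \<xi>))" for \<xi>
      unfolding Gn heat_def using tent_le_1[OF n, of \<xi>] by (intro mult_left_mono mult_left_le) auto
    have "ennreal x \<le> ?v + N ^ 4"
    proof (cases "?v < \<top>")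
      case True
      have w: "integrable lborel (\<lambda>\<zeta>. (weight \<epsilon> (t - r) \<zeta>)\<^sup>2)"
        by (rule integrableI_bounded) (use True in auto)
      define w2 where "w2 = (LINT \<zeta>|lborel. (weight \<epsilon> (t - r) \<zeta>)\<^sup>2)"
      have w20: "0 \<le> w2" by (simp add: w2_def)
      have v: "?v = ennreal w2" unfolding w2_def by (rule nn_integral_eq_integral[OF w]) simp
      show ?thesis
      proof (cases "x \<le> w2")
        case True
        then have "ennreal x \<le> ennreal w2" by (rule ennreal_leI)
        also have "\<dots> \<le> ennreal w2 + N ^ 4" by simp
        finally show ?thesis unfolding v .
      next
        case False
        \<comment> \<open>Solved for the Sobolev norm, the claim becomes a lower bound for an
          infimum and can be checked for each transform F separately; the fourth power is taken
          afterwards.\<close>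
        have "ennreal (sqrt (sqrt (x - w2))) \<le> N"
          unfolding N_def
        proof (rule sobolev_norm_ge[OF u_meas])
          fix F :: "real \<Rightarrow> complex" assume F: "F \<in> borel_measurable borel" "L2_fourier (\<lambda>x. of_real (u r x)) F"
            "integrable lborel (\<lambda>\<xi>. ((1 + \<xi>\<^sup>2) powr ((3/4 + \<epsilon>) / 2) * norm (F \<xi>))\<^sup>2)"
          define l where "l = (LINT \<xi>|lborel. ((1 + \<xi>\<^sup>2) powr ((3/4 + \<epsilon>) / 2) * norm (F \<xi>))\<^sup>2)"
          have l0: "0 \<le> l" by (simp add: l_def)
          have "norm (flux n y t r) \<le> C * l * sqrt w2"
            unfolding flux_def l_def w2_def G_def[symmetric]
            by (rule qf[OF u_meas F G1 _ Gle w]) (use Gb in blast)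
          also have "\<dots> \<le> (C + 1) * (l * sqrt w2)" using l0 w20 by (simp add: algebra_simps)
          finally have "x \<le> l * sqrt w2" using C by (simp add: x_def pos_divide_le_eq mult.commute)
          also have "\<dots> \<le> l\<^sup>2 + w2"
          proof -
            have "2 * l * sqrt w2 \<le> l\<^sup>2 + (sqrt w2)\<^sup>2" by (rule sum_squares_bound)
            moreover have "0 \<le> l * sqrt w2" using l0 w20 by simp
            ultimately show ?thesis using w20 by simp
          qed
          finally have "sqrt (x - w2) \<le> sqrt (l\<^sup>2)" by (intro real_sqrt_le_mono) simp
          then have "sqrt (sqrt (x - w2)) \<le> sqrt l" using l0 by (intro real_sqrt_le_mono) simp
          then show "ennreal (sqrt (sqrt (x - w2))) \<le> ennreal (sqrt (LINT \<xi>|lborel. ((1 + \<xi>\<^sup>2) powr ((3/4 + \<epsilon>) / 2) * norm (F \<xi>))\<^sup>2))"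
            unfolding l_def by (rule ennreal_leI)
        qed
        then have "(ennreal (sqrt (sqrt (x - w2)))) ^ 4 \<le> N ^ 4" by (rule power_mono) simp
        moreover have "(ennreal (sqrt (sqrt (x - w2)))) ^ 4 = ennreal (x - w2)"
        proof -
          have "sqrt (sqrt (x - w2)) ^ 4 = ((sqrt (sqrt (x - w2)))\<^sup>2)\<^sup>2" by (simp add: power_mult[symmetric])
          also have "\<dots> = x - w2" using False by simp
          finally show ?thesis using False by (simp add: ennreal_power)
        qed
        moreover have "ennreal x = ennreal w2 + ennreal (x - w2)"
          using False w20 by (subst ennreal_plus[symmetric]) auto
        ultimately show ?thesis unfolding v by (simp add: add_left_mono)
      qed
    next
      case False
      then show ?thesis by (simp add: not_less top_unique)
    qed
    then show "ennreal (norm (flux n y t r) / (C + 1)) \<le> ?v + (sobolev_norm (3/4 + \<epsilon>) (u r)) ^ 4"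
      unfolding x_def N_def .
  qed
qed

text \<open>The map \<open>r \<mapsto> sobolev_norm s (u r)\<close> is not known to be measurable, so its integral is a lower
  integral, which is not subadditive. Subtracting the measurable weight first avoids adding.\<close>

lemma flux_integral_bound:
  assumes \<epsilon>: "0 < \<epsilon>" "\<epsilon> < 1/4" and T: "0 < T"
    and fin: "(\<integral>\<^sup>+r. (sobolev_norm (3/4 + \<epsilon>) (u r)) ^ 4 * indicator {0..T} r \<partial>lborel) < \<top>"
  obtains q where "0 \<le> q"
    "\<And>n y t. 0 < n \<Longrightarrow> t \<le> T \<Longrightarrow> (\<integral>\<^sup>+s. ennreal (norm (flux n y t s)) * indicator {0..t} s \<partial>lborel) \<le> ennreal q"
proof -
  obtain C where C: "0 < C" and fb: "\<And>n y t r. 0 < n \<Longrightarrow> r \<le> t \<Longrightarrow> ennreal (norm (flux n y t r) / C)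
       \<le> (\<integral>\<^sup>+\<zeta>. ennreal ((weight \<epsilon> (t - r) \<zeta>)\<^sup>2) \<partial>lborel) + (sobolev_norm (3/4 + \<epsilon>) (u r)) ^ 4"
    by (rule flux_bound[OF \<epsilon>]) (rule that; assumption)
  obtain Cw where Cw: "0 \<le> Cw" and wb: "(\<integral>\<^sup>+\<tau>. (\<integral>\<^sup>+\<zeta>. ennreal ((weight \<epsilon> \<tau> \<zeta>)\<^sup>2) \<partial>lborel) * indicator {0..T} \<tau> \<partial>lborel) \<le> ennreal Cw"
    by (rule weight_integral_bound[OF \<epsilon> T]) (rule that; assumption)
  let ?I = "\<integral>\<^sup>+r. (sobolev_norm (3/4 + \<epsilon>) (u r)) ^ 4 * indicator {0..T} r \<partial>lborel"
  define I where "I = enn2real ?I"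
  have I: "?I = ennreal I" unfolding I_def using fin by simp
  have I0: "0 \<le> I" by (simp add: I_def)
  show thesis
  proof (rule that[of "C * (I + Cw)"])
    show "0 \<le> C * (I + Cw)" using C I0 Cw by simp
    fix n y t :: real assume n: "0 < n" and t: "t \<le> T"
    define v where "v \<tau> = (\<integral>\<^sup>+\<zeta>. ennreal ((weight \<epsilon> \<tau> \<zeta>)\<^sup>2) \<partial>lborel)" for \<tau>
    have [measurable]: "v \<in> borel_measurable borel" unfolding v_def[abs_def] by measurable
    define h where "h r = ennreal (norm (flux n y t r) / C)" for r
    have [measurable]: "h \<in> borel_measurable borel" unfolding h_def[abs_def] by measurable
    have "(\<integral>\<^sup>+r. h r * indicator {0..t} r \<partial>lborel) \<le> (\<integral>\<^sup>+r. (h r - v (t - r)) * indicator {0..t} r + v (t - r) * indicator {0..t} r \<partial>lborel)"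
    proof (intro nn_integral_mono)
      fix r
      \<comment> \<open>Subtraction on \<open>ennreal\<close> is truncated at 0, so adding v back
        gives at least h.\<close>
      have "h r \<le> v (t - r) + (h r - v (t - r))"
        using ennreal_minus_le_iff[of "h r" "v (t - r)" "h r - v (t - r)"] by simp
      then show "h r * indicator {0..t} r \<le> (h r - v (t - r)) * indicator {0..t} r + v (t - r) * indicator {0..t} r"
        by (simp add: indicator_def add.commute)
    qed
    also have "\<dots> = (\<integral>\<^sup>+r. (h r - v (t - r)) * indicator {0..t} r \<partial>lborel) + (\<integral>\<^sup>+r. v (t - r) * indicator {0..t} r \<partial>lborel)"
      by (rule nn_integral_add) measurable
    also have "(\<integral>\<^sup>+r. (h r - v (t - r)) * indicator {0..t} r \<partial>lborel) \<le> ?I"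
    proof (rule nn_integral_mono)
      fix r
      have "h r - v (t - r) \<le> (sobolev_norm (3/4 + \<epsilon>) (u r)) ^ 4" if "r \<le> t"
        using fb[OF n that, of y] unfolding h_def v_def ennreal_minus_le_iff by auto
      then show "(h r - v (t - r)) * indicator {0..t} r \<le> (sobolev_norm (3/4 + \<epsilon>) (u r)) ^ 4 * indicator {0..T} r"
        using t by (auto simp: indicator_def)
    qed
    also have "(\<integral>\<^sup>+r. v (t - r) * indicator {0..t} r \<partial>lborel) = (\<integral>\<^sup>+\<tau>. v \<tau> * indicator {0..t} \<tau> \<partial>lborel)"
    proof -
      have "(\<integral>\<^sup>+\<tau>. v \<tau> * indicator {0..t} \<tau> \<partial>lborel) = (\<integral>\<^sup>+r. v (t + - 1 * r) * indicator {0..t} (t + - 1 * r) \<partial>lborel)"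
        by (subst nn_integral_real_affine[of _ "-1" t]) simp_all
      also have "\<dots> = (\<integral>\<^sup>+r. v (t - r) * indicator {0..t} r \<partial>lborel)"
        by (intro nn_integral_cong) (auto simp: indicator_def)
      finally show ?thesis by simp
    qed
    also have "\<dots> \<le> (\<integral>\<^sup>+\<tau>. v \<tau> * indicator {0..T} \<tau> \<partial>lborel)"
      using t by (intro nn_integral_mono) (auto simp: indicator_def)
    also have "\<dots> \<le> ennreal Cw" unfolding v_def by (rule wb)
    finally have hb: "(\<integral>\<^sup>+r. h r * indicator {0..t} r \<partial>lborel) \<le> ennreal (I + Cw)"
      unfolding I using I0 Cw by (simp add: ennreal_plus add_mono)
    have "(\<integral>\<^sup>+s. ennreal (norm (flux n y t s)) * indicator {0..t} s \<partial>lborel) = (\<integral>\<^sup>+s. ennreal C * (h s * indicator {0..t} s) \<partial>lborel)"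
      unfolding h_def using C by (intro nn_integral_cong) (simp add: mult.assoc[symmetric] ennreal_mult[symmetric])
    also have "\<dots> = ennreal C * (\<integral>\<^sup>+s. h s * indicator {0..t} s \<partial>lborel)"
      by (rule nn_integral_cmult) measurable
    also have "\<dots> \<le> ennreal C * ennreal (I + Cw)" by (rule mult_left_mono[OF hb]) simp
    also have "\<dots> = ennreal (C * (I + Cw))" using C I0 Cw by (simp add: ennreal_mult)
    finally show "(\<integral>\<^sup>+s. ennreal (norm (flux n y t s)) * indicator {0..t} s \<partial>lborel) \<le> ennreal (C * (I + Cw))" .
  qed
qed

text \<open>By duality the pairing is the integral of F(-\<xi>) against a mode. For \<tau> \<ge> s
  the mode is bounded by 1 and converges pointwise to cis(-y \<xi>), so \<bar>F(-\<xi>)\<bar> is the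
  majorant. A single index drives both limits, the band to infinity and \<tau> to s.\<close>

lemma pairing_limit:
  assumes F: "L2_fourier (\<lambda>x. of_real (u s x)) F" and [measurable]: "F \<in> borel_measurable borel" and F1: "integrable lborel F"
    and \<tau>: "\<And>k. s \<le> \<tau> k" "\<tau> \<longlonglongrightarrow> s"
  shows "(\<lambda>k. pairing (real (Suc k)) y (\<tau> k) s) \<longlonglongrightarrow> ft F y"
proof -
  have Fm: "integrable lborel (\<lambda>\<xi>. F (- \<xi>))" by (rule lborel_integrable_uminus[OF F1])
  have eq: "pairing (real (Suc k)) y (\<tau> k) s = (LINT \<xi>|lborel. F (- \<xi>) * mode (real (Suc k)) y (\<tau> k - s) \<xi>)" for k
  proof -
    have n: "0 < real (Suc k)" by simp
    note f = bounded_support_facts[OF mode_measurable n norm_mode_le[OF n order_refl] mode_outside[OF n]]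
    show ?thesis unfolding pairing_def by (rule L2_fourier_duality[OF F _ _ f(1,2)]) auto
  qed
  have "(\<lambda>k. LINT \<xi>|lborel. F (- \<xi>) * mode (real (Suc k)) y (\<tau> k - s) \<xi>) \<longlonglongrightarrow> (LINT \<xi>|lborel. F (- \<xi>) * cis (- (y * \<xi>)))"
  proof (rule integral_dominated_convergence[where w = "\<lambda>\<xi>. norm (F (- \<xi>))"])
    show "integrable lborel (\<lambda>\<xi>. norm (F (- \<xi>)))" using Fm by simp
    show "AE \<xi> in lborel. norm (F (- \<xi>) * mode (real (Suc k)) y (\<tau> k - s) \<xi>) \<le> norm (F (- \<xi>))" for k
    proof (rule AE_I2)
      fix \<xi>
      have "heat (real (Suc k)) (\<tau> k - s) \<xi> \<le> 1" by (rule heat_le_1) (use \<tau>(1)[of k] in auto)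
      then show "norm (F (- \<xi>) * mode (real (Suc k)) y (\<tau> k - s) \<xi>) \<le> norm (F (- \<xi>))"
        unfolding norm_mult norm_mode by (intro mult_left_le) auto
    qed
    show "AE \<xi> in lborel. (\<lambda>k. F (- \<xi>) * mode (real (Suc k)) y (\<tau> k - s) \<xi>) \<longlonglongrightarrow> F (- \<xi>) * cis (- (y * \<xi>))"
    proof (rule AE_I2)
      fix \<xi>
      have "(\<lambda>k. \<bar>\<xi>\<bar> / real (Suc k)) \<longlonglongrightarrow> 0"
        by (rule LIMSEQ_Suc[OF tendsto_divide_0[OF tendsto_const]]) (auto intro: filterlim_at_top_imp_at_infinity filterlim_real_sequentially)
      then have "(\<lambda>k. tent (real (Suc k)) \<xi>) \<longlonglongrightarrow> max 0 (1 - 0)"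
        unfolding tent_def by (intro tendsto_max tendsto_diff tendsto_const)
      moreover have "(\<lambda>k. exp (- ((\<tau> k - s) * psym \<xi>))) \<longlonglongrightarrow> exp (- ((s - s) * psym \<xi>))"
        by (intro tendsto_intros \<tau>(2))
      ultimately have "(\<lambda>k. heat (real (Suc k)) (\<tau> k - s) \<xi>) \<longlonglongrightarrow> exp (- ((s - s) * psym \<xi>)) * max 0 (1 - 0)"
        unfolding heat_def by (intro tendsto_mult)
      then have "(\<lambda>k. heat (real (Suc k)) (\<tau> k - s) \<xi>) \<longlonglongrightarrow> 1" by simp
      then have "(\<lambda>k. F (- \<xi>) * (of_real (heat (real (Suc k)) (\<tau> k - s) \<xi>) * cis (- (y * \<xi>)))) \<longlonglongrightarrow> F (- \<xi>) * (of_real 1 * cis (- (y * \<xi>)))"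
        by (intro tendsto_mult tendsto_const tendsto_of_real)
      then show "(\<lambda>k. F (- \<xi>) * mode (real (Suc k)) y (\<tau> k - s) \<xi>) \<longlonglongrightarrow> F (- \<xi>) * cis (- (y * \<xi>))"
        unfolding mode_def by simp
    qed
  qed measurable
  moreover have "(LINT \<xi>|lborel. F (- \<xi>) * cis (- (y * \<xi>))) = ft F y"
    unfolding ft_def using lborel_integral_uminus[of "\<lambda>\<xi>. cis (y * \<xi>) * F \<xi>"] by (simp add: mult.commute)
  ultimately show ?thesis unfolding eq by simp
qed

text \<open>Each bound of \<open>pairing_bound_AE\<close> may fail on a null set of times depending
  on t, y and n, so countably many parameters are used. At a good time s, letting t decrease to s
  bounds \<open>ft F\<close> at rational y, continuity extends the bound to all y, and inversion
  turns it into a bound for u(s).\<close>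

lemma bounded_AE:
  assumes \<epsilon>: "0 < \<epsilon>" "\<epsilon> < 1/4" and T: "0 < T" and B: "\<And>x. \<bar>u0 x\<bar> \<le> B"
    and fin: "(\<integral>\<^sup>+r. (sobolev_norm (3/4 + \<epsilon>) (u r)) ^ 4 * indicator {0..T} r \<partial>lborel) < \<top>"
  shows "\<exists>C. AE s in lborel. s \<in> {0<..<T} \<longrightarrow> (AE x in lborel. \<bar>u s x\<bar> \<le> C)"
proof -
  obtain c where L1: "\<And>F s. F \<in> borel_measurable borel \<Longrightarrow> 3/4 \<le> s \<Longrightarrow>
       integrable lborel (\<lambda>\<xi>. ((1 + \<xi>\<^sup>2) powr (s / 2) * norm (F \<xi> :: complex))\<^sup>2) \<Longrightarrow>
       integrable lborel F \<and>
       (LINT \<xi>|lborel. norm (F \<xi>)) \<le> c * sqrt (LINT \<xi>|lborel. ((1 + \<xi>\<^sup>2) powr (s / 2) * norm (F \<xi>))\<^sup>2)"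
    by (rule L1_le_sobolev) (rule that; assumption)
  obtain CK where CK: "0 \<le> CK" and kern: "\<And>t n. 0 < t \<Longrightarrow> t \<le> T \<Longrightarrow> 1 / (root 3 t)\<^sup>2 \<le> n \<Longrightarrow>
       integrable lborel (ft (\<lambda>\<xi>. of_real (heat n t \<xi>))) \<and>
       (LINT x|lborel. norm (ft (\<lambda>\<xi>. of_real (heat n t \<xi>)) x)) \<le> CK"
    by (rule heat_kernel_L1_uniform) (rule that; assumption)
  obtain q where q: "0 \<le> q" and fl: "\<And>n y t. 0 < n \<Longrightarrow> t \<le> T \<Longrightarrow> (\<integral>\<^sup>+s. ennreal (norm (flux n y t s)) * indicator {0..t} s \<partial>lborel) \<le> ennreal q"
    by (rule flux_integral_bound[OF \<epsilon> T fin]) (rule that; assumption)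
  define C where "C = B * CK + q / 2"
  have pb: "AE s in lborel. s \<in> {0<..<t} \<longrightarrow> norm (pairing n y t s) \<le> C"
    if t: "0 < t" "t \<le> T" and n: "1 / (root 3 t)\<^sup>2 \<le> n" for t n y
  proof -
    have "0 < 1 / (root 3 t)\<^sup>2" using t by simp
    then have n0: "0 < n" using n by linarith
    have k: "integrable lborel (ft (\<lambda>\<xi>. of_real (heat n t \<xi>)))" "(LINT x|lborel. norm (ft (\<lambda>\<xi>. of_real (heat n t \<xi>)) x)) \<le> CK"
      using kern[OF t n] by auto
    show ?thesis
      unfolding C_def by (rule pairing_bound_AE[OF n0 t(1) initial_term_bound[OF B k] fl[OF n0 t(2)] q])
  qed
  define S :: "(real \<times> real \<times> nat) set" where "S = {(t, y, n). t \<in> \<rat> \<and> y \<in> \<rat> \<and> 0 < t \<and> t \<le> T \<and> 1 / (root 3 t)\<^sup>2 \<le> real n}"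
  have "countable S"
    by (rule countable_subset[of _ "\<rat> \<times> \<rat> \<times> (UNIV :: nat set)"]) (auto simp: S_def intro!: countable_SIGMA countable_rat)
  then have all: "AE s in lborel. \<forall>(t, y, n) \<in> S. s \<in> {0<..<t} \<longrightarrow> norm (pairing (real n) y t s) \<le> C"
    by (intro AE_ball_countable') (use pb in \<open>auto simp: S_def\<close>)
  have good: "AE x in lborel. \<bar>u s x\<bar> \<le> C / (2 * pi)"
    if s: "s \<in> {0<..<T}" and bnd: "\<forall>(t, y, n) \<in> S. s \<in> {0<..<t} \<longrightarrow> norm (pairing (real n) y t s) \<le> C"
      and N: "sobolev_norm (3/4 + \<epsilon>) (u s) < \<top>" for s
  proof -
    obtain F where F [measurable]: "F \<in> borel_measurable borel" and LF: "L2_fourier (\<lambda>x. of_real (u s x)) F"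
      and F2: "integrable lborel (\<lambda>\<xi>. ((1 + \<xi>\<^sup>2) powr ((3/4 + \<epsilon>) / 2) * norm (F \<xi>))\<^sup>2)"
      by (rule sobolev_norm_finiteD[OF u_meas N])
    have F1: "integrable lborel F" using L1[OF F _ F2] \<epsilon> by simp
    have rat: "norm (ft F y) \<le> C" if y: "y \<in> \<rat>" for y
    proof -
      have "\<exists>t. t \<in> \<rat> \<and> s < t \<and> t < min T (s + 1 / real (Suc k))" for k
        using Rats_dense_in_real[of s "min T (s + 1 / real (Suc k))"] s by auto
      then obtain \<tau> where \<tau>: "\<And>k. \<tau> k \<in> \<rat>" "\<And>k. s < \<tau> k" "\<And>k. \<tau> k < min T (s + 1 / real (Suc k))" by metis
      have "(\<lambda>k. s + 1 / real (Suc k)) \<longlonglongrightarrow> s + 0"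
        by (intro tendsto_add tendsto_const LIMSEQ_Suc[OF lim_1_over_n])
      then have \<tau>lim: "\<tau> \<longlonglongrightarrow> s"
        by (intro tendsto_sandwich[OF _ _ tendsto_const, of s \<tau> sequentially "\<lambda>k. s + 1 / real (Suc k)"])
           (use \<tau> in \<open>auto intro!: always_eventually less_imp_le\<close>)
      have lim: "(\<lambda>k. pairing (real (Suc k)) y (\<tau> k) s) \<longlonglongrightarrow> ft F y"
        by (rule pairing_limit[OF LF F F1 less_imp_le[OF \<tau>(2)] \<tau>lim])
      \<comment> \<open>Since \<open>root 3\<close> is increasing, a band admissible for the time s
        is admissible for all later times \<tau>.\<close>
      have "eventually (\<lambda>k. 1 / (root 3 s)\<^sup>2 \<le> real k) sequentially"
        using filterlim_real_sequentially by (simp add: filterlim_at_top)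
      then have "eventually (\<lambda>k. norm (pairing (real (Suc k)) y (\<tau> k) s) \<le> C) sequentially"
      proof eventually_elim
        case (elim k)
        have "root 3 s \<le> root 3 (\<tau> k)" using \<tau>(2)[of k] by simp
        then have "(root 3 s)\<^sup>2 \<le> (root 3 (\<tau> k))\<^sup>2" using s by (intro power_mono) auto
        moreover have "0 < root 3 s" "0 < root 3 (\<tau> k)" using s \<tau>(2)[of k] by auto
        ultimately have "1 / (root 3 (\<tau> k))\<^sup>2 \<le> 1 / (root 3 s)\<^sup>2"
          by (intro divide_left_mono mult_pos_pos zero_less_power) auto
        also have "\<dots> \<le> real (Suc k)" using elim by simp
        finally have "(\<tau> k, y, Suc k) \<in> S" using \<tau>[of k] y s by (auto simp: S_def)
        then show ?case using bnd \<tau>(2)[of k] s by fastforce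
      qed
      then show ?thesis by (intro LIMSEQ_le_const2[OF tendsto_norm[OF lim]]) (auto simp: eventually_sequentially)
    qed
    have all: "norm (ft F y) \<le> C" for y
    proof -
      have "closed {y. norm (ft F y) \<le> C}"
        by (intro closed_Collect_le continuous_intros ft_continuous[OF F1])
      moreover have "closure \<rat> = (UNIV :: real set)" by (rule Rats_closure_real)
      ultimately have "UNIV \<subseteq> {y. norm (ft F y) \<le> C}"
        using closure_minimal[of \<rat> "{y. norm (ft F y) \<le> C}"] rat by auto
      then show ?thesis by auto
    qed
    have "AE x in lborel. of_real (u s x) = ft F x / of_real (2 * pi)"
      by (rule fourier_inversion_AE[OF LF _ F F1]) measurable
    then show ?thesis
    proof eventually_elim
      case (elim x)
      have "\<bar>u s x\<bar> = norm (complex_of_real (u s x))" by simp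
      also have "\<dots> = norm (ft F x) / (2 * pi)" unfolding elim by (simp add: norm_divide)
      also have "\<dots> \<le> C / (2 * pi)" by (intro divide_right_mono all) simp
      finally show ?case .
    qed
  qed
  \<comment> \<open>The set of bad times is Borel because u is. On it the Sobolev norm is infinite
    almost everywhere, so \<top> times its measure is at most the given integral, which is finite,
    and the set is null. Arguing through E avoids measurability in time of the Sobolev norm: the
    integral is a lower integral, and comparison with a smaller measurable function is all that is
    asked of it.\<close>
  define E where "E = {s \<in> {0<..<T}. \<not> (AE x in lborel. \<bar>u s x\<bar> \<le> C / (2 * pi))}"
  have E_eq: "E = {s \<in> {0<..<T}. (\<integral>\<^sup>+x. indicator {x. C / (2 * pi) < \<bar>u s x\<bar>} x \<partial>lborel) \<noteq> 0}"
  proof -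
    have "(AE x in lborel. \<bar>u s x\<bar> \<le> C / (2 * pi)) \<longleftrightarrow> (\<integral>\<^sup>+x. indicator {x. C / (2 * pi) < \<bar>u s x\<bar>} x \<partial>lborel) = 0" for s
    proof -
      have "(\<lambda>x. indicator {x. C / (2 * pi) < \<bar>u s x\<bar>} x :: ennreal) \<in> borel_measurable lborel" by measurable
      from nn_integral_0_iff_AE[OF this] show ?thesis by (simp add: indicator_def not_less)
    qed
    then show ?thesis unfolding E_def by simp
  qed
  have [measurable]: "E \<in> sets borel"
  proof -
    have "(\<lambda>s. \<integral>\<^sup>+x. (if C / (2 * pi) < \<bar>u s x\<bar> then 1 else 0) \<partial>lborel) \<in> borel_measurable borel" by measurable
    moreover have "(\<integral>\<^sup>+x. indicator {x. C / (2 * pi) < \<bar>u s x\<bar>} x \<partial>lborel) = (\<integral>\<^sup>+x. (if C / (2 * pi) < \<bar>u s x\<bar> then 1 else 0) \<partial>lborel)" for s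
      by (simp add: indicator_def of_bool_def)
    ultimately have [measurable]: "(\<lambda>s. \<integral>\<^sup>+x. indicator {x. C / (2 * pi) < \<bar>u s x\<bar>} x \<partial>lborel) \<in> borel_measurable borel" by simp
    show ?thesis unfolding E_eq by measurable
  qed
  have EN: "AE s in lborel. s \<in> E \<longrightarrow> sobolev_norm (3/4 + \<epsilon>) (u s) = \<top>"
    using all
  proof eventually_elim
    case (elim s)
    show ?case
    proof (intro impI, rule ccontr)
      assume "s \<in> E" and "sobolev_norm (3/4 + \<epsilon>) (u s) \<noteq> \<top>"
      then show False using good[OF _ elim] by (auto simp: E_def less_top)
    qed
  qed
  have "(\<integral>\<^sup>+s. \<top> * indicator E s \<partial>lborel) \<le> (\<integral>\<^sup>+r. (sobolev_norm (3/4 + \<epsilon>) (u r)) ^ 4 * indicator {0..T} r \<partial>lborel)"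
    by (rule nn_integral_mono_AE) (use EN in eventually_elim, auto simp: indicator_def E_def)
  then have "\<top> * emeasure lborel E < \<top>" using fin by (simp add: nn_integral_cmult_indicator)
  then have "emeasure lborel E = 0" by (simp add: ennreal_mult_less_top ennreal_top_mult split: if_splits)
  then have "E \<in> null_sets lborel" by (intro null_setsI) auto
  then have "AE s in lborel. s \<notin> E" by (rule AE_not_in)
  then have "AE s in lborel. s \<in> {0<..<T} \<longrightarrow> (AE x in lborel. \<bar>u s x\<bar> \<le> C / (2 * pi))"
    by eventually_elim (auto simp: E_def)
  then show ?thesis by blast
qed

end

section \<open>Reduction to Borel representatives\<close>

lemma weak_solution_cong_AE:
  assumes u: "AE t in lebesgue. 0 < t \<longrightarrow> (AE x in lebesgue. u t x = u' t x)"
    and u0: "AE x in lebesgue. u\<^sub>0 x = u\<^sub>0' x"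
    and weak: "weak_solution u\<^sub>0 u"
  shows "weak_solution u\<^sub>0' u'"
  unfolding weak_solution_def
proof (intro allI impI)
  fix \<phi> assume \<phi>: "test_function \<phi>"
  let ?m = "\<lambda>t. multiplier (\<lambda>\<xi>. frac_laplacian_symbol (1/2) \<xi> * M_symbol \<xi>) (\<lambda>y. complex_of_real (\<phi> (t, y)))"
  let ?I = "\<lambda>u t. LINT x|lebesgue.
           (complex_of_real (u t x * deriv (\<lambda>s. \<phi> (s, x)) t) - complex_of_real (u t x) * ?m t x
          - complex_of_real ((u t x)\<^sup>2 / 2 * deriv (\<lambda>y. \<phi> (t, y)) x))"
  have inner: "AE t in lebesgue. indicator {0<..} t *\<^sub>R ?I u t = indicator {0<..} t *\<^sub>R ?I u' t"
    using u
  proof eventually_elim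
    case (elim t)
    show ?case
    proof (cases "0 < t")
      case True
      with elim have eq: "AE x in lebesgue. u t x = u' t x" by simp
      have "?I u t = ?I u' t"
        by (rule integral_lebesgue_cong_AE(1)) (use eq in eventually_elim, simp)
      then show ?thesis by simp
    qed simp
  qed
  have "(LINT t|lebesgue_on {0<..}. ?I u t) = (LINT t|lebesgue. indicator {0<..} t *\<^sub>R ?I u t)"
    by (rule integral_restrict_space) simp
  also have "\<dots> = (LINT t|lebesgue. indicator {0<..} t *\<^sub>R ?I u' t)"
    by (rule integral_lebesgue_cong_AE(1)[OF inner])
  also have "\<dots> = (LINT t|lebesgue_on {0<..}. ?I u' t)"
    by (rule integral_restrict_space[symmetric]) simp
  finally have 1: "(LINT t|lebesgue_on {0<..}. ?I u t) = (LINT t|lebesgue_on {0<..}. ?I u' t)" .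
  have 2: "(LINT x|lebesgue. u\<^sub>0 x * \<phi> (0, x)) = (LINT x|lebesgue. u\<^sub>0' x * \<phi> (0, x))"
    by (rule integral_lebesgue_cong_AE(1)) (use u0 in eventually_elim, simp)
  show "(LINT t|lebesgue_on {0<..}. ?I u' t) + complex_of_real (LINT x|lebesgue. u\<^sub>0' x * \<phi> (0, x)) = 0"
    using weak \<phi> unfolding weak_solution_def 1[symmetric] 2[symmetric] by blast
qed

lemma initial_data_borel:
  assumes L2: "L2_norm u\<^sub>0 < \<infinity>" and Linf: "Linf_norm u\<^sub>0 < \<infinity>"
  obtains v B where "(v :: real \<Rightarrow> real) \<in> borel_measurable borel" "AE x in lebesgue. u\<^sub>0 x = v x"
    "integrable lborel (\<lambda>x. (v x)\<^sup>2)" "\<And>x. \<bar>v x\<bar> \<le> B"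
proof -
  have m: "u\<^sub>0 \<in> borel_measurable lebesgue" using L2 by (simp add: L2_norm_finite_iff)
  obtain w where "w \<in> borel_measurable lborel" and uw: "AE x in lborel. u\<^sub>0 x = w x"
    using completion_ex_borel_measurable_real[OF m] by blast
  then have [measurable]: "w \<in> borel_measurable borel" by simp
  define B where "B = enn2real (Linf_norm u\<^sub>0)"
  have B0: "0 \<le> B" by (simp add: B_def)
  have LB: "Linf_norm u\<^sub>0 = ennreal B" using Linf by (simp add: B_def)
  have "AE x in lebesgue. ennreal (norm (u\<^sub>0 x)) \<le> ennreal B"
    unfolding LB[symmetric] Linf_norm_def using m esssup_AE[of "\<lambda>x. ennreal (norm (u\<^sub>0 x))" lebesgue] by simp
  then have uB: "AE x in lebesgue. \<bar>u\<^sub>0 x\<bar> \<le> B"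
    by eventually_elim (use B0 in simp)
  \<comment> \<open>Setting w to 0 where it is too large turns the essential bound into a bound at
    every point.\<close>
  define v where "v x = (if \<bar>w x\<bar> \<le> B then w x else 0)" for x
  have [measurable]: "v \<in> borel_measurable borel" unfolding v_def[abs_def] by measurable
  have "AE x in lebesgue. u\<^sub>0 x = w x" using uw by (simp add: AE_completion_iff)
  then have uv: "AE x in lebesgue. u\<^sub>0 x = v x"
    using uB by eventually_elim (simp add: v_def)
  have "L2_norm v < \<top>" using L2 L2_norm_cong_AE[OF uv] by simp
  then have "integrable lborel (\<lambda>x. (v x)\<^sup>2)" using L2_norm_borel(1)[of v] by simp
  moreover have "\<bar>v x\<bar> \<le> B" for x using B0 by (simp add: v_def)
  ultimately show thesis using that[of v B] uv by simp
qed

lemma solution_borel: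
  assumes "in_Linf_time {0<..} L2_norm u"
  obtains v M where "(\<lambda>(t, x). v t x :: real) \<in> borel_measurable (borel \<Otimes>\<^sub>M borel)" "0 \<le> M"
    "\<And>t. integrable lborel (\<lambda>x. (v t x)\<^sup>2)" "\<And>t. (LINT x|lborel. (v t x)\<^sup>2) \<le> M\<^sup>2"
    "AE t in lebesgue. 0 < t \<longrightarrow> (AE x in lebesgue. u t x = v t x)"
proof -
  let ?S = "{0<..} \<times> UNIV :: (real \<times> real) set"
  have um: "(\<lambda>(t, x). u t x) \<in> borel_measurable (lebesgue_on ?S)"
    using assms by (simp add: in_Linf_time_def)
  obtain C where C: "C < \<infinity>" and uC: "AE t in lebesgue_on {0<..}. L2_norm (u t) \<le> C"
    using assms by (auto simp: in_Linf_time_def)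
  define M where "M = enn2real C"
  have M0: "0 \<le> M" by (simp add: M_def)
  have CM: "C = ennreal M" using C by (simp add: M_def)
  have uM: "AE t in lborel. 0 < t \<longrightarrow> L2_norm (u t) \<le> ennreal M"
    using uC unfolding CM by (simp add: AE_restrict_space_iff AE_completion_iff)
  have "open ?S" by (intro open_Times) auto
  then have S: "?S \<in> sets lebesgue" by (intro sets_completionI_sets) simp
  \<comment> \<open>Extension by zero to the whole plane, where a Lebesgue measurable function has a
    Borel version.\<close>
  define f where "f p = (if p \<in> ?S then (case p of (t, x) \<Rightarrow> u t x) else 0)" for p
  have "f \<in> borel_measurable lebesgue"
    unfolding f_def using borel_measurable_if[OF S, of "\<lambda>(t, x). u t x"] um by simp
  then obtain g where "g \<in> borel_measurable lborel" and fg: "AE p in lborel. f p = g p"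
    using completion_ex_borel_measurable_real by blast
  then have "g \<in> borel_measurable borel" by simp
  then have [measurable]: "g \<in> borel_measurable (borel \<Otimes>\<^sub>M borel)" by (simp only: borel_prod)
  have "AE p in lborel \<Otimes>\<^sub>M lborel. f p = g p" using fg by (simp only: lborel_prod)
  then have "AE t in lborel. AE x in lborel. f (t, x) = g (t, x)" by (rule lborel_pair.AE_pair)
  then have ug: "AE t in lborel. 0 < t \<longrightarrow> (AE x in lborel. u t x = g (t, x))"
    by eventually_elim (auto simp: f_def cong: if_cong)
  \<comment> \<open>Times at which the Borel version satisfies the norm bound. The set is Borel by
    Tonelli, and v is set to 0 at all other times, so that the bounds of \<open>weak_flow\<close>
    hold at every t, including t \<le> 0.\<close>
  define G where "G = {t. 0 < t \<and> (\<integral>\<^sup>+x. ennreal ((g (t, x))\<^sup>2) \<partial>lborel) \<le> ennreal (M\<^sup>2)}"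
  have [measurable]: "G \<in> sets borel" unfolding G_def by measurable
  define v where "v t x = (if t \<in> G then g (t, x) else 0)" for t x
  have vm: "(\<lambda>(t, x). v t x) \<in> borel_measurable (borel \<Otimes>\<^sub>M borel)" unfolding v_def by measurable
  have nn: "(\<integral>\<^sup>+x. ennreal ((v t x)\<^sup>2) \<partial>lborel) \<le> ennreal (M\<^sup>2)" for t
    by (cases "t \<in> G") (auto simp: v_def G_def)
  have [measurable]: "(\<lambda>x. v t x) \<in> borel_measurable borel" for t using vm by measurable
  have vi: "integrable lborel (\<lambda>x. (v t x)\<^sup>2)" for t
    by (rule integrableI_bounded) (use le_less_trans[OF nn[of t] ennreal_less_top] in auto)
  have vM: "(LINT x|lborel. (v t x)\<^sup>2) \<le> M\<^sup>2" for t
    using nn[of t] by (subst (asm) nn_integral_eq_integral[OF vi]) auto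
  have uv: "AE t in lborel. 0 < t \<longrightarrow> (AE x in lborel. u t x = v t x)"
    using ug uM
  proof eventually_elim
    case (elim t)
    show ?case
    proof
      assume t: "0 < t"
      with elim have eq: "AE x in lborel. u t x = g (t, x)" and le: "L2_norm (u t) \<le> ennreal M" by auto
      have [measurable]: "(\<lambda>x. g (t, x)) \<in> borel_measurable borel" by measurable
      have "L2_norm (u t) = L2_norm (\<lambda>x. g (t, x))"
        by (rule L2_norm_cong_AE) (use eq in \<open>simp add: AE_completion_iff\<close>)
      then have le: "L2_norm (\<lambda>x. g (t, x)) \<le> ennreal M" using le by simp
      then have "L2_norm (\<lambda>x. g (t, x)) < \<top>" using ennreal_less_top le_less_trans by blast
      then have i: "integrable lborel (\<lambda>x. (norm (g (t, x)))\<^sup>2)" using L2_norm_borel(1)[of "\<lambda>x. g (t, x)"] by simp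
      have "L2_norm (\<lambda>x. g (t, x)) = ennreal (sqrt (LINT x|lborel. (norm (g (t, x)))\<^sup>2))"
        by (rule L2_norm_borel(2)[OF _ i]) measurable
      then have "sqrt (LINT x|lborel. (norm (g (t, x)))\<^sup>2) \<le> M" using le M0 by simp
      then have "(LINT x|lborel. (norm (g (t, x)))\<^sup>2) \<le> M\<^sup>2" by (rule sqrt_le_D)
      then have "(\<integral>\<^sup>+x. ennreal ((norm (g (t, x)))\<^sup>2) \<partial>lborel) \<le> ennreal (M\<^sup>2)"
        by (subst nn_integral_eq_integral[OF i]) (auto intro: ennreal_leI)
      then have "t \<in> G" using t by (simp add: G_def)
      then show "AE x in lborel. u t x = v t x" using eq by (simp add: v_def)
    qed
  qed
  show thesis
    by (rule that[OF vm M0 vi vM]) (use uv in \<open>simp add: AE_completion_iff\<close>)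
qed

theorem proposition4:
  "\<exists>\<epsilon>\<^sub>0::real. \<epsilon>\<^sub>0 > 0 \<and>
     (\<forall>(u\<^sub>0 :: real \<Rightarrow> real) (u :: real \<Rightarrow> real \<Rightarrow> real) (T :: real) (\<epsilon> :: real).
        L2_norm u\<^sub>0 < \<infinity> \<and> Linf_norm u\<^sub>0 < \<infinity> \<and>
        in_Linf_time {0<..} L2_norm u \<and> in_Lp_time 2 {0<..} N_norm u \<and>
        weak_solution u\<^sub>0 u \<and>
        (AE t in lebesgue_on {0<..}.
           (L2_norm (u t))\<^sup>2 + (\<integral>\<^sup>+s. (N_norm (u s))\<^sup>2 \<partial>lebesgue_on {0..t}) \<le> (L2_norm u\<^sub>0)\<^sup>2) \<and>
        0 < T \<and> 0 < \<epsilon> \<and> \<epsilon> < \<epsilon>\<^sub>0 \<and>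
        in_Lp_time 4 {0..T} (sobolev_norm (3/4 + \<epsilon>)) u
        \<longrightarrow> in_Linf_time {0..T} Linf_norm u)"
\<comment> \<open>For \<epsilon> < 1/4 the order 3/4 + \<epsilon> stays below 1, as
  \<open>bracket_bound\<close> requires, and the exponent 1/4 - \<epsilon> of \<open>weight\<close>
  is positive.\<close>
proof (intro exI[of _ "1/4"] conjI allI impI; (elim conjE)?)
  show "0 < (1/4 :: real)" by simp
  fix u\<^sub>0 :: "real \<Rightarrow> real" and u :: "real \<Rightarrow> real \<Rightarrow> real" and T \<epsilon> :: real
  assume L2: "L2_norm u\<^sub>0 < \<infinity>" and Linf: "Linf_norm u\<^sub>0 < \<infinity>" and uL: "in_Linf_time {0<..} L2_norm u"
    and weak: "weak_solution u\<^sub>0 u" and T: "0 < T" and \<epsilon>: "0 < \<epsilon>" "\<epsilon> < 1/4"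
    and uH: "in_Lp_time 4 {0..T} (sobolev_norm (3/4 + \<epsilon>)) u"
  obtain v\<^sub>0 B where v0 [measurable]: "v\<^sub>0 \<in> borel_measurable borel" and u0v0: "AE x in lebesgue. u\<^sub>0 x = v\<^sub>0 x"
    and v0i: "integrable lborel (\<lambda>x. (v\<^sub>0 x)\<^sup>2)" and v0B: "\<And>x. \<bar>v\<^sub>0 x\<bar> \<le> B"
    by (rule initial_data_borel[OF L2 Linf]) (rule that; assumption)
  obtain v M where vm [measurable]: "(\<lambda>(t, x). v t x :: real) \<in> borel_measurable (borel \<Otimes>\<^sub>M borel)" and M: "0 \<le> M"
    and vi: "\<And>t. integrable lborel (\<lambda>x. (v t x)\<^sup>2)" and vM: "\<And>t. (LINT x|lborel. (v t x)\<^sup>2) \<le> M\<^sup>2"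
    and uv: "AE t in lebesgue. 0 < t \<longrightarrow> (AE x in lebesgue. u t x = v t x)"
    by (rule solution_borel[OF uL]) (rule that; assumption)
  interpret weak_flow v\<^sub>0 v M
    by unfold_locales (use vm v0 vi vM M v0i weak_solution_cong_AE[OF uv u0v0 weak] in auto)
  \<comment> \<open>The representative agrees with u only at positive times and the bound holds on
    the open interval; the endpoints 0 and T form a null set.\<close>
  have zero: "AE r in lebesgue. r \<noteq> (0::real)" using AE_lborel_singleton[of 0] by (simp add: AE_completion_iff)
  have "(\<integral>\<^sup>+r. (sobolev_norm (3/4 + \<epsilon>) (v r)) ^ 4 * indicator {0..T} r \<partial>lborel)
     = (\<integral>\<^sup>+r. (sobolev_norm (3/4 + \<epsilon>) (v r)) ^ 4 * indicator {0..T} r \<partial>lebesgue)"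
    by (rule nn_integral_completion[symmetric])
  also have "\<dots> = (\<integral>\<^sup>+r. (sobolev_norm (3/4 + \<epsilon>) (u r)) ^ 4 * indicator {0..T} r \<partial>lebesgue)"
  proof (rule nn_integral_cong_AE)
    show "AE r in lebesgue. (sobolev_norm (3/4 + \<epsilon>) (v r)) ^ 4 * indicator {0..T} r = (sobolev_norm (3/4 + \<epsilon>) (u r)) ^ 4 * indicator {0..T} r"
      using uv zero
    proof eventually_elim
      case (elim r)
      then show ?case using sobolev_norm_cong_AE[of "u r" "v r"] by (cases "0 < r") (auto simp: indicator_def)
    qed
  qed
  also have "\<dots> = (\<integral>\<^sup>+r. (sobolev_norm (3/4 + \<epsilon>) (u r)) ^ 4 \<partial>lebesgue_on {0..T})"
    by (rule nn_integral_restrict_space[symmetric]) simp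
  also have "\<dots> < \<top>" using uH by (simp add: in_Lp_time_def)
  finally have fin: "(\<integral>\<^sup>+r. (sobolev_norm (3/4 + \<epsilon>) (v r)) ^ 4 * indicator {0..T} r \<partial>lborel) < \<top>" .
  obtain C where C: "AE s in lborel. s \<in> {0<..<T} \<longrightarrow> (AE x in lborel. \<bar>v s x\<bar> \<le> C)"
    using bounded_AE[OF \<epsilon> T v0B fin] by blast
  have ends: "AE r in lebesgue. r \<noteq> T" using AE_lborel_singleton[of T] by (simp add: AE_completion_iff)
  have C': "AE s in lebesgue. s \<in> {0<..<T} \<longrightarrow> (AE x in lborel. \<bar>v s x\<bar> \<le> C)"
    using C by (simp add: AE_completion_iff)
  have "AE s in lebesgue. s \<in> {0..T} \<longrightarrow> Linf_norm (u s) \<le> ennreal C"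
    using C' uv zero ends
  proof eventually_elim
    case (elim s)
    show ?case
    proof
      assume "s \<in> {0..T}"
      then have s: "s \<in> {0<..<T}" using elim by auto
      then have eq: "AE x in lebesgue. u s x = v s x" and vC: "AE x in lebesgue. \<bar>v s x\<bar> \<le> C"
        using elim by (auto simp: AE_completion_iff)
      have "v s \<in> borel_measurable lebesgue" using u_meas[of s] by (intro measurable_completion) simp
      moreover have "AE x in lebesgue. v s x = u s x" using eq by eventually_elim simp
      ultimately have um: "u s \<in> borel_measurable lebesgue" by (rule measurable_lebesgue_cong_AE)
      have "esssup lebesgue (\<lambda>x. ennreal (norm (u s x))) \<le> ennreal C"
      proof (rule esssup_I)
        show "(\<lambda>x. ennreal (norm (u s x))) \<in> borel_measurable lebesgue" using um by measurable
        show "AE x in lebesgue. ennreal (norm (u s x)) \<le> ennreal C"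
          using eq vC by eventually_elim (auto intro: ennreal_leI)
      qed
      then show "Linf_norm (u s) \<le> ennreal C" using um by (simp add: Linf_norm_def)
    qed
  qed
  then have "AE s in lebesgue_on {0..T}. Linf_norm (u s) \<le> ennreal C"
    by (simp add: AE_restrict_space_iff)
  moreover have "(\<lambda>(t, x). u t x) \<in> borel_measurable (lebesgue_on ({0..T} \<times> UNIV))"
    using uH by (simp add: in_Lp_time_def)
  ultimately show "in_Linf_time {0..T} Linf_norm u"
    unfolding in_Linf_time_def by (intro conjI exI[of _ "ennreal C"]) auto
qed

end
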